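(* Let $(M,g)$ be a connected Riemannian manifold of dimension $n\ge2$ with $g\in C^0(M)$, and suppose that $M$ has a weakly hyperboloidal end $\widetilde M\simeq(0,x_0)\times\mathcal{N}$. Let $E$ be a real vector bundle with inner product over $M$ and suppose that the connection $\nabla_i=\partial_i-\Gamma_i$ on $E$ satisfies $\Gamma\in L^{n^*}_{\rm loc}(M)$ and the decay condition $$\limsup_{x\to0}|x\,\Gamma^S_x|<\frac{n-1}{2}$$ in $\widetilde M$, where $\Gamma^S_x$ is the symmetric part of $\nabla_{\partial_x}$, with norm understood as that of an endomorphism of the fibres of $E$. Then $M$ admits a weighted Poincar\'e inequality: there is a function $w\in L^1_{\rm loc}(M)$, with $\mathrm{ess\,inf}_\Omega w>0$ for every relatively compact $\Omega\subset M$, such that $$\int_M|u|^2\,w\,dv_M\le\int_M|\nabla u|^2\,dv_M\qquad\text{for all }u\in C^1_c(M).$$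
   Context: $n^*=n$ for $n\ge3$; $2^*=2/(1-2/q_0)$ with $q_0=10^6$ (any fixed large constant). A weakly hyperboloidal end $\widetilde M\subset M$ is a connected component of $M\setminus\mathcal{C}$ for some compact set $\mathcal{C}$, such that $\widetilde M\simeq(0,x_0)\times\mathcal{N}$, where $(\mathcal{N},h)$ is a compact Riemannian manifold without boundary with continuous metric $h$, and $g|_{\widetilde M}$ is uniformly equivalent to $x^{-2}(dx^2+h)$. Here $x$ is the coordinate along the factor $(0,x_0)$. The connection $\nabla$ need not be compatible with the inner product $\langle\cdot,\cdot\rangle$ on $E$; its symmetric part is the tensor defined by $\langle\phi,\Gamma^S(X)\psi\rangle=\frac12\big(X\langle\phi,\psi\rangle-\langle\phi,\nabla_X\psi\rangle-\langle\nabla_X\phi,\psi\rangle\big)$, and $\Gamma^S_x=\Gamma^S(\partial_x)$. $M$ may have a compact boundary; $C^1_c(M)$ denotes compactly supported $C^1$ sections of $E$. $|\nabla u|^2$ and $dv_M$ are taken with respect to $g$ and the inner product of $E$. *)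

theory Defs
  imports "HOL-Analysis.Analysis"
begin

section \<open>Smooth functions on relatively open subsets of a half-space\<close>

text \<open>
  On the sets used below (open sets, and relatively open subsets of a half-space) the derivative
  relative to the set is unique, so \<^term>\<open>f'\<close> is determined on \<^term>\<open>S\<close> and continuity up to the
  boundary face is included.
\<close>

primrec Ck_on :: "nat \<Rightarrow> ('a::real_normed_vector \<Rightarrow> 'b::real_normed_vector) \<Rightarrow> 'a set \<Rightarrow> bool" where
  "Ck_on 0 = (\<lambda>f S. continuous_on S f)"
| "Ck_on (Suc k) = (\<lambda>f S. \<exists>f'. (\<forall>x\<in>S. (f has_derivative f' x) (at x within S)) \<and>
                             (\<forall>v. Ck_on k (\<lambda>x. f' x v) S))"

definition smooth_on :: "('a::real_normed_vector \<Rightarrow> 'b::real_normed_vector) \<Rightarrow> 'a set \<Rightarrow> bool" where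
  "smooth_on f S \<longleftrightarrow> (\<forall>k. Ck_on k f S)"


section \<open>Manifolds with boundary\<close>

text \<open>
  The underlying set of a manifold is a whole type. A chart is a pair of a domain and a coordinate
  map; the values of the coordinate map outside the domain are irrelevant.
\<close>

type_synonym ('m, 'n) chart = "'m set \<times> ('m \<Rightarrow> real ^ 'n)"

definition cinv :: "('m, 'n::finite) chart \<Rightarrow> real ^ 'n \<Rightarrow> 'm" where
  "cinv c = inv_into (fst c) (snd c)"

definition model_open :: "(real ^ 'n::finite) set \<Rightarrow> bool" where
  "model_open V \<longleftrightarrow> open V \<or> (\<exists>k. openin (top_of_set {y. 0 \<le> y $ k}) V)"

definition smooth_manifold ::
    "('m::{t2_space, second_countable_topology}, 'n::finite) chart set \<Rightarrow> bool" where
  "smooth_manifold A \<longleftrightarrow>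
     (\<Union>c\<in>A. fst c) = UNIV \<and>
     (\<forall>c\<in>A. open (fst c) \<and> model_open (snd c ` fst c) \<and>
             homeomorphism (fst c) (snd c ` fst c) (snd c) (cinv c)) \<and>
     (\<forall>c\<in>A. \<forall>c'\<in>A. smooth_on (snd c' \<circ> cinv c) (snd c ` (fst c \<inter> fst c')))"

definition manifold_boundary :: "('m, 'n::finite) chart set \<Rightarrow> 'm set" where
  "manifold_boundary A = {p. \<exists>c\<in>A. p \<in> fst c \<and> snd c p \<notin> interior (snd c ` fst c)}"

text \<open>
  Tangent vectors at a point are represented, relative to a chart around it, by their coordinate
  vectors. \<open>cderiv c F p v\<close> is the derivative of \<open>F\<close> at \<open>p\<close> in the direction of the tangent vector with
  coordinates \<open>v\<close> in the chart \<open>c\<close>; in particular \<open>cderiv c (snd c') p v\<close> are the coordinates of the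
  same tangent vector in the chart \<open>c'\<close>.
\<close>

definition cderiv ::
    "('m, 'n::finite) chart \<Rightarrow> ('m \<Rightarrow> 'b::real_normed_vector) \<Rightarrow> 'm \<Rightarrow> real ^ 'n \<Rightarrow> 'b" where
  "cderiv c F p v =
     frechet_derivative (F \<circ> cinv c) (at (snd c p) within snd c ` fst c) v"

text \<open>
  Geometric objects that are needed at a point are evaluated in an arbitrary chart (and, for bundles,
  an arbitrary trivialization) around that point; the transformation laws make the choice immaterial.
\<close>

definition chart_at :: "('m, 'n::finite) chart set \<Rightarrow> 'm \<Rightarrow> ('m, 'n) chart" where
  "chart_at A p = (SOME c. c \<in> A \<and> p \<in> fst c)"


section \<open>Continuous Riemannian metrics\<close>

text \<open>\<open>g c p\<close> is the Gram matrix of the metric at \<open>p\<close> in the coordinates of the chart \<open>c\<close>.\<close>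

definition riemannian_metric ::
    "('m::topological_space, 'n::finite) chart set \<Rightarrow> (('m, 'n) chart \<Rightarrow> 'm \<Rightarrow> real ^ 'n ^ 'n) \<Rightarrow> bool"
  where
  "riemannian_metric A g \<longleftrightarrow>
     (\<forall>c\<in>A. continuous_on (fst c) (g c)) \<and>
     (\<forall>c\<in>A. \<forall>p\<in>fst c. transpose (g c p) = g c p \<and> (\<forall>v. v \<noteq> 0 \<longrightarrow> 0 < v \<bullet> (g c p *v v))) \<and>
     (\<forall>c\<in>A. \<forall>c'\<in>A. \<forall>p\<in>fst c \<inter> fst c'. \<forall>v w.
        v \<bullet> (g c p *v w) = cderiv c (snd c') p v \<bullet> (g c' p *v cderiv c (snd c') p w))"

text \<open>
  The Riemannian volume is the unique Borel measure with density \<open>sqrt (det g)\<close> in every chart.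
\<close>

definition riemannian_volume ::
    "('m::topological_space, 'n::finite) chart set \<Rightarrow> (('m, 'n) chart \<Rightarrow> 'm \<Rightarrow> real ^ 'n ^ 'n) \<Rightarrow>
     'm measure \<Rightarrow> bool" where
  "riemannian_volume A g dv \<longleftrightarrow>
     sets dv = sets borel \<and>
     (\<forall>c\<in>A. \<forall>B\<in>sets borel. B \<subseteq> fst c \<longrightarrow>
        emeasure dv B = (\<integral>\<^sup>+q\<in>snd c ` B. ennreal (sqrt (det (g c (cinv c q)))) \<partial>lborel))"


section \<open>Vector bundles with inner product\<close>

text \<open>
  A bundle is given by its projection \<open>\<pi>\<close> from the total space and a family \<open>T\<close> of local
  trivializations: pairs of an open subset of the base and a map that is a bijection from every fibre
  over that subset onto the model fibre. The vector space structure of the fibres is the one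
  transported by the trivializations.
\<close>

type_synonym ('m, 'e, 'r) triv = "'m set \<times> ('e \<Rightarrow> real ^ 'r)"

definition fibre :: "('e \<Rightarrow> 'm) \<Rightarrow> 'm \<Rightarrow> 'e set" where
  "fibre \<pi> p = {e. \<pi> e = p}"

definition tinv :: "('e \<Rightarrow> 'm) \<Rightarrow> ('m, 'e, 'r::finite) triv \<Rightarrow> 'm \<Rightarrow> real ^ 'r \<Rightarrow> 'e" where
  "tinv \<pi> t p = inv_into (fibre \<pi> p) (snd t)"

definition vector_bundle ::
    "('m::topological_space, 'n::finite) chart set \<Rightarrow> ('e \<Rightarrow> 'm) \<Rightarrow> ('m, 'e, 'r::finite) triv set \<Rightarrow> bool"
  where
  "vector_bundle A \<pi> T \<longleftrightarrow>
     (\<Union>t\<in>T. fst t) = UNIV \<and>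
     (\<forall>t\<in>T. open (fst t) \<and> (\<forall>p\<in>fst t. bij_betw (snd t) (fibre \<pi> p) UNIV)) \<and>
     (\<forall>t\<in>T. \<forall>t'\<in>T.
        (\<forall>p\<in>fst t \<inter> fst t'. linear (\<lambda>f. snd t' (tinv \<pi> t p f))) \<and>
        (\<forall>c\<in>A. \<forall>f. smooth_on (\<lambda>q. snd t' (tinv \<pi> t (cinv c q) f))
                                (snd c ` (fst c \<inter> fst t \<inter> fst t'))))"

definition triv_at :: "('m, 'e, 'r::finite) triv set \<Rightarrow> 'm \<Rightarrow> ('m, 'e, 'r) triv" where
  "triv_at T p = (SOME t. t \<in> T \<and> p \<in> fst t)"

definition C1_section_on ::
    "('m::topological_space, 'n::finite) chart set \<Rightarrow> ('e \<Rightarrow> 'm) \<Rightarrow> ('m, 'e, 'r::finite) triv set \<Rightarrow>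
     'm set \<Rightarrow> ('m \<Rightarrow> 'e) \<Rightarrow> bool" where
  "C1_section_on A \<pi> T \<Omega> u \<longleftrightarrow>
     (\<forall>p\<in>\<Omega>. u p \<in> fibre \<pi> p) \<and>
     (\<forall>c\<in>A. \<forall>t\<in>T. Ck_on 1 (\<lambda>q. snd t (u (cinv c q))) (snd c ` (fst c \<inter> fst t \<inter> \<Omega>)))"

text \<open>
  Only the values of \<open>ip\<close> on pairs from the same fibre matter. The inner product is \<open>C\<^sup>1\<close>, as required
  for the derivative of \<open>\<langle>\<phi>, \<psi>\<rangle>\<close> in the symmetric part of a connection.
\<close>

definition bundle_inner_product ::
    "('m::topological_space, 'n::finite) chart set \<Rightarrow> ('e \<Rightarrow> 'm) \<Rightarrow> ('m, 'e, 'r::finite) triv set \<Rightarrow>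
     ('e \<Rightarrow> 'e \<Rightarrow> real) \<Rightarrow> bool" where
  "bundle_inner_product A \<pi> T ip \<longleftrightarrow>
     (\<forall>t\<in>T. \<forall>p\<in>fst t.
        bilinear (\<lambda>f f'. ip (tinv \<pi> t p f) (tinv \<pi> t p f')) \<and>
        (\<forall>f f'. ip (tinv \<pi> t p f) (tinv \<pi> t p f') = ip (tinv \<pi> t p f') (tinv \<pi> t p f)) \<and>
        (\<forall>f. f \<noteq> 0 \<longrightarrow> 0 < ip (tinv \<pi> t p f) (tinv \<pi> t p f))) \<and>
     (\<forall>t\<in>T. \<forall>c\<in>A. \<forall>f f'.
        Ck_on 1 (\<lambda>q. ip (tinv \<pi> t (cinv c q) f) (tinv \<pi> t (cinv c q) f'))
                (snd c ` (fst c \<inter> fst t)))"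

definition section_support :: "('e \<Rightarrow> 'e \<Rightarrow> real) \<Rightarrow> ('m::topological_space \<Rightarrow> 'e) \<Rightarrow> 'm set" where
  "section_support ip u = closure {p. ip (u p) (u p) \<noteq> 0}"

definition fibre_opnorm ::
    "('e \<Rightarrow> 'm) \<Rightarrow> ('e \<Rightarrow> 'e \<Rightarrow> real) \<Rightarrow> 'm \<Rightarrow> ('e \<Rightarrow> 'e) \<Rightarrow> real" where
  "fibre_opnorm \<pi> ip p S = (SUP e\<in>{e \<in> fibre \<pi> p. ip e e \<le> 1}. sqrt (ip (S e) (S e)))"


section \<open>Connections\<close>

text \<open>
  \<open>\<Gamma> t c p i\<close> is the coefficient matrix \<open>\<Gamma>\<^sub>i\<close> at \<open>p\<close> in the trivialization \<open>t\<close> and the chart \<open>c\<close>,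
  so that \<open>covd \<Gamma> \<pi> t c u p v = v\<^sup>i (\<partial>\<^sub>i - \<Gamma>\<^sub>i) u\<close>, an element of the fibre over \<open>p\<close>.
  The coefficients are everywhere defined representatives of locally integrable functions, and
  the transformation law (independence of the covariant derivative from \<open>t\<close> and \<open>c\<close>) is imposed at
  every point. This is no restriction: given coefficients that transform correctly almost
  everywhere, choose representatives on the pieces of a countable Borel partition subordinate to
  charts and trivializations, and define all other coefficients by the transformation law.
\<close>

definition covd ::
    "(('m, 'e, 'r::finite) triv \<Rightarrow> ('m, 'n::finite) chart \<Rightarrow> 'm \<Rightarrow> 'n \<Rightarrow> real ^ 'r ^ 'r) \<Rightarrow>
     ('e \<Rightarrow> 'm) \<Rightarrow> ('m, 'e, 'r) triv \<Rightarrow> ('m, 'n) chart \<Rightarrow> ('m \<Rightarrow> 'e) \<Rightarrow> 'm \<Rightarrow> real ^ 'n \<Rightarrow> 'e" where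
  "covd \<Gamma> \<pi> t c u p v =
     tinv \<pi> t p (cderiv c (\<lambda>p'. snd t (u p')) p v -
                 (\<Sum>i\<in>UNIV. v $ i *\<^sub>R (\<Gamma> t c p i *v snd t (u p))))"

definition connection ::
    "('m::topological_space, 'n::finite) chart set \<Rightarrow> ('e \<Rightarrow> 'm) \<Rightarrow> ('m, 'e, 'r::finite) triv set \<Rightarrow>
     (('m, 'e, 'r) triv \<Rightarrow> ('m, 'n) chart \<Rightarrow> 'm \<Rightarrow> 'n \<Rightarrow> real ^ 'r ^ 'r) \<Rightarrow> bool" where
  "connection A \<pi> T \<Gamma> \<longleftrightarrow>
     (\<forall>c\<in>A. \<forall>c'\<in>A. \<forall>t\<in>T. \<forall>t'\<in>T. \<forall>p\<in>fst c \<inter> fst c' \<inter> fst t \<inter> fst t'. \<forall>\<Omega> u v.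
        open \<Omega> \<and> p \<in> \<Omega> \<and> C1_section_on A \<pi> T \<Omega> u \<longrightarrow>
        covd \<Gamma> \<pi> t' c' u p (cderiv c (snd c') p v) = covd \<Gamma> \<pi> t c u p v)"

definition connection_Lp_loc ::
    "real \<Rightarrow> ('m::topological_space, 'n::finite) chart set \<Rightarrow> ('m, 'e, 'r::finite) triv set \<Rightarrow>
     (('m, 'e, 'r) triv \<Rightarrow> ('m, 'n) chart \<Rightarrow> 'm \<Rightarrow> 'n \<Rightarrow> real ^ 'r ^ 'r) \<Rightarrow> bool" where
  "connection_Lp_loc s A T \<Gamma> \<longleftrightarrow>
     (\<forall>c\<in>A. \<forall>t\<in>T. \<forall>i.
        set_borel_measurable lebesgue (snd c ` (fst c \<inter> fst t)) (\<lambda>q. \<Gamma> t c (cinv c q) i) \<and>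
        (\<forall>K. compact K \<and> K \<subseteq> fst c \<inter> fst t \<longrightarrow>
           set_integrable lebesgue (snd c ` K) (\<lambda>q. norm (\<Gamma> t c (cinv c q) i) powr s)))"

definition nabla ::
    "('m, 'e, 'r::finite) triv set \<Rightarrow> ('e \<Rightarrow> 'm) \<Rightarrow>
     (('m, 'e, 'r) triv \<Rightarrow> ('m, 'n::finite) chart \<Rightarrow> 'm \<Rightarrow> 'n \<Rightarrow> real ^ 'r ^ 'r) \<Rightarrow>
     ('m, 'n) chart \<Rightarrow> ('m \<Rightarrow> 'e) \<Rightarrow> 'm \<Rightarrow> real ^ 'n \<Rightarrow> 'e" where
  "nabla T \<pi> \<Gamma> c u p v = covd \<Gamma> \<pi> (triv_at T p) c u p v"

text \<open>\<open>|\<nabla>u|\<^sup>2 = g\<^sup>i\<^sup>j \<langle>\<nabla>\<^sub>i u, \<nabla>\<^sub>j u\<rangle>\<close>\<close>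

definition nabla_norm_sq ::
    "('m, 'n::finite) chart set \<Rightarrow> (('m, 'n) chart \<Rightarrow> 'm \<Rightarrow> real ^ 'n ^ 'n) \<Rightarrow>
     ('m, 'e, 'r::finite) triv set \<Rightarrow> ('e \<Rightarrow> 'm) \<Rightarrow> ('e \<Rightarrow> 'e \<Rightarrow> real) \<Rightarrow>
     (('m, 'e, 'r) triv \<Rightarrow> ('m, 'n) chart \<Rightarrow> 'm \<Rightarrow> 'n \<Rightarrow> real ^ 'r ^ 'r) \<Rightarrow>
     ('m \<Rightarrow> 'e) \<Rightarrow> 'm \<Rightarrow> real" where
  "nabla_norm_sq A g T \<pi> ip \<Gamma> u p =
     (let c = chart_at A p in
      \<Sum>i\<in>UNIV. \<Sum>j\<in>UNIV. matrix_inv (g c p) $ i $ j *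
         ip (nabla T \<pi> \<Gamma> c u p (axis i 1)) (nabla T \<pi> \<Gamma> c u p (axis j 1)))"

text \<open>
  The endomorphism \<open>\<Gamma>\<^sup>S(X)\<close> of the fibre over \<open>p\<close>, where \<open>X\<close> has coordinates \<open>v\<close> in the chart \<open>c\<close>,
  defined by
  \<open>\<langle>\<phi>, \<Gamma>\<^sup>S(X) \<psi>\<rangle> = 1/2 (X\<langle>\<phi>, \<psi>\<rangle> - \<langle>\<phi>, \<nabla>\<^sub>X \<psi>\<rangle> - \<langle>\<nabla>\<^sub>X \<phi>, \<psi>\<rangle>)\<close> for \<open>C\<^sup>1\<close> sections near \<open>p\<close>.
\<close>

definition symmetric_part ::
    "('m::topological_space, 'n::finite) chart set \<Rightarrow> ('m, 'e, 'r::finite) triv set \<Rightarrow> ('e \<Rightarrow> 'm) \<Rightarrow>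
     ('e \<Rightarrow> 'e \<Rightarrow> real) \<Rightarrow>
     (('m, 'e, 'r) triv \<Rightarrow> ('m, 'n) chart \<Rightarrow> 'm \<Rightarrow> 'n \<Rightarrow> real ^ 'r ^ 'r) \<Rightarrow>
     ('m, 'n) chart \<Rightarrow> 'm \<Rightarrow> real ^ 'n \<Rightarrow> 'e \<Rightarrow> 'e" where
  "symmetric_part A T \<pi> ip \<Gamma> c p v e =
     (THE s. s \<in> fibre \<pi> p \<and>
        (\<forall>\<Omega> \<phi> \<psi>. open \<Omega> \<and> p \<in> \<Omega> \<and> C1_section_on A \<pi> T \<Omega> \<phi> \<and> C1_section_on A \<pi> T \<Omega> \<psi> \<and> \<psi> p = e \<longrightarrow>
           ip (\<phi> p) s = 1 / 2 * (cderiv c (\<lambda>p'. ip (\<phi> p') (\<psi> p')) p v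
                                  - ip (\<phi> p) (nabla T \<pi> \<Gamma> c \<psi> p v)
                                  - ip (nabla T \<pi> \<Gamma> c \<phi> p v) (\<psi> p))))"


section \<open>Weakly hyperboloidal ends\<close>

text \<open>
  The diffeomorphism of the end \<open>W\<close> with \<open>(0, x0) \<times> N\<close> is \<open>p \<mapsto> (x p, y p)\<close>; \<open>N\<close> is the type of
  the values of \<open>y\<close>, with atlas \<open>AN\<close>. The values of \<open>x\<close> and \<open>y\<close> outside \<open>W\<close> are irrelevant.
\<close>

definition end_inv :: "'m set \<Rightarrow> ('m \<Rightarrow> real) \<Rightarrow> ('m \<Rightarrow> 'k) \<Rightarrow> real \<times> 'k \<Rightarrow> 'm" where
  "end_inv W x y = inv_into W (\<lambda>p. (x p, y p))"

definition end_diffeomorphism ::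
    "('m::topological_space, 'n::finite) chart set \<Rightarrow> ('k::topological_space, 'l::finite) chart set \<Rightarrow>
     'm set \<Rightarrow> real \<Rightarrow> ('m \<Rightarrow> real) \<Rightarrow> ('m \<Rightarrow> 'k) \<Rightarrow> bool" where
  "end_diffeomorphism A AN W x0 x y \<longleftrightarrow>
     homeomorphism W ({0<..<x0} \<times> UNIV) (\<lambda>p. (x p, y p)) (end_inv W x y) \<and>
     (\<forall>c\<in>A. \<forall>d\<in>AN.
        smooth_on ((\<lambda>p. (x p, snd d (y p))) \<circ> cinv c) (snd c ` (fst c \<inter> W \<inter> y -` fst d)) \<and>
        smooth_on (\<lambda>(s, z). snd c (end_inv W x y (s, cinv d z)))
                  ((\<lambda>p. (x p, snd d (y p))) ` (fst c \<inter> W \<inter> y -` fst d)))"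

definition weakly_hyperboloidal_end ::
    "('m::topological_space, 'n::finite) chart set \<Rightarrow> (('m, 'n) chart \<Rightarrow> 'm \<Rightarrow> real ^ 'n ^ 'n) \<Rightarrow>
     ('k::{t2_space, second_countable_topology}, 'l::finite) chart set \<Rightarrow>
     (('k, 'l) chart \<Rightarrow> 'k \<Rightarrow> real ^ 'l ^ 'l) \<Rightarrow>
     'm set \<Rightarrow> real \<Rightarrow> ('m \<Rightarrow> real) \<Rightarrow> ('m \<Rightarrow> 'k) \<Rightarrow> bool" where
  "weakly_hyperboloidal_end A g AN h W x0 x y \<longleftrightarrow>
     (\<exists>C. compact C \<and> W \<in> components (UNIV - C)) \<and>
     smooth_manifold AN \<and> compact (UNIV :: 'k set) \<and> manifold_boundary AN = {} \<and>
     riemannian_metric AN h \<and>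
     0 < x0 \<and> end_diffeomorphism A AN W x0 x y \<and>
     (\<exists>\<Lambda>>0. \<forall>c\<in>A. \<forall>d\<in>AN. \<forall>p\<in>fst c \<inter> W \<inter> y -` fst d. \<forall>v.
        let w = cderiv c (\<lambda>p'. snd d (y p')) p v;
            Q = ((cderiv c x p v)\<^sup>2 + w \<bullet> (h d (y p) *v w)) / (x p)\<^sup>2
        in Q / \<Lambda> \<le> v \<bullet> (g c p *v v) \<and> v \<bullet> (g c p *v v) \<le> \<Lambda> * Q)"

text \<open>Coordinates in the chart \<open>c\<close> of the vector field \<open>\<partial>\<^sub>x\<close> (velocity of the \<open>x\<close>-lines) at \<open>p\<close>.\<close>

definition partial_x ::
    "'m set \<Rightarrow> ('m \<Rightarrow> real) \<Rightarrow> ('m \<Rightarrow> 'k) \<Rightarrow> ('m, 'n::finite) chart \<Rightarrow> 'm \<Rightarrow> real ^ 'n" where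
  "partial_x W x y c p = vector_derivative (\<lambda>s. snd c (end_inv W x y (s, y p))) (at (x p))"

text \<open>\<open>|x \<Gamma>\<^sup>S\<^sub>x|\<close> at \<open>p\<close>\<close>

definition end_symmetric_norm ::
    "('m::topological_space, 'n::finite) chart set \<Rightarrow> ('m, 'e, 'r::finite) triv set \<Rightarrow> ('e \<Rightarrow> 'm) \<Rightarrow>
     ('e \<Rightarrow> 'e \<Rightarrow> real) \<Rightarrow>
     (('m, 'e, 'r) triv \<Rightarrow> ('m, 'n) chart \<Rightarrow> 'm \<Rightarrow> 'n \<Rightarrow> real ^ 'r ^ 'r) \<Rightarrow>
     'm set \<Rightarrow> ('m \<Rightarrow> real) \<Rightarrow> ('m \<Rightarrow> 'k) \<Rightarrow> 'm \<Rightarrow> real" where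
  "end_symmetric_norm A T \<pi> ip \<Gamma> W x y p =
     (let c = chart_at A p in
      \<bar>x p\<bar> * fibre_opnorm \<pi> ip p (symmetric_part A T \<pi> ip \<Gamma> c p (partial_x W x y c p)))"

text \<open>
  The filter of neighbourhoods of \<open>x = 0\<close> in the end, modulo null sets: a property holds eventually
  iff for some \<open>\<epsilon> > 0\<close> it holds at almost every point of \<open>W\<close> with \<open>x < \<epsilon>\<close>. As \<open>\<Gamma>\<close> is only defined
  almost everywhere, limits superior as \<open>x \<rightarrow> 0\<close> are taken along this filter.
\<close>

definition end_filter :: "'m measure \<Rightarrow> 'm set \<Rightarrow> ('m \<Rightarrow> real) \<Rightarrow> 'm filter" where
  "end_filter dv W x = inf (ae_filter dv) (inf (principal W) (filtercomap x (at_right 0)))"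


section \<open>Exponent and essential infimum\<close>

definition n_star :: "nat \<Rightarrow> real" where
  "n_star n = (if n = 2 then 2 / (1 - 2 / 10 ^ 6) else real n)"

definition ess_inf_on :: "'m measure \<Rightarrow> 'm set \<Rightarrow> ('m \<Rightarrow> real) \<Rightarrow> ereal" where
  "ess_inf_on dv \<Omega> w = Sup {a. AE p in dv. p \<in> \<Omega> \<longrightarrow> a \<le> ereal (w p)}"

end

theory Submission imports Defs
begin

text \<open>
  The proof bounds the integral of \<open>|u|\<^sup>2\<close> over small open sets by a constant times the energy
  \<open>\<integral> |\<nabla>u|\<^sup>2\<close>; such sets are called controlled. Once every point has a controlled neighbourhood,
  the weight is a convergent series of their indicators (\<open>weight_exists\<close>).

  The source of all estimates is the end. For \<open>F = |u|\<^sup>2\<close> the Leibniz rule gives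
  \<open>|\<partial>\<^sub>x F| \<le> 2 |u| |\<nabla>\<^sub>x u| + 2 |\<Gamma>\<^sup>S\<^sub>x| F\<close>: the part of the connection that is not symmetric does
  not enter. As the length of \<open>\<partial>\<^sub>x\<close> is comparable to \<open>1 / x\<close>, it follows that
  \<open>x |\<partial>\<^sub>x F| \<le> \<alpha> F + C |\<nabla>u|\<^sup>2\<close> near infinity with \<open>\<alpha> < n - 1\<close>, by the decay condition. The volume
  is comparable to \<open>x\<^sup>-\<^sup>n dx dz\<close>, and the one-dimensional Hardy inequality for the weight
  \<open>x\<^sup>-\<^sup>n\<close> has the constant \<open>n - 1\<close>; hence \<open>F\<close> is integrated against the volume by a multiple of the
  energy (\<open>hardy_interval\<close>, \<open>radial_derivative_bound\<close>, \<open>end_controlled\<close>). So there is a nonempty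
  controlled set.

  Control spreads over the connected manifold (\<open>controlled_step\<close>, \<open>controlled_everywhere\<close>). In a chart,
  \<open>|dF| \<le> \<gamma> F + C |\<nabla>u|\<^sup>2\<close> with a potential \<open>\<gamma>\<close> in \<open>L\<^sup>n\<close>, because the power \<open>n\<^sup>* \<ge> n\<close> of
  \<open>|\<Gamma>|\<close> is locally integrable. On a cube where the \<open>L\<^sup>n\<close> norm of \<open>\<gamma>\<close> is small, the Sobolev inequality
  for \<open>W\<^sup>1\<^sup>,\<^sup>1\<close> absorbs \<open>\<gamma> F\<close>, and a Poincare inequality bounds \<open>\<integral> F\<close> over the cube by \<open>\<integral> F\<close> over
  a subcube and the energy (\<open>absorption\<close>, \<open>cube_doubling\<close>). The Sobolev inequality is that of Gagliardo
  and Nirenberg, derived from Finner's form of Hoelder's inequality by averaging over one coordinate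
  at a time; it works with \<open>|u|\<^sup>2\<close> and its first derivatives only, and cubes fit equally well into
  half-spaces, so boundary points need no separate treatment (\<open>model_open_cubes\<close>).
\<close>

section \<open>Hoelder's inequality for several factors\<close>

definition enn_root :: "nat \<Rightarrow> ennreal \<Rightarrow> ennreal" where
  "enn_root m c = (if c = top then top else ennreal (root m (enn2real c)))"

lemma enn_root_measurable [measurable]: "enn_root m \<in> borel_measurable borel"
  unfolding enn_root_def by measurable

lemma enn_root_power: assumes "m > 0" shows "enn_root m c ^ m = c"
proof (cases "c = top")
  case True
  then show ?thesis using assms by (simp add: enn_root_def power_top_ennreal)
next
  case False
  then show ?thesis using assms
    by (simp add: enn_root_def ennreal_power less_top)
qed

lemma ennreal_power_le_iff:
  fixes a b :: ennreal assumes "m > 0" shows "a ^ m \<le> b ^ m \<longleftrightarrow> a \<le> b"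
proof
  assume *: "a ^ m \<le> b ^ m"
  show "a \<le> b"
  proof (cases "b = top")
    case True then show ?thesis by simp
  next
    case False
    then obtain b' where b: "b = ennreal b'" "b' \<ge> 0" by (cases b) auto
    show ?thesis
    proof (cases "a = top")
      case True
      then show ?thesis using * assms b by (simp add: power_top_ennreal ennreal_power top_unique)
    next
      case False
      then obtain a' where a: "a = ennreal a'" "a' \<ge> 0" by (cases a) auto
      from * show ?thesis using a b assms by (simp add: ennreal_power power_mono_iff)
    qed
  qed
qed (simp add: power_mono)

lemma enn_root_eqI: assumes "m > 0" "a ^ m = c" shows "enn_root m c = a"
  using ennreal_power_le_iff[OF assms(1)] enn_root_power[OF assms(1), of c] assms(2)
  by (metis order_antisym order_refl)

lemma enn_root_of_power: "m > 0 \<Longrightarrow> enn_root m (a ^ m) = a"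
  by (rule enn_root_eqI) auto

lemma enn_root_mono: assumes "m > 0" "a \<le> b" shows "enn_root m a \<le> enn_root m b"
  using ennreal_power_le_iff[OF assms(1), of "enn_root m a" "enn_root m b"] assms
  by (simp add: enn_root_power)

text \<open>
  The inequality of arithmetic and geometric means, from convexity of \<open>exp\<close>.
\<close>

lemma prod_le_sum_powers:
  fixes a :: "'j \<Rightarrow> real"
  assumes "finite J" "J \<noteq> {}" "\<And>j. j \<in> J \<Longrightarrow> 0 \<le> a j"
  shows "real (card J) * (\<Prod>j\<in>J. a j) \<le> (\<Sum>j\<in>J. a j ^ card J)"
proof (cases "\<exists>j\<in>J. a j = 0")
  case True
  then have "(\<Prod>j\<in>J. a j) = 0" using assms by auto
  moreover have "0 \<le> (\<Sum>j\<in>J. a j ^ card J)" using assms(3) by (intro sum_nonneg) auto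
  ultimately show ?thesis by simp
next
  case False
  then have pos: "\<And>j. j \<in> J \<Longrightarrow> 0 < a j" using assms(3) by force
  define m where "m = card J"
  have m: "m > 0" using assms by (simp add: m_def card_gt_0_iff)
  have "exp (\<Sum>j\<in>J. (1 / real m) *\<^sub>R (real m * ln (a j))) \<le> (\<Sum>j\<in>J. (1 / real m) * exp (real m * ln (a j)))"
    by (rule convex_on_sum[OF assms(1,2) exp_convex]) (use m in \<open>auto simp: m_def\<close>)
  moreover have "(\<Sum>j\<in>J. (1 / real m) *\<^sub>R (real m * ln (a j))) = (\<Sum>j\<in>J. ln (a j))"
    using m by simp
  moreover have "exp (\<Sum>j\<in>J. ln (a j)) = (\<Prod>j\<in>J. a j)"
    using assms(1) pos by (simp add: exp_sum)
  moreover have "exp (real m * ln (a j)) = a j ^ m" if "j \<in> J" for j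
    using pos[OF that] by (metis exp_ln exp_of_nat_mult)
  ultimately have "(\<Prod>j\<in>J. a j) \<le> (\<Sum>j\<in>J. (1 / real m) * a j ^ m)" by simp
  then show ?thesis using m unfolding m_def[symmetric]
    by (simp add: sum_divide_distrib[symmetric] field_simps)
qed

lemma ennreal_prod_le_sum_powers:
  fixes a :: "'j \<Rightarrow> ennreal"
  assumes "finite J" "J \<noteq> {}"
  shows "of_nat (card J) * (\<Prod>j\<in>J. a j) \<le> (\<Sum>j\<in>J. a j ^ card J)"
proof (cases "\<exists>j\<in>J. a j = top")
  case True
  then obtain j where j: "j \<in> J" "a j = top" by auto
  have "card J > 0" using assms by (simp add: card_gt_0_iff)
  then have "a j ^ card J = top" using j by (simp add: power_top_ennreal)
  then have "(\<Sum>j\<in>J. a j ^ card J) = top"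
    using member_le_sum[of j J "\<lambda>j. a j ^ card J"] assms j by (simp add: top_unique)
  then show ?thesis by simp
next
  case False
  define b where "b = (\<lambda>j. enn2real (a j))"
  have ab: "a j = ennreal (b j)" if "j \<in> J" for j
    using False that by (auto simp: b_def less_top)
  have b0: "b j \<ge> 0" for j by (simp add: b_def)
  have "of_nat (card J) * (\<Prod>j\<in>J. a j) = ennreal (real (card J) * (\<Prod>j\<in>J. b j))"
    using ab b0 by (simp add: prod_ennreal ennreal_mult' prod_nonneg ennreal_of_nat_eq_real_of_nat cong: prod.cong)
  also have "\<dots> \<le> ennreal (\<Sum>j\<in>J. b j ^ card J)"
    using prod_le_sum_powers[OF assms, of b] b0 by (simp add: ennreal_leI)
  also have "\<dots> = (\<Sum>j\<in>J. a j ^ card J)"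
    using ab b0 by (simp add: sum_ennreal[symmetric] ennreal_power del: sum_ennreal cong: sum.cong)
  finally show ?thesis .
qed

text \<open>
  Hoelder's inequality with \<open>m\<close> equal exponents: normalize every factor to have \<open>m\<close>-th power
  integral 1 and integrate the inequality of arithmetic and geometric means. Extended values cost
  two cases: a root that is 0 makes the product vanish almost everywhere, and otherwise a root that
  is infinite makes the right-hand side infinite.
\<close>

lemma nn_integral_prod_le_roots:
  fixes h :: "'j \<Rightarrow> 'a \<Rightarrow> ennreal"
  assumes J: "finite J" "J \<noteq> {}" and m: "m = card J"
    and [measurable]: "\<And>j. j \<in> J \<Longrightarrow> h j \<in> borel_measurable N"
  shows "(\<integral>\<^sup>+x. (\<Prod>j\<in>J. h j x) \<partial>N) \<le> (\<Prod>j\<in>J. enn_root m (\<integral>\<^sup>+x. h j x ^ m \<partial>N))"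
proof -
  define c where "c = (\<lambda>j. enn_root m (\<integral>\<^sup>+x. h j x ^ m \<partial>N))"
  have m0: "m > 0" using J m by (simp add: card_gt_0_iff)
  have cm: "c j ^ m = (\<integral>\<^sup>+x. h j x ^ m \<partial>N)" for j unfolding c_def by (rule enn_root_power[OF m0])
  show ?thesis unfolding c_def[symmetric]
  proof (cases "\<exists>j\<in>J. c j = 0")
    case True
    then obtain j where j: "j \<in> J" "c j = 0" by auto
    then have "(\<integral>\<^sup>+x. h j x ^ m \<partial>N) = 0" using cm[of j] m0 by (simp add: zero_power)
    then have "AE x in N. h j x ^ m = 0" using j by (subst (asm) nn_integral_0_iff_AE) auto
    then have "AE x in N. (\<Prod>j\<in>J. h j x) = 0"
      by eventually_elim (use J j in auto)
    then have "(\<integral>\<^sup>+x. (\<Prod>j\<in>J. h j x) \<partial>N) = (\<integral>\<^sup>+x. 0 \<partial>N)" by (rule nn_integral_cong_AE)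
    then show "(\<integral>\<^sup>+x. (\<Prod>j\<in>J. h j x) \<partial>N) \<le> (\<Prod>j\<in>J. c j)" by simp
  next
    case False
    show "(\<integral>\<^sup>+x. (\<Prod>j\<in>J. h j x) \<partial>N) \<le> (\<Prod>j\<in>J. c j)"
    proof (cases "\<exists>j\<in>J. c j = top")
      case True
      then have "(\<Prod>j\<in>J. c j) = top" using False J(1) by (simp add: ennreal_prod_eq_top)
      then show ?thesis by simp
    next
      case F2: False
      have cj: "c j * inverse (c j) = 1" if "j \<in> J" for j
        using that False F2 by (simp add: ennreal_divide_self[unfolded divide_ennreal_def] less_top)
      have hc: "h j x = c j * (inverse (c j) * h j x)" if "j \<in> J" for j x
        using cj[OF that] by (simp add: mult.assoc[symmetric])
      have I: "(\<integral>\<^sup>+x. (inverse (c j) * h j x) ^ m \<partial>N) = 1" if "j \<in> J" for j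
      proof -
        have "(\<integral>\<^sup>+x. (inverse (c j) * h j x) ^ m \<partial>N) = inverse (c j) ^ m * (\<integral>\<^sup>+x. h j x ^ m \<partial>N)"
          using that by (simp add: power_mult_distrib nn_integral_cmult)
        also have "\<dots> = (c j * inverse (c j)) ^ m" unfolding cm[symmetric] by (simp add: power_mult_distrib mult.commute)
        finally show ?thesis using cj[OF that] by simp
      qed
      have "of_nat m * (\<integral>\<^sup>+x. (\<Prod>j\<in>J. inverse (c j) * h j x) \<partial>N)
           = (\<integral>\<^sup>+x. of_nat m * (\<Prod>j\<in>J. inverse (c j) * h j x) \<partial>N)"
        by (rule nn_integral_cmult[symmetric]) measurable
      also have "\<dots> \<le> (\<integral>\<^sup>+x. (\<Sum>j\<in>J. (inverse (c j) * h j x) ^ m) \<partial>N)"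
        unfolding m by (intro nn_integral_mono ennreal_prod_le_sum_powers J)
      also have "\<dots> = (\<Sum>j\<in>J. \<integral>\<^sup>+x. (inverse (c j) * h j x) ^ m \<partial>N)"
        by (rule nn_integral_sum) measurable
      also have "\<dots> = of_nat m * 1" using I m by simp
      finally have le1: "(\<integral>\<^sup>+x. (\<Prod>j\<in>J. inverse (c j) * h j x) \<partial>N) \<le> 1"
        using m0 by (subst (asm) ennreal_mult_le_mult_iff) auto
      have "(\<integral>\<^sup>+x. (\<Prod>j\<in>J. h j x) \<partial>N) = (\<integral>\<^sup>+x. (\<Prod>j\<in>J. c j) * (\<Prod>j\<in>J. inverse (c j) * h j x) \<partial>N)"
        unfolding prod.distrib[symmetric] by (intro nn_integral_cong prod.cong refl hc)
      also have "\<dots> = (\<Prod>j\<in>J. c j) * (\<integral>\<^sup>+x. (\<Prod>j\<in>J. inverse (c j) * h j x) \<partial>N)"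
        by (rule nn_integral_cmult) measurable
      also have "\<dots> \<le> (\<Prod>j\<in>J. c j) * 1" by (rule mult_left_mono[OF le1]) simp
      finally show ?thesis by simp
    qed
  qed
qed

section \<open>Sobolev and Poincare inequalities on product spaces\<close>

locale unit_product = product_sigma_finite M for M :: "'i::finite \<Rightarrow> 'a measure" +
  assumes total: "\<And>i. emeasure (M i) (space (M i)) = 1"
    and space_M [simp]: "\<And>i. space (M i) = UNIV"
begin

abbreviation P where "P \<equiv> PiM UNIV M"

text \<open>
  Averaging over a single coordinate. For a probability product measure these operators commute
  with multiplication by functions that do not depend on the coordinate, and composing all of them
  gives the integral; every inequality of this section is obtained by averaging one coordinate after
  the other.
\<close>

definition avg :: "'i \<Rightarrow> (('i \<Rightarrow> 'a) \<Rightarrow> ennreal) \<Rightarrow> ('i \<Rightarrow> 'a) \<Rightarrow> ennreal" where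
  "avg i f x = (\<integral>\<^sup>+t. f (x(i := t)) \<partial>M i)"

definition indep_of :: "'i \<Rightarrow> (('i \<Rightarrow> 'a) \<Rightarrow> ennreal) \<Rightarrow> bool" where
  "indep_of i f \<longleftrightarrow> (\<forall>x t. f (x(i := t)) = f x)"

lemma space_P [simp]: "space P = UNIV"
  by (simp add: space_PiM PiE_UNIV_domain)

lemma upd_measurable: "(\<lambda>(x, t). x(i := t)) \<in> measurable (P \<Otimes>\<^sub>M M i) P"
  using measurable_add_dim[of i UNIV M] by simp

lemma upd_measurable' [measurable]:
  assumes "g \<in> measurable N P" "h \<in> measurable N (M i)"
  shows "(\<lambda>z. (g z)(i := h z)) \<in> measurable N P"
  using measurable_compose[OF measurable_Pair[OF assms] upd_measurable] by simp

lemma avg_measurable [measurable]: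
  assumes [measurable]: "f \<in> borel_measurable P" shows "avg i f \<in> borel_measurable P"
proof -
  interpret sigma_finite_measure "M i" by (rule sigma_finite_measures)
  show ?thesis unfolding avg_def by measurable
qed

lemma indep_avg: "indep_of i (avg i f)"
  by (simp add: indep_of_def avg_def)

lemma indep_of_avg: assumes "indep_of k f" shows "indep_of k (avg i f)"
proof (cases "k = i")
  case False
  then show ?thesis using assms by (simp add: indep_of_def avg_def fun_upd_twist)
qed (simp add: indep_avg)

lemma avg_indep: "indep_of i f \<Longrightarrow> avg i f = f"
  by (rule ext) (simp add: indep_of_def avg_def total[simplified])

lemma avg_mult_left:
  assumes "indep_of i g" and [measurable]: "f \<in> borel_measurable P"
  shows "avg i (\<lambda>x. g x * f x) x = g x * avg i f x"
  using assms(1) by (simp add: avg_def indep_of_def nn_integral_cmult)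

lemma avg_mono: "(\<And>x. f x \<le> g x) \<Longrightarrow> avg i f x \<le> avg i g x"
  by (simp add: avg_def nn_integral_mono)

lemma nn_integral_avg:
  assumes [measurable]: "f \<in> borel_measurable P"
  shows "(\<integral>\<^sup>+x. avg i f x \<partial>P) = (\<integral>\<^sup>+x. f x \<partial>P)"
proof -
  let ?I = "UNIV - {i}"
  have eq: "(\<integral>\<^sup>+x. g x \<partial>P) = (\<integral>\<^sup>+x. (\<integral>\<^sup>+t. g (x(i := t)) \<partial>M i) \<partial>PiM ?I M)"
    if "g \<in> borel_measurable P" for g :: "_ \<Rightarrow> ennreal"
    using product_nn_integral_insert[of ?I i g] that by (simp add: insert_UNIV)
  have "(\<integral>\<^sup>+x. avg i f x \<partial>P) = (\<integral>\<^sup>+x. (\<integral>\<^sup>+t. avg i f (x(i := t)) \<partial>M i) \<partial>PiM ?I M)"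
    by (rule eq) measurable
  also have "\<dots> = (\<integral>\<^sup>+x. avg i f x \<partial>PiM ?I M)"
    using indep_avg[of i f] by (simp add: indep_of_def total[simplified])
  also have "\<dots> = (\<integral>\<^sup>+x. f x \<partial>P)" unfolding eq[OF assms] avg_def ..
  finally show ?thesis .
qed

lemma emeasure_P: "emeasure P UNIV = 1"
  using emeasure_PiM[of UNIV "\<lambda>_. UNIV"] sets.top[of "M _"]
  by (simp add: PiE_UNIV_domain total[simplified] del: sets.top)

text \<open>
  Induction over the coordinates: averaging over one of them leaves the independent factors alone,
  and Hoelder's inequality applies to the \<open>m\<close> factors that do depend on it. The averaged
  powers satisfy the same independence assumptions for the remaining coordinates.
\<close>

lemma finner_list:
  fixes g :: "'j \<Rightarrow> ('i \<Rightarrow> 'a) \<Rightarrow> ennreal"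
  assumes J: "finite J" and m: "m > 0"
    and [measurable]: "\<And>j. j \<in> J \<Longrightarrow> g j \<in> borel_measurable P"
    and dep: "\<And>i. i \<in> set is \<Longrightarrow> card {j\<in>J. \<not> indep j i} = m"
    and ind: "\<And>i j. i \<in> set is \<Longrightarrow> j \<in> J \<Longrightarrow> indep j i \<Longrightarrow> indep_of i (g j)"
  shows "foldr avg is (\<lambda>x. \<Prod>j\<in>J. g j x) x \<le> (\<Prod>j\<in>J. enn_root m (foldr avg is (\<lambda>x. g j x ^ m) x))"
  using dep ind
proof (induction "is" arbitrary: x)
  case Nil
  then show ?case using m by (simp add: enn_root_of_power)
next
  case (Cons i "is")
  define h where "h j x = enn_root m (foldr avg is (\<lambda>x. g j x ^ m) x)" for j x
  have meas: "foldr avg js f \<in> borel_measurable P" if "f \<in> borel_measurable P" for f js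
    using that by (induction js) (auto intro: avg_measurable)
  have [measurable]: "h j \<in> borel_measurable P" if "j \<in> J" for j
    unfolding h_def using meas[of "\<lambda>x. g j x ^ m" "is"] that by measurable
  have foldr_ind: "indep_of i (foldr avg js f)" if "indep_of i f" for f js
    using that by (induction js) (auto intro: indep_of_avg)
  have hind: "h j (x(i := t)) = h j x" if "j \<in> J" "indep j i" for j x t
  proof -
    have "indep_of i (\<lambda>x. g j x ^ m)" using Cons.prems(2)[of i j] that by (simp add: indep_of_def)
    from foldr_ind[OF this, of "is"] show ?thesis by (simp add: h_def indep_of_def)
  qed
  let ?D = "{j\<in>J. \<not> indep j i}" and ?E = "{j\<in>J. indep j i}"
  have JDE: "J = ?D \<union> ?E" "?D \<inter> ?E = {}" by auto
  have cD: "card ?D = m" using Cons.prems(1) by simp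
  have D0: "?D \<noteq> {}" using cD m by (metis card.empty less_irrefl)
  have split: "(\<Prod>j\<in>J. f j) = (\<Prod>j\<in>?E. f j) * (\<Prod>j\<in>?D. f j)" for f :: "'j \<Rightarrow> ennreal"
    by (subst JDE(1), subst prod.union_disjoint) (use J in \<open>auto simp: mult.commute\<close>)
  have "foldr avg (i # is) (\<lambda>x. \<Prod>j\<in>J. g j x) x \<le> avg i (\<lambda>x. \<Prod>j\<in>J. h j x) x"
    unfolding foldr.simps o_def h_def by (intro avg_mono Cons.IH Cons.prems) auto
  also have "\<dots> = (\<integral>\<^sup>+t. (\<Prod>j\<in>?E. h j x) * (\<Prod>j\<in>?D. h j (x(i := t))) \<partial>M i)"
    unfolding avg_def split by (intro nn_integral_cong arg_cong2[where f="(*)"] prod.cong refl) (auto simp: hind)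
  also have "\<dots> = (\<Prod>j\<in>?E. h j x) * (\<integral>\<^sup>+t. (\<Prod>j\<in>?D. h j (x(i := t))) \<partial>M i)"
    by (rule nn_integral_cmult) measurable
  also have "\<dots> \<le> (\<Prod>j\<in>?E. h j x) * (\<Prod>j\<in>?D. enn_root m (\<integral>\<^sup>+t. h j (x(i := t)) ^ m \<partial>M i))"
    using J cD D0 by (intro mult_left_mono nn_integral_prod_le_roots) auto
  also have "(\<Prod>j\<in>?D. enn_root m (\<integral>\<^sup>+t. h j (x(i := t)) ^ m \<partial>M i)) =
      (\<Prod>j\<in>?D. enn_root m (foldr avg (i # is) (\<lambda>x. g j x ^ m) x))"
    by (simp add: h_def enn_root_power m avg_def)
  also have "(\<Prod>j\<in>?E. h j x) = (\<Prod>j\<in>?E. enn_root m (foldr avg (i # is) (\<lambda>x. g j x ^ m) x))"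
  proof (rule prod.cong[OF refl])
    fix j assume j: "j \<in> ?E"
    then have "indep_of i (\<lambda>x. g j x ^ m)" using Cons.prems(2)[of i j] by (simp add: indep_of_def)
    from avg_indep[OF foldr_ind[OF this, of "is"]]
    show "h j x = enn_root m (foldr avg (i # is) (\<lambda>x. g j x ^ m) x)" by (simp add: h_def)
  qed
  finally show ?case unfolding split[symmetric] .
qed

text \<open>
  After averaging over all coordinates nothing depends on any coordinate, so the result is constant,
  and its integral is that of the original function.
\<close>

lemma foldr_avg_all:
  assumes f: "f \<in> borel_measurable P" and "set is = UNIV"
  shows "foldr avg is f x = (\<integral>\<^sup>+x. f x \<partial>P)"
proof -
  let ?h = "foldr avg is f"
  have "?h \<in> borel_measurable P \<and> (\<integral>\<^sup>+x. ?h x \<partial>P) = (\<integral>\<^sup>+x. f x \<partial>P)"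
    using f by (induction "is") (auto intro: avg_measurable simp: nn_integral_avg)
  have ind: "indep_of i (foldr avg js f)" if "i \<in> set js" for i js
    using that by (induction js) (auto intro: indep_of_avg indep_avg)
  have upd: "?h (\<lambda>i. if i \<in> S then y i else x i) = ?h x" if "finite S" for S y
    using that
  proof (induction S)
    case (insert k S)
    have "(\<lambda>i. if i \<in> insert k S then y i else x i) = (\<lambda>i. if i \<in> S then y i else x i)(k := y k)"
      by auto
    moreover have "?h (z(k := t)) = ?h z" for z t using ind[of k "is"] assms(2) by (simp add: indep_of_def)
    ultimately show ?case using insert by simp
  qed simp
  have const: "?h y = ?h x" for y using upd[of UNIV y] by simp
  have "(\<integral>\<^sup>+x. f x \<partial>P) = (\<integral>\<^sup>+y. ?h y \<partial>P)"
    using \<open>_ \<and> _\<close> by simp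
  also have "\<dots> = (\<integral>\<^sup>+y. ?h x \<partial>P)" by (intro nn_integral_cong const)
  also have "\<dots> = ?h x" by (simp add: emeasure_P)
  finally show ?thesis by simp
qed

text \<open>
  Finner's generalization of Hoelder's inequality (for \<open>m\<close> factors per coordinate). With the
  \<open>n\<close> functions that omit one coordinate each it is the Loomis-Whitney inequality.
\<close>

lemma finner:
  fixes g :: "'j \<Rightarrow> ('i \<Rightarrow> 'a) \<Rightarrow> ennreal"
  assumes J: "finite J" and m: "m > 0"
    and [measurable]: "\<And>j. j \<in> J \<Longrightarrow> g j \<in> borel_measurable P"
    and dep: "\<And>i. card {j\<in>J. \<not> indep j i} = m"
    and ind: "\<And>i j. j \<in> J \<Longrightarrow> indep j i \<Longrightarrow> indep_of i (g j)"
  shows "(\<integral>\<^sup>+x. (\<Prod>j\<in>J. g j x) \<partial>P) \<le> (\<Prod>j\<in>J. enn_root m (\<integral>\<^sup>+x. g j x ^ m \<partial>P))"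
proof -
  obtain "is" :: "'i list" where "is": "set is = UNIV" using finite_list[OF finite, of UNIV] by blast
  have "(\<integral>\<^sup>+x. (\<Prod>j\<in>J. g j x) \<partial>P) = foldr avg is (\<lambda>x. \<Prod>j\<in>J. g j x) undefined"
    by (rule foldr_avg_all[OF _ "is", symmetric]) measurable
  also have "\<dots> \<le> (\<Prod>j\<in>J. enn_root m (foldr avg is (\<lambda>x. g j x ^ m) undefined))"
    by (rule finner_list[where indep = indep]) (use J m dep ind assms(3) in auto)
  also have "\<dots> = (\<Prod>j\<in>J. enn_root m (\<integral>\<^sup>+x. g j x ^ m \<partial>P))"
    by (intro prod.cong refl arg_cong[where f="enn_root m"] foldr_avg_all[OF _ "is"]) measurable
  finally show ?thesis .
qed

text \<open>
  The Gagliardo-Nirenberg form of the critical Sobolev inequality, already combined with Hoelder's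
  inequality for the potential \<open>\<gamma>\<close>: \<open>F\<close> is at most the product of the \<open>n\<close>-th roots of
  the averages of \<open>G\<close>. The \<open>i\<close>-th average omits the coordinate \<open>i\<close> while \<open>\<gamma>\<close>
  depends on all coordinates, so each coordinate occurs in exactly \<open>n\<close> of the \<open>n + 1\<close>
  factors, which is what Finner's inequality needs.
\<close>

lemma sobolev_product:
  fixes F G \<gamma> :: "('i \<Rightarrow> 'a) \<Rightarrow> ennreal"
  assumes [measurable]: "F \<in> borel_measurable P" "G \<in> borel_measurable P" "\<gamma> \<in> borel_measurable P"
    and F: "\<And>i x. F x \<le> avg i G x"
  shows "(\<integral>\<^sup>+x. \<gamma> x * F x \<partial>P) \<le> enn_root CARD('i) (\<integral>\<^sup>+x. \<gamma> x ^ CARD('i) \<partial>P) * (\<integral>\<^sup>+x. G x \<partial>P)"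
proof -
  let ?n = "CARD('i)"
  have n: "?n > 0" by simp
  \<comment> \<open>\<open>None\<close> stands for the potential, \<open>Some i\<close> for the root of the average that omits the coordinate \<open>i\<close>\<close>
  define g where "g j = (case j of None \<Rightarrow> \<gamma> | Some i \<Rightarrow> (\<lambda>x. enn_root ?n (avg i G x)))" for j
  define indep where "indep j i = (j = Some i)" for j :: "'i option" and i
  have Fle: "F x \<le> (\<Prod>i\<in>UNIV. enn_root ?n (avg i G x))" for x
  proof -
    have "F x = (\<Prod>i\<in>(UNIV::'i set). enn_root ?n (F x))" by (simp add: enn_root_power)
    also have "\<dots> \<le> (\<Prod>i\<in>UNIV. enn_root ?n (avg i G x))"
      by (intro prod_mono_ennreal enn_root_mono n F)
    finally show ?thesis .
  qed
  have U: "(UNIV :: 'i option set) = insert None (range Some)" by (auto simp: UNIV_option_conv)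
  have prodU: "(\<Prod>j\<in>UNIV. f j) = f None * (\<Prod>i\<in>UNIV. f (Some i))" for f :: "'i option \<Rightarrow> ennreal"
    unfolding U by (subst prod.insert) (auto simp: prod.reindex)
  have "(\<integral>\<^sup>+x. \<gamma> x * F x \<partial>P) \<le> (\<integral>\<^sup>+x. (\<Prod>j\<in>UNIV. g j x) \<partial>P)"
    unfolding prodU by (intro nn_integral_mono) (simp add: g_def mult_left_mono Fle)
  also have "\<dots> \<le> (\<Prod>j\<in>UNIV. enn_root ?n (\<integral>\<^sup>+x. g j x ^ ?n \<partial>P))"
  proof (rule finner[where indep = indep])
    show "g j \<in> borel_measurable P" for j unfolding g_def by (cases j) simp_all
    show "card {j \<in> UNIV. \<not> indep j i} = ?n" for i
    proof -
      have "{j \<in> UNIV. \<not> indep j i} = UNIV - {Some i}" by (auto simp: indep_def)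
      then show ?thesis by (simp add: card_Diff_singleton card_UNIV_option)
    qed
    show "indep_of i (g j)" if "indep j i" for i j
      using that indep_avg[of i G] by (simp add: indep_def g_def indep_of_def)
  qed auto
  also have "\<dots> = enn_root ?n (\<integral>\<^sup>+x. \<gamma> x ^ ?n \<partial>P) * (\<Prod>i\<in>(UNIV::'i set). enn_root ?n (\<integral>\<^sup>+x. G x \<partial>P))"
    unfolding prodU by (simp add: g_def enn_root_power nn_integral_avg)
  also have "(\<Prod>i\<in>(UNIV::'i set). enn_root ?n (\<integral>\<^sup>+x. G x \<partial>P)) = (\<integral>\<^sup>+x. G x \<partial>P)"
    by (simp add: enn_root_power)
  finally show ?thesis .
qed

text \<open>
  A Poincare inequality that controls \<open>F\<close> by its integral against the product weight: the factors
  \<open>\<rho> i\<close> are inserted one at a time, and inserting one costs a multiple of \<open>r\<close> times the integral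
  of \<open>K\<close>, because the factors inserted earlier are bounded by \<open>c\<close>.
\<close>

lemma poincare_product:
  fixes F K :: "('i \<Rightarrow> 'a) \<Rightarrow> ennreal"
  assumes [measurable]: "F \<in> borel_measurable P" "K \<in> borel_measurable P" "\<And>i. \<rho> i \<in> borel_measurable (M i)"
    and \<rho>: "\<And>i t. \<rho> i t \<le> c" and c: "1 \<le> c"
    and F: "\<And>i x. F x \<le> avg i (\<lambda>x. \<rho> i (x i) * F x) x + r * avg i K x"
  shows "(\<integral>\<^sup>+x. F x \<partial>P) \<le> (\<integral>\<^sup>+x. (\<Prod>i\<in>UNIV. \<rho> i (x i)) * F x \<partial>P) + of_nat CARD('i) * c ^ CARD('i) * r * (\<integral>\<^sup>+x. K x \<partial>P)"
proof -
  have "(\<integral>\<^sup>+x. F x \<partial>P) \<le> (\<integral>\<^sup>+x. (\<Prod>i\<in>S. \<rho> i (x i)) * F x \<partial>P) + of_nat (card S) * c ^ CARD('i) * r * (\<integral>\<^sup>+x. K x \<partial>P)"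
    for S :: "'i set" using finite[of S]
  proof (induction S)
    case (insert k S)
    define w where "w x = (\<Prod>i\<in>S. \<rho> i (x i))" for x :: "'i \<Rightarrow> 'a"
    have [measurable]: "w \<in> borel_measurable P" unfolding w_def by measurable
    have wk: "indep_of k w" unfolding indep_of_def w_def
      using insert by (intro allI prod.cong) auto
    have wle: "w x \<le> c ^ CARD('i)" for x
    proof -
      have "w x \<le> (\<Prod>i\<in>S. c)" unfolding w_def by (intro prod_mono_ennreal \<rho>)
      also have "\<dots> \<le> c ^ CARD('i)" using c by (simp add: card_mono power_increasing)
      finally show ?thesis .
    qed
    have "(\<integral>\<^sup>+x. w x * F x \<partial>P) \<le> (\<integral>\<^sup>+x. avg k (\<lambda>x. w x * (\<rho> k (x k) * F x)) x + c ^ CARD('i) * r * avg k K x \<partial>P)"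
    proof (rule nn_integral_mono)
      fix x
      have "w x * F x \<le> w x * (avg k (\<lambda>x. \<rho> k (x k) * F x) x + r * avg k K x)" by (intro mult_left_mono F) simp
      also have "\<dots> = avg k (\<lambda>x. w x * (\<rho> k (x k) * F x)) x + w x * (r * avg k K x)"
        by (subst avg_mult_left[OF wk]) (simp_all add: distrib_left)
      also have "\<dots> \<le> avg k (\<lambda>x. w x * (\<rho> k (x k) * F x)) x + c ^ CARD('i) * (r * avg k K x)"
        by (intro add_left_mono mult_right_mono wle) simp
      finally show "w x * F x \<le> avg k (\<lambda>x. w x * (\<rho> k (x k) * F x)) x + c ^ CARD('i) * r * avg k K x" by (simp add: mult.assoc)
    qed
    also have "\<dots> = (\<integral>\<^sup>+x. w x * (\<rho> k (x k) * F x) \<partial>P) + c ^ CARD('i) * r * (\<integral>\<^sup>+x. K x \<partial>P)"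
      by (simp add: nn_integral_add nn_integral_cmult nn_integral_avg)
    finally have step: "(\<integral>\<^sup>+x. w x * F x \<partial>P) \<le> (\<integral>\<^sup>+x. (\<Prod>i\<in>insert k S. \<rho> i (x i)) * F x \<partial>P) + c ^ CARD('i) * r * (\<integral>\<^sup>+x. K x \<partial>P)"
      using insert by (simp add: w_def mult.assoc mult.left_commute)
    have "(\<integral>\<^sup>+x. F x \<partial>P) \<le> (\<integral>\<^sup>+x. w x * F x \<partial>P) + of_nat (card S) * c ^ CARD('i) * r * (\<integral>\<^sup>+x. K x \<partial>P)"
      using insert.IH by (simp add: w_def)
    also have "\<dots> \<le> ((\<integral>\<^sup>+x. (\<Prod>i\<in>insert k S. \<rho> i (x i)) * F x \<partial>P) + c ^ CARD('i) * r * (\<integral>\<^sup>+x. K x \<partial>P))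
        + of_nat (card S) * c ^ CARD('i) * r * (\<integral>\<^sup>+x. K x \<partial>P)"
      by (rule add_right_mono[OF step])
    also have "\<dots> = (\<integral>\<^sup>+x. (\<Prod>i\<in>insert k S. \<rho> i (x i)) * F x \<partial>P) + of_nat (card (insert k S)) * c ^ CARD('i) * r * (\<integral>\<^sup>+x. K x \<partial>P)"
      using insert.hyps by (simp add: distrib_right add_ac)
    finally show ?case .
  qed simp
  from this[of UNIV] show ?thesis .
qed

text \<open>
  Here \<open>K\<close> plays the role of a bound for the gradient of \<open>F\<close>; it contains \<open>F\<close> itself
  with the unbounded coefficient \<open>\<gamma>\<close>. The Sobolev inequality bounds this term by the \<open>L\<^sup>n\<close> norm of
  \<open>\<gamma>\<close> times the integrals of \<open>F\<close> and \<open>K\<close>, the Poincare inequality bounds the integral of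
  \<open>F\<close>, and smallness of \<open>\<gamma>\<close> lets the term be absorbed. Absorption subtracts the integral
  of \<open>K\<close> from both sides and therefore needs it to be finite.
\<close>

lemma absorption:
  fixes F H \<gamma> :: "('i \<Rightarrow> 'a) \<Rightarrow> ennreal" and c r :: ennreal
  defines "K \<equiv> \<lambda>x. \<gamma> x * F x + H x" and "A \<equiv> of_nat CARD('i) * c ^ CARD('i)"
  assumes m [measurable]: "F \<in> borel_measurable P" "H \<in> borel_measurable P" "\<gamma> \<in> borel_measurable P"
     "\<And>i. \<rho> i \<in> borel_measurable (M i)"
    and \<rho>: "\<And>i t. \<rho> i t \<le> c" and c: "1 \<le> c"
    and F1: "\<And>i x. F x \<le> avg i F x + r * avg i K x"
    and F2: "\<And>i x. F x \<le> avg i (\<lambda>x. \<rho> i (x i) * F x) x + r * avg i K x"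
    and small: "2 * (enn_root CARD('i) (\<integral>\<^sup>+x. \<gamma> x ^ CARD('i) \<partial>P) * r * (1 + A)) \<le> 1"
    and fin: "(\<integral>\<^sup>+x. K x \<partial>P) < top"
  shows "(\<integral>\<^sup>+x. F x \<partial>P) \<le> 2 * (\<integral>\<^sup>+x. (\<Prod>i\<in>UNIV. \<rho> i (x i)) * F x \<partial>P) + 2 * A * r * (\<integral>\<^sup>+x. H x \<partial>P)"
proof -
  define g where "g = enn_root CARD('i) (\<integral>\<^sup>+x. \<gamma> x ^ CARD('i) \<partial>P)"
  define k f e h where "k = (\<integral>\<^sup>+x. K x \<partial>P)" and "f = (\<integral>\<^sup>+x. F x \<partial>P)"
    and "e = (\<integral>\<^sup>+x. (\<Prod>i\<in>UNIV. \<rho> i (x i)) * F x \<partial>P)" and "h = (\<integral>\<^sup>+x. H x \<partial>P)"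
  have Km [measurable]: "K \<in> borel_measurable P" unfolding K_def by measurable
  have p: "f \<le> e + A * r * k"
    unfolding f_def e_def k_def A_def by (rule poincare_product[OF m(1) Km m(4) \<rho> c F2])
  have "(\<integral>\<^sup>+x. \<gamma> x * F x \<partial>P) \<le> g * (\<integral>\<^sup>+x. F x + r * K x \<partial>P)"
    unfolding g_def
  proof (rule sobolev_product)
    fix i x
    have "avg i (\<lambda>x. F x + r * K x) x = avg i F x + r * avg i K x"
      unfolding avg_def by (subst nn_integral_add) (simp_all add: nn_integral_cmult)
    then show "F x \<le> avg i (\<lambda>x. F x + r * K x) x" using F1 by simp
  qed measurable
  also have "\<dots> = g * (f + r * k)"
    by (simp add: nn_integral_add nn_integral_cmult f_def k_def)
  finally have "(\<integral>\<^sup>+x. \<gamma> x * F x \<partial>P) \<le> g * (f + r * k)" .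
  then have "k \<le> g * (f + r * k) + h"
    by (simp add: k_def K_def nn_integral_add h_def add_right_mono)
  also have "\<dots> \<le> g * ((e + A * r * k) + r * k) + h"
    by (intro add_right_mono mult_left_mono p) simp
  also have "\<dots> = (g * r * (1 + A)) * k + (g * e + h)" by (simp add: algebra_simps)
  finally have k1: "k \<le> (g * r * (1 + A)) * k + (g * e + h)" .
  have "2 * k \<le> 2 * ((g * r * (1 + A)) * k + (g * e + h))" by (intro mult_left_mono k1) simp
  also have "\<dots> = (2 * (g * r * (1 + A))) * k + 2 * (g * e + h)" by (simp add: algebra_simps)
  also have "\<dots> \<le> 1 * k + 2 * (g * e + h)"
    using small by (intro add_right_mono mult_right_mono) (simp_all add: g_def)
  finally have "k + k \<le> k + 2 * (g * e + h)" by (simp add: mult_2)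
  then have k2: "k \<le> 2 * (g * e + h)" using fin by (auto simp: k_def ennreal_add_left_cancel_le)
  have gA: "2 * (A * r * g) \<le> 1"
  proof -
    have "2 * (A * r * g) \<le> 2 * (g * r * (1 + A))" by (simp add: algebra_simps mult_left_mono)
    then show ?thesis using small unfolding g_def by (rule order_trans)
  qed
  have "f \<le> e + A * r * k" by (rule p)
  also have "\<dots> \<le> e + A * r * (2 * (g * e + h))" by (intro add_left_mono mult_left_mono k2) simp
  also have "\<dots> = e + ((2 * (A * r * g)) * e + 2 * A * r * h)" by (simp add: algebra_simps)
  also have "\<dots> \<le> e + (1 * e + 2 * A * r * h)" by (intro add_left_mono add_right_mono mult_right_mono gA) simp
  also have "\<dots> = 2 * e + 2 * A * r * h" by (simp add: mult_2)
  finally show ?thesis unfolding f_def e_def h_def .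
qed

end

section \<open>Estimates on cubes\<close>

lemma borel_measurable_vecI:
  fixes f :: "'a \<Rightarrow> real ^ 'n::finite"
  assumes "\<And>i. (\<lambda>x. f x $ i) \<in> borel_measurable M"
  shows "f \<in> borel_measurable M"
proof (subst borel_measurable_euclidean_space, intro ballI)
  fix b :: "real ^ 'n" assume "b \<in> Basis"
  then obtain i where "b = axis i 1" by (auto simp: Basis_vec_def)
  then show "(\<lambda>x. f x \<bullet> b) \<in> borel_measurable M" using assms[of i] by (simp add: inner_axis)
qed

lemma lborel_vec:
  "(lborel :: (real ^ 'n::finite) measure) = distr (PiM UNIV (\<lambda>_::'n. lborel)) borel vec_lambda"
proof (rule lborel_eqI)
  interpret product_sigma_finite "\<lambda>_::'n. lborel :: real measure" by standard
  have [measurable]: "vec_lambda \<in> borel_measurable (PiM UNIV (\<lambda>_::'n. lborel :: real measure))"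
    by (rule borel_measurable_vecI) simp
  fix l u :: "real ^ 'n" assume le: "\<And>b. b \<in> Basis \<Longrightarrow> l \<bullet> b \<le> u \<bullet> b"
  have le': "l $ i \<le> u $ i" for i using le[of "axis i 1"] by (auto simp: inner_axis Basis_vec_def)
  have "vec_lambda -` box l u = PiE UNIV (\<lambda>i. {l$i<..<u$i})"
    by (auto simp: mem_box_cart PiE_UNIV_domain Pi_iff)
  then have "emeasure (distr (PiM UNIV (\<lambda>_::'n. lborel)) borel vec_lambda) (box l u)
     = (\<Prod>i\<in>UNIV. emeasure lborel {l$i<..<u$i})"
    by (subst emeasure_distr) (simp_all add: space_PiM PiE_UNIV_domain emeasure_PiM[of UNIV "\<lambda>i. {l$i<..<u$i}", symmetric, unfolded PiE_UNIV_domain])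
  also have "\<dots> = ennreal (\<Prod>i\<in>UNIV. (u - l) $ i)"
    using le' by (simp add: prod_ennreal)
  also have "(\<Prod>i\<in>UNIV. (u - l) $ i) = (\<Prod>b\<in>Basis. (u - l) \<bullet> b)"
  proof -
    have "(\<Prod>b\<in>Basis. (u - l) \<bullet> b) = (\<Prod>b\<in>range (\<lambda>i::'n. axis i (1::real)). (u - l) \<bullet> b)"
      by (intro prod.cong) (auto simp: Basis_vec_def)
    also have "\<dots> = (\<Prod>i\<in>UNIV. (u - l) $ i)"
      by (subst prod.reindex) (auto simp: inj_on_def axis_eq_axis inner_axis)
    finally show ?thesis by simp
  qed
  finally show "emeasure (distr (PiM UNIV (\<lambda>_::'n. lborel)) borel vec_lambda) (box l u) = ennreal (\<Prod>b\<in>Basis. (u - l) \<bullet> b)" .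
qed simp

definition updv :: "real ^ 'n \<Rightarrow> 'n::finite \<Rightarrow> real \<Rightarrow> real ^ 'n" where
  "updv x i s = (\<chi> j. if j = i then s else x $ j)"

lemma vec_lambda_fun_upd: "vec_lambda (x(i := s)) = updv (vec_lambda x) i s"
  by (simp add: updv_def vec_eq_iff)

definition cube :: "real ^ 'n::finite \<Rightarrow> real \<Rightarrow> (real ^ 'n) set" where
  "cube a r = {x. \<forall>i. a $ i \<le> x $ i \<and> x $ i \<le> a $ i + r}"

lemma cube_eq_cbox: "cube a r = cbox a (a + (\<chi> i. r))"
  by (auto simp: cube_def mem_box_cart)

lemma cube_measurable [measurable]: "cube a r \<in> sets borel"
  by (simp add: cube_eq_cbox)

text \<open>
  The uniform probability measure on the interval \<open>[a, a + r]\<close>.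
\<close>

definition unif :: "real \<Rightarrow> real \<Rightarrow> real measure" where
  "unif a r = density lborel (\<lambda>t. ennreal (1 / r) * indicator {a..a+r} t)"

lemma space_unif [simp]: "space (unif a r) = UNIV" and sets_unif [simp, measurable_cong]: "sets (unif a r) = sets borel"
  by (simp_all add: unif_def)

lemma nn_integral_unif:
  assumes [measurable]: "f \<in> borel_measurable borel"
  shows "(\<integral>\<^sup>+t. f t \<partial>unif a r) = ennreal (1 / r) * (\<integral>\<^sup>+t\<in>{a..a+r}. f t \<partial>lborel)"
proof -
  have "(\<integral>\<^sup>+t. f t \<partial>unif a r) = (\<integral>\<^sup>+t. ennreal (1 / r) * indicator {a..a+r} t * f t \<partial>lborel)"
    unfolding unif_def by (rule nn_integral_density) measurable
  also have "\<dots> = (\<integral>\<^sup>+t. ennreal (1 / r) * (f t * indicator {a..a+r} t) \<partial>lborel)"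
    by (simp add: mult_ac)
  finally show ?thesis by (simp add: nn_integral_cmult)
qed

lemma emeasure_unif: assumes "r > 0" shows "emeasure (unif a r) UNIV = 1"
proof -
  have "emeasure (unif a r) UNIV = (\<integral>\<^sup>+t. 1 \<partial>unif a r)" by simp
  also have "\<dots> = ennreal (1 / r) * ennreal r" using assms by (subst nn_integral_unif) simp_all
  finally show ?thesis using assms by (simp add: ennreal_mult[symmetric])
qed

lemma unit_product_unif: assumes "r > 0" shows "unit_product (\<lambda>i::'n::finite. unif (a $ i) r)"
proof -
  have "sigma_finite_measure (unif (a $ i) r)" for i
    by (rule finite_measure.axioms(1), rule finite_measureI) (simp add: emeasure_unif assms)
  then show ?thesis
    by (simp add: unit_product_def product_sigma_finite_def unit_product_axioms_def emeasure_unif assms)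
qed

lemma nn_integral_unif_product:
  fixes f :: "real ^ 'n::finite \<Rightarrow> ennreal"
  assumes r: "r > 0" and [measurable]: "f \<in> borel_measurable borel"
  shows "(\<integral>\<^sup>+x. f (vec_lambda x) \<partial>PiM UNIV (\<lambda>i. unif (a $ i) r)) = ennreal (1 / r ^ CARD('n)) * (\<integral>\<^sup>+x\<in>cube a r. f x \<partial>lborel)"
proof -
  let ?L = "PiM UNIV (\<lambda>_::'n. lborel :: real measure)"
  interpret L: product_sigma_finite "\<lambda>_::'n. lborel :: real measure" by standard
  interpret U: unit_product "\<lambda>i::'n. unif (a $ i) r" by (rule unit_product_unif[OF r])
  define w where "w x = (\<Prod>i\<in>UNIV. ennreal (1 / r) * indicator {a$i..a$i+r} (x i))" for x :: "'n \<Rightarrow> real"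
  have [measurable]: "w \<in> borel_measurable ?L" unfolding w_def by measurable
  have [measurable]: "vec_lambda \<in> borel_measurable ?L"
    by (rule borel_measurable_vecI) simp
  have "density ?L w = PiM UNIV (\<lambda>i. unif (a $ i) r)"
  proof (rule U.PiM_eqI)
    show "sets (density ?L w) = sets (PiM UNIV (\<lambda>i. unif (a $ i) r))"
      by (simp, intro sets_PiM_cong) simp_all
    fix A :: "'n \<Rightarrow> real set" assume "\<And>i. i \<in> UNIV \<Longrightarrow> A i \<in> sets (unif (a $ i) r)"
    then have A[measurable]: "A i \<in> sets borel" for i by simp
    have "PiE UNIV A \<in> sets ?L" by (rule sets_PiM_I_finite) simp_all
    then have "emeasure (density ?L w) (PiE UNIV A) = (\<integral>\<^sup>+x\<in>PiE UNIV A. w x \<partial>?L)"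
      by (subst emeasure_density) simp_all
    also have "\<dots> = (\<integral>\<^sup>+x. (\<Prod>i\<in>UNIV. ennreal (1 / r) * indicator {a$i..a$i+r} (x i) * indicator (A i) (x i)) \<partial>?L)"
    proof (intro nn_integral_cong)
      fix x
      have "indicator (PiE UNIV A) x = (\<Prod>i\<in>UNIV. indicator (A i) (x i) :: ennreal)"
        by (auto simp: indicator_def PiE_UNIV_domain Pi_iff prod_eq_1_iff)
      then show "w x * indicator (PiE UNIV A) x = (\<Prod>i\<in>UNIV. ennreal (1 / r) * indicator {a$i..a$i+r} (x i) * indicator (A i) (x i))"
        by (simp add: w_def prod.distrib)
    qed
    also have "\<dots> = (\<Prod>i\<in>UNIV. \<integral>\<^sup>+t. ennreal (1 / r) * indicator {a$i..a$i+r} t * indicator (A i) t \<partial>lborel)"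
      by (rule L.product_nn_integral_prod) simp_all
    also have "\<dots> = (\<Prod>i\<in>UNIV. emeasure (unif (a $ i) r) (A i))"
      by (intro prod.cong refl) (simp add: unif_def emeasure_density)
    finally show "emeasure (density ?L w) (PiE UNIV A) = (\<Prod>i\<in>UNIV. emeasure (unif (a $ i) r) (A i))" .
  qed simp
  then have "(\<integral>\<^sup>+x. f (vec_lambda x) \<partial>PiM UNIV (\<lambda>i. unif (a $ i) r)) = (\<integral>\<^sup>+x. f (vec_lambda x) \<partial>density ?L w)" by simp
  also have "\<dots> = (\<integral>\<^sup>+x. w x * f (vec_lambda x) \<partial>?L)"
    by (rule nn_integral_density) measurable
  also have "\<dots> = (\<integral>\<^sup>+x. ennreal (1 / r ^ CARD('n)) * (f (vec_lambda x) * indicator (cube a r) (vec_lambda x)) \<partial>?L)"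
  proof (intro nn_integral_cong)
    fix x :: "'n \<Rightarrow> real"
    have "indicator (cube a r) (vec_lambda x) = (\<Prod>i\<in>UNIV. indicator {a$i..a$i+r} (x i) :: ennreal)"
      by (auto simp: indicator_def cube_def)
    moreover have "ennreal (1 / r) ^ CARD('n) = ennreal (1 / r ^ CARD('n))"
      using r by (simp add: ennreal_power power_one_over)
    ultimately show "w x * f (vec_lambda x) = ennreal (1 / r ^ CARD('n)) * (f (vec_lambda x) * indicator (cube a r) (vec_lambda x))"
      by (simp add: w_def prod.distrib mult_ac)
  qed
  also have "\<dots> = ennreal (1 / r ^ CARD('n)) * (\<integral>\<^sup>+x. f (vec_lambda x) * indicator (cube a r) (vec_lambda x) \<partial>?L)"
    by (rule nn_integral_cmult) measurable
  also have "(\<integral>\<^sup>+x. f (vec_lambda x) * indicator (cube a r) (vec_lambda x) \<partial>?L) = (\<integral>\<^sup>+x\<in>cube a r. f x \<partial>lborel)"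
    by (subst lborel_vec, subst nn_integral_distr) simp_all
  finally show ?thesis .
qed

text \<open>
  The absorption inequality on a cube, with \<open>\<rho> i\<close> twice the indicator of the \<open>i\<close>-th edge of the
  subcube of half the size. The product of these weights is \<open>2 ^ n\<close> times the indicator of the
  subcube, so \<open>F\<close> on the cube is controlled by \<open>F\<close> on the subcube and by the part \<open>H\<close> of
  the gradient that the potential does not dominate. The hypothesis on \<open>F\<close> is the fundamental
  theorem of calculus along coordinate lines.
\<close>

lemma cube_doubling:
  fixes F H \<gamma> :: "real ^ 'n::finite \<Rightarrow> ennreal" and a a' :: "real ^ 'n" and r :: real
  defines "n \<equiv> CARD('n)"
  assumes m [measurable]: "F \<in> borel_measurable borel" "H \<in> borel_measurable borel" "\<gamma> \<in> borel_measurable borel"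
    and r: "r > 0" and sub: "cube a' (r / 2) \<subseteq> cube a r"
    and F: "\<And>x i s. x \<in> cube a r \<Longrightarrow> a $ i \<le> s \<Longrightarrow> s \<le> a $ i + r \<Longrightarrow>
       F x \<le> F (updv x i s) + (\<integral>\<^sup>+t\<in>{a$i..a$i+r}. (\<gamma> (updv x i t) * F (updv x i t) + H (updv x i t)) \<partial>lborel)"
    and small: "(\<integral>\<^sup>+x\<in>cube a r. \<gamma> x ^ n \<partial>lborel) \<le> ennreal ((1 / (2 * (1 + real n * 2 ^ n))) ^ n)"
    and fin: "(\<integral>\<^sup>+x\<in>cube a r. (\<gamma> x * F x + H x) \<partial>lborel) < top"
  shows "(\<integral>\<^sup>+x\<in>cube a r. F x \<partial>lborel) \<le> ennreal (2 * 2 ^ n) * (\<integral>\<^sup>+x\<in>cube a' (r / 2). F x \<partial>lborel)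
            + ennreal (2 * real n * 2 ^ n * r) * (\<integral>\<^sup>+x\<in>cube a r. H x \<partial>lborel)"
proof -
  interpret U: unit_product "\<lambda>i::'n. unif (a $ i) r" by (rule unit_product_unif[OF r])
  have n0: "n > 0" by (simp add: n_def)
  have [measurable]: "(\<lambda>x. updv v i x) \<in> borel_measurable borel" for v :: "real ^ 'n" and i
    by (rule borel_measurable_vecI) (simp add: updv_def)
  have [measurable]: "vec_lambda \<in> borel_measurable U.P"
    by (rule borel_measurable_vecI) simp
  define Fv Hv gv where "Fv x = F (vec_lambda x) * indicator (cube a r) (vec_lambda x)" and "Hv x = H (vec_lambda x)"
    and "gv x = \<gamma> (vec_lambda x)" for x :: "'n \<Rightarrow> real"
  have mv [measurable]: "Fv \<in> borel_measurable U.P" "Hv \<in> borel_measurable U.P" "gv \<in> borel_measurable U.P"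
    unfolding Fv_def Hv_def gv_def by measurable
  define \<rho> :: "'n \<Rightarrow> real \<Rightarrow> ennreal" where "\<rho> i t = 2 * indicator {a'$i..a'$i+r/2} t" for i and t :: real
  have \<rho>m [measurable]: "\<rho> i \<in> borel_measurable (unif (a $ i) r)" for i unfolding \<rho>_def by measurable
  have \<rho>m' [measurable]: "\<rho> i \<in> borel_measurable borel" for i unfolding \<rho>_def by measurable
  have sub': "a $ i \<le> a' $ i \<and> a' $ i + r / 2 \<le> a $ i + r" for i
  proof -
    have "a' \<in> cube a' (r / 2)" "a' + (\<chi> i. r / 2) \<in> cube a' (r / 2)" using r by (auto simp: cube_def)
    then show ?thesis using sub by (fastforce simp: cube_def)
  qed
  have avg: "U.avg i f x = ennreal (1 / r) * (\<integral>\<^sup>+t\<in>{a$i..a$i+r}. f (x(i := t)) \<partial>lborel)"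
    if "f \<in> borel_measurable U.P" for f i x
  proof -
    have "(\<lambda>t. f (x(i := t))) \<in> borel_measurable (unif (a $ i) r)" using that by measurable
    then have "(\<lambda>t. f (x(i := t))) \<in> borel_measurable borel" by (simp cong: measurable_cong_sets)
    then show ?thesis unfolding U.avg_def by (rule nn_integral_unif)
  qed
  define K where "K x = gv x * Fv x + Hv x" for x
  have [measurable]: "K \<in> borel_measurable U.P" unfolding K_def by measurable
  have line: "Fv x \<le> Fv (x(i := s)) + ennreal r * U.avg i K x"
    if x: "vec_lambda x \<in> cube a r" and s: "a $ i \<le> s" "s \<le> a $ i + r" for x i s
  proof -
    have xc: "updv (vec_lambda x) i t \<in> cube a r \<longleftrightarrow> t \<in> {a$i..a$i+r}" for t
      using x by (auto simp: cube_def updv_def)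
    have "Fv x \<le> F (updv (vec_lambda x) i s) + (\<integral>\<^sup>+t\<in>{a$i..a$i+r}. (\<gamma> (updv (vec_lambda x) i t) * F (updv (vec_lambda x) i t) + H (updv (vec_lambda x) i t)) \<partial>lborel)"
      using F[OF x s] x by (simp add: Fv_def)
    also have "F (updv (vec_lambda x) i s) = Fv (x(i := s))"
      using s by (simp add: Fv_def vec_lambda_fun_upd xc)
    also have "(\<integral>\<^sup>+t\<in>{a$i..a$i+r}. (\<gamma> (updv (vec_lambda x) i t) * F (updv (vec_lambda x) i t) + H (updv (vec_lambda x) i t)) \<partial>lborel)
        = (\<integral>\<^sup>+t\<in>{a$i..a$i+r}. K (x(i := t)) \<partial>lborel)"
      by (intro nn_integral_cong) (auto simp: K_def Fv_def gv_def Hv_def vec_lambda_fun_upd xc indicator_def)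
    also have "\<dots> = ennreal r * U.avg i K x"
    proof -
      have "ennreal r * ennreal (1 / r) = 1" using r by (simp add: ennreal_mult[symmetric])
      then show ?thesis by (simp add: avg mult.assoc[symmetric])
    qed
    finally show ?thesis .
  qed
  have I1: "(\<integral>\<^sup>+t. 1 \<partial>unif (a $ i) r) = 1" for i by (simp add: emeasure_unif r)
  have I2: "(\<integral>\<^sup>+t. \<rho> i t \<partial>unif (a $ i) r) = 1" for i
  proof -
    have "(\<integral>\<^sup>+t. \<rho> i t \<partial>unif (a $ i) r) = ennreal (1 / r) * (\<integral>\<^sup>+t. 2 * indicator {a'$i..a'$i+r/2} t \<partial>lborel)"
    proof -
      have "\<rho> i t * indicator {a$i..a$i+r} t = 2 * indicator {a'$i..a'$i+r/2} t" for t
        using sub'[of i] by (auto simp: \<rho>_def indicator_def)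
      then show ?thesis by (subst nn_integral_unif) simp_all
    qed
    also have "\<dots> = ennreal (1 / r) * (2 * ennreal (r / 2))" using r by (simp add: nn_integral_cmult)
    also have "2 * ennreal (r / 2) = ennreal r" using r by (simp add: ennreal_mult'[symmetric] flip: ennreal_numeral)
    finally show ?thesis using r by (simp add: ennreal_mult[symmetric])
  qed
  have weighted: "Fv x \<le> U.avg i (\<lambda>x. w (x i) * Fv x) x + ennreal r * U.avg i K x"
    if [measurable]: "w \<in> borel_measurable borel" and w: "(\<integral>\<^sup>+t. w t \<partial>unif (a $ i) r) = 1" for w i x
  proof (cases "vec_lambda x \<in> cube a r")
    case False then show ?thesis by (simp add: Fv_def)
  next
    case True
    have "Fv x = (\<integral>\<^sup>+t. w t \<partial>unif (a $ i) r) * Fv x" by (simp add: w)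
    also have "\<dots> = (\<integral>\<^sup>+t. w t * Fv x \<partial>unif (a $ i) r)" by (simp add: nn_integral_multc)
    also have "\<dots> = ennreal (1 / r) * (\<integral>\<^sup>+t\<in>{a$i..a$i+r}. w t * Fv x \<partial>lborel)" by (rule nn_integral_unif) measurable
    also have "\<dots> \<le> ennreal (1 / r) * (\<integral>\<^sup>+t\<in>{a$i..a$i+r}. w t * (Fv (x(i := t)) + ennreal r * U.avg i K x) \<partial>lborel)"
      by (intro mult_left_mono nn_integral_mono) (auto simp: indicator_def intro!: mult_left_mono line[OF True])
    also have "\<dots> = (\<integral>\<^sup>+t. w t * (Fv (x(i := t)) + ennreal r * U.avg i K x) \<partial>unif (a $ i) r)"
    proof (rule nn_integral_unif[symmetric])
      have "(\<lambda>t. w t * (Fv (x(i := t)) + ennreal r * U.avg i K x)) \<in> borel_measurable (unif (a $ i) r)" by measurable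
      then show "(\<lambda>t. w t * (Fv (x(i := t)) + ennreal r * U.avg i K x)) \<in> borel_measurable borel" by (simp cong: measurable_cong_sets)
    qed
    also have "\<dots> = (\<integral>\<^sup>+t. w t * Fv (x(i := t)) \<partial>unif (a $ i) r) + (\<integral>\<^sup>+t. w t * (ennreal r * U.avg i K x) \<partial>unif (a $ i) r)"
      unfolding distrib_left by (rule nn_integral_add) measurable
    also have "(\<integral>\<^sup>+t. w t * (ennreal r * U.avg i K x) \<partial>unif (a $ i) r) = ennreal r * U.avg i K x"
      by (subst nn_integral_multc) (simp_all add: w)
    finally show ?thesis unfolding U.avg_def by (simp only: fun_upd_same)
  qed
  have I: "(\<integral>\<^sup>+x. f (vec_lambda x) \<partial>U.P) = ennreal (1 / r ^ n) * (\<integral>\<^sup>+x\<in>cube a r. f x \<partial>lborel)"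
    if "f \<in> borel_measurable borel" for f :: "real ^ 'n \<Rightarrow> ennreal"
    unfolding n_def by (rule nn_integral_unif_product[OF r that])
  have K: "(\<integral>\<^sup>+x. K x \<partial>U.P) = ennreal (1 / r ^ n) * (\<integral>\<^sup>+x\<in>cube a r. (\<gamma> x * F x + H x) \<partial>lborel)"
  proof -
    have "(\<integral>\<^sup>+x. K x \<partial>U.P) = (\<integral>\<^sup>+x. (\<lambda>x. \<gamma> x * (F x * indicator (cube a r) x) + H x) (vec_lambda x) \<partial>U.P)"
      by (simp add: K_def gv_def Fv_def Hv_def)
    also have "\<dots> = ennreal (1 / r ^ n) * (\<integral>\<^sup>+x\<in>cube a r. (\<gamma> x * (F x * indicator (cube a r) x) + H x) \<partial>lborel)"
      by (rule I) measurable
    also have "(\<integral>\<^sup>+x\<in>cube a r. (\<gamma> x * (F x * indicator (cube a r) x) + H x) \<partial>lborel) = (\<integral>\<^sup>+x\<in>cube a r. (\<gamma> x * F x + H x) \<partial>lborel)"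
      by (intro nn_integral_cong) (simp add: indicator_def)
    finally show ?thesis .
  qed
  define B where "B = 1 + real n * 2 ^ n"
  have B: "B > 0" by (simp add: B_def add_pos_nonneg)
  have g: "enn_root n (\<integral>\<^sup>+x. gv x ^ n \<partial>U.P) \<le> ennreal (1 / r * (1 / (2 * B)))"
  proof -
    have "(\<integral>\<^sup>+x. gv x ^ n \<partial>U.P) = ennreal (1 / r ^ n) * (\<integral>\<^sup>+x\<in>cube a r. \<gamma> x ^ n \<partial>lborel)"
      unfolding gv_def by (rule I) measurable
    also have "\<dots> \<le> ennreal (1 / r ^ n) * ennreal ((1 / (2 * B)) ^ n)"
      using small unfolding B_def by (intro mult_left_mono) auto
    also have "\<dots> = ennreal (1 / r * (1 / (2 * B))) ^ n"
      using r B by (simp add: ennreal_mult[symmetric] ennreal_power power_mult_distrib power_divide)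
    finally show ?thesis using enn_root_mono[OF n0] enn_root_of_power[OF n0] by metis
  qed
  have A: "of_nat n * (2::ennreal) ^ n = ennreal (real n * 2 ^ n)"
    by (simp add: ennreal_mult ennreal_of_nat_eq_real_of_nat ennreal_power[symmetric])
  have "(\<integral>\<^sup>+x. Fv x \<partial>U.P) \<le> 2 * (\<integral>\<^sup>+x. (\<Prod>i\<in>UNIV. \<rho> i (x i)) * Fv x \<partial>U.P)
       + 2 * (of_nat CARD('n) * 2 ^ CARD('n)) * ennreal r * (\<integral>\<^sup>+x. Hv x \<partial>U.P)"
  proof (rule U.absorption[OF mv \<rho>m])
    show "\<rho> i t \<le> 2" for i t by (simp add: \<rho>_def indicator_def)
    show "(1::ennreal) \<le> 2" by simp
    show "Fv x \<le> U.avg i Fv x + ennreal r * U.avg i (\<lambda>x. gv x * Fv x + Hv x) x" for i x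
      using weighted[of "\<lambda>_. 1" i x] I1 by (simp add: K_def[symmetric])
    show "Fv x \<le> U.avg i (\<lambda>x. \<rho> i (x i) * Fv x) x + ennreal r * U.avg i (\<lambda>x. gv x * Fv x + Hv x) x" for i x
      using weighted[of "\<rho> i" i x] I2 by (simp add: K_def[symmetric])
    show "(\<integral>\<^sup>+x. gv x * Fv x + Hv x \<partial>U.P) < top"
      using K fin by (simp add: K_def ennreal_mult_less_top)
    have "2 * (enn_root n (\<integral>\<^sup>+x. gv x ^ n \<partial>U.P) * ennreal r * (1 + of_nat n * 2 ^ n))
       \<le> 2 * (ennreal (1 / r * (1 / (2 * B))) * ennreal r * ennreal B)"
      unfolding A B_def by (intro mult_left_mono mult_mono g[unfolded B_def]) (simp_all add: ennreal_plus[symmetric] del: ennreal_plus flip: ennreal_1)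
    also have "ennreal (1 / r * (1 / (2 * B))) * ennreal r * ennreal B = ennreal (1 / r * (1 / (2 * B)) * r * B)"
      using r B by (simp only: ennreal_mult[symmetric] mult_nonneg_nonneg zero_le_divide_1_iff less_imp_le zero_le_numeral)
    also have "1 / r * (1 / (2 * B)) * r * B = 1 / 2" using r B by simp
    also have "2 * ennreal (1 / 2) = ennreal (2 * (1 / 2))" by (subst ennreal_mult) simp_all
    also have "\<dots> = 1" by simp
    finally show "2 * (enn_root CARD('n) (\<integral>\<^sup>+x. gv x ^ CARD('n) \<partial>U.P) * ennreal r * (1 + of_nat CARD('n) * 2 ^ CARD('n))) \<le> 1"
      by (simp add: n_def)
  qed
  also have "(\<integral>\<^sup>+x. Fv x \<partial>U.P) = ennreal (1 / r ^ n) * (\<integral>\<^sup>+x\<in>cube a r. F x \<partial>lborel)"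
  proof -
    have "(\<integral>\<^sup>+x. Fv x \<partial>U.P) = ennreal (1 / r ^ n) * (\<integral>\<^sup>+x\<in>cube a r. F x * indicator (cube a r) x \<partial>lborel)"
      unfolding Fv_def by (rule I) measurable
    also have "(\<integral>\<^sup>+x\<in>cube a r. F x * indicator (cube a r) x \<partial>lborel) = (\<integral>\<^sup>+x\<in>cube a r. F x \<partial>lborel)"
      by (intro nn_integral_cong) (simp add: indicator_def)
    finally show ?thesis .
  qed
  also have "(\<integral>\<^sup>+x. Hv x \<partial>U.P) = ennreal (1 / r ^ n) * (\<integral>\<^sup>+x\<in>cube a r. H x \<partial>lborel)"
    unfolding Hv_def by (rule I) measurable
  also have "(\<integral>\<^sup>+x. (\<Prod>i\<in>UNIV. \<rho> i (x i)) * Fv x \<partial>U.P) = ennreal (1 / r ^ n) * (ennreal (2 ^ n) * (\<integral>\<^sup>+x\<in>cube a' (r/2). F x \<partial>lborel))"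
  proof -
    have "(\<Prod>i\<in>UNIV. \<rho> i (x i)) * Fv x = (\<lambda>x. ennreal (2 ^ n) * (F x * indicator (cube a' (r/2)) x)) (vec_lambda x)" for x
    proof -
      have "(\<Prod>i\<in>UNIV. \<rho> i (x i)) = ennreal (2 ^ n) * indicator (cube a' (r/2)) (vec_lambda x)"
        unfolding \<rho>_def prod.distrib by (auto simp: n_def indicator_def cube_def ennreal_power[symmetric])
      moreover have "indicator (cube a' (r/2)) z * indicator (cube a r) z = (indicator (cube a' (r/2)) z :: ennreal)" for z
        using sub by (auto simp: indicator_def)
      ultimately show ?thesis by (simp add: Fv_def mult_ac)
    qed
    then have "(\<integral>\<^sup>+x. (\<Prod>i\<in>UNIV. \<rho> i (x i)) * Fv x \<partial>U.P) = (\<integral>\<^sup>+x. (\<lambda>x. ennreal (2 ^ n) * (F x * indicator (cube a' (r/2)) x)) (vec_lambda x) \<partial>U.P)"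
      by presburger
    also have "\<dots> = ennreal (1 / r ^ n) * (\<integral>\<^sup>+x\<in>cube a r. ennreal (2 ^ n) * (F x * indicator (cube a' (r/2)) x) \<partial>lborel)"
      by (rule I) measurable
    also have "(\<integral>\<^sup>+x\<in>cube a r. ennreal (2 ^ n) * (F x * indicator (cube a' (r/2)) x) \<partial>lborel) = (\<integral>\<^sup>+x. ennreal (2 ^ n) * (F x * indicator (cube a' (r/2)) x) \<partial>lborel)"
      using sub by (intro nn_integral_cong) (auto simp: indicator_def)
    also have "\<dots> = ennreal (2 ^ n) * (\<integral>\<^sup>+x\<in>cube a' (r/2). F x \<partial>lborel)" by (rule nn_integral_cmult) measurable
    finally show ?thesis .
  qed
  finally have "ennreal (1 / r ^ n) * (\<integral>\<^sup>+x\<in>cube a r. F x \<partial>lborel)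
    \<le> ennreal (1 / r ^ n) * (2 * (ennreal (2 ^ n) * (\<integral>\<^sup>+x\<in>cube a' (r/2). F x \<partial>lborel)) + 2 * (of_nat n * 2 ^ n) * ennreal r * (\<integral>\<^sup>+x\<in>cube a r. H x \<partial>lborel))"
    by (simp add: n_def distrib_left mult_ac)
  then have "(\<integral>\<^sup>+x\<in>cube a r. F x \<partial>lborel)
    \<le> 2 * (ennreal (2 ^ n) * (\<integral>\<^sup>+x\<in>cube a' (r/2). F x \<partial>lborel)) + 2 * (of_nat n * 2 ^ n) * ennreal r * (\<integral>\<^sup>+x\<in>cube a r. H x \<partial>lborel)"
    using r by (subst (asm) ennreal_mult_le_mult_iff) auto
  also have "2 * (of_nat n * 2 ^ n) * ennreal r = ennreal (2 * real n * 2 ^ n * r)"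
    unfolding A using r by (simp add: ennreal_mult[symmetric] mult.assoc flip: ennreal_numeral)
  also have "2 * (ennreal (2 ^ n) * (\<integral>\<^sup>+x\<in>cube a' (r/2). F x \<partial>lborel)) = ennreal (2 * 2 ^ n) * (\<integral>\<^sup>+x\<in>cube a' (r/2). F x \<partial>lborel)"
    by (simp add: ennreal_mult mult.assoc)
  finally show ?thesis .
qed

text \<open>
  The image of \<open>cube a r\<close> under the homothety with centre \<open>s\<close> and ratio \<open>l\<close>.
\<close>

definition shrunk :: "real ^ 'n::finite \<Rightarrow> real \<Rightarrow> real ^ 'n \<Rightarrow> real \<Rightarrow> (real ^ 'n) set" where
  "shrunk a r s l = cube ((1 - l) *\<^sub>R s + l *\<^sub>R a) (l * r)"

lemma shrunk_subset:
  assumes s: "s \<in> cube a r" and l: "0 \<le> l" "l \<le> m"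
  shows "shrunk a r s l \<subseteq> shrunk a r s m"
proof
  fix x assume x: "x \<in> shrunk a r s l"
  show "x \<in> shrunk a r s m"
    unfolding shrunk_def cube_def
  proof (intro CollectI allI)
    fix i
    have 1: "a $ i - s $ i \<le> 0" "0 \<le> a $ i + r - s $ i" using s by (auto simp: cube_def)
    have "m * (a $ i - s $ i) \<le> l * (a $ i - s $ i)" using l 1 by (intro mult_right_mono_neg) auto
    moreover have "l * (a $ i + r - s $ i) \<le> m * (a $ i + r - s $ i)" using l 1 by (intro mult_right_mono) auto
    moreover have "s $ i + l * (a $ i - s $ i) \<le> x $ i" "x $ i \<le> s $ i + l * (a $ i + r - s $ i)"
      using x by (auto simp: shrunk_def cube_def algebra_simps)
    ultimately show "((1 - m) *\<^sub>R s + m *\<^sub>R a) $ i \<le> x $ i \<and> x $ i \<le> ((1 - m) *\<^sub>R s + m *\<^sub>R a) $ i + m * r"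
      by (simp add: algebra_simps)
  qed
qed

lemma shrunk_1: "shrunk a r s 1 = cube a r" by (simp add: shrunk_def)

text \<open>
  Halving \<open>k\<close> times towards \<open>s\<close> bounds \<open>F\<close> on the cube by \<open>F\<close> on an arbitrarily small
  cube at \<open>s\<close>. The smallness condition on the potential is scale invariant, so all the
  intermediate cubes inherit it.
\<close>

lemma cube_propagation:
  fixes F H \<gamma> :: "real ^ 'n::finite \<Rightarrow> ennreal" and a s :: "real ^ 'n" and r :: real
  defines "n \<equiv> CARD('n)"
  assumes m [measurable]: "F \<in> borel_measurable borel" "H \<in> borel_measurable borel" "\<gamma> \<in> borel_measurable borel"
    and r: "r > 0" and s: "s \<in> cube a r"
    and F: "\<And>x i t lo hi. x \<in> cube a r \<Longrightarrow> a $ i \<le> lo \<Longrightarrow> lo \<le> t \<Longrightarrow> t \<le> hi \<Longrightarrow> lo \<le> x $ i \<Longrightarrow> x $ i \<le> hi \<Longrightarrow> hi \<le> a $ i + r \<Longrightarrow>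
       F x \<le> F (updv x i t) + (\<integral>\<^sup>+t\<in>{lo..hi}. (\<gamma> (updv x i t) * F (updv x i t) + H (updv x i t)) \<partial>lborel)"
    and small: "(\<integral>\<^sup>+x\<in>cube a r. \<gamma> x ^ n \<partial>lborel) \<le> ennreal ((1 / (2 * (1 + real n * 2 ^ n))) ^ n)"
    and fin: "(\<integral>\<^sup>+x\<in>cube a r. (\<gamma> x * F x + H x) \<partial>lborel) < top"
  shows "(\<integral>\<^sup>+x\<in>cube a r. F x \<partial>lborel) \<le> ennreal (2 * 2 ^ n) ^ k * (\<integral>\<^sup>+x\<in>shrunk a r s ((1/2)^k). F x \<partial>lborel)
            + of_nat k * ennreal (2 * 2 ^ n) ^ k * ennreal (2 * real n * 2 ^ n * r) * (\<integral>\<^sup>+x\<in>cube a r. H x \<partial>lborel)"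
proof (induction k)
  case 0 show ?case by (simp add: shrunk_1)
next
  case (Suc k)
  let ?l = "(1/2::real) ^ k"
  let ?A = "ennreal (2 * 2 ^ n)" and ?B = "ennreal (2 * real n * 2 ^ n * r)" and ?h = "(\<integral>\<^sup>+x\<in>cube a r. H x \<partial>lborel)"
  define b where "b = (1 - ?l) *\<^sub>R s + ?l *\<^sub>R a"
  define b' where "b' = (1 - (1/2)^Suc k) *\<^sub>R s + (1/2)^Suc k *\<^sub>R a"
  have l: "0 < ?l" "?l \<le> 1" by (auto simp: power_le_one)
  have sh: "shrunk a r s ?l = cube b (?l * r)" "shrunk a r s ((1/2) ^ Suc k) = cube b' (?l * r / 2)"
    by (simp_all add: shrunk_def b_def b'_def)
  have sub: "cube b (?l * r) \<subseteq> cube a r"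
    using shrunk_subset[OF s, of ?l 1] l by (simp add: sh shrunk_1)
  have sub': "cube b' (?l * r / 2) \<subseteq> cube b (?l * r)"
  proof -
    have "shrunk a r s ((1/2)^Suc k) \<subseteq> shrunk a r s ?l" by (rule shrunk_subset[OF s]) (use l in auto)
    then show ?thesis by (simp only: sh)
  qed
  have sub_le: "(\<integral>\<^sup>+x\<in>cube b (?l * r). f x \<partial>lborel) \<le> (\<integral>\<^sup>+x\<in>cube a r. f x \<partial>lborel)" for f
    using sub by (intro nn_integral_mono) (auto simp: indicator_def)
  have bi: "a $ i \<le> b $ i" "b $ i + ?l * r \<le> a $ i + r" for i
  proof -
    have "b \<in> cube b (?l * r)" "b + (\<chi> i. ?l * r) \<in> cube b (?l * r)" using r l by (auto simp: cube_def)
    then show "a $ i \<le> b $ i" "b $ i + ?l * r \<le> a $ i + r" using sub by (fastforce simp: cube_def)+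
  qed
  have "(\<integral>\<^sup>+x\<in>cube b (?l * r). F x \<partial>lborel) \<le> ?A * (\<integral>\<^sup>+x\<in>cube b' (?l * r / 2). F x \<partial>lborel)
        + ennreal (2 * real n * 2 ^ n * (?l * r)) * (\<integral>\<^sup>+x\<in>cube b (?l * r). H x \<partial>lborel)"
    unfolding n_def
  proof (rule cube_doubling[OF m _ sub'])
    show "0 < ?l * r" using l r by simp
    show "(\<integral>\<^sup>+x\<in>cube b (?l * r). \<gamma> x ^ CARD('n) \<partial>lborel) \<le> ennreal ((1 / (2 * (1 + real CARD('n) * 2 ^ CARD('n)))) ^ CARD('n))"
      using order_trans[OF sub_le small] by (simp add: n_def)
    show "(\<integral>\<^sup>+x\<in>cube b (?l * r). (\<gamma> x * F x + H x) \<partial>lborel) < top"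
      by (rule le_less_trans[OF sub_le fin])
    fix x i t assume "x \<in> cube b (?l * r)" "b $ i \<le> t" "t \<le> b $ i + ?l * r"
    then show "F x \<le> F (updv x i t) + (\<integral>\<^sup>+t\<in>{b$i..b$i+?l*r}. (\<gamma> (updv x i t) * F (updv x i t) + H (updv x i t)) \<partial>lborel)"
      using bi[of i] sub by (intro F) (auto simp: cube_def)
  qed
  also have "\<dots> \<le> ?A * (\<integral>\<^sup>+x\<in>cube b' (?l * r / 2). F x \<partial>lborel) + ?B * ?h"
  proof (intro add_left_mono mult_mono sub_le ennreal_leI mult_left_mono)
    show "?l * r \<le> r" using l r by simp
  qed (use r l in simp_all)
  finally have step: "(\<integral>\<^sup>+x\<in>shrunk a r s ?l. F x \<partial>lborel) \<le> ?A * (\<integral>\<^sup>+x\<in>shrunk a r s ((1/2)^Suc k). F x \<partial>lborel) + ?B * ?h"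
    by (simp only: sh)
  have A1: "1 \<le> ?A"
  proof -
    have "ennreal 1 \<le> ?A" using one_le_power[of "2::real" n] by (intro ennreal_leI) linarith
    then show ?thesis by simp
  qed
  have "(\<integral>\<^sup>+x\<in>cube a r. F x \<partial>lborel) \<le> ?A ^ k * (\<integral>\<^sup>+x\<in>shrunk a r s ?l. F x \<partial>lborel) + of_nat k * ?A ^ k * ?B * ?h"
    by (rule Suc.IH)
  also have "\<dots> \<le> ?A ^ k * (?A * (\<integral>\<^sup>+x\<in>shrunk a r s ((1/2)^Suc k). F x \<partial>lborel) + ?B * ?h) + of_nat k * ?A ^ k * ?B * ?h"
    by (intro add_right_mono mult_left_mono step) simp
  also have "\<dots> = ?A ^ Suc k * (\<integral>\<^sup>+x\<in>shrunk a r s ((1/2)^Suc k). F x \<partial>lborel) + of_nat (Suc k) * ?A ^ k * ?B * ?h"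
    by (simp add: distrib_left distrib_right mult_ac add_ac)
  also have "\<dots> \<le> ?A ^ Suc k * (\<integral>\<^sup>+x\<in>shrunk a r s ((1/2)^Suc k). F x \<partial>lborel) + of_nat (Suc k) * ?A ^ Suc k * ?B * ?h"
    by (intro add_left_mono mult_right_mono mult_left_mono power_increasing A1) simp_all
  finally show ?case .
qed

text \<open>
  The same for a \<open>C\<^sup>1\<close> function, with \<open>H\<close> the excess of the gradient over
  \<open>\<gamma> x * f x\<close>. Boundedness of \<open>f\<close> and of its gradient on the compact cube supplies the
  finiteness on which the absorption rests.
\<close>

lemma cube_propagation_C1:
  fixes f \<gamma> :: "real ^ 'n::finite \<Rightarrow> real" and f' :: "'n \<Rightarrow> real ^ 'n \<Rightarrow> real" and a s :: "real ^ 'n" and r :: real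
  defines "n \<equiv> CARD('n)"
  assumes r: "r > 0" and s: "s \<in> cube a r"
    and f0: "\<And>x. x \<in> cube a r \<Longrightarrow> 0 \<le> f x" and fc: "continuous_on (cube a r) f"
    and f': "\<And>i. continuous_on (cube a r) (f' i)"
    and der: "\<And>x i. x \<in> cube a r \<Longrightarrow> ((\<lambda>t. f (updv x i t)) has_real_derivative f' i x) (at (x $ i) within {a$i..a$i+r})"
    and g [measurable]: "\<gamma> \<in> borel_measurable borel" and g0: "\<And>x. 0 \<le> \<gamma> x"
    and small: "(\<integral>\<^sup>+x\<in>cube a r. ennreal (\<gamma> x ^ n) \<partial>lborel) \<le> ennreal ((1 / (2 * (1 + real n * 2 ^ n))) ^ n)"
  shows "(\<integral>\<^sup>+x\<in>cube a r. ennreal (f x) \<partial>lborel) \<le> ennreal (2 * 2 ^ n) ^ k * (\<integral>\<^sup>+x\<in>shrunk a r s ((1/2)^k). ennreal (f x) \<partial>lborel)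
            + of_nat k * ennreal (2 * 2 ^ n) ^ k * ennreal (2 * real n * 2 ^ n * r) *
               (\<integral>\<^sup>+x\<in>cube a r. ennreal ((\<Sum>i\<in>UNIV. \<bar>f' i x\<bar>) - \<gamma> x * f x) \<partial>lborel)"
proof -
  let ?Q = "cube a r"
  have cQ: "compact ?Q" by (simp add: cube_eq_cbox)
  define S where "S x = (\<Sum>i\<in>UNIV. \<bar>f' i x\<bar>)" for x
  have Sc: "continuous_on ?Q S" unfolding S_def by (intro continuous_intros f')
  define F where "F x = ennreal (if x \<in> ?Q then f x else 0)" for x
  define H where "H x = ennreal (if x \<in> ?Q then S x - \<gamma> x * f x else 0)" for x
  define G where "G x = ennreal (\<gamma> x)" for x
  have fm [measurable]: "(\<lambda>x. if x \<in> ?Q then f x else 0) \<in> borel_measurable borel"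
    by (rule borel_measurable_continuous_on_if) (rule cube_measurable fc continuous_on_const)+
  have Sm [measurable]: "(\<lambda>x. if x \<in> ?Q then S x else 0) \<in> borel_measurable borel"
    by (rule borel_measurable_continuous_on_if) (rule cube_measurable Sc continuous_on_const)+
  have m: "F \<in> borel_measurable borel" "G \<in> borel_measurable borel"
    unfolding F_def G_def by measurable
  have "H = (\<lambda>x. ennreal ((if x \<in> ?Q then S x else 0) - \<gamma> x * (if x \<in> ?Q then f x else 0)))"
    by (auto simp: H_def)
  then have mH: "H \<in> borel_measurable borel" using fm Sm g by simp
  obtain Mf where Mf: "\<And>x. x \<in> ?Q \<Longrightarrow> f x \<le> Mf"
    using compact_imp_bounded[OF compact_continuous_image[OF fc cQ]] unfolding bounded_iff by (force simp: abs_le_iff)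
  obtain MS where MS: "\<And>x. x \<in> ?Q \<Longrightarrow> S x \<le> MS"
    using compact_imp_bounded[OF compact_continuous_image[OF Sc cQ]] unfolding bounded_iff by (force simp: abs_le_iff)
  have Mf0: "0 \<le> Mf" using Mf[OF s] f0[OF s] by linarith
  have "(\<integral>\<^sup>+x\<in>?Q. F x \<partial>lborel) \<le> ennreal (2 * 2 ^ n) ^ k * (\<integral>\<^sup>+x\<in>shrunk a r s ((1/2)^k). F x \<partial>lborel)
            + of_nat k * ennreal (2 * 2 ^ n) ^ k * ennreal (2 * real n * 2 ^ n * r) * (\<integral>\<^sup>+x\<in>?Q. H x \<partial>lborel)"
    unfolding n_def
  proof (rule cube_propagation[OF m(1) mH m(2) r s])
    show "(\<integral>\<^sup>+x\<in>?Q. G x ^ CARD('n) \<partial>lborel) \<le> ennreal ((1 / (2 * (1 + real CARD('n) * 2 ^ CARD('n)))) ^ CARD('n))"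
      using small by (simp add: G_def ennreal_power g0 n_def)
    have "(\<integral>\<^sup>+x\<in>?Q. (G x * F x + H x) \<partial>lborel) \<le> (\<integral>\<^sup>+x\<in>?Q. (ennreal Mf * (1 + ennreal (\<gamma> x ^ n)) + ennreal MS) \<partial>lborel)"
    proof (intro nn_integral_mono)
      fix x
      show "(G x * F x + H x) * indicator ?Q x \<le> (ennreal Mf * (1 + ennreal (\<gamma> x ^ n)) + ennreal MS) * indicator ?Q x"
      proof (cases "x \<in> ?Q")
        case True
        have "\<gamma> x \<le> 1 + \<gamma> x ^ n"
        proof (cases "\<gamma> x \<le> 1")
          case False
          then have "\<gamma> x ^ 1 \<le> \<gamma> x ^ n" by (intro power_increasing) (auto simp: n_def)
          then show ?thesis by simp
        qed (use g0[of x] in \<open>simp add: add_increasing2\<close>)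
        then have "G x * F x \<le> ennreal ((1 + \<gamma> x ^ n) * Mf)"
          using True g0 f0[OF True] Mf[OF True] by (auto simp: G_def F_def ennreal_mult[symmetric] intro!: ennreal_leI mult_mono)
        also have "\<dots> = ennreal Mf * (1 + ennreal (\<gamma> x ^ n))"
          using g0[of x] Mf0 by (simp add: ennreal_mult mult.commute)
        finally have 1: "G x * F x \<le> ennreal Mf * (1 + ennreal (\<gamma> x ^ n))" .
        have "S x - \<gamma> x * f x \<le> MS" using MS[OF True] mult_nonneg_nonneg[OF g0[of x] f0[OF True]] by linarith
        then have "H x \<le> ennreal MS" using True by (simp add: H_def ennreal_leI)
        then show ?thesis using 1 True by (simp add: add_mono)
      qed simp
    qed
    also have "\<dots> = (\<integral>\<^sup>+x. (ennreal Mf + ennreal MS) * indicator ?Q x + ennreal Mf * (ennreal (\<gamma> x ^ n) * indicator ?Q x) \<partial>lborel)"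
      by (intro nn_integral_cong) (simp add: indicator_def distrib_left add_ac)
    also have "\<dots> = (ennreal Mf + ennreal MS) * emeasure lborel ?Q + ennreal Mf * (\<integral>\<^sup>+x\<in>?Q. ennreal (\<gamma> x ^ n) \<partial>lborel)"
      by (subst nn_integral_add) (simp_all add: nn_integral_cmult nn_integral_cmult_indicator)
    also have "\<dots> < top"
    proof -
      have "emeasure lborel ?Q < top" using emeasure_lborel_cbox_finite unfolding cube_eq_cbox by (simp add: less_top)
      moreover have "(\<integral>\<^sup>+x\<in>?Q. ennreal (\<gamma> x ^ n) \<partial>lborel) < top" by (rule le_less_trans[OF small]) simp
      ultimately show ?thesis by (simp add: ennreal_mult_less_top)
    qed
    finally show "(\<integral>\<^sup>+x\<in>?Q. (G x * F x + H x) \<partial>lborel) < top" .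
    fix x i t lo hi
    assume A: "x \<in> ?Q" "a $ i \<le> lo" "lo \<le> t" "t \<le> hi" "lo \<le> x $ i" "x $ i \<le> hi" "hi \<le> a $ i + r"
    define p where "p \<tau> = f (updv x i \<tau>)" for \<tau>
    define p' where "p' \<tau> = f' i (updv x i \<tau>)" for \<tau>
    have uQ: "updv x i \<tau> \<in> ?Q" if "\<tau> \<in> {lo..hi}" for \<tau> using A that by (auto simp: cube_def updv_def)
    have uu: "updv (updv x i \<tau>) i \<sigma> = updv x i \<sigma>" for \<tau> \<sigma> by (simp add: updv_def vec_eq_iff)
    have ux: "updv x i (x $ i) = x" by (simp add: updv_def vec_eq_iff)
    have pd: "(p has_real_derivative p' \<tau>) (at \<tau> within {lo..hi})" if "\<tau> \<in> {lo..hi}" for \<tau>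
    proof -
      have "(p has_real_derivative p' \<tau>) (at \<tau> within {a$i..a$i+r})"
        using der[OF uQ[OF that], of i] unfolding uu p_def p'_def by (simp add: updv_def)
      then show ?thesis by (rule DERIV_subset) (use A in auto)
    qed
    have uc: "continuous_on {lo..hi} (updv x i)"
      unfolding updv_def by (intro continuous_on_vec_lambda, rename_tac j, case_tac "j = i") auto
    have pc: "continuous_on {lo..hi} p'"
      unfolding p'_def by (rule continuous_on_compose2[OF f' uc]) (use uQ in auto)
    have absint: "(\<lambda>\<tau>. \<bar>p' \<tau>\<bar>) integrable_on {lo..hi}" using pc by (intro integrable_continuous_real continuous_intros)
    define I where "I = integral {lo..hi} (\<lambda>\<tau>. \<bar>p' \<tau>\<bar>)"
    have diff: "\<bar>p v - p u\<bar> \<le> I" if uv: "lo \<le> u" "u \<le> v" "v \<le> hi" for u v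
    proof -
      have "(p' has_integral (p v - p u)) {u..v}"
        using uv by (intro fundamental_theorem_of_calculus)
          (auto simp: has_real_derivative_iff_has_vector_derivative[symmetric] intro!: DERIV_subset[OF pd])
      then have "p v - p u = integral {u..v} p'" by (simp add: integral_unique)
      moreover have "\<bar>integral {u..v} p'\<bar> \<le> integral {u..v} (\<lambda>\<tau>. \<bar>p' \<tau>\<bar>)"
        unfolding real_norm_def[symmetric]
        by (intro integral_norm_bound_integral integrable_continuous_real continuous_intros continuous_on_subset[OF pc]) (use uv in auto)
      moreover have "integral {u..v} (\<lambda>\<tau>. \<bar>p' \<tau>\<bar>) \<le> I" unfolding I_def
        by (intro integral_subset_le integrable_continuous_real continuous_intros continuous_on_subset[OF pc] absint) (use uv in auto)
      ultimately show ?thesis by linarith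
    qed
    have I: "ennreal I = (\<integral>\<^sup>+\<tau>. indicator {lo..hi} \<tau> * ennreal \<bar>p' \<tau>\<bar> \<partial>lborel)"
      using nn_integral_has_integral_lebesgue'[OF _ integrable_integral[OF absint]]
      unfolding I_def by (simp add: mult.commute)
    have "f x \<le> f (updv x i t) + I"
      using diff[of t "x $ i"] diff[of "x $ i" t] A by (cases "t \<le> x $ i") (auto simp: p_def ux)
    moreover have "0 \<le> I" unfolding I_def by (intro integral_nonneg absint) auto
    ultimately have "F x \<le> F (updv x i t) + ennreal I"
      using A uQ[of t] f0[OF uQ, of t] by (simp add: F_def ennreal_plus[symmetric] ennreal_leI del: ennreal_plus)
    also have "ennreal I \<le> (\<integral>\<^sup>+t\<in>{lo..hi}. (G (updv x i t) * F (updv x i t) + H (updv x i t)) \<partial>lborel)"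
      unfolding I
    proof (intro nn_integral_mono)
      fix \<tau>
      show "indicator {lo..hi} \<tau> * ennreal \<bar>p' \<tau>\<bar> \<le> (G (updv x i \<tau>) * F (updv x i \<tau>) + H (updv x i \<tau>)) * indicator {lo..hi} \<tau>"
      proof (cases "\<tau> \<in> {lo..hi}")
        case True
        note q = uQ[OF True]
        let ?z = "updv x i \<tau>"
        have gf: "0 \<le> \<gamma> ?z * f ?z" using g0 f0[OF q] by simp
        have "\<bar>p' \<tau>\<bar> \<le> S ?z" unfolding p'_def S_def by (rule member_le_sum) auto
        then have "ennreal \<bar>p' \<tau>\<bar> \<le> ennreal (\<gamma> ?z * f ?z + max 0 (S ?z - \<gamma> ?z * f ?z))"
          using gf by (intro ennreal_leI) linarith
        also have "\<dots> = G ?z * F ?z + H ?z"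
          using q gf g0 f0[OF q] by (simp add: G_def F_def H_def ennreal_mult ennreal_max_0)
        finally show ?thesis using True by simp
      qed simp
    qed
    finally show "F x \<le> F (updv x i t) + (\<integral>\<^sup>+t\<in>{lo..hi}. (G (updv x i t) * F (updv x i t) + H (updv x i t)) \<partial>lborel)" by simp
  qed
  moreover have "(\<integral>\<^sup>+x\<in>?Q. F x \<partial>lborel) = (\<integral>\<^sup>+x\<in>?Q. ennreal (f x) \<partial>lborel)"
    "(\<integral>\<^sup>+x\<in>?Q. H x \<partial>lborel) = (\<integral>\<^sup>+x\<in>?Q. ennreal (S x - \<gamma> x * f x) \<partial>lborel)"
    by (intro nn_integral_cong; simp add: F_def H_def indicator_def)+
  moreover have "shrunk a r s ((1/2)^k) \<subseteq> ?Q"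
    using shrunk_subset[OF s, of "(1/2)^k" 1] by (simp add: shrunk_1 power_le_one)
  then have "(\<integral>\<^sup>+x\<in>shrunk a r s ((1/2)^k). F x \<partial>lborel) = (\<integral>\<^sup>+x\<in>shrunk a r s ((1/2)^k). ennreal (f x) \<partial>lborel)"
    by (intro nn_integral_cong) (auto simp: F_def indicator_def)
  ultimately show ?thesis by (simp add: S_def)
qed

section \<open>Positive definite matrices\<close>

lemma cauchy_schwarz_form:
  fixes B :: "'a::real_vector \<Rightarrow> 'a \<Rightarrow> real"
  assumes B: "bilinear B" and sym: "\<And>x y. B x y = B y x" and pos: "\<And>x. 0 \<le> B x x"
  shows "(B x y)\<^sup>2 \<le> B x x * B y y"
proof -
  have expand: "B (s *\<^sub>R x + t *\<^sub>R y) (s *\<^sub>R x + t *\<^sub>R y) = s\<^sup>2 * B x x + 2 * s * t * B x y + t\<^sup>2 * B y y" for s t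
    by (simp add: bilinear_ladd[OF B] bilinear_radd[OF B] bilinear_lmul[OF B] bilinear_rmul[OF B] sym[of y x] power2_eq_square algebra_simps)
  show ?thesis
  proof (cases "B y y = 0")
    case False
    then have y: "B y y > 0" using pos[of y] by simp
    have "0 \<le> (B y y)\<^sup>2 * B x x + 2 * B y y * (- B x y) * B x y + (- B x y)\<^sup>2 * B y y"
      unfolding expand[symmetric] by (rule pos)
    also have "\<dots> = B y y * (B x x * B y y - (B x y)\<^sup>2)" by (simp add: power2_eq_square algebra_simps)
    finally show ?thesis using y by (simp add: zero_le_mult_iff)
  next
    case True
    have "B x y = 0"
    proof (rule ccontr)
      assume nz: "B x y \<noteq> 0"
      have "0 \<le> 1\<^sup>2 * B x x + 2 * 1 * (- (B x x + 1) / (2 * B x y)) * B x y + (- (B x x + 1) / (2 * B x y))\<^sup>2 * B y y"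
        unfolding expand[symmetric] by (rule pos)
      then show False using nz True by (simp add: field_simps)
    qed
    then show ?thesis using True by simp
  qed
qed

text \<open>
  The contraction of two positive semidefinite forms is nonnegative. Induction on the index set,
  completing the square in one index: the Schur complement of \<open>H\<close> is again positive
  semidefinite.
\<close>

lemma psd_form_contraction:
  fixes H :: "'i \<Rightarrow> 'i \<Rightarrow> real" and B :: "'a::real_vector \<Rightarrow> 'a \<Rightarrow> real" and a :: "'i \<Rightarrow> 'a"
  assumes B: "bilinear B" and Bsym: "\<And>x y. B x y = B y x" and Bpos: "\<And>x. 0 \<le> B x x"
    and "finite I"
    and "\<And>i j. i \<in> I \<Longrightarrow> j \<in> I \<Longrightarrow> H i j = H j i"
    and "\<And>c. 0 \<le> (\<Sum>i\<in>I. \<Sum>j\<in>I. H i j * c i * c j)"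
  shows "0 \<le> (\<Sum>i\<in>I. \<Sum>j\<in>I. H i j * B (a i) (a j))"
  using assms(4-6)
proof (induction I arbitrary: H rule: finite_induct)
  case (insert k I)
  note sym = insert.prems(1) and psd = insert.prems(2)
  have split: "(\<Sum>i\<in>insert k I. \<Sum>j\<in>insert k I. H i j * f i j)
      = H k k * f k k + 2 * (\<Sum>i\<in>I. H k i * f k i) + (\<Sum>i\<in>I. \<Sum>j\<in>I. H i j * f i j)"
    if "\<And>i j. f i j = f j i" for f
  proof -
    have "(\<Sum>i\<in>I. H i k * f i k) = (\<Sum>i\<in>I. H k i * f k i)"
      using sym that by (intro sum.cong refl) auto
    then show ?thesis using insert.hyps by (simp add: sum.distrib)
  qed
  have q: "0 \<le> H k k * (c k)\<^sup>2 + 2 * c k * (\<Sum>i\<in>I. H k i * c i) + (\<Sum>i\<in>I. \<Sum>j\<in>I. H i j * (c i * c j))" for c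
    using psd[of c] split[of "\<lambda>i j. c i * c j"]
    by (simp add: mult_ac power2_eq_square sum_distrib_left)
  have Hkk: "0 \<le> H k k"
  proof -
    have *: "(\<Sum>i\<in>I. H k i * (if i = k then 1 else 0)) = 0" "(\<Sum>i\<in>I. \<Sum>j\<in>I. H i j * ((if i = k then 1 else 0) * (if j = k then 1 else 0))) = (0::real)"
      using insert.hyps by (auto intro!: sum.neutral)
    show ?thesis using q[of "\<lambda>i. if i = k then 1 else 0"] unfolding * by simp
  qed
  define b where "b = (\<Sum>i\<in>I. H k i *\<^sub>R a i)"
  have Bb: "B x b = (\<Sum>i\<in>I. H k i * B x (a i))" for x
    unfolding b_def using B by (simp add: bilinear_def linear_sum linear_cmul)
  have Bbb: "B b b = (\<Sum>i\<in>I. \<Sum>j\<in>I. H k i * H k j * B (a i) (a j))"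
    by (subst Bb, subst Bsym, subst Bb) (simp add: sum_distrib_left mult_ac Bsym)
  have goal: "(\<Sum>i\<in>insert k I. \<Sum>j\<in>insert k I. H i j * B (a i) (a j))
      = H k k * B (a k) (a k) + 2 * B (a k) b + (\<Sum>i\<in>I. \<Sum>j\<in>I. H i j * B (a i) (a j))"
    unfolding split[of "\<lambda>i j. B (a i) (a j)", OF Bsym] Bb ..
  show ?case
  proof (cases "H k k = 0")
    case True
    have Hki: "H k i = 0" if i: "i \<in> I" for i
    proof (rule ccontr)
      assume nz: "H k i \<noteq> 0"
      define t where "t = - (H i i + 1) / (2 * H k i)"
      define c where "c j = (if j = k then t else if j = i then 1 else 0)" for j
      have ik: "i \<noteq> k" using i insert.hyps by auto
      have c: "c j = (if j = i then 1 else 0)" if "j \<in> I" for j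
        using that insert.hyps by (auto simp: c_def)
      have "(\<Sum>j\<in>I. H k j * c j) = (\<Sum>j\<in>I. if j = i then H k j else 0)"
        by (intro sum.cong refl) (simp add: c)
      then have 1: "(\<Sum>j\<in>I. H k j * c j) = H k i" using i insert.hyps by simp
      have "(\<Sum>j\<in>I. \<Sum>l\<in>I. H j l * (c j * c l)) = (\<Sum>j\<in>I. if j = i then (\<Sum>l\<in>I. if l = i then H j l else 0) else 0)"
        by (intro sum.cong refl) (auto simp: c intro!: sum.cong)
      then have 2: "(\<Sum>j\<in>I. \<Sum>l\<in>I. H j l * (c j * c l)) = H i i" using i insert.hyps by simp
      have "0 \<le> 2 * t * H k i + H i i" using q[of c] True unfolding 1 2 by (simp add: c_def)
      then show False using nz by (simp add: t_def field_simps)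
    qed
    have "b = 0" unfolding b_def using Hki by simp
    then have "B (a k) b = 0" using bilinear_rzero[OF B] by simp
    moreover have "0 \<le> (\<Sum>i\<in>I. \<Sum>j\<in>I. H i j * B (a i) (a j))"
    proof (rule insert.IH)
      show "0 \<le> (\<Sum>i\<in>I. \<Sum>j\<in>I. H i j * c i * c j)" for c
        using q[of "c"] True Hki by (simp add: mult_ac)
    qed (use sym in auto)
    ultimately show ?thesis unfolding goal using True by simp
  next
    case False
    then have kk: "H k k > 0" using Hkk by simp
    define H' where "H' i j = H i j - H k i * H k j / H k k" for i j
    have "0 \<le> (\<Sum>i\<in>I. \<Sum>j\<in>I. H' i j * B (a i) (a j))"
    proof (rule insert.IH)
      show "H' i j = H' j i" if "i \<in> I" "j \<in> I" for i j using sym that by (simp add: H'_def mult.commute)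
      fix c
      define s where "s = (\<Sum>i\<in>I. H k i * c i)"
      define c' where "c' = c(k := - s / H k k)"
      have c': "c' i = c i" if "i \<in> I" for i using that insert.hyps by (auto simp: c'_def)
      have s': "(\<Sum>i\<in>I. H k i * c' i) = s" unfolding s_def by (intro sum.cong refl) (simp add: c')
      have "(\<Sum>i\<in>I. \<Sum>j\<in>I. H' i j * c i * c j) = (\<Sum>i\<in>I. \<Sum>j\<in>I. H i j * (c' i * c' j)) - (\<Sum>i\<in>I. \<Sum>j\<in>I. (H k i * c i) * (H k j * c j)) / H k k"
        unfolding sum_divide_distrib sum_subtractf[symmetric]
        by (intro sum.cong refl) (simp add: H'_def c' field_simps)
      also have "(\<Sum>i\<in>I. \<Sum>j\<in>I. (H k i * c i) * (H k j * c j)) = s\<^sup>2"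
        by (simp add: s_def power2_eq_square sum_product)
      finally have "(\<Sum>i\<in>I. \<Sum>j\<in>I. H' i j * c i * c j) = H k k * (c' k)\<^sup>2 + 2 * c' k * s + (\<Sum>i\<in>I. \<Sum>j\<in>I. H i j * (c' i * c' j))"
        using kk by (simp add: c'_def power2_eq_square field_simps)
      then show "0 \<le> (\<Sum>i\<in>I. \<Sum>j\<in>I. H' i j * c i * c j)" using q[of c'] unfolding s' by simp
    qed
    also have "(\<Sum>i\<in>I. \<Sum>j\<in>I. H' i j * B (a i) (a j)) = (\<Sum>i\<in>I. \<Sum>j\<in>I. H i j * B (a i) (a j)) - B b b / H k k"
      unfolding Bbb sum_divide_distrib sum_subtractf[symmetric]
      by (intro sum.cong refl) (simp add: H'_def left_diff_distrib)
    finally have 1: "B b b / H k k \<le> (\<Sum>i\<in>I. \<Sum>j\<in>I. H i j * B (a i) (a j))" by simp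
    have "0 \<le> H k k * B (a k + (1 / H k k) *\<^sub>R b) (a k + (1 / H k k) *\<^sub>R b)" using kk Bpos by simp
    also have "\<dots> = H k k * B (a k) (a k) + 2 * B (a k) b + B b b / H k k"
      using kk by (simp add: bilinear_ladd[OF B] bilinear_radd[OF B] bilinear_lmul[OF B] bilinear_rmul[OF B] Bsym[of b "a k"] field_simps)
    finally show ?thesis unfolding goal using 1 by linarith
  qed
qed simp

definition pos_def :: "real ^ 'n ^ 'n \<Rightarrow> bool" where
  "pos_def G \<longleftrightarrow> transpose G = G \<and> (\<forall>v. v \<noteq> 0 \<longrightarrow> 0 < v \<bullet> (G *v v))"

lemma matrix_inv_inverse:
  assumes "invertible (A :: real ^ 'n::finite ^ 'n)"
  shows "A ** matrix_inv A = mat 1" "matrix_inv A ** A = mat 1"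
  using assms someI_ex[of "\<lambda>A'. A ** A' = mat 1 \<and> A' ** A = mat 1"]
  unfolding matrix_inv_def invertible_def by auto

lemma pos_def_invertible: assumes "pos_def (G :: real ^ 'n::finite ^ 'n)" shows "invertible G"
proof -
  have "inj ((*v) G)"
    unfolding linear_injective_0[OF matrix_vector_mul_linear]
    using assms by (metis inner_zero_right less_irrefl pos_def_def)
  then show ?thesis by (metis invertible_left_inverse matrix_left_invertible_injective)
qed

lemma pos_def_det: assumes G: "pos_def (G :: real ^ 'n::finite ^ 'n)" shows "0 < det G"
proof -
  define f where "f t = det ((1 - t) *\<^sub>R mat 1 + t *\<^sub>R G)" for t :: real
  have pd: "pos_def ((1 - t) *\<^sub>R mat 1 + t *\<^sub>R G)" if "0 \<le> t" "t \<le> 1" for t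
    unfolding pos_def_def
  proof (intro conjI allI impI)
    show "transpose ((1 - t) *\<^sub>R mat 1 + t *\<^sub>R G) = (1 - t) *\<^sub>R mat 1 + t *\<^sub>R G"
      using G unfolding pos_def_def by (simp add: vec_eq_iff transpose_def mat_def)
    fix v :: "real ^ 'n" assume v: "v \<noteq> 0"
    have "v \<bullet> (((1 - t) *\<^sub>R mat 1 + t *\<^sub>R G) *v v) = (1 - t) * (v \<bullet> v) + t * (v \<bullet> (G *v v))"
      by (simp add: matrix_vector_mult_add_rdistrib scaleR_matrix_vector_assoc[symmetric] inner_add_right)
    moreover have "0 < v \<bullet> v" "0 < v \<bullet> (G *v v)" using v G by (auto simp: pos_def_def)
    ultimately show "0 < v \<bullet> (((1 - t) *\<^sub>R mat 1 + t *\<^sub>R G) *v v)"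
      using that by (cases "t = 0") (auto intro!: add_nonneg_pos mult_nonneg_nonneg)
  qed
  have nz: "f t \<noteq> 0" if "0 \<le> t" "t \<le> 1" for t
    using pos_def_invertible[OF pd[OF that]] by (simp add: f_def invertible_det_nz)
  have c: "continuous_on {0..1} f"
    unfolding f_def det_def by (intro continuous_intros)
  have f0: "f 0 = 1" by (simp add: f_def)
  have "0 < f 1"
  proof (rule ccontr)
    assume "\<not> 0 < f 1"
    then obtain t where "0 \<le> t" "t \<le> 1" "f t = 0"
      using IVT2'[of f 1 0 0] c f0 by auto
    then show False using nz by blast
  qed
  then show ?thesis by (simp add: f_def)
qed

text \<open>
  The squared norm of a covector-valued quantity with respect to the metric dominates its value on
  a single vector, \<open>|a(v)|\<^sup>2 \<le> |v|\<^sup>2 |a|\<^sup>2\<close>. In terms of components, the matrix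
  \<open>|v|\<^sup>2 G\<^sup>-\<^sup>1 - v v\<^sup>T\<close> is positive semidefinite by the Cauchy-Schwarz inequality for \<open>G\<close>, and is
  contracted with the form \<open>B\<close>.
\<close>

lemma metric_gradient_bound:
  fixes G :: "real ^ 'n::finite ^ 'n" and B :: "'a::real_vector \<Rightarrow> 'a \<Rightarrow> real" and a :: "'n \<Rightarrow> 'a"
  assumes G: "pos_def G"
    and B: "bilinear B" and Bsym: "\<And>x y. B x y = B y x" and Bpos: "\<And>x. 0 \<le> B x x"
  shows "B (\<Sum>i\<in>UNIV. v $ i *\<^sub>R a i) (\<Sum>i\<in>UNIV. v $ i *\<^sub>R a i)
     \<le> (v \<bullet> (G *v v)) * (\<Sum>i\<in>UNIV. \<Sum>j\<in>UNIV. matrix_inv G $ i $ j * B (a i) (a j))" (is "?L \<le> _ * ?R")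
    and "0 \<le> (\<Sum>i\<in>UNIV. \<Sum>j\<in>UNIV. matrix_inv G $ i $ j * B (a i) (a j))"
proof -
  define H where "H = matrix_inv G"
  have GH: "G ** H = mat 1" and HG: "H ** G = mat 1"
    using matrix_inv_inverse[OF pos_def_invertible[OF G]] by (auto simp: H_def)
  have Gt: "transpose G = G" using G by (simp add: pos_def_def)
  have Gsym: "v \<bullet> (G *v w) = w \<bullet> (G *v v)" for v w
  proof -
    have "v \<bullet> (G *v w) = (transpose G *v v) \<bullet> w" by (simp only: dot_lmul_matrix[symmetric] transpose_matrix_vector)
    then show ?thesis by (simp add: Gt inner_commute)
  qed
  have Gpos: "0 \<le> v \<bullet> (G *v v)" for v using G by (cases "v = 0") (auto simp: pos_def_def less_imp_le)
  have Gbil: "bilinear (\<lambda>v w. v \<bullet> (G *v w))"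
    unfolding bilinear_def by (auto intro!: linearI simp: inner_add_left inner_add_right matrix_vector_right_distrib matrix_vector_mult_scaleR)
  have Hsym: "transpose H = H"
  proof -
    have "transpose H = transpose H ** (G ** H)" by (simp add: GH)
    also have "\<dots> = (transpose H ** transpose G) ** H" by (simp add: matrix_mul_assoc Gt)
    also have "transpose H ** transpose G = mat 1" by (simp add: matrix_transpose_mul[symmetric] GH transpose_mat)
    finally show ?thesis by simp
  qed
  have Hc: "(\<Sum>i\<in>UNIV. \<Sum>j\<in>UNIV. H $ i $ j * c i * c j) = (\<chi> i. c i) \<bullet> (H *v (\<chi> i. c i))" for c
    unfolding inner_vec_def matrix_vector_mult_def by (simp add: sum_distrib_left mult.left_commute mult.assoc[symmetric])
      (simp add: mult.commute mult.left_commute)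
  have GHv: "G *v (H *v c) = c" for c by (simp add: matrix_vector_mul_assoc GH)
  have Hij: "H $ i $ j = H $ j $ i" for i j using arg_cong[OF Hsym, of "\<lambda>M. M $ i $ j"] by (simp add: transpose_def)
  show "0 \<le> ?R" unfolding H_def[symmetric]
  proof (rule psd_form_contraction[OF B Bsym Bpos])
    fix c :: "'n \<Rightarrow> real"
    let ?c = "\<chi> i. c i"
    have "0 \<le> (H *v ?c) \<bullet> (G *v (H *v ?c))" by (rule Gpos)
    then show "0 \<le> (\<Sum>i\<in>UNIV. \<Sum>j\<in>UNIV. H $ i $ j * c i * c j)" unfolding Hc GHv by (simp add: inner_commute)
  qed (auto simp: Hij)
  show "?L \<le> (v \<bullet> (G *v v)) * ?R"
  proof (cases "v = 0")
    case True then show ?thesis using bilinear_lzero[OF B] by simp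
  next
    case False
    define t where "t = v \<bullet> (G *v v)"
    have t: "t > 0" using G False by (simp add: t_def pos_def_def)
    have "0 \<le> (\<Sum>i\<in>UNIV. \<Sum>j\<in>UNIV. (H $ i $ j - v $ i * v $ j / t) * B (a i) (a j))"
    proof (rule psd_form_contraction[OF B Bsym Bpos])
      fix c :: "'n \<Rightarrow> real"
      let ?c = "\<chi> i. c i"
      have "(v \<bullet> (G *v (H *v ?c)))\<^sup>2 \<le> t * ((H *v ?c) \<bullet> (G *v (H *v ?c)))"
        unfolding t_def by (rule cauchy_schwarz_form[OF Gbil Gsym Gpos])
      then have "(v \<bullet> ?c)\<^sup>2 / t \<le> ?c \<bullet> (H *v ?c)" unfolding GHv using t by (simp add: field_simps inner_commute)
      also have "(v \<bullet> ?c)\<^sup>2 = (\<Sum>i\<in>UNIV. \<Sum>j\<in>UNIV. (v $ i * c i) * (v $ j * c j))"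
        by (simp add: inner_vec_def power2_eq_square sum_product)
      finally show "0 \<le> (\<Sum>i\<in>UNIV. \<Sum>j\<in>UNIV. (H $ i $ j - v $ i * v $ j / t) * c i * c j)"
        unfolding Hc[symmetric] by (simp add: left_diff_distrib right_diff_distrib sum_subtractf sum_divide_distrib mult_ac)
    next
      show "H $ i $ j - v $ i * v $ j / t = H $ j $ i - v $ j * v $ i / t" for i j
        by (simp only: Hij[of i j] mult.commute)
    qed simp
    then have "(\<Sum>i\<in>UNIV. \<Sum>j\<in>UNIV. v $ i * v $ j * B (a i) (a j)) / t \<le> ?R"
      unfolding H_def[symmetric] by (simp add: left_diff_distrib sum_subtractf sum_divide_distrib)
    moreover have "?L = (\<Sum>i\<in>UNIV. \<Sum>j\<in>UNIV. v $ i * v $ j * B (a i) (a j))"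
      by (simp add: bilinear_sum[OF B] bilinear_lmul[OF B] bilinear_rmul[OF B] sum.cartesian_product mult.assoc mult.left_commute)
    ultimately have "?L / t \<le> ?R" by simp
    then show ?thesis using t unfolding t_def[symmetric] by (simp add: pos_divide_le_eq mult.commute)
  qed
qed

lemma det_le_entries:
  fixes M :: "real ^ 'n::finite ^ 'n"
  assumes "\<And>i j. \<bar>M $ i $ j\<bar> \<le> c"
  shows "\<bar>det M\<bar> \<le> fact CARD('n) * c ^ CARD('n)"
proof -
  have "\<bar>det M\<bar> \<le> (\<Sum>p\<in>{p. p permutes (UNIV::'n set)}. \<bar>of_int (sign p) * (\<Prod>i\<in>UNIV. M $ i $ p i)\<bar>)"
    unfolding det_def by (rule sum_abs)
  also have "\<dots> \<le> (\<Sum>p\<in>{p. p permutes (UNIV::'n set)}. c ^ CARD('n))"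
  proof (rule sum_mono)
    fix p :: "'n \<Rightarrow> 'n"
    have "\<bar>of_int (sign p) * (\<Prod>i\<in>UNIV. M $ i $ p i)\<bar> = (\<Prod>i\<in>UNIV. \<bar>M $ i $ p i\<bar>)"
      by (auto simp: abs_mult abs_prod sign_def)
    also have "\<dots> \<le> (\<Prod>i\<in>(UNIV::'n set). c)" by (intro prod_mono) (auto simp: assms)
    finally show "\<bar>of_int (sign p) * (\<Prod>i\<in>UNIV. M $ i $ p i)\<bar> \<le> c ^ CARD('n)" by simp
  qed
  also have "\<dots> = fact CARD('n) * c ^ CARD('n)" by (simp add: card_permutations[OF refl finite])
  finally show ?thesis .
qed

text \<open>
  Comparison of volumes from a comparison of quadratic forms. If \<open>C\<close> is the inverse of \<open>A\<close>, the
  form \<open>C\<^sup>T G C\<close> is bounded below by \<open>k\<close>, so its inverse has entries at most \<open>1 / k\<close> and a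
  bounded determinant. The factorial is the crude bound of the Leibniz formula; it avoids eigenvalues.
\<close>

lemma det_lower_bound:
  fixes G A :: "real ^ 'n::finite ^ 'n"
  assumes G: "pos_def G" and k: "k > 0"
    and le: "\<And>v. k * ((A *v v) \<bullet> (A *v v)) \<le> v \<bullet> (G *v v)"
  shows "(det A)\<^sup>2 \<le> fact CARD('n) / k ^ CARD('n) * det G"
proof (cases "invertible A")
  case False
  then have "det A = 0" by (simp add: invertible_det_nz)
  then show ?thesis using pos_def_det[OF G] k by simp
next
  case True
  define C where "C = matrix_inv A"
  have AC: "A ** C = mat 1" using matrix_inv_inverse[OF True] by (simp add: C_def)
  define N where "N = transpose C ** G ** C"
  have Nw: "k * (w \<bullet> w) \<le> w \<bullet> (N *v w)" for w
  proof -
    have "k * ((A *v (C *v w)) \<bullet> (A *v (C *v w))) \<le> (C *v w) \<bullet> (G *v (C *v w))" by (rule le)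
    moreover have "A *v (C *v w) = w" by (simp add: matrix_vector_mul_assoc AC)
    moreover have "(C *v w) \<bullet> (G *v (C *v w)) = w \<bullet> (N *v w)"
    proof -
      have "w \<bullet> (N *v w) = w \<bullet> (transpose C *v (G *v (C *v w)))"
        by (simp only: N_def matrix_vector_mul_assoc[symmetric])
      also have "\<dots> = (C *v w) \<bullet> (G *v (C *v w))" by (simp only: dot_lmul_matrix[symmetric] vector_transpose_matrix)
      finally show ?thesis by simp
    qed
    ultimately show ?thesis by (simp only:)
  qed
  have lower: "k * norm w \<le> norm (N *v w)" for w
  proof (cases "w = 0")
    case False
    have "k * (w \<bullet> w) \<le> norm w * norm (N *v w)"
      by (rule order_trans[OF Nw norm_cauchy_schwarz])
    then have "norm w * (k * norm w) \<le> norm w * norm (N *v w)"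
      by (simp only: dot_square_norm power2_eq_square mult_ac)
    then show ?thesis using False by simp
  qed simp
  have "inj ((*v) N)"
    unfolding linear_injective_0[OF matrix_vector_mul_linear]
  proof (intro allI impI)
    fix w assume "N *v w = 0"
    then have "k * norm w \<le> 0" using lower[of w] by simp
    then show "w = 0" using k by (simp add: mult_le_0_iff)
  qed
  then have invN: "invertible N" by (metis invertible_left_inverse matrix_left_invertible_injective)
  define R where "R = matrix_inv N"
  have NR: "N ** R = mat 1" using matrix_inv_inverse[OF invN] by (simp add: R_def)
  have "\<bar>R $ i $ j\<bar> \<le> 1 / k" for i j
  proof -
    have "k * norm (R *v axis j 1) \<le> norm (N *v (R *v axis j 1))" by (rule lower)
    also have "\<dots> = 1" by (simp add: matrix_vector_mul_assoc NR)
    finally have "norm (R *v axis j 1) \<le> 1 / k" using k by (simp add: field_simps)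
    moreover have "\<bar>R $ i $ j\<bar> \<le> norm (R *v axis j 1)"
      using component_le_norm_cart[of "R *v axis j 1" i] by (simp add: matrix_vector_mult_basis column_def)
    ultimately show ?thesis by linarith
  qed
  then have Rle: "\<bar>det R\<bar> \<le> fact CARD('n) * (1 / k) ^ CARD('n)" by (rule det_le_entries)
  have NR1: "det N * det R = 1" using arg_cong[OF NR, of det] by (simp add: det_mul)
  have detN: "det N = det G * (det C)\<^sup>2" by (simp add: N_def det_mul power2_eq_square)
  have AC1: "det A * det C = 1" using arg_cong[OF AC, of det] by (simp add: det_mul)
  then have "det C \<noteq> 0" by auto
  then have N0: "0 < det N" unfolding detN using pos_def_det[OF G] by simp
  have "1 = det N * det R" by (simp add: NR1)
  also have "\<dots> \<le> det N * (fact CARD('n) * (1 / k) ^ CARD('n))"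
    by (rule mult_left_mono) (use Rle N0 in auto)
  finally have "1 \<le> (det G * (det C)\<^sup>2) * (fact CARD('n) * (1 / k) ^ CARD('n))" unfolding detN .
  from mult_left_mono[OF this, of "(det A)\<^sup>2"]
  have "(det A)\<^sup>2 \<le> det G * (det A * det C)\<^sup>2 * (fact CARD('n) * (1 / k) ^ CARD('n))"
    by (simp add: power_mult_distrib mult_ac)
  then show ?thesis unfolding AC1 by (simp add: power_one_over mult_ac)
qed

section \<open>Measures of differentiable images\<close>

text \<open>
  The change of variables estimate for images of measurable sets is applied to vectors whose index
  type is well-ordered. Every finite type has a copy that carries such an order.
\<close>

typedef 'a wo = "UNIV :: 'a set" morphisms of_wo to_wo by simp

instance wo :: (finite) finite
proof
  have "(UNIV :: 'a wo set) = range to_wo" by (metis of_wo_inverse surj_def)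
  then show "finite (UNIV :: 'a wo set)" by (metis finite finite_imageI)
qed

instantiation wo :: (finite) wellorder
begin
definition less_eq_wo :: "'a wo \<Rightarrow> 'a wo \<Rightarrow> bool" where "less_eq_wo a b \<longleftrightarrow> to_nat (of_wo a) \<le> to_nat (of_wo b)"
definition less_wo :: "'a wo \<Rightarrow> 'a wo \<Rightarrow> bool" where "less_wo a b \<longleftrightarrow> to_nat (of_wo a) < to_nat (of_wo b)"
instance
proof
  fix P :: "'a wo \<Rightarrow> bool" and a :: "'a wo" assume *: "\<And>x. (\<And>y. y < x \<Longrightarrow> P y) \<Longrightarrow> P x"
  show "P a"
    by (induction a rule: measure_induct_rule[of "\<lambda>a. to_nat (of_wo a)"]) (auto intro: * simp: less_wo_def)
qed (auto simp: less_eq_wo_def less_wo_def of_wo_inject)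
end

lemma bij_of_wo: "bij of_wo"
  by (metis bijI' of_wo_inject of_wo_inverse to_wo_inverse UNIV_I)

lemma det_reindex:
  fixes M :: "real ^ 'n::finite ^ 'n" and \<beta> :: "'m::finite \<Rightarrow> 'n"
  assumes "bij \<beta>"
  shows "det (\<chi> i j. M $ \<beta> i $ \<beta> j) = det M"
proof -
  have inj: "inj \<beta>" and surj: "range \<beta> = UNIV" using assms by (auto simp: bij_def)
  let ?c = "\<lambda>p. map_permutation UNIV \<beta> p"
  have c: "?c p = \<beta> \<circ> p \<circ> inv \<beta>" for p
    by (simp add: map_permutation_def surj restrict_id_def fun_eq_iff)
  have perm: "p permutes (UNIV :: 'k set) \<longleftrightarrow> bij p" for p :: "'k \<Rightarrow> 'k"
    by (simp add: permutes_univ bij_iff)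
  have bij: "bij_betw ?c {p. p permutes UNIV} {p. p permutes UNIV}"
  proof (rule bij_betw_byWitness[where f' = "\<lambda>p. inv \<beta> \<circ> p \<circ> \<beta>"])
    show "\<forall>p\<in>{p. p permutes UNIV}. inv \<beta> \<circ> ?c p \<circ> \<beta> = p"
      unfolding c using inj by (simp add: fun_eq_iff)
    show "\<forall>p\<in>{p. p permutes UNIV}. ?c (inv \<beta> \<circ> p \<circ> \<beta>) = p"
      unfolding c using surj by (simp add: fun_eq_iff surj_f_inv_f)
    show "?c ` {p. p permutes UNIV} \<subseteq> {p. p permutes UNIV}"
      unfolding c perm using assms by (auto intro!: bij_comp bij_imp_bij_inv)
    show "(\<lambda>p. inv \<beta> \<circ> p \<circ> \<beta>) ` {p. p permutes UNIV} \<subseteq> {p. p permutes UNIV}"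
      unfolding perm using assms by (auto intro!: bij_comp bij_imp_bij_inv)
  qed
  have "det M = (\<Sum>p\<in>{p. p permutes UNIV}. of_int (sign (?c p)) * (\<Prod>i\<in>UNIV. M $ i $ ?c p i))"
    unfolding det_def by (rule sum.reindex_bij_betw[OF bij, symmetric])
  also have "\<dots> = det (\<chi> i j. M $ \<beta> i $ \<beta> j)"
    unfolding det_def
  proof (rule sum.cong[OF refl])
    fix p :: "'m \<Rightarrow> 'm" assume p: "p \<in> {p. p permutes UNIV}"
    have "sign (?c p) = sign p" using sign_map_permutation[OF inj] p by simp
    moreover have "(\<Prod>i\<in>UNIV. M $ i $ ?c p i) = (\<Prod>i\<in>UNIV. M $ \<beta> i $ ?c p (\<beta> i))"
      by (rule prod.reindex_bij_betw[OF assms, symmetric])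
    ultimately show "of_int (sign (?c p)) * (\<Prod>i\<in>UNIV. M $ i $ ?c p i) = of_int (sign p) * (\<Prod>i\<in>UNIV. (\<chi> i j. M $ \<beta> i $ \<beta> j) $ i $ p i)"
      using inj by (simp add: c)
  qed
  finally show ?thesis by simp
qed

text \<open>
  Euclidean spaces of equal dimension are identified by matching their bases; this is used to identify
  the product of an interval and an \<open>(n - 1)\<close>-dimensional coordinate space with the
  \<open>n\<close>-dimensional one.
\<close>

lemma basis_isometry_exists:
  assumes dim: "DIM('a::euclidean_space) = DIM('b::euclidean_space)"
  obtains L :: "'a::euclidean_space \<Rightarrow> 'b::euclidean_space" and K :: "'b \<Rightarrow> 'a" where "linear L" "linear K" "\<And>x. K (L x) = x" "\<And>y. L (K y) = y"
    "\<And>x. norm (L x) = norm x" "\<And>B. B \<in> sets borel \<Longrightarrow> emeasure lborel (L ` B) = emeasure lborel B"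
    "\<And>B. B \<in> sets borel \<Longrightarrow> L ` B \<in> sets borel"
proof -
  obtain \<phi> where \<phi>: "bij_betw \<phi> (Basis :: 'a set) (Basis :: 'b set)"
    using finite_same_card_bij[OF finite_Basis finite_Basis dim] by blast
  define L where "L x = (\<Sum>b\<in>Basis. (x \<bullet> b) *\<^sub>R \<phi> b)" for x
  define K where "K y = (\<Sum>b\<in>Basis. (y \<bullet> \<phi> b) *\<^sub>R b)" for y
  have \<phi>B: "\<phi> b \<in> Basis" if "b \<in> Basis" for b using \<phi> that by (auto simp: bij_betw_def)
  have inj: "\<phi> b = \<phi> c \<longleftrightarrow> b = c" if "b \<in> Basis" "c \<in> Basis" for b c
    using \<phi> that by (auto simp: bij_betw_def inj_on_def)
  have lin: "linear L" "linear K"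
    unfolding L_def K_def by (auto intro!: linearI simp: inner_add_left scaleR_add_left sum.distrib scaleR_sum_right)
  have Lb: "L x \<bullet> \<phi> b = x \<bullet> b" if b: "b \<in> Basis" for x b
  proof -
    have "L x \<bullet> \<phi> b = (\<Sum>c\<in>Basis. (x \<bullet> c) * (\<phi> c \<bullet> \<phi> b))" by (simp add: L_def inner_sum_left)
    also have "\<dots> = (\<Sum>c\<in>Basis. if c = b then x \<bullet> c else 0)"
      by (intro sum.cong refl) (auto simp: inner_Basis \<phi>B b inj)
    finally show ?thesis using b by simp
  qed
  have Kb: "K y \<bullet> b = y \<bullet> \<phi> b" if b: "b \<in> Basis" for y b
    unfolding K_def using b by (simp add: inner_sum_left inner_Basis if_distrib cong: if_cong)
  have KL: "K (L x) = x" for x by (rule euclidean_eqI) (simp add: Kb Lb)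
  have LK: "L (K y) = y" for y
  proof (rule euclidean_eqI)
    fix c :: 'b assume "c \<in> Basis"
    then obtain b where "b \<in> Basis" "c = \<phi> b" using \<phi> by (auto simp: bij_betw_def)
    then show "L (K y) \<bullet> c = y \<bullet> c" by (simp add: Lb Kb)
  qed
  have nrm: "norm (L x) = norm x" for x
  proof -
    have "(\<Sum>b\<in>Basis. (L x \<bullet> b)\<^sup>2) = (\<Sum>b\<in>Basis. (x \<bullet> b)\<^sup>2)"
      by (subst sum.reindex_bij_betw[OF \<phi>, symmetric]) (simp add: Lb)
    moreover have "L x \<bullet> L x = (\<Sum>b\<in>Basis. (L x \<bullet> b)\<^sup>2)" by (subst euclidean_inner) (simp add: power2_eq_square)
    moreover have "x \<bullet> x = (\<Sum>b\<in>Basis. (x \<bullet> b)\<^sup>2)" by (subst euclidean_inner) (simp add: power2_eq_square)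
    ultimately show ?thesis by (simp add: norm_eq_sqrt_inner)
  qed
  have img: "L ` B = K -` B" for B
  proof (intro set_eqI iffI)
    fix y assume "y \<in> L ` B" then show "y \<in> K -` B" by (auto simp: KL)
  next
    fix y assume "y \<in> K -` B" then show "y \<in> L ` B" using imageI[of "K y" B L] by (simp add: LK)
  qed
  have Km [measurable]: "K \<in> borel_measurable borel"
    using lin(2) by (intro borel_measurable_continuous_onI linear_continuous_on) (simp add: linear_conv_bounded_linear)
  have lbK: "lborel = distr lborel borel K"
  proof (rule lborel_eqI)
    fix l u :: 'a assume le: "\<And>b. b \<in> Basis \<Longrightarrow> l \<bullet> b \<le> u \<bullet> b"
    have "K -` box l u = box (L l) (L u)"
    proof (intro set_eqI)
      fix y
      have "y \<in> box (L l) (L u) \<longleftrightarrow> (\<forall>b\<in>Basis. L l \<bullet> \<phi> b < y \<bullet> \<phi> b \<and> y \<bullet> \<phi> b < L u \<bullet> \<phi> b)"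
        unfolding box_def mem_Collect_eq by (subst bij_betw_imp_surj_on[OF \<phi>, symmetric]) simp
      then show "y \<in> K -` box l u \<longleftrightarrow> y \<in> box (L l) (L u)" by (simp add: box_def Kb Lb)
    qed
    then have "emeasure (distr lborel borel K) (box l u) = emeasure lborel (box (L l) (L u))"
      by (simp add: emeasure_distr)
    also have "\<dots> = (\<Prod>c\<in>Basis. (L u - L l) \<bullet> c)"
    proof (rule emeasure_lborel_box)
      fix c :: 'b assume "c \<in> Basis"
      then obtain b where "b \<in> Basis" "c = \<phi> b" using \<phi> by (auto simp: bij_betw_def)
      then show "L l \<bullet> c \<le> L u \<bullet> c" using le by (simp add: Lb)
    qed
    also have "(\<Prod>c\<in>Basis. (L u - L l) \<bullet> c) = (\<Prod>b\<in>Basis. (u - l) \<bullet> b)"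
      by (subst prod.reindex_bij_betw[OF \<phi>, symmetric]) (simp add: Lb inner_diff_left)
    finally show "emeasure (distr lborel borel K) (box l u) = ennreal (\<Prod>b\<in>Basis. (u - l) \<bullet> b)" .
  qed simp
  have em: "emeasure lborel (L ` B) = emeasure lborel B" if "B \<in> sets borel" for B
    using that by (subst lbK) (simp add: img emeasure_distr)
  show thesis
    using that[OF lin KL LK nrm em] measurable_sets_borel[OF Km] unfolding img by blast
qed

lemma emeasure_image_le_wellordered:
  fixes f :: "real ^ 'n::{finite,wellorder} \<Rightarrow> real ^ 'n::_"
  assumes S: "S \<in> sets borel" "bounded S"
    and der: "\<And>x. x \<in> S \<Longrightarrow> (f has_derivative f' x) (at x within S)"
    and fS: "f ` S \<in> sets borel"
    and \<rho>m: "\<rho> \<in> borel_measurable borel" and le: "\<And>x. x \<in> S \<Longrightarrow> \<bar>det (matrix (f' x))\<bar> \<le> \<rho> x"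
    and bd: "\<And>x. x \<in> S \<Longrightarrow> \<rho> x \<le> b"
  shows "emeasure lborel (f ` S) \<le> (\<integral>\<^sup>+x\<in>S. ennreal (\<rho> x) \<partial>lborel)"
proof -
  have SL: "S \<in> sets lebesgue" by (rule sets_completionI_sets) (use S(1) in simp)
  have Sm: "S \<in> lmeasurable" by (rule bounded_set_imp_lmeasurable[OF S(2) SL])
  define D where "D x = \<bar>det (matrix (f' x))\<bar>" for x
  have mD: "(\<lambda>x. D x) \<in> borel_measurable (lebesgue_on S)"
    unfolding D_def by (intro borel_measurable_abs borel_measurable_det_Jacobian[OF SL der])
  have int: "D integrable_on S"
  proof (rule measurable_bounded_by_integrable_imp_integrable[OF mD _ _ SL])
    show "(\<lambda>x. b) integrable_on S" by (rule integrable_on_const[OF Sm])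
    show "norm (D x) \<le> b" if "x \<in> S" for x using le[OF that] bd[OF that] by (simp add: D_def)
  qed
  have int': "(\<lambda>x. \<bar>det (matrix (f' x))\<bar>) integrable_on S" using int unfolding D_def .
  have fm: "f ` S \<in> lmeasurable" by (rule measurable_differentiable_image[OF SL der int'])
  have ml: "measure lebesgue (f ` S) \<le> integral S D"
    unfolding D_def by (rule measure_differentiable_image[OF SL der int'])
  have "emeasure lborel (f ` S) = emeasure lebesgue (f ` S)" using fS by simp
  also have "\<dots> = ennreal (measure lebesgue (f ` S))" by (rule emeasure_eq_measure2[OF fm])
  also have "\<dots> \<le> ennreal (integral S D)" by (rule ennreal_leI[OF ml])
  also have "\<dots> = (\<integral>\<^sup>+x. ennreal (D x) * indicator S x \<partial>lborel)"
    by (rule nn_integral_has_integral_lebesgue'[OF _ integrable_integral[OF int], symmetric]) (simp add: D_def)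
  also have "\<dots> \<le> (\<integral>\<^sup>+x\<in>S. ennreal (\<rho> x) \<partial>lborel)"
    using le by (intro nn_integral_mono) (auto simp: D_def indicator_def intro: ennreal_leI)
  finally show ?thesis .
qed

text \<open>
  The area estimate without injectivity, for maps into any Euclidean space of the same dimension and
  with an unbounded bound \<open>\<rho>\<close>: transport along the isometries, and exhaust \<open>S\<close> by the bounded pieces
  on which \<open>\<rho>\<close> is bounded.
\<close>

lemma emeasure_image_le:
  fixes f :: "real ^ 'n::finite \<Rightarrow> 'b::euclidean_space" and L :: "'b \<Rightarrow> real ^ 'n"
  assumes S: "S \<in> sets borel"
    and der: "\<And>x. x \<in> S \<Longrightarrow> (f has_derivative f' x) (at x within S)"
    and fB: "\<And>B. B \<in> sets borel \<Longrightarrow> B \<subseteq> S \<Longrightarrow> f ` B \<in> sets borel"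
    and \<rho>m [measurable]: "\<rho> \<in> borel_measurable borel" and le: "\<And>x. x \<in> S \<Longrightarrow> \<bar>det (matrix (\<lambda>v. L (f' x v)))\<bar> \<le> \<rho> x"
    and L: "linear L" "\<And>B. B \<in> sets borel \<Longrightarrow> emeasure lborel (L ` B) = emeasure lborel B"
      "\<And>B. B \<in> sets borel \<Longrightarrow> L ` B \<in> sets borel"
  shows "emeasure lborel (f ` S) \<le> (\<integral>\<^sup>+x\<in>S. ennreal (\<rho> x) \<partial>lborel)"
proof -
  define R :: "real ^ 'n \<Rightarrow> real ^ 'n wo" where "R v = (\<chi> i. v $ of_wo i)" for v
  define Q :: "real ^ 'n wo \<Rightarrow> real ^ 'n" where "Q w = (\<chi> i. w $ to_wo i)" for w
  have QR: "Q (R v) = v" and RQ: "R (Q w) = w" for v w by (simp_all add: Q_def R_def vec_eq_iff to_wo_inverse of_wo_inverse)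
  have linR: "linear R" and linQ: "linear Q" by (auto intro!: linearI simp: R_def Q_def vec_eq_iff)
  have blR: "bounded_linear R" and blQ: "bounded_linear Q" and blL: "bounded_linear L"
    using linR linQ L by (simp_all add: linear_conv_bounded_linear)
  have Rm [measurable]: "R \<in> borel_measurable borel" and Qm [measurable]: "Q \<in> borel_measurable borel"
    using blR blQ by (auto intro!: borel_measurable_continuous_onI linear_continuous_on)
  have imR: "R ` B = Q -` B" for B
  proof (intro set_eqI iffI)
    fix y assume "y \<in> R ` B" then show "y \<in> Q -` B" by (auto simp: QR)
  next
    fix y assume "y \<in> Q -` B" then show "y \<in> R ` B" using imageI[of "Q y" B R] by (simp add: RQ)
  qed
  have lb: "lborel = distr lborel borel Q"
  proof (rule lborel_eqI)
    fix l u :: "real ^ 'n" assume le: "\<And>b. b \<in> Basis \<Longrightarrow> l \<bullet> b \<le> u \<bullet> b"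
    have le': "l $ i \<le> u $ i" for i using le[of "axis i 1"] by (auto simp: inner_axis Basis_vec_def)
    have pr: "(\<Prod>b\<in>Basis. z \<bullet> b) = (\<Prod>i\<in>UNIV. z $ i)" for z :: "real ^ 'k::finite"
    proof -
      have "(\<Prod>b\<in>Basis. z \<bullet> b) = (\<Prod>b\<in>range (\<lambda>i::'k. axis i (1::real)). z \<bullet> b)"
        by (intro prod.cong) (auto simp: Basis_vec_def)
      also have "\<dots> = (\<Prod>i\<in>UNIV. z $ i)"
        by (subst prod.reindex) (auto simp: inj_on_def axis_eq_axis inner_axis)
      finally show ?thesis by simp
    qed
    have "Q -` box l u = box (R l) (R u)"
      by (auto simp: mem_box_cart Q_def R_def) (metis of_wo_inverse to_wo_inverse UNIV_I)+
    then have "emeasure (distr lborel borel Q) (box l u) = emeasure lborel (box (R l) (R u))" by (simp add: emeasure_distr)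
    also have "\<dots> = (\<Prod>b\<in>Basis. (R u - R l) \<bullet> b)"
      by (rule emeasure_lborel_box) (use le' in \<open>auto simp: Basis_vec_def inner_axis R_def\<close>)
    also have "(\<Prod>b\<in>Basis. (R u - R l) \<bullet> b) = (\<Prod>i\<in>UNIV. (R u - R l) $ i)" by (rule pr)
    also have "\<dots> = (\<Prod>i\<in>UNIV. (\<lambda>i. (u - l) $ i) (of_wo i))" by (simp add: R_def)
    also have "\<dots> = (\<Prod>i\<in>UNIV. (u - l) $ i)" by (rule prod.reindex_bij_betw[OF bij_of_wo])
    also have "\<dots> = (\<Prod>b\<in>Basis. (u - l) \<bullet> b)" by (rule pr[symmetric])
    finally show "emeasure (distr lborel borel Q) (box l u) = ennreal (\<Prod>b\<in>Basis. (u - l) \<bullet> b)" .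
  qed simp
  have Remeas: "emeasure lborel (R ` B) = emeasure lborel B" if "B \<in> sets borel" for B
    using that by (subst lb) (simp add: imR emeasure_distr)
  have R_int: "(\<integral>\<^sup>+x\<in>R ` B. g (Q x) \<partial>lborel) = (\<integral>\<^sup>+x\<in>B. g x \<partial>lborel)" if [measurable]: "B \<in> sets borel" "g \<in> borel_measurable borel" for B g
  proof -
    have "(\<integral>\<^sup>+x\<in>B. g x \<partial>lborel) = (\<integral>\<^sup>+x. g (Q x) * indicator B (Q x) \<partial>lborel)"
      by (subst lb, subst nn_integral_distr) auto
    then show ?thesis by (simp add: imR indicator_def)
  qed
  let ?h = "\<lambda>w. R (L (f (Q w)))"
  let ?h' = "\<lambda>w v. R (L (f' (Q w) (Q v)))"
  have step: "emeasure lborel (f ` B) \<le> (\<integral>\<^sup>+x\<in>B. ennreal (\<rho> x) \<partial>lborel)"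
    if B [measurable]: "B \<in> sets borel" and BS: "B \<subseteq> S" and bd: "bounded B" and bound: "\<And>x. x \<in> B \<Longrightarrow> \<rho> x \<le> b" for B b
  proof -
    have imh: "?h ` (R ` B) = R ` (L ` (f ` B))" by (auto simp: QR image_iff)
    have fBB: "f ` B \<in> sets borel" by (rule fB[OF B BS])
    have "emeasure lborel (?h ` (R ` B)) \<le> (\<integral>\<^sup>+x\<in>R ` B. ennreal (\<rho> (Q x)) \<partial>lborel)"
    proof (rule emeasure_image_le_wellordered[where f' = ?h'])
      show "R ` B \<in> sets borel" unfolding imR using measurable_sets_borel[OF Qm B] by simp
      show "bounded (R ` B)" by (rule bounded_linear_image[OF bd blR])
      show "?h ` (R ` B) \<in> sets borel" unfolding imh unfolding imR using measurable_sets_borel[OF Qm L(3)[OF fBB]] by simp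
      show "(\<lambda>x. \<rho> (Q x)) \<in> borel_measurable borel" by measurable
      fix w assume "w \<in> R ` B"
      then have Qw: "Q w \<in> B" by (auto simp: QR)
      show "\<rho> (Q w) \<le> b" by (rule bound[OF Qw])
      have "(f has_derivative f' (Q w)) (at (Q w) within Q ` (R ` B))"
        using der[of "Q w"] Qw BS by (auto simp: image_image QR intro: has_derivative_subset)
      from diff_chain_within[OF bounded_linear_imp_has_derivative[OF blQ] this]
      have 1: "((\<lambda>w. f (Q w)) has_derivative (\<lambda>v. f' (Q w) (Q v))) (at w within R ` B)" by (simp add: o_def)
      show "(?h has_derivative ?h' w) (at w within R ` B)"
        by (rule bounded_linear.has_derivative[OF blR bounded_linear.has_derivative[OF blL 1]])
      have "matrix (?h' w) = (\<chi> i j. matrix (\<lambda>v. L (f' (Q w) v)) $ of_wo i $ of_wo j)"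
      proof -
        have Qa: "Q (axis j 1) = axis (of_wo j) 1" for j
          by (auto simp: Q_def axis_def vec_eq_iff) (metis to_wo_inverse of_wo_inverse UNIV_I)+
        show ?thesis unfolding matrix_def R_def Qa by simp
      qed
      then have "det (matrix (?h' w)) = det (matrix (\<lambda>v. L (f' (Q w) v)))"
        by (simp only: det_reindex[OF bij_of_wo])
      then show "\<bar>det (matrix (?h' w))\<bar> \<le> \<rho> (Q w)" using le[of "Q w"] Qw BS by auto
    qed
    also have "\<dots> = (\<integral>\<^sup>+x\<in>B. ennreal (\<rho> x) \<partial>lborel)" by (rule R_int) measurable
    also have "emeasure lborel (?h ` (R ` B)) = emeasure lborel (f ` B)"
      unfolding imh Remeas[OF L(3)[OF fBB]] by (rule L(2)[OF fBB])
    finally show ?thesis .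
  qed
  define T where "T k = {x \<in> S. \<rho> x \<le> real k} \<inter> cball 0 (real k)" for k :: nat
  have T [measurable]: "T k \<in> sets borel" for k
  proof -
    have "{x \<in> space borel. \<rho> x \<le> real k} \<in> sets borel" by measurable
    then have "S \<inter> {x \<in> space borel. \<rho> x \<le> real k} \<inter> cball 0 (real k) \<in> sets borel"
      by (intro sets.Int[OF sets.Int[OF S] borel_closed[OF closed_cball]])
    also have "S \<inter> {x \<in> space borel. \<rho> x \<le> real k} \<inter> cball 0 (real k) = T k" by (auto simp: T_def)
    finally show ?thesis .
  qed
  have Tinc: "incseq (\<lambda>k. f ` T k)"
    unfolding incseq_def T_def by (auto intro!: image_mono)
  have TU: "(\<Union>k. f ` T k) = f ` S"
  proof -
    have "\<exists>k. x \<in> T k" if "x \<in> S" for x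
    proof -
      obtain k where "max (\<rho> x) (norm x) \<le> real k" using real_arch_simple by blast
      then show ?thesis using that by (auto simp: T_def)
    qed
    then show ?thesis unfolding T_def by blast
  qed
  have "emeasure lborel (f ` S) = (SUP k. emeasure lborel (f ` T k))"
    unfolding TU[symmetric] using fB[OF T] Tinc
    by (intro SUP_emeasure_incseq[symmetric]) (auto simp: T_def)
  also have "\<dots> \<le> (\<integral>\<^sup>+x\<in>S. ennreal (\<rho> x) \<partial>lborel)"
  proof (rule SUP_least)
    fix k
    have "emeasure lborel (f ` T k) \<le> (\<integral>\<^sup>+x\<in>T k. ennreal (\<rho> x) \<partial>lborel)"
      by (rule step[OF T, of k "real k"]) (auto simp: T_def intro: bounded_subset[OF bounded_cball])
    also have "\<dots> \<le> (\<integral>\<^sup>+x\<in>S. ennreal (\<rho> x) \<partial>lborel)"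
      by (intro nn_integral_mono) (auto simp: T_def indicator_def)
    finally show "emeasure lborel (f ` T k) \<le> (\<integral>\<^sup>+x\<in>S. ennreal (\<rho> x) \<partial>lborel)" .
  qed
  finally show ?thesis .
qed

section \<open>A one-dimensional Hardy inequality\<close>

text \<open>
  The Hardy inequality on the half-line near 0. Integrating the derivative of \<open>- f s / s ^ m\<close> gives
  \<open>m \<integral> f / s ^ (m + 1) \<le> f u / u ^ m + \<integral> |f'| / s ^ m\<close> over \<open>[u, \<tau>]\<close>, and part of the last term
  is absorbed because \<open>\<alpha> < m\<close>. The boundary term is arbitrarily small for suitable \<open>u\<close>, since
  otherwise the integral assumed to be finite would diverge like \<open>\<integral> ds / s\<close>.
\<close>

lemma hardy_interval:
  fixes f f' :: "real \<Rightarrow> real" and m :: nat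
  assumes f0: "\<And>s. s \<in> {0<..<e} \<Longrightarrow> 0 \<le> f s"
    and der: "\<And>s. s \<in> {0<..<e} \<Longrightarrow> (f has_real_derivative f' s) (at s)"
    and f'c: "continuous_on {0<..<e} f'"
    and al: "\<alpha> < real m"
    and fin: "(\<integral>\<^sup>+s\<in>{0<..<e}. ennreal (f s / s ^ Suc m) \<partial>lborel) < top"
    and st: "0 < \<sigma>" "\<tau> < e"
  shows "ennreal (real m - \<alpha>) * (\<integral>\<^sup>+s\<in>{\<sigma>..\<tau>}. ennreal (f s / s ^ Suc m) \<partial>lborel)
     \<le> (\<integral>\<^sup>+s\<in>{0<..<e}. ennreal ((s * \<bar>f' s\<bar> - \<alpha> * f s) / s ^ Suc m) \<partial>lborel)" (is "_ \<le> ?R")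
proof (cases "\<sigma> \<le> \<tau>")
  case False then show ?thesis by simp
next
  case True
  define h where "h s = max 0 (s * \<bar>f' s\<bar> - \<alpha> * f s)" for s
  have sub: "{u..\<tau>} \<subseteq> {0<..<e}" if "0 < u" for u using that st by auto
  have fc: "continuous_on {0<..<e} f"
    by (rule DERIV_continuous_on) (rule has_field_derivative_at_within[OF der])
  have key: "ennreal (real m - \<alpha>) * (\<integral>\<^sup>+s\<in>{u..\<tau>}. ennreal (f s / s ^ Suc m) \<partial>lborel) \<le> ennreal (f u / u ^ m) + ?R"
    if u: "0 < u" "u \<le> \<tau>" for u
  proof -
    note sb = sub[OF u(1)]
    have c1: "continuous_on {u..\<tau>} (\<lambda>s. f s / s ^ Suc m)" and c2: "continuous_on {u..\<tau>} (\<lambda>s. h s / s ^ Suc m)"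
      unfolding h_def using sb u
      by (auto intro!: continuous_intros continuous_on_subset[OF fc] continuous_on_subset[OF f'c])
    have i1: "(\<lambda>s. f s / s ^ Suc m) integrable_on {u..\<tau>}" and i2: "(\<lambda>s. h s / s ^ Suc m) integrable_on {u..\<tau>}"
      using c1 c2 by (auto intro: integrable_continuous_real)
    define p where "p s = real m * (f s / s ^ Suc m) - f' s / s ^ m" for s
    have ip: "(p has_integral (- (f \<tau> / \<tau> ^ m) - - (f u / u ^ m))) {u..\<tau>}"
    proof (rule fundamental_theorem_of_calculus[OF u(2)])
      fix s assume s: "s \<in> {u..\<tau>}"
      then have s0: "s > 0" using u by auto
      have "((\<lambda>s. - (f s / s ^ m)) has_real_derivative p s) (at s)"
      proof -
        have "((\<lambda>s. - (f s / s ^ m)) has_real_derivative - ((f' s * s ^ m - f s * (real m * s ^ (m - 1))) / (s ^ m * s ^ m))) (at s)"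
          using s0 sb s by (auto intro!: derivative_eq_intros der)
        also have "- ((f' s * s ^ m - f s * (real m * s ^ (m - 1))) / (s ^ m * s ^ m)) = p s"
          using s0 by (cases m) (simp_all add: p_def field_simps)
        finally show ?thesis .
      qed
      then show "((\<lambda>s. - (f s / s ^ m)) has_vector_derivative p s) (at s within {u..\<tau>})"
        by (auto simp: has_real_derivative_iff_has_vector_derivative[symmetric] intro: has_field_derivative_at_within)
    qed
    have "(real m - \<alpha>) * integral {u..\<tau>} (\<lambda>s. f s / s ^ Suc m) - integral {u..\<tau>} (\<lambda>s. h s / s ^ Suc m)
        = integral {u..\<tau>} (\<lambda>s. (real m - \<alpha>) * (f s / s ^ Suc m) - h s / s ^ Suc m)"
      using integral_diff[OF integrable_on_cmult_left[OF i1, of "real m - \<alpha>"] i2] by (simp only: integral_mult_right of_real_eq_id id_apply)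
    also have "\<dots> \<le> integral {u..\<tau>} p"
    proof (rule integral_le)
      show "(\<lambda>s. (real m - \<alpha>) * (f s / s ^ Suc m) - h s / s ^ Suc m) integrable_on {u..\<tau>}"
        using integrable_diff[OF integrable_cmul[OF i1, of "real m - \<alpha>"] i2] by (simp only: real_scaleR_def)
      show "p integrable_on {u..\<tau>}" using ip by blast
      fix s assume s: "s \<in> {u..\<tau>}"
      then have s0: "s > 0" using u by auto
      have "s * f' s \<le> \<alpha> * f s + h s"
        using mult_left_mono[OF abs_ge_self[of "f' s"], of s] s0 unfolding h_def by linarith
      then have "s * f' s / s ^ Suc m \<le> (\<alpha> * f s + h s) / s ^ Suc m" using s0 by (intro divide_right_mono) auto
      then show "(real m - \<alpha>) * (f s / s ^ Suc m) - h s / s ^ Suc m \<le> p s"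
        using s0 by (simp add: p_def add_divide_distrib left_diff_distrib diff_divide_distrib)
    qed
    also have "\<dots> = f u / u ^ m - f \<tau> / \<tau> ^ m" using ip by (simp add: integral_unique)
    also have "\<dots> \<le> f u / u ^ m" using f0[of \<tau>] sb u st by simp
    finally have main: "(real m - \<alpha>) * integral {u..\<tau>} (\<lambda>s. f s / s ^ Suc m) \<le> f u / u ^ m + integral {u..\<tau>} (\<lambda>s. h s / s ^ Suc m)" by simp
    have n1: "(\<integral>\<^sup>+s\<in>{u..\<tau>}. ennreal (f s / s ^ Suc m) \<partial>lborel) = ennreal (integral {u..\<tau>} (\<lambda>s. f s / s ^ Suc m))"
      by (rule nn_integral_has_integral_lebesgue'[OF _ integrable_integral[OF i1]]) (use f0 sb u in auto)
    have n2: "(\<integral>\<^sup>+s\<in>{u..\<tau>}. ennreal (h s / s ^ Suc m) \<partial>lborel) = ennreal (integral {u..\<tau>} (\<lambda>s. h s / s ^ Suc m))"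
      by (rule nn_integral_has_integral_lebesgue'[OF _ integrable_integral[OF i2]]) (use u in \<open>auto simp: h_def\<close>)
    have "ennreal (real m - \<alpha>) * (\<integral>\<^sup>+s\<in>{u..\<tau>}. ennreal (f s / s ^ Suc m) \<partial>lborel)
       = ennreal ((real m - \<alpha>) * integral {u..\<tau>} (\<lambda>s. f s / s ^ Suc m))"
      unfolding n1 using al by (simp add: ennreal_mult')
    also have "\<dots> \<le> ennreal (f u / u ^ m + integral {u..\<tau>} (\<lambda>s. h s / s ^ Suc m))" by (rule ennreal_leI[OF main])
    also have "\<dots> = ennreal (f u / u ^ m) + (\<integral>\<^sup>+s\<in>{u..\<tau>}. ennreal (h s / s ^ Suc m) \<partial>lborel)"
      unfolding n2 using f0[of u] sb u
      by (intro ennreal_plus integral_nonneg i2) (auto simp: h_def)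
    also have "(\<integral>\<^sup>+s\<in>{u..\<tau>}. ennreal (h s / s ^ Suc m) \<partial>lborel) \<le> ?R"
    proof (intro nn_integral_mono)
      fix s
      show "ennreal (h s / s ^ Suc m) * indicator {u..\<tau>} s \<le> ennreal ((s * \<bar>f' s\<bar> - \<alpha> * f s) / s ^ Suc m) * indicator {0<..<e} s"
        using sb u by (auto simp: indicator_def h_def max_def ennreal_neg)
    qed
    finally show ?thesis by (simp add: add_left_mono)
  qed
  show ?thesis
  proof (rule ennreal_le_epsilon)
    fix d :: real assume d: "0 < d"
    have "\<exists>u. 0 < u \<and> u < \<sigma> \<and> f u / u ^ m < d"
    proof (rule ccontr)
      assume "\<not> ?thesis"
      then have ge: "d \<le> f u / u ^ m" if "0 < u" "u < \<sigma>" for u using that by (meson not_le)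
      obtain C where C: "(\<integral>\<^sup>+s\<in>{0<..<e}. ennreal (f s / s ^ Suc m) \<partial>lborel) = ennreal C" "0 \<le> C"
        using fin by (cases "\<integral>\<^sup>+s\<in>{0<..<e}. ennreal (f s / s ^ Suc m) \<partial>lborel") auto
      \<comment> \<open>between \<open>a\<close> and \<open>b\<close> the integral of \<open>d / s\<close> is \<open>C + 1\<close>, more than the whole integral allows\<close>
      define b where "b = \<sigma> / 2"
      define a where "a = b * exp (- (C + 1) / d)"
      have b: "0 < b" "b < \<sigma>" using st by (auto simp: b_def)
      have "exp (- (C + 1) / d) \<le> 1" using C d by (simp add: divide_nonpos_pos)
      then have a: "0 < a" "a \<le> b" using b mult_left_mono[of "exp (- (C + 1) / d)" 1 b] by (simp_all add: a_def)
      have "ennreal (d * ln b - d * ln a) = (\<integral>\<^sup>+s. ennreal (d / s) * indicator {a..b} s \<partial>lborel)"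
        by (rule nn_integral_FTC_Icc[symmetric]) (use a d in \<open>auto intro!: derivative_eq_intros\<close>)
      also have "\<dots> \<le> (\<integral>\<^sup>+s\<in>{0<..<e}. ennreal (f s / s ^ Suc m) \<partial>lborel)"
      proof (intro nn_integral_mono)
        fix s
        show "ennreal (d / s) * indicator {a..b} s \<le> ennreal (f s / s ^ Suc m) * indicator {0<..<e} s"
        proof (cases "s \<in> {a..b}")
          case True
          then have s: "0 < s" "s < \<sigma>" using a b by auto
          have "d / s \<le> (f s / s ^ m) / s" using ge[OF s] s by (intro divide_right_mono) auto
          also have "\<dots> = f s / s ^ Suc m" by (simp add: mult.commute)
          finally show ?thesis using True s st \<open>\<sigma> \<le> \<tau>\<close> by (auto simp: ennreal_leI)
        qed simp
      qed
      also have "\<dots> = ennreal C" by (rule C)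
      finally have "d * ln b - d * ln a \<le> C" using C by (simp add: ennreal_le_iff)
      moreover have "ln a = ln b - (C + 1) / d" unfolding a_def using b by (simp add: ln_mult minus_divide_left)
      ultimately show False using d by (simp add: right_diff_distrib)
    qed
    then obtain u where u: "0 < u" "u < \<sigma>" "f u / u ^ m < d" by blast
    have "ennreal (real m - \<alpha>) * (\<integral>\<^sup>+s\<in>{\<sigma>..\<tau>}. ennreal (f s / s ^ Suc m) \<partial>lborel)
       \<le> ennreal (real m - \<alpha>) * (\<integral>\<^sup>+s\<in>{u..\<tau>}. ennreal (f s / s ^ Suc m) \<partial>lborel)"
      using u by (intro mult_left_mono nn_integral_mono) (auto simp: indicator_def)
    also have "\<dots> \<le> ennreal (f u / u ^ m) + ?R" by (rule key) (use u True in auto)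
    also have "\<dots> \<le> ennreal d + ?R" using u by (intro add_right_mono ennreal_leI) auto
    finally show "ennreal (real m - \<alpha>) * (\<integral>\<^sup>+s\<in>{\<sigma>..\<tau>}. ennreal (f s / s ^ Suc m) \<partial>lborel) \<le> ?R + ennreal d"
      by (simp add: add.commute)
  qed
qed

section \<open>Calculus in charts\<close>

lemma model_open_Int: assumes "model_open V" "open X" shows "model_open (V \<inter> X)"
  using assms unfolding model_open_def by (meson open_Int openin_Int_open)

lemma model_open_derivative_unique:
  fixes f :: "real ^ 'n::finite \<Rightarrow> 'b::real_normed_vector"
  assumes V: "model_open V" and q: "q \<in> V"
    and d: "(f has_derivative f1) (at q within V)" "(f has_derivative f2) (at q within V)"
  shows "f1 = f2"
proof (rule frechet_derivative_unique_within[OF d])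
  fix b :: "real ^ 'n" and e :: real assume b: "b \<in> Basis" and e: "e > 0"
  have nb: "norm b = 1" using b by simp
  show "\<exists>d. 0 < \<bar>d\<bar> \<and> \<bar>d\<bar> < e \<and> q + d *\<^sub>R b \<in> V"
    using V unfolding model_open_def
  proof (elim disjE exE)
    assume "open V"
    then obtain r where r: "r > 0" "ball q r \<subseteq> V" using q openE by blast
    have "q + (min e r / 2) *\<^sub>R b \<in> ball q r" using nb r e by (simp add: dist_norm)
    then show ?thesis using r e by (intro exI[of _ "min e r / 2"]) auto
  next
    fix k assume "openin (top_of_set {y. 0 \<le> y $ k}) V"
    then obtain X where X: "open X" "V = {y. 0 \<le> y $ k} \<inter> X" unfolding openin_open by blast
    then obtain r where r: "r > 0" "ball q r \<subseteq> X" using q openE by blast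
    have "q + (min e r / 2) *\<^sub>R b \<in> ball q r" using nb r e by (simp add: dist_norm)
    moreover have "0 \<le> b $ k" using b by (auto simp: Basis_vec_def axis_def)
    then have "0 \<le> (q + (min e r / 2) *\<^sub>R b) $ k" using q X r e by auto
    ultimately show ?thesis using r e X by (intro exI[of _ "min e r / 2"]) auto
  qed
qed

locale manifold =
  fixes A :: "('m::{t2_space, second_countable_topology}, 'n::finite) chart set"
  assumes smooth_mfd: "smooth_manifold A"
begin

lemma chart_open: "c \<in> A \<Longrightarrow> open (fst c)"
  and chart_model: "c \<in> A \<Longrightarrow> model_open (snd c ` fst c)"
  and chart_homeo: "c \<in> A \<Longrightarrow> homeomorphism (fst c) (snd c ` fst c) (snd c) (cinv c)"
  and charts_cover: "\<exists>c\<in>A. p \<in> fst c"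
  using smooth_mfd unfolding smooth_manifold_def by blast+

lemma cinv_chart [simp]: "c \<in> A \<Longrightarrow> p \<in> fst c \<Longrightarrow> cinv c (snd c p) = p"
  using chart_homeo homeomorphism_apply1 by blast

lemma chart_cinv [simp]: "c \<in> A \<Longrightarrow> q \<in> snd c ` fst c \<Longrightarrow> snd c (cinv c q) = q"
  using chart_homeo homeomorphism_apply2 by blast

lemma cinv_in: "c \<in> A \<Longrightarrow> q \<in> snd c ` fst c \<Longrightarrow> cinv c q \<in> fst c"
  by auto

lemma chart_cont: "c \<in> A \<Longrightarrow> continuous_on (fst c) (snd c)"
  and cinv_cont: "c \<in> A \<Longrightarrow> continuous_on (snd c ` fst c) (cinv c)"
  using chart_homeo unfolding homeomorphism_def by blast+

lemma chart_image_open: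
  assumes c: "c \<in> A" and X: "open X"
  obtains Z where "open Z" "snd c ` (fst c \<inter> X) = snd c ` fst c \<inter> Z"
proof -
  have "openin (top_of_set (fst c)) (fst c \<inter> X)" using X by (simp add: openin_open_Int)
  then have "openin (top_of_set (snd c ` fst c)) (snd c ` (fst c \<inter> X))"
    using homeomorphism_imp_open_map[OF chart_homeo[OF c]] by blast
  then show thesis using that unfolding openin_open by blast
qed

lemma chart_image_model: "c \<in> A \<Longrightarrow> open X \<Longrightarrow> model_open (snd c ` (fst c \<inter> X))"
  using chart_image_open chart_model model_open_Int by metis

lemma at_within_chart_image:
  assumes c: "c \<in> A" and X: "open X" and p: "p \<in> fst c \<inter> X"
  shows "at (snd c p) within snd c ` (fst c \<inter> X) = at (snd c p) within snd c ` fst c"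
proof -
  obtain Z where Z: "open Z" "snd c ` (fst c \<inter> X) = snd c ` fst c \<inter> Z" using chart_image_open[OF c X] .
  show ?thesis by (rule at_within_nhd[of _ Z]) (use Z p in auto)
qed

lemma chart_derivative_unique:
  assumes c: "c \<in> A" and p: "p \<in> fst c"
    and d: "(f has_derivative f1) (at (snd c p) within snd c ` fst c)" "(f has_derivative f2) (at (snd c p) within snd c ` fst c)"
  shows "f1 = f2"
  using model_open_derivative_unique[OF chart_model[OF c] _ d] p by auto

text \<open>
  Differentiability in a chart, stated with the derivative \<open>cderiv\<close> that a mere choice operator
  delivers for functions without a derivative.
\<close>

definition cdiff :: "('m, 'n) chart \<Rightarrow> ('m \<Rightarrow> 'b::real_normed_vector) \<Rightarrow> 'm \<Rightarrow> bool" where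
  "cdiff c F p \<longleftrightarrow> (F \<circ> cinv c has_derivative cderiv c F p) (at (snd c p) within snd c ` fst c)"

lemma cdiffI:
  assumes c: "c \<in> A" and p: "p \<in> fst c" and X: "open X" "p \<in> X"
    and d: "((\<lambda>q. F (cinv c q)) has_derivative D) (at (snd c p) within snd c ` (fst c \<inter> X))"
  shows "cdiff c F p" "cderiv c F p = D"
proof -
  have d': "(F \<circ> cinv c has_derivative D) (at (snd c p) within snd c ` fst c)"
    using d at_within_chart_image[OF c X(1)] p X by (simp add: o_def)
  then have "(F \<circ> cinv c has_derivative cderiv c F p) (at (snd c p) within snd c ` fst c)"
    unfolding cderiv_def using frechet_derivative_works differentiable_def by blast
  then show "cdiff c F p" "cderiv c F p = D" using chart_derivative_unique[OF c p] d' by (auto simp: cdiff_def)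
qed

lemma cdiffD: "cdiff c F p \<Longrightarrow> ((\<lambda>q. F (cinv c q)) has_derivative cderiv c F p) (at (snd c p) within snd c ` fst c)"
  by (simp add: cdiff_def o_def)

lemma cderiv_eqI:
  assumes "c \<in> A" "p \<in> fst c" "((\<lambda>q. F (cinv c q)) has_derivative D) (at (snd c p) within snd c ` fst c)"
  shows "cdiff c F p" "cderiv c F p = D"
  using cdiffI[of c p UNIV F D] assms by auto

lemma cderiv_linear: "cdiff c F p \<Longrightarrow> linear (cderiv c F p)"
  unfolding cdiff_def by (rule has_derivative_linear)

lemma Ck1_cdiff:
  assumes c: "c \<in> A" and X: "open X" and C: "Ck_on 1 (\<lambda>q. F (cinv c q)) (snd c ` (fst c \<inter> X))"
  shows "\<And>p. p \<in> fst c \<inter> X \<Longrightarrow> cdiff c F p" "continuous_on (snd c ` (fst c \<inter> X)) (\<lambda>q. cderiv c F (cinv c q) v)"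
    and "continuous_on (fst c \<inter> X) F"
proof -
  let ?S = "snd c ` (fst c \<inter> X)"
  obtain f' where f': "\<And>q. q \<in> ?S \<Longrightarrow> ((\<lambda>q. F (cinv c q)) has_derivative f' q) (at q within ?S)"
    and f'c: "\<And>v. continuous_on ?S (\<lambda>q. f' q v)"
    using C by (auto simp: numeral_eq_Suc)
  show 1: "cdiff c F p" if "p \<in> fst c \<inter> X" for p
    using cdiffI[OF c _ X _ f'] that by auto
  have "cderiv c F p = f' (snd c p)" if "p \<in> fst c \<inter> X" for p
    using cdiffI[OF c _ X _ f'] that by auto
  then have "cderiv c F (cinv c q) v = f' q v" if "q \<in> ?S" for q
    using that c by auto
  then show "continuous_on ?S (\<lambda>q. cderiv c F (cinv c q) v)"
    using f'c[of v] by (simp cong: continuous_on_cong)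
  have "continuous_on ?S (\<lambda>q. F (cinv c q))"
    using f' by (meson has_derivative_continuous continuous_on_eq_continuous_within)
  then have "continuous_on (fst c \<inter> X) (\<lambda>p. F (cinv c (snd c p)))"
    by (rule continuous_on_compose2) (auto intro: continuous_on_subset[OF chart_cont[OF c]])
  then show "continuous_on (fst c \<inter> X) F" by (rule continuous_on_eq) (use c in auto)
qed

lemma smooth_Ck1: "smooth_on f S \<Longrightarrow> Ck_on 1 f S" unfolding smooth_on_def by blast

end

section \<open>Bundles with connection\<close>

lemma bilinear_form_expand:
  fixes B :: "real ^ 'r::finite \<Rightarrow> real ^ 'r \<Rightarrow> real"
  assumes "bilinear B"
  shows "B f f' = (\<Sum>a\<in>UNIV. \<Sum>b\<in>UNIV. f $ a * f' $ b * B (axis a 1) (axis b 1))"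
proof -
  have "B f f' = B (\<Sum>a\<in>UNIV. f $ a *\<^sub>R axis a 1) (\<Sum>b\<in>UNIV. f' $ b *\<^sub>R axis b 1)"
    using basis_expansion[of f] basis_expansion[of f'] by (simp add: scalar_mult_eq_scaleR)
  then show ?thesis
    by (simp add: bilinear_sum[OF assms] bilinear_lmul[OF assms] bilinear_rmul[OF assms] sum.cartesian_product mult.assoc mult.left_commute)
qed

lemma linear_form_expand:
  fixes l :: "real ^ 'r::finite \<Rightarrow> real"
  assumes "linear l"
  shows "l f = (\<Sum>a\<in>UNIV. f $ a * l (axis a 1))"
proof -
  have "l f = l (\<Sum>a\<in>UNIV. f $ a *\<^sub>R axis a 1)"
    using basis_expansion[of f] by (simp add: scalar_mult_eq_scaleR)
  then show ?thesis by (simp add: linear_sum[OF assms] linear_cmul[OF assms])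
qed

text \<open>
  By compactness of the unit sphere.
\<close>

lemma pos_bilinear_lower:
  fixes B :: "real ^ 'r::finite \<Rightarrow> real ^ 'r \<Rightarrow> real"
  assumes B: "bilinear B" and pos: "\<And>f. f \<noteq> 0 \<Longrightarrow> 0 < B f f"
  obtains \<beta> where "\<beta> > 0" "\<And>f. \<beta> * (norm f)\<^sup>2 \<le> B f f"
proof -
  have c: "continuous_on (sphere 0 1) (\<lambda>f. B f f)"
  proof -
    have eq: "(\<lambda>f. B f f) = (\<lambda>f. \<Sum>a\<in>UNIV. \<Sum>b\<in>UNIV. f $ a * f $ b * B (axis a 1) (axis b 1))"
      by (rule ext) (rule bilinear_form_expand[OF B])
    show ?thesis by (subst eq) (intro continuous_intros)
  qed
  obtain a :: 'r where True by simp
  have "axis a (1::real) \<in> sphere 0 1" by simp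
  then obtain f0 where f0: "f0 \<in> sphere 0 1" "\<And>f. f \<in> sphere 0 1 \<Longrightarrow> B f0 f0 \<le> B f f"
    using continuous_attains_inf[OF compact_sphere _ c] by blast
  show thesis
  proof (rule that)
    show "0 < B f0 f0" using f0 by (intro pos) auto
    show "B f0 f0 * (norm f)\<^sup>2 \<le> B f f" for f
    proof (cases "f = 0")
      case True then show ?thesis using bilinear_lzero[OF B] by simp
    next
      case False
      have "B f0 f0 \<le> B ((1 / norm f) *\<^sub>R f) ((1 / norm f) *\<^sub>R f)" by (rule f0) (use False in simp)
      also have "\<dots> = B f f / (norm f)\<^sup>2" by (simp add: bilinear_lmul[OF B] bilinear_rmul[OF B] power2_eq_square)
      finally show ?thesis using False by (simp add: field_simps)
    qed
  qed
qed

lemma riesz_form: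
  fixes B S :: "real ^ 'r::finite \<Rightarrow> real ^ 'r \<Rightarrow> real"
  assumes B: "bilinear B" and pos: "\<And>f. f \<noteq> 0 \<Longrightarrow> 0 < B f f" and S: "bilinear S"
  obtains M where "linear M" "\<And>f e. B f (M e) = S f e"
proof -
  define J where "J s = (\<chi> a. B (axis a 1) s)" for s :: "real ^ 'r"
  define K where "K e = (\<chi> a. S (axis a 1) e)" for e :: "real ^ 'r"
  have lJ: "linear J" and lK: "linear K"
    by (auto intro!: linearI simp: J_def K_def vec_eq_iff bilinear_radd[OF B] bilinear_rmul[OF B] bilinear_radd[OF S] bilinear_rmul[OF S])
  have BJ: "B f s = f \<bullet> J s" for f s
  proof -
    have "linear (\<lambda>f. B f s)" using B by (simp add: bilinear_def)
    from linear_form_expand[OF this, of f] show ?thesis by (simp add: J_def inner_vec_def)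
  qed
  have SK: "S f e = f \<bullet> K e" for f e
  proof -
    have "linear (\<lambda>f. S f e)" using S by (simp add: bilinear_def)
    from linear_form_expand[OF this, of f] show ?thesis by (simp add: K_def inner_vec_def)
  qed
  have "inj J"
    unfolding linear_injective_0[OF lJ]
  proof (intro allI impI)
    fix s assume "J s = 0"
    then have "B s s = 0" by (simp add: BJ)
    then show "s = 0" using pos[of s] by force
  qed
  then have "surj J" using linear_injective_imp_surjective[OF lJ] by simp
  then obtain J' where J': "linear J'" "J \<circ> J' = id" using linear_surjective_right_inverse[OF lJ] by auto
  have JJ': "J (J' x) = x" for x using J'(2) by (metis comp_apply id_apply)
  show thesis
    by (rule that[of "\<lambda>e. J' (K e)"]) (use linear_compose[OF lK J'(1)] in \<open>simp_all add: o_def BJ JJ' SK\<close>)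
qed

text \<open>
  A Riemannian manifold with a bundle, an inner product and a connection, as in the theorem. The
  connection is compatible with the inner product only up to its symmetric part.
\<close>

locale hermitian_bundle = manifold A
  for A :: "('m::{t2_space, second_countable_topology}, 'n::finite) chart set" +
  fixes T :: "('m, 'e, 'r::finite) triv set" and \<pi> :: "'e \<Rightarrow> 'm" and ip :: "'e \<Rightarrow> 'e \<Rightarrow> real"
    and \<Gamma> :: "('m, 'e, 'r) triv \<Rightarrow> ('m, 'n) chart \<Rightarrow> 'm \<Rightarrow> 'n \<Rightarrow> real ^ 'r ^ 'r"
    and g :: "('m, 'n) chart \<Rightarrow> 'm \<Rightarrow> real ^ 'n ^ 'n"
  assumes vbundle: "vector_bundle A \<pi> T" and inner: "bundle_inner_product A \<pi> T ip"
    and conn: "connection A \<pi> T \<Gamma>" and metric: "riemannian_metric A g"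
begin

lemma trivs_cover: "\<exists>t\<in>T. p \<in> fst t"
  and triv_open: "t \<in> T \<Longrightarrow> open (fst t)"
  and triv_bij: "t \<in> T \<Longrightarrow> p \<in> fst t \<Longrightarrow> bij_betw (snd t) (fibre \<pi> p) UNIV"
proof -
  note v = vbundle[unfolded vector_bundle_def]
  show "\<exists>t\<in>T. p \<in> fst t" using v[THEN conjunct1] by blast
  show "open (fst t)" if "t \<in> T" using v[THEN conjunct2, THEN conjunct1] that by blast
  show "bij_betw (snd t) (fibre \<pi> p) UNIV" if "t \<in> T" "p \<in> fst t"
    using v[THEN conjunct2, THEN conjunct1] that by blast
qed

lemma triv_at: "triv_at T p \<in> T" "p \<in> fst (triv_at T p)"
  using someI_ex[of "\<lambda>t. t \<in> T \<and> p \<in> fst t"] trivs_cover[of p] unfolding triv_at_def by blast+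

lemma chart_at: "chart_at A p \<in> A" "p \<in> fst (chart_at A p)"
  using someI_ex[of "\<lambda>c. c \<in> A \<and> p \<in> fst c"] charts_cover[of p] unfolding chart_at_def by blast+

lemma snd_tinv [simp]: "t \<in> T \<Longrightarrow> p \<in> fst t \<Longrightarrow> snd t (tinv \<pi> t p f) = f"
  using bij_betw_inv_into_right[OF triv_bij] unfolding tinv_def by blast

lemma tinv_snd: "t \<in> T \<Longrightarrow> p \<in> fst t \<Longrightarrow> e \<in> fibre \<pi> p \<Longrightarrow> tinv \<pi> t p (snd t e) = e"
  using bij_betw_inv_into_left[OF triv_bij] unfolding tinv_def by blast

lemma tinv_fibre: "t \<in> T \<Longrightarrow> p \<in> fst t \<Longrightarrow> tinv \<pi> t p f \<in> fibre \<pi> p"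
  using bij_betwE[OF bij_betw_inv_into[OF triv_bij]] unfolding tinv_def by blast

definition form :: "('m, 'e, 'r) triv \<Rightarrow> 'm \<Rightarrow> real ^ 'r \<Rightarrow> real ^ 'r \<Rightarrow> real" where
  "form t p f f' = ip (tinv \<pi> t p f) (tinv \<pi> t p f')"

lemma form_bilinear: "t \<in> T \<Longrightarrow> p \<in> fst t \<Longrightarrow> bilinear (form t p)"
  and form_sym: "t \<in> T \<Longrightarrow> p \<in> fst t \<Longrightarrow> form t p f f' = form t p f' f"
  and form_pos: "t \<in> T \<Longrightarrow> p \<in> fst t \<Longrightarrow> f \<noteq> 0 \<Longrightarrow> 0 < form t p f f"
proof -
  note i = inner[unfolded bundle_inner_product_def, THEN conjunct1, rule_format]
  show "bilinear (form t p)" if "t \<in> T" "p \<in> fst t"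
    using i[OF that, THEN conjunct1] by (simp add: form_def[abs_def])
  show "form t p f f' = form t p f' f" if "t \<in> T" "p \<in> fst t"
    using i[OF that, THEN conjunct2, THEN conjunct1, rule_format] by (simp add: form_def)
  show "0 < form t p f f" if "t \<in> T" "p \<in> fst t" "f \<noteq> 0"
    using i[OF that(1,2), THEN conjunct2, THEN conjunct2, rule_format, OF that(3)] by (simp add: form_def)
qed

lemma form_nonneg: "t \<in> T \<Longrightarrow> p \<in> fst t \<Longrightarrow> 0 \<le> form t p f f"
  using form_pos[of t p f] bilinear_lzero[OF form_bilinear] by (cases "f = 0") (auto intro: less_imp_le)

lemma form_Ck: "t \<in> T \<Longrightarrow> c \<in> A \<Longrightarrow> Ck_on 1 (\<lambda>q. form t (cinv c q) f f') (snd c ` (fst c \<inter> fst t))"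
  using inner[unfolded bundle_inner_product_def, THEN conjunct2, rule_format] by (simp add: form_def)

lemma ip_form:
  assumes "t \<in> T" "p \<in> fst t" "e \<in> fibre \<pi> p" "e' \<in> fibre \<pi> p"
  shows "ip e e' = form t p (snd t e) (snd t e')"
  using assms by (simp add: form_def tinv_snd)

definition coef :: "('m, 'e, 'r) triv \<Rightarrow> 'r \<Rightarrow> 'r \<Rightarrow> 'm \<Rightarrow> real" where
  "coef t a b p = form t p (axis a 1) (axis b 1)"

definition dform :: "('m, 'e, 'r) triv \<Rightarrow> ('m, 'n) chart \<Rightarrow> 'm \<Rightarrow> real ^ 'n \<Rightarrow> real ^ 'r \<Rightarrow> real ^ 'r \<Rightarrow> real" where
  "dform t c p v f f' = (\<Sum>a\<in>UNIV. \<Sum>b\<in>UNIV. f $ a * f' $ b * cderiv c (coef t a b) p v)"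

definition conn_term :: "('m, 'e, 'r) triv \<Rightarrow> ('m, 'n) chart \<Rightarrow> 'm \<Rightarrow> real ^ 'n \<Rightarrow> real ^ 'r \<Rightarrow> real ^ 'r" where
  "conn_term t c p v f = (\<Sum>i\<in>UNIV. v $ i *\<^sub>R (\<Gamma> t c p i *v f))"

definition loc :: "('m, 'e, 'r) triv \<Rightarrow> ('m \<Rightarrow> 'e) \<Rightarrow> 'm \<Rightarrow> real ^ 'r" where
  "loc t u p = snd t (u p)"

text \<open>
  With \<open>\<nabla> = \<partial> - \<Gamma>\<close> the derivatives of the components of both sections cancel from the formula
  that defines the symmetric part of the connection; this bilinear form on the model fibre remains.
\<close>

definition sform :: "('m, 'e, 'r) triv \<Rightarrow> ('m, 'n) chart \<Rightarrow> 'm \<Rightarrow> real ^ 'n \<Rightarrow> real ^ 'r \<Rightarrow> real ^ 'r \<Rightarrow> real" where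
  "sform t c p v f f' = 1 / 2 * (dform t c p v f f' + form t p f (conn_term t c p v f') + form t p (conn_term t c p v f) f')"

lemma form_coef: "t \<in> T \<Longrightarrow> p \<in> fst t \<Longrightarrow> form t p f f' = (\<Sum>a\<in>UNIV. \<Sum>b\<in>UNIV. f $ a * f' $ b * coef t a b p)"
  unfolding coef_def by (rule bilinear_form_expand[OF form_bilinear])

lemma dform_bilinear: "bilinear (dform t c p v)"
  unfolding bilinear_def dform_def
  by (auto intro!: linearI simp: sum.distrib algebra_simps sum_distrib_left)

lemma conn_term_linear: "linear (conn_term t c p v)"
  unfolding conn_term_def
  by (intro linearI) (auto simp: matrix_vector_right_distrib matrix_vector_mult_scaleR scaleR_add_right sum.distrib scaleR_sum_right mult.commute)

lemma sform_bilinear: assumes "t \<in> T" "p \<in> fst t" shows "bilinear (sform t c p v)"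
proof -
  have avg: "linear (\<lambda>x. 1 / 2 * (h1 x + h2 x + h3 x))" if "linear h1" "linear h2" "linear h3" for h1 h2 h3 :: "real ^ 'r \<Rightarrow> real"
    using linear_compose_scale_right[OF linear_compose_add[OF linear_compose_add[OF that(1,2)] that(3)], of "1 / 2"] by simp
  note B = form_bilinear[OF assms, unfolded bilinear_def] and D = dform_bilinear[of t c p v, unfolded bilinear_def]
    and C = conn_term_linear[of t c p v]
  have BC: "linear (\<lambda>x. form t p (conn_term t c p v x) f')" "linear (\<lambda>x. form t p f (conn_term t c p v x))" for f f'
    using linear_compose[OF C, of "\<lambda>x. form t p x f'"] linear_compose[OF C, of "form t p f"] B by (simp_all add: o_def)
  show ?thesis
    unfolding bilinear_def sform_def by (intro conjI allI avg) (use B D BC in auto)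
qed

lemma C1_section_fibre: "C1_section_on A \<pi> T \<Omega> u \<Longrightarrow> p \<in> \<Omega> \<Longrightarrow> u p \<in> fibre \<pi> p"
  and C1_section_Ck: "C1_section_on A \<pi> T \<Omega> u \<Longrightarrow> c \<in> A \<Longrightarrow> t \<in> T \<Longrightarrow>
      Ck_on 1 (\<lambda>q. loc t u (cinv c q)) (snd c ` (fst c \<inter> fst t \<inter> \<Omega>))"
  unfolding C1_section_on_def loc_def by (blast, simp del: Ck_on.simps)

lemma loc_cdiff:
  assumes u: "C1_section_on A \<pi> T \<Omega> u" and O: "open \<Omega>" and c: "c \<in> A" and t: "t \<in> T" and p: "p \<in> fst c \<inter> fst t \<inter> \<Omega>"
  shows "cdiff c (loc t u) p"
  by (rule Ck1_cdiff(1)[OF c open_Int[OF triv_open[OF t] O]]) (use C1_section_Ck[OF u c t] p in \<open>auto simp: Int_assoc\<close>)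

lemma coef_cdiff:
  assumes c: "c \<in> A" and t: "t \<in> T" and p: "p \<in> fst c \<inter> fst t"
  shows "cdiff c (coef t a b) p"
  by (rule Ck1_cdiff(1)[OF c triv_open[OF t]]) (use form_Ck[OF t c] p in \<open>auto simp: coef_def\<close>)

lemma pairing_cderiv:
  assumes u: "C1_section_on A \<pi> T \<Omega> u" and w: "C1_section_on A \<pi> T \<Omega> w" and O: "open \<Omega>"
    and c: "c \<in> A" and t: "t \<in> T" and p: "p \<in> fst c \<inter> fst t \<inter> \<Omega>"
  shows "cdiff c (\<lambda>p'. ip (u p') (w p')) p"
    and "cderiv c (\<lambda>p'. ip (u p') (w p')) p v = dform t c p v (loc t u p) (loc t w p)
       + form t p (cderiv c (loc t u) p v) (loc t w p) + form t p (loc t u p) (cderiv c (loc t w) p v)"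
proof -
  let ?X = "fst t \<inter> \<Omega>"
  have X: "open ?X" "p \<in> ?X" using triv_open[OF t] O p by auto
  have pc: "p \<in> fst c" "p \<in> fst t" using p by auto
  define D where "D v = (\<Sum>a\<in>UNIV. \<Sum>b\<in>UNIV.
      (loc t u p $ a * loc t w p $ b) * cderiv c (coef t a b) p v +
      ((loc t u p $ a) * (cderiv c (loc t w) p v $ b) + (cderiv c (loc t u) p v $ a) * (loc t w p $ b)) * coef t a b p)" for v
  let ?F = "at (snd c p) within snd c ` fst c"
  note du = cdiffD[OF loc_cdiff[OF u O c t p]] and dw = cdiffD[OF loc_cdiff[OF w O c t p]]
  note db = cdiffD[OF coef_cdiff[OF c t]]
  have comp: "((\<lambda>q. f q $ a) has_derivative (\<lambda>v. f' v $ a)) ?F" if "(f has_derivative f') ?F" for f :: "real ^ 'n \<Rightarrow> real ^ 'r" and f' a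
    by (rule bounded_linear.has_derivative[OF bounded_linear_vec_nth that])
  have "((\<lambda>q. \<Sum>a\<in>UNIV. \<Sum>b\<in>UNIV. loc t u (cinv c q) $ a * loc t w (cinv c q) $ b * coef t a b (cinv c q)) has_derivative D) ?F"
    unfolding D_def
    by (rule has_derivative_eq_rhs, (rule has_derivative_sum has_derivative_mult comp[OF du] comp[OF dw] db)+)
      (use p c in \<open>auto\<close>)
  then have "((\<lambda>q. \<Sum>a\<in>UNIV. \<Sum>b\<in>UNIV. loc t u (cinv c q) $ a * loc t w (cinv c q) $ b * coef t a b (cinv c q)) has_derivative D)
     (at (snd c p) within snd c ` (fst c \<inter> ?X))"
    using at_within_chart_image[OF c X(1)] p by auto
  then have "((\<lambda>q. ip (u (cinv c q)) (w (cinv c q))) has_derivative D) (at (snd c p) within snd c ` (fst c \<inter> ?X))"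
  proof (rule has_derivative_transform_within[where d = 1])
    fix q assume "q \<in> snd c ` (fst c \<inter> ?X)"
    then have q: "cinv c q \<in> ?X" using c by auto
    then show "(\<Sum>a\<in>UNIV. \<Sum>b\<in>UNIV. loc t u (cinv c q) $ a * loc t w (cinv c q) $ b * coef t a b (cinv c q)) = ip (u (cinv c q)) (w (cinv c q))"
      using ip_form[OF t, of "cinv c q"] C1_section_fibre[OF u] C1_section_fibre[OF w] form_coef[OF t, of "cinv c q"]
      by (simp add: loc_def)
  qed (use p in auto)
  note res = cdiffI[OF c pc(1) X, of "\<lambda>p'. ip (u p') (w p')", OF this]
  show "cdiff c (\<lambda>p'. ip (u p') (w p')) p" by (rule res)
  show "cderiv c (\<lambda>p'. ip (u p') (w p')) p v = dform t c p v (loc t u p) (loc t w p)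
       + form t p (cderiv c (loc t u) p v) (loc t w p) + form t p (loc t u p) (cderiv c (loc t w) p v)"
    unfolding res(2) D_def dform_def form_coef[OF t pc(2)] sum.distrib[symmetric]
    by (intro sum.cong refl) (simp add: algebra_simps)
qed

lemma covd_eq: "covd \<Gamma> \<pi> t c u p v = tinv \<pi> t p (cderiv c (loc t u) p v - conn_term t c p v (loc t u p))"
  by (simp add: covd_def loc_def[abs_def] conn_term_def)

lemma covd_fibre: "t \<in> T \<Longrightarrow> p \<in> fst t \<Longrightarrow> covd \<Gamma> \<pi> t c u p v \<in> fibre \<pi> p"
  unfolding covd_eq by (rule tinv_fibre)

text \<open>
  The Leibniz rule for a connection that is not metric; the defect is twice the symmetric part.
\<close>

lemma pairing_connection:
  assumes u: "C1_section_on A \<pi> T \<Omega> u" and w: "C1_section_on A \<pi> T \<Omega> w" and O: "open \<Omega>"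
    and c: "c \<in> A" and t: "t \<in> T" and p: "p \<in> fst c \<inter> fst t \<inter> \<Omega>"
  shows "cderiv c (\<lambda>p'. ip (u p') (w p')) p v
     = ip (u p) (covd \<Gamma> \<pi> t c w p v) + ip (covd \<Gamma> \<pi> t c u p v) (w p) + 2 * sform t c p v (loc t u p) (loc t w p)"
proof -
  have p': "p \<in> fst t" "p \<in> \<Omega>" using p by auto
  note B = form_bilinear[OF t p'(1)]
  have "ip (u p) (covd \<Gamma> \<pi> t c w p v) = form t p (loc t u p) (cderiv c (loc t w) p v - conn_term t c p v (loc t w p))"
    using ip_form[OF t p'(1) C1_section_fibre[OF u p'(2)] covd_fibre[OF t p'(1)]] t p'
    unfolding covd_eq by (simp add: loc_def)
  moreover have "ip (covd \<Gamma> \<pi> t c u p v) (w p) = form t p (cderiv c (loc t u) p v - conn_term t c p v (loc t u p)) (loc t w p)"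
    using ip_form[OF t p'(1) covd_fibre[OF t p'(1)] C1_section_fibre[OF w p'(2)]] t p'
    unfolding covd_eq by (simp add: loc_def)
  ultimately show ?thesis
    unfolding pairing_cderiv(2)[OF u w O c t p] sform_def by (simp add: bilinear_lsub[OF B] bilinear_rsub[OF B] field_simps)
qed

lemma metric_pos_def: "c \<in> A \<Longrightarrow> p \<in> fst c \<Longrightarrow> pos_def (g c p)"
  and metric_cont: "c \<in> A \<Longrightarrow> continuous_on (fst c) (g c)"
  and metric_transform: "c \<in> A \<Longrightarrow> c' \<in> A \<Longrightarrow> p \<in> fst c \<inter> fst c' \<Longrightarrow>
     v \<bullet> (g c p *v w) = cderiv c (snd c') p v \<bullet> (g c' p *v cderiv c (snd c') p w)"
proof -
  note m = metric[unfolded riemannian_metric_def]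
  show "pos_def (g c p)" if "c \<in> A" "p \<in> fst c"
    using m[THEN conjunct2, THEN conjunct1, rule_format, OF that] by (simp add: pos_def_def)
  show "continuous_on (fst c) (g c)" if "c \<in> A" using m[THEN conjunct1] that by blast
  show "v \<bullet> (g c p *v w) = cderiv c (snd c') p v \<bullet> (g c' p *v cderiv c (snd c') p w)"
    if "c \<in> A" "c' \<in> A" "p \<in> fst c \<inter> fst c'"
    by (rule m[THEN conjunct2, THEN conjunct2, rule_format, OF that])
qed

text \<open>
  The squared norm of the covariant derivative is evaluated in an arbitrarily chosen chart and
  trivialization; the transformation laws of connection and metric carry the bound to any others.
\<close>

lemma nabla_bound:
  assumes u: "C1_section_on A \<pi> T UNIV u" and c: "c \<in> A" and t: "t \<in> T" and p: "p \<in> fst c" "p \<in> fst t"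
  shows "ip (covd \<Gamma> \<pi> t c u p v) (covd \<Gamma> \<pi> t c u p v) \<le> (v \<bullet> (g c p *v v)) * nabla_norm_sq A g T \<pi> ip \<Gamma> u p"
    and "0 \<le> nabla_norm_sq A g T \<pi> ip \<Gamma> u p"
proof -
  define c0 where "c0 = chart_at A p"
  define t0 where "t0 = triv_at T p"
  have c0: "c0 \<in> A" "p \<in> fst c0" and t0: "t0 \<in> T" "p \<in> fst t0" using chart_at triv_at by (auto simp: c0_def t0_def)
  define v0 where "v0 = cderiv c (snd c0) p v"
  define Y where "Y v = cderiv c0 (loc t0 u) p v - conn_term t0 c0 p v (loc t0 u p)" for v
  have Ylin: "linear Y"
  proof -
    have "linear (\<lambda>v. conn_term t0 c0 p v (loc t0 u p))"
      unfolding conn_term_def by (intro linearI) (auto simp: scaleR_add_left sum.distrib scaleR_sum_right)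
    moreover have "linear (cderiv c0 (loc t0 u) p)"
      by (rule cderiv_linear[OF loc_cdiff[OF u open_UNIV c0(1) t0(1)]]) (use c0 t0 in auto)
    ultimately show ?thesis unfolding Y_def by (intro linear_compose_sub)
  qed
  have ipY: "ip (covd \<Gamma> \<pi> t0 c0 u p a) (covd \<Gamma> \<pi> t0 c0 u p b) = form t0 p (Y a) (Y b)" for a b
    unfolding covd_eq form_def Y_def ..
  have D: "nabla_norm_sq A g T \<pi> ip \<Gamma> u p =
     (\<Sum>i\<in>UNIV. \<Sum>j\<in>UNIV. matrix_inv (g c0 p) $ i $ j * form t0 p (Y (axis i 1)) (Y (axis j 1)))"
    unfolding nabla_norm_sq_def nabla_def Let_def c0_def[symmetric] t0_def[symmetric] ipY ..
  note bound = metric_gradient_bound[OF metric_pos_def[OF c0] form_bilinear[OF t0] form_sym[OF t0] form_nonneg[OF t0]]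
  show "0 \<le> nabla_norm_sq A g T \<pi> ip \<Gamma> u p" unfolding D by (rule bound(2))
  have "covd \<Gamma> \<pi> t0 c0 u p v0 = covd \<Gamma> \<pi> t c u p v"
    unfolding v0_def
    by (rule conn[unfolded connection_def, rule_format, OF c c0(1) t t0(1), of p UNIV u v]) (use p c0 t0 u in auto)
  then have "ip (covd \<Gamma> \<pi> t c u p v) (covd \<Gamma> \<pi> t c u p v) = form t0 p (Y v0) (Y v0)" unfolding ipY[symmetric] by simp
  also have "Y v0 = (\<Sum>i\<in>UNIV. v0 $ i *\<^sub>R Y (axis i 1))"
  proof -
    have "Y v0 = Y (\<Sum>i\<in>UNIV. v0 $ i *\<^sub>R axis i 1)" using basis_expansion[of v0] by (simp add: scalar_mult_eq_scaleR)
    then show ?thesis by (simp add: linear_sum[OF Ylin] linear_cmul[OF Ylin])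
  qed
  also have "form t0 p (\<Sum>i\<in>UNIV. v0 $ i *\<^sub>R Y (axis i 1)) (\<Sum>i\<in>UNIV. v0 $ i *\<^sub>R Y (axis i 1))
      \<le> (v0 \<bullet> (g c0 p *v v0)) * nabla_norm_sq A g T \<pi> ip \<Gamma> u p"
    unfolding D by (rule bound(1))
  also have "v0 \<bullet> (g c0 p *v v0) = v \<bullet> (g c p *v v)"
    unfolding v0_def using metric_transform[OF c c0(1), of p v v] p c0 by auto
  finally show "ip (covd \<Gamma> \<pi> t c u p v) (covd \<Gamma> \<pi> t c u p v) \<le> (v \<bullet> (g c p *v v)) * nabla_norm_sq A g T \<pi> ip \<Gamma> u p" .
qed

text \<open>
  Enough test sections: at a point they take every value of the fibre, which makes the description of
  the symmetric part unique.
\<close>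

lemma constant_section:
  assumes t: "t \<in> T"
  shows "C1_section_on A \<pi> T (fst t) (\<lambda>p. tinv \<pi> t p f)"
  unfolding C1_section_on_def
proof (intro conjI ballI)
  show "tinv \<pi> t p f \<in> fibre \<pi> p" if "p \<in> fst t" for p by (rule tinv_fibre[OF t that])
  fix c t' assume c: "c \<in> A" and t': "t' \<in> T"
  have "smooth_on (\<lambda>q. snd t' (tinv \<pi> t (cinv c q) f)) (snd c ` (fst c \<inter> fst t \<inter> fst t'))"
    using vbundle[unfolded vector_bundle_def, THEN conjunct2, THEN conjunct2] t t' c by blast
  then have "Ck_on 1 (\<lambda>q. snd t' (tinv \<pi> t (cinv c q) f)) (snd c ` (fst c \<inter> fst t \<inter> fst t'))" by (rule smooth_Ck1)
  moreover have "fst c \<inter> fst t \<inter> fst t' = fst c \<inter> fst t' \<inter> fst t" by auto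
  ultimately show "Ck_on 1 (\<lambda>q. snd t' (tinv \<pi> t (cinv c q) f)) (snd c ` (fst c \<inter> fst t' \<inter> fst t))" by simp
qed

text \<open>
  The definite description of the symmetric part is realized by the endomorphism \<open>M\<close> that represents
  \<open>sform\<close>. Uniqueness holds because the inner product is nondegenerate and sections that are
  constant in the trivialization test all directions.
\<close>

lemma symmetric_part_eq:
  assumes c: "c \<in> A" and p: "p \<in> fst c" and e: "e \<in> fibre \<pi> p"
    and t: "t = triv_at T p" and M: "\<And>f e. form t p f (M e) = sform t c p v f e"
  shows "symmetric_part A T \<pi> ip \<Gamma> c p v e = tinv \<pi> t p (M (snd t e))"
proof -
  have tT: "t \<in> T" "p \<in> fst t" using triv_at t by auto
  let ?s = "tinv \<pi> t p (M (snd t e))"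
  have val: "1 / 2 * (cderiv c (\<lambda>p'. ip (\<phi> p') (\<psi> p')) p v - ip (\<phi> p) (nabla T \<pi> \<Gamma> c \<psi> p v) - ip (nabla T \<pi> \<Gamma> c \<phi> p v) (\<psi> p))
      = ip (\<phi> p) ?s"
    if O: "open \<Omega>" "p \<in> \<Omega>" and f: "C1_section_on A \<pi> T \<Omega> \<phi>" and s: "C1_section_on A \<pi> T \<Omega> \<psi>" and "\<psi> p = e" for \<Omega> \<phi> \<psi>
  proof -
    have "1 / 2 * (cderiv c (\<lambda>p'. ip (\<phi> p') (\<psi> p')) p v - ip (\<phi> p) (nabla T \<pi> \<Gamma> c \<psi> p v) - ip (nabla T \<pi> \<Gamma> c \<phi> p v) (\<psi> p))
       = sform t c p v (loc t \<phi> p) (loc t \<psi> p)"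
      using pairing_connection[OF f s O(1) c tT(1), of p v] p tT O by (simp add: nabla_def t)
    also have "\<dots> = form t p (loc t \<phi> p) (M (snd t e))" using that(5) by (simp add: M loc_def)
    also have "\<dots> = ip (\<phi> p) ?s"
      using ip_form[OF tT C1_section_fibre[OF f O(2)] tinv_fibre[OF tT]] tT by (simp add: loc_def)
    finally show ?thesis .
  qed
  show ?thesis unfolding symmetric_part_def
  proof (rule the_equality)
    show "?s \<in> fibre \<pi> p \<and> (\<forall>\<Omega> \<phi> \<psi>. open \<Omega> \<and> p \<in> \<Omega> \<and> C1_section_on A \<pi> T \<Omega> \<phi> \<and> C1_section_on A \<pi> T \<Omega> \<psi> \<and> \<psi> p = e \<longrightarrow>
           ip (\<phi> p) ?s = 1 / 2 * (cderiv c (\<lambda>p'. ip (\<phi> p') (\<psi> p')) p v - ip (\<phi> p) (nabla T \<pi> \<Gamma> c \<psi> p v) - ip (nabla T \<pi> \<Gamma> c \<phi> p v) (\<psi> p)))"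
      using val tinv_fibre[OF tT] by auto
    fix s assume s: "s \<in> fibre \<pi> p \<and> (\<forall>\<Omega> \<phi> \<psi>. open \<Omega> \<and> p \<in> \<Omega> \<and> C1_section_on A \<pi> T \<Omega> \<phi> \<and> C1_section_on A \<pi> T \<Omega> \<psi> \<and> \<psi> p = e \<longrightarrow>
           ip (\<phi> p) s = 1 / 2 * (cderiv c (\<lambda>p'. ip (\<phi> p') (\<psi> p')) p v - ip (\<phi> p) (nabla T \<pi> \<Gamma> c \<psi> p v) - ip (nabla T \<pi> \<Gamma> c \<phi> p v) (\<psi> p)))"
    have "form t p f (snd t s - M (snd t e)) = 0" for f
    proof -
      let ?f = "\<lambda>p. tinv \<pi> t p f" and ?e = "\<lambda>p. tinv \<pi> t p (snd t e)"
      have cs: "C1_section_on A \<pi> T (fst t) ?f" "C1_section_on A \<pi> T (fst t) ?e" by (rule constant_section[OF tT(1)])+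
      have ee: "?e p = e" by (rule tinv_snd[OF tT e])
      have h: "open (fst t) \<and> p \<in> fst t \<and> C1_section_on A \<pi> T (fst t) ?f \<and> C1_section_on A \<pi> T (fst t) ?e \<and> ?e p = e"
        by (intro conjI triv_open[OF tT(1)] tT(2) cs ee)
      have "ip (?f p) s = ip (?f p) ?s"
        by (rule trans[OF s[THEN conjunct2, rule_format, OF h] val[OF triv_open[OF tT(1)] tT(2) cs ee]])
      then have "form t p f (snd t s) = form t p f (M (snd t e))"
        using ip_form[OF tT tinv_fibre[OF tT], of s f] ip_form[OF tT tinv_fibre[OF tT] tinv_fibre[OF tT], of f "M (snd t e)"] s tT by simp
      then show ?thesis by (simp add: bilinear_rsub[OF form_bilinear[OF tT]])
    qed
    from this[of "snd t s - M (snd t e)"] form_pos[OF tT, of "snd t s - M (snd t e)"]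
    have "snd t s = M (snd t e)" by (metis less_irrefl right_minus_eq)
    then show "s = ?s" using tinv_snd[OF tT, of s] s by simp
  qed
qed

end

section \<open>Differential inequalities for the squared norm\<close>

context hermitian_bundle begin

text \<open>
  Kato's inequality for \<open>|u|\<^sup>2\<close>: of the three terms of the Leibniz rule, two are estimated by
  the Cauchy-Schwarz inequality and the third is the quadratic form of the symmetric part, bounded by
  its operator norm. Only the symmetric part enters without a factor \<open>|\<nabla>u|\<close>; this is why the decay
  condition concerns it alone.
\<close>

lemma derivative_symmetric_bound:
  assumes u: "C1_section_on A \<pi> T UNIV u" and c: "c \<in> A" and p: "p \<in> fst c"
  shows "\<bar>cderiv c (\<lambda>p. ip (u p) (u p)) p v\<bar> \<le> 2 * sqrt (ip (u p) (u p)) * sqrt ((v \<bullet> (g c p *v v)) * nabla_norm_sq A g T \<pi> ip \<Gamma> u p)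
      + 2 * fibre_opnorm \<pi> ip p (symmetric_part A T \<pi> ip \<Gamma> c p v) * ip (u p) (u p)"
proof -
  define t where "t = triv_at T p"
  have t: "t \<in> T" "p \<in> fst t" using triv_at by (auto simp: t_def)
  note B = form_bilinear[OF t]
  obtain M where M: "linear M" "\<And>f e. form t p f (M e) = sform t c p v f e"
    by (rule riesz_form[OF B form_pos[OF t] sform_bilinear[OF t, of c v]]) (assumption | rule that)+
  let ?S = "symmetric_part A T \<pi> ip \<Gamma> c p v"
  let ?op = "fibre_opnorm \<pi> ip p ?S"
  have Seq: "?S e = tinv \<pi> t p (M (snd t e))" if "e \<in> fibre \<pi> p" for e
    by (rule symmetric_part_eq[OF c p that t_def M(2)])
  define N where "N f = sqrt (form t p f f)" for f
  have N0: "0 \<le> N f" for f using form_nonneg[OF t] by (simp add: N_def)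
  have NN: "N f * N f = form t p f f" for f using form_nonneg[OF t] by (simp add: N_def)
  have CS: "\<bar>form t p f f'\<bar> \<le> N f * N f'" for f f'
    using cauchy_schwarz_form[OF B form_sym[OF t] form_nonneg[OF t], of f f']
    by (metis N_def real_sqrt_abs real_sqrt_le_iff real_sqrt_mult)
  have Nscale: "N (a *\<^sub>R f) = \<bar>a\<bar> * N f" for a f
    by (simp add: N_def bilinear_lmul[OF B] bilinear_rmul[OF B] real_sqrt_mult mult.assoc[symmetric])
  have set: "(\<lambda>e. sqrt (ip (?S e) (?S e))) ` {e \<in> fibre \<pi> p. ip e e \<le> 1} = (\<lambda>f. N (M f)) ` {f. form t p f f \<le> 1}" (is "?I1 = ?I2")
  proof
    show "?I1 \<subseteq> ?I2"
    proof
      fix y assume "y \<in> ?I1"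
      then obtain e where e: "e \<in> fibre \<pi> p" "ip e e \<le> 1" "y = sqrt (ip (?S e) (?S e))" by blast
      have "form t p (snd t e) (snd t e) \<le> 1" using e(2) ip_form[OF t e(1) e(1)] by simp
      moreover have "y = N (M (snd t e))" unfolding e(3) Seq[OF e(1)] N_def form_def ..
      ultimately show "y \<in> ?I2" by blast
    qed
    show "?I2 \<subseteq> ?I1"
    proof
      fix y assume "y \<in> ?I2"
      then obtain f where f: "y = N (M f)" "form t p f f \<le> 1" by auto
      let ?e = "tinv \<pi> t p f"
      have "?e \<in> fibre \<pi> p" by (rule tinv_fibre[OF t])
      moreover have "ip ?e ?e \<le> 1" using f by (simp add: form_def)
      moreover have "y = sqrt (ip (?S ?e) (?S ?e))" unfolding f(1) Seq[OF tinv_fibre[OF t]] snd_tinv[OF t] N_def form_def ..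
      ultimately show "y \<in> ?I1" by blast
    qed
  qed
  obtain \<beta> where \<beta>: "\<beta> > 0" "\<And>f. \<beta> * (norm f)\<^sup>2 \<le> form t p f f" by (rule pos_bilinear_lower[OF B form_pos[OF t]]) (assumption | rule that)+
  have bdd: "bdd_above ?I2"
  proof -
    have "bounded {f. form t p f f \<le> 1}"
      unfolding bounded_iff
    proof (intro exI ballI)
      fix f assume "f \<in> {f. form t p f f \<le> 1}"
      then have "\<beta> * (norm f)\<^sup>2 \<le> 1" using \<beta>(2)[of f] by simp
      then have "(norm f)\<^sup>2 \<le> 1 / \<beta>" using \<beta>(1) by (simp add: field_simps)
      then show "norm f \<le> sqrt (1 / \<beta>)" by (simp add: real_le_rsqrt)
    qed
    then have "compact (closure {f. form t p f f \<le> 1})" by (simp add: compact_closure)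
    moreover have "continuous_on UNIV (\<lambda>f. N (M f))"
    proof -
      have cM: "continuous_on UNIV (\<lambda>f. M f $ a)" for a
        using M(1) by (intro linear_continuous_on bounded_linear_compose[OF bounded_linear_vec_nth, of M, unfolded o_def])
          (simp add: linear_conv_bounded_linear)
      show ?thesis unfolding N_def form_coef[OF t] by (intro continuous_intros cM)
    qed
    ultimately have "bounded ((\<lambda>f. N (M f)) ` closure {f. form t p f f \<le> 1})"
      by (intro compact_imp_bounded compact_continuous_image) (auto intro: continuous_on_subset)
    then show ?thesis
      by (rule bounded_imp_bdd_above[OF bounded_subset[OF _ image_mono[OF closure_subset]]])
  qed
  have MN: "N (M f) \<le> ?op * N f" for f
  proof (cases "f = 0")
    case True
    then show ?thesis using linear_0[OF M(1)] bilinear_lzero[OF B] by (simp add: N_def)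
  next
    case False
    then have Nf: "N f > 0" using form_pos[OF t] by (simp add: N_def)
    let ?f = "(1 / N f) *\<^sub>R f"
    have "N ?f = 1" using Nf by (simp add: Nscale)
    then have "form t p ?f ?f = 1" using NN[of ?f] by simp
    then have "N (M ?f) \<in> ?I2" by (metis (mono_tags, lifting) image_eqI mem_Collect_eq order_refl)
    then have "N (M ?f) \<le> ?op" unfolding fibre_opnorm_def set by (rule cSup_upper[OF _ bdd])
    moreover have "N (M ?f) = N (M f) / N f" using Nf by (simp add: linear_cmul[OF M(1)] Nscale)
    ultimately show ?thesis using Nf by (simp add: field_simps)
  qed
  let ?U = "loc t u p" and ?X = "covd \<Gamma> \<pi> t c u p v"
  have up: "u p \<in> fibre \<pi> p" by (rule C1_section_fibre[OF u UNIV_I])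
  have Xf: "?X \<in> fibre \<pi> p" by (rule covd_fibre[OF t])
  have F: "ip (u p) (u p) = form t p ?U ?U" unfolding loc_def by (rule ip_form[OF t up up])
  have sN: "sqrt (ip (u p) (u p)) = N ?U" by (simp add: F N_def)
  have 1: "ip (u p) ?X = form t p ?U (snd t ?X)" "ip ?X (u p) = form t p (snd t ?X) ?U" "ip ?X ?X = form t p (snd t ?X) (snd t ?X)"
    unfolding loc_def by (rule ip_form[OF t up Xf] ip_form[OF t Xf up] ip_form[OF t Xf Xf])+
  have "cderiv c (\<lambda>p. ip (u p) (u p)) p v = 2 * form t p ?U (snd t ?X) + 2 * sform t c p v ?U ?U"
    using pairing_connection[OF u u open_UNIV c t(1), of p v] p t(2)
    unfolding 1 form_sym[OF t, of "snd t ?X" ?U] by simp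
  moreover have "\<bar>form t p ?U (snd t ?X)\<bar> \<le> N ?U * sqrt ((v \<bullet> (g c p *v v)) * nabla_norm_sq A g T \<pi> ip \<Gamma> u p)"
  proof -
    have "N (snd t ?X) \<le> sqrt ((v \<bullet> (g c p *v v)) * nabla_norm_sq A g T \<pi> ip \<Gamma> u p)"
      using nabla_bound(1)[OF u c t(1) p t(2), of v] unfolding N_def 1 by (rule real_sqrt_le_mono)
    then show ?thesis using CS[of ?U "snd t ?X"] N0[of ?U] by (meson mult_left_mono order_trans)
  qed
  moreover have "\<bar>sform t c p v ?U ?U\<bar> \<le> ?op * form t p ?U ?U"
  proof -
    have "\<bar>sform t c p v ?U ?U\<bar> \<le> N ?U * N (M ?U)" unfolding M(2)[symmetric] by (rule CS)
    also have "\<dots> \<le> N ?U * (?op * N ?U)" by (intro mult_left_mono MN N0)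
    finally show ?thesis unfolding NN[of ?U, symmetric] by (simp add: mult_ac)
  qed
  ultimately have "\<bar>cderiv c (\<lambda>p. ip (u p) (u p)) p v\<bar>
      \<le> 2 * (N ?U * sqrt ((v \<bullet> (g c p *v v)) * nabla_norm_sq A g T \<pi> ip \<Gamma> u p)) + 2 * (?op * form t p ?U ?U)"
    by linarith
  then show ?thesis unfolding sN unfolding F by (simp add: mult.assoc)
qed

lemma compact_family_bound:
  fixes h :: "'i::finite \<Rightarrow> 'a::topological_space \<Rightarrow> real"
  assumes K: "compact K" and h: "\<And>i. continuous_on K (h i)"
  obtains m where "0 \<le> m" "\<And>i p. p \<in> K \<Longrightarrow> \<bar>h i p\<bar> \<le> m"
proof -
  have "\<exists>b. \<forall>p\<in>K. \<bar>h i p\<bar> \<le> b" for i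
    using compact_imp_bounded[OF compact_continuous_image[OF h K]] unfolding bounded_iff by auto
  then obtain b where b: "\<And>i p. p \<in> K \<Longrightarrow> \<bar>h i p\<bar> \<le> b i" by metis
  show thesis
  proof (rule that[of "\<Sum>i\<in>UNIV. \<bar>b i\<bar>"])
    fix i p assume "p \<in> K"
    then have "\<bar>h i p\<bar> \<le> \<bar>b i\<bar>" using b[of p i] by linarith
    also have "\<dots> \<le> (\<Sum>i\<in>UNIV. \<bar>b i\<bar>)" by (rule member_le_sum) auto
    finally show "\<bar>h i p\<bar> \<le> (\<Sum>i\<in>UNIV. \<bar>b i\<bar>)" .
  qed (simp add: sum_nonneg)
qed

lemma bilinear_sum_bound:
  fixes f f' :: "real ^ 'r::finite" and k :: "'r \<Rightarrow> 'r \<Rightarrow> real"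
  assumes "\<And>a b. \<bar>k a b\<bar> \<le> m" "\<And>b. \<bar>f' $ b\<bar> \<le> l" "0 \<le> m"
  shows "\<bar>\<Sum>a\<in>UNIV. \<Sum>b\<in>UNIV. f $ a * f' $ b * k a b\<bar> \<le> (real CARD('r))\<^sup>2 * m * norm f * l"
proof -
  have "\<bar>\<Sum>a\<in>UNIV. \<Sum>b\<in>UNIV. f $ a * f' $ b * k a b\<bar> \<le> (\<Sum>a\<in>UNIV. \<Sum>b\<in>UNIV. \<bar>f $ a * f' $ b * k a b\<bar>)"
    by (rule order_trans[OF sum_abs sum_mono[OF sum_abs]])
  also have "\<dots> \<le> (\<Sum>a\<in>(UNIV::'r set). \<Sum>b\<in>(UNIV::'r set). norm f * l * m)"
    unfolding abs_mult
    by (intro sum_mono mult_mono assms component_le_norm_cart mult_nonneg_nonneg) (use assms(2) in \<open>auto intro: order_trans[OF abs_ge_zero]\<close>)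
  also have "\<dots> = (real CARD('r))\<^sup>2 * m * norm f * l" by (simp add: power2_eq_square)
  finally show ?thesis .
qed

lemma coef_cont: "c \<in> A \<Longrightarrow> t \<in> T \<Longrightarrow> continuous_on (fst c \<inter> fst t) (coef t a b)"
  and coef_deriv_cont: "c \<in> A \<Longrightarrow> t \<in> T \<Longrightarrow> continuous_on (snd c ` (fst c \<inter> fst t)) (\<lambda>q. cderiv c (coef t a b) (cinv c q) v)"
  using Ck1_cdiff(2,3)[OF _ triv_open, of c t "coef t a b"] form_Ck[of t c "axis a 1" "axis b 1"]
  by (simp_all add: coef_def[abs_def] del: Ck_on.simps)

lemma to_chart_cont:
  assumes c: "c \<in> A" and K: "K \<subseteq> fst c \<inter> X" and f: "continuous_on (snd c ` (fst c \<inter> X)) (\<lambda>q. f (cinv c q))"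
  shows "continuous_on K f"
proof -
  have "continuous_on K (\<lambda>p. f (cinv c (snd c p)))"
    by (rule continuous_on_compose2[OF f continuous_on_subset[OF chart_cont[OF c]]]) (use K in auto)
  then show ?thesis by (rule continuous_on_eq) (use K c in auto)
qed

lemma form_lower_compact:
  assumes c: "c \<in> A" and t: "t \<in> T" and K: "compact K" "K \<subseteq> fst c \<inter> fst t"
  obtains \<beta> where "\<beta> > 0" "\<And>p f. p \<in> K \<Longrightarrow> \<beta> * (norm f)\<^sup>2 \<le> form t p f f"
proof (cases "K = {}")
  case True then show thesis using that[of 1] by auto
next
  case False
  let ?S = "sphere 0 1 :: (real ^ 'r) set"
  have cc: "continuous_on (K \<times> ?S) (\<lambda>(p, f). \<Sum>a\<in>UNIV. \<Sum>b\<in>UNIV. f $ a * f $ b * coef t a b p)"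
    unfolding case_prod_beta
    by (intro continuous_intros continuous_on_compose2[OF continuous_on_subset[OF coef_cont[OF c t] K(2)]]) auto
  have cf: "continuous_on (K \<times> ?S) (\<lambda>(p, f). form t p f f)"
    by (rule continuous_on_eq[OF cc]) (use K form_coef[OF t] in auto)
  obtain a :: 'r where True by simp
  have "axis a (1::real) \<in> ?S" by simp
  then have "K \<times> ?S \<noteq> {}" using False by auto
  then obtain z where z: "z \<in> K \<times> ?S" "\<And>w. w \<in> K \<times> ?S \<Longrightarrow> (\<lambda>(p, f). form t p f f) z \<le> (\<lambda>(p, f). form t p f f) w"
    using continuous_attains_inf[OF compact_Times[OF K(1) compact_sphere] _ cf] by blast
  obtain p0 f0 where z0: "z = (p0, f0)" by force
  show thesis
  proof (rule that)
    show "0 < form t p0 f0 f0" using z(1) K z0 by (intro form_pos[OF t]) auto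
    fix p f assume p: "p \<in> K"
    show "form t p0 f0 f0 * (norm f)\<^sup>2 \<le> form t p f f"
    proof (cases "f = 0")
      case True then show ?thesis using bilinear_lzero[OF form_bilinear[OF t]] p K by auto
    next
      case False
      have B: "bilinear (form t p)" using form_bilinear[OF t] p K by auto
      have "form t p0 f0 f0 \<le> form t p ((1 / norm f) *\<^sub>R f) ((1 / norm f) *\<^sub>R f)"
        using z(2)[of "(p, (1 / norm f) *\<^sub>R f)"] p False z0 by auto
      also have "\<dots> = form t p f f / (norm f)\<^sup>2" by (simp add: bilinear_lmul[OF B] bilinear_rmul[OF B] power2_eq_square)
      finally show ?thesis using False by (simp add: field_simps)
    qed
  qed
qed

text \<open>
  On compact pieces of a chart the gradient of \<open>|u|\<^sup>2\<close> is at most \<open>\<gamma> |u|\<^sup>2 + C |\<nabla>u|\<^sup>2\<close>, where the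
  potential \<open>\<gamma>\<close> is affine in the size of the connection coefficients and hence locally in \<open>L\<^sup>n\<close>.
\<close>

lemma local_gradient_bound:
  assumes c: "c \<in> A" and t: "t \<in> T" and K: "compact K" "K \<subseteq> fst c \<inter> fst t"
  obtains C where "0 \<le> C"
    "\<And>u p. C1_section_on A \<pi> T UNIV u \<Longrightarrow> p \<in> K \<Longrightarrow>
       (\<Sum>i\<in>UNIV. \<bar>cderiv c (\<lambda>p. ip (u p) (u p)) p (axis i 1)\<bar>)
        \<le> C * (1 + (\<Sum>i\<in>UNIV. norm (\<Gamma> t c p i))) * ip (u p) (u p) + C * nabla_norm_sq A g T \<pi> ip \<Gamma> u p"
proof -
  obtain \<beta> where \<beta>: "\<beta> > 0" "\<And>p f. p \<in> K \<Longrightarrow> \<beta> * (norm f)\<^sup>2 \<le> form t p f f"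
    by (rule form_lower_compact[OF c t K]) (rule that)
  obtain m1 where m1: "0 \<le> m1" "\<And>a b p. p \<in> K \<Longrightarrow> \<bar>coef t a b p\<bar> \<le> m1"
    by (rule compact_family_bound[OF K(1), of "\<lambda>(a, b). coef t a b"])
      (auto intro: continuous_on_subset[OF coef_cont[OF c t] K(2)] dest: that)
  obtain m2 where m2: "0 \<le> m2" "\<And>a b i p. p \<in> K \<Longrightarrow> \<bar>cderiv c (coef t a b) p (axis i 1)\<bar> \<le> m2"
    by (rule compact_family_bound[OF K(1), of "\<lambda>(a, b, i) p. cderiv c (coef t a b) p (axis i 1)"])
      (auto intro!: to_chart_cont[OF c K(2)] coef_deriv_cont[OF c t] dest: that)
  obtain m3 where m3: "0 \<le> m3" "\<And>i p. p \<in> K \<Longrightarrow> \<bar>g c p $ i $ i\<bar> \<le> m3"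
    by (rule compact_family_bound[OF K(1), of "\<lambda>i p. g c p $ i $ i"])
      (use K in \<open>auto intro!: continuous_intros continuous_on_subset[OF metric_cont[OF c]] dest: that\<close>)
  let ?n = "real CARD('n)" and ?r = "(real CARD('r))\<^sup>2"
  define C1 where "C1 = 1 + ?r * m2 / \<beta>"
  define C2 where "C2 = 2 * (?r * m1 / \<beta>)"
  define C where "C = ?n * C1 + C2 + ?n * m3"
  have C12: "0 \<le> C1" "0 \<le> C2" using \<beta> m1 m2 by (auto simp: C1_def C2_def)
  have C0: "0 \<le> C" using C12 m3 by (simp add: C_def)
  show thesis
  proof (rule that[OF C0])
    fix u p assume u: "C1_section_on A \<pi> T UNIV u" and p: "p \<in> K"
    let ?F = "ip (u p) (u p)" and ?D = "nabla_norm_sq A g T \<pi> ip \<Gamma> u p" and ?U = "loc t u p"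
    have pc: "p \<in> fst c" "p \<in> fst t" using p K by auto
    note B = form_bilinear[OF t pc(2)]
    have F: "?F = form t p ?U ?U" unfolding loc_def by (rule ip_form[OF t pc(2) C1_section_fibre[OF u UNIV_I] C1_section_fibre[OF u UNIV_I]])
    have F0: "0 \<le> ?F" unfolding F by (rule form_nonneg[OF t pc(2)])
    have D0: "0 \<le> ?D" by (rule nabla_bound(2)[OF u c t pc])
    have UF: "norm ?U * norm ?U \<le> ?F / \<beta>"
      using \<beta>(2)[OF p, of ?U] \<beta>(1) by (simp add: F power2_eq_square field_simps)
    have each: "\<bar>cderiv c (\<lambda>p. ip (u p) (u p)) p (axis i 1)\<bar> \<le> C1 * ?F + C2 * norm (\<Gamma> t c p i) * ?F + m3 * ?D" for i
    proof -
      let ?X = "covd \<Gamma> \<pi> t c u p (axis i 1)"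
      have Xf: "?X \<in> fibre \<pi> p" by (rule covd_fibre[OF t pc(2)])
      note uf = C1_section_fibre[OF u UNIV_I, of p]
      have ct: "conn_term t c p (axis i 1) f = \<Gamma> t c p i *v f" for f
        unfolding conn_term_def by (simp add: axis_def if_distrib if_distribR cong: if_cong)
      have "cderiv c (\<lambda>p. ip (u p) (u p)) p (axis i 1)
         = 2 * form t p ?U (snd t ?X) + dform t c p (axis i 1) ?U ?U + 2 * form t p ?U (\<Gamma> t c p i *v ?U)"
        using pairing_connection[OF u u open_UNIV c t, of p "axis i 1"] pc
        unfolding ip_form[OF t pc(2) uf Xf] ip_form[OF t pc(2) Xf uf] loc_def[symmetric] sform_def ct
          form_sym[OF t pc(2), of "snd t ?X" ?U] form_sym[OF t pc(2), of "\<Gamma> t c p i *v ?U" ?U]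
        by (simp add: field_simps)
      moreover have "\<bar>2 * form t p ?U (snd t ?X)\<bar> \<le> ?F + m3 * ?D"
      proof -
        have "0 \<le> form t p (?U + snd t ?X) (?U + snd t ?X)" "0 \<le> form t p (?U - snd t ?X) (?U - snd t ?X)"
          by (rule form_nonneg[OF t pc(2)])+
        then have "\<bar>2 * form t p ?U (snd t ?X)\<bar> \<le> ?F + form t p (snd t ?X) (snd t ?X)"
          unfolding F by (simp add: bilinear_ladd[OF B] bilinear_radd[OF B] bilinear_lsub[OF B] bilinear_rsub[OF B] form_sym[OF t pc(2), of "snd t ?X" ?U])
        also have "form t p (snd t ?X) (snd t ?X) = ip ?X ?X" by (rule ip_form[OF t pc(2) Xf Xf, symmetric])
        also have "\<dots> \<le> (axis i 1 \<bullet> (g c p *v axis i 1)) * ?D" by (rule nabla_bound(1)[OF u c t pc])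
        also have "axis i 1 \<bullet> (g c p *v axis i 1) = g c p $ i $ i" by (simp add: matrix_vector_mult_basis inner_axis' column_def)
        also have "g c p $ i $ i * ?D \<le> m3 * ?D" using m3(2)[OF p, of i] D0 by (intro mult_right_mono) auto
        finally show ?thesis by simp
      qed
      moreover have "\<bar>dform t c p (axis i 1) ?U ?U\<bar> \<le> ?r * m2 / \<beta> * ?F"
      proof -
        have "\<bar>dform t c p (axis i 1) ?U ?U\<bar> \<le> ?r * m2 * norm ?U * norm ?U"
          unfolding dform_def by (rule bilinear_sum_bound) (use m2 p component_le_norm_cart in auto)
        also have "\<dots> = ?r * m2 * (norm ?U * norm ?U)" by simp
        also have "\<dots> \<le> ?r * m2 * (?F / \<beta>)" using m2 by (intro mult_left_mono UF) auto
        finally show ?thesis by (simp add: mult_ac)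
      qed
      moreover have "\<bar>2 * form t p ?U (\<Gamma> t c p i *v ?U)\<bar> \<le> C2 * norm (\<Gamma> t c p i) * ?F"
      proof -
        have "\<bar>(\<Gamma> t c p i *v ?U) $ b\<bar> \<le> norm (\<Gamma> t c p i) * norm ?U" for b
        proof -
          have "\<bar>(\<Gamma> t c p i *v ?U) $ b\<bar> = \<bar>\<Gamma> t c p i $ b \<bullet> ?U\<bar>" by (simp add: matrix_vector_mul_component)
          also have "\<dots> \<le> norm (\<Gamma> t c p i $ b) * norm ?U" by (rule Cauchy_Schwarz_ineq2)
          also have "\<dots> \<le> norm (\<Gamma> t c p i) * norm ?U" by (intro mult_right_mono Finite_Cartesian_Product.norm_nth_le) auto
          finally show ?thesis .
        qed
        then have "\<bar>form t p ?U (\<Gamma> t c p i *v ?U)\<bar> \<le> ?r * m1 * norm ?U * (norm (\<Gamma> t c p i) * norm ?U)"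
          unfolding form_coef[OF t pc(2)] by (intro bilinear_sum_bound m1 p)
        also have "\<dots> = ?r * m1 * norm (\<Gamma> t c p i) * (norm ?U * norm ?U)" by simp
        also have "\<dots> \<le> ?r * m1 * norm (\<Gamma> t c p i) * (?F / \<beta>)" using m1 by (intro mult_left_mono UF) auto
        finally have "\<bar>2 * form t p ?U (\<Gamma> t c p i *v ?U)\<bar> \<le> 2 * (?r * m1 * norm (\<Gamma> t c p i) * (?F / \<beta>))"
          by simp
        also have "\<dots> = C2 * norm (\<Gamma> t c p i) * ?F" by (simp add: C2_def mult_ac)
        finally show ?thesis .
      qed
      moreover have "C1 * ?F = ?F + ?r * m2 / \<beta> * ?F" unfolding C1_def by (simp only: distrib_right mult_1)
      ultimately show ?thesis by linarith
    qed
    have "(\<Sum>i\<in>UNIV. \<bar>cderiv c (\<lambda>p. ip (u p) (u p)) p (axis i 1)\<bar>)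
       \<le> (\<Sum>i\<in>UNIV. C1 * ?F + C2 * norm (\<Gamma> t c p i) * ?F + m3 * ?D)" by (intro sum_mono each)
    also have "\<dots> = ?n * C1 * ?F + C2 * (\<Sum>i\<in>UNIV. norm (\<Gamma> t c p i)) * ?F + ?n * m3 * ?D"
      by (simp add: sum.distrib sum_distrib_left sum_distrib_right)
    also have "\<dots> \<le> C * ?F + C * (\<Sum>i\<in>UNIV. norm (\<Gamma> t c p i)) * ?F + C * ?D"
      using C12 m3 F0 D0 by (intro add_mono mult_right_mono) (auto simp: C_def sum_nonneg)
    finally show "(\<Sum>i\<in>UNIV. \<bar>cderiv c (\<lambda>p. ip (u p) (u p)) p (axis i 1)\<bar>)
        \<le> C * (1 + (\<Sum>i\<in>UNIV. norm (\<Gamma> t c p i))) * ?F + C * ?D"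
      by (simp add: distrib_left distrib_right)
  qed
qed

lemma norm_sq_cont_deriv:
  assumes u: "C1_section_on A \<pi> T UNIV u" and c: "c \<in> A" and t: "t \<in> T"
  shows "continuous_on (snd c ` (fst c \<inter> fst t)) (\<lambda>q. cderiv c (\<lambda>p. ip (u p) (u p)) (cinv c q) v)"
proof -
  let ?S = "snd c ` (fst c \<inter> fst t)"
  have O: "open (fst t)" by (rule triv_open[OF t])
  have Ck: "Ck_on 1 (\<lambda>q. loc t u (cinv c q)) ?S" using C1_section_Ck[OF u c t] by (simp del: Ck_on.simps)
  have cl: "continuous_on ?S (\<lambda>q. loc t u (cinv c q))" and dl: "continuous_on ?S (\<lambda>q. cderiv c (loc t u) (cinv c q) v)"
    and cc: "continuous_on ?S (\<lambda>q. coef t a b (cinv c q))" for a b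
    using Ck1_cdiff(2,3)[OF c O Ck] coef_cont[OF c t, of a b]
    by (auto intro!: continuous_on_compose2[OF _ continuous_on_subset[OF cinv_cont[OF c]]] simp: c)
  note dc = coef_deriv_cont[OF c t]
  have "continuous_on ?S (\<lambda>q. (\<Sum>a\<in>UNIV. \<Sum>b\<in>UNIV. loc t u (cinv c q) $ a * loc t u (cinv c q) $ b * cderiv c (coef t a b) (cinv c q) v)
      + (\<Sum>a\<in>UNIV. \<Sum>b\<in>UNIV. cderiv c (loc t u) (cinv c q) v $ a * loc t u (cinv c q) $ b * coef t a b (cinv c q))
      + (\<Sum>a\<in>UNIV. \<Sum>b\<in>UNIV. loc t u (cinv c q) $ a * cderiv c (loc t u) (cinv c q) v $ b * coef t a b (cinv c q)))"
    by (intro continuous_intros cl dl cc dc)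
  then show ?thesis
  proof (rule continuous_on_eq)
    fix q assume "q \<in> ?S"
    then have p: "cinv c q \<in> fst c \<inter> fst t \<inter> UNIV" using c by auto
    then have pt: "cinv c q \<in> fst t" by auto
    show "(\<Sum>a\<in>UNIV. \<Sum>b\<in>UNIV. loc t u (cinv c q) $ a * loc t u (cinv c q) $ b * cderiv c (coef t a b) (cinv c q) v)
      + (\<Sum>a\<in>UNIV. \<Sum>b\<in>UNIV. cderiv c (loc t u) (cinv c q) v $ a * loc t u (cinv c q) $ b * coef t a b (cinv c q))
      + (\<Sum>a\<in>UNIV. \<Sum>b\<in>UNIV. loc t u (cinv c q) $ a * cderiv c (loc t u) (cinv c q) v $ b * coef t a b (cinv c q))
      = cderiv c (\<lambda>p. ip (u p) (u p)) (cinv c q) v"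
      unfolding pairing_cderiv(2)[OF u u open_UNIV c t p] dform_def form_coef[OF t pt] ..
  qed
qed

lemma norm_sq_cdiff:
  assumes u: "C1_section_on A \<pi> T UNIV u" and c: "c \<in> A" and p: "p \<in> fst c"
  shows "cdiff c (\<lambda>p. ip (u p) (u p)) p"
  using pairing_cderiv(1)[OF u u open_UNIV c triv_at(1), of p p] p triv_at(2) by auto

lemma norm_sq_nonneg:
  assumes u: "C1_section_on A \<pi> T UNIV u" shows "0 \<le> ip (u p) (u p)"
  using ip_form[OF triv_at C1_section_fibre[OF u UNIV_I] C1_section_fibre[OF u UNIV_I], of p] form_nonneg[OF triv_at] by metis

lemma norm_sq_cont:
  assumes u: "C1_section_on A \<pi> T UNIV u" shows "continuous_on UNIV (\<lambda>p. ip (u p) (u p))"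
proof (rule continuous_at_imp_continuous_on, intro ballI)
  fix p :: 'm
  obtain c where c: "c \<in> A" "p \<in> fst c" using charts_cover by blast
  have "continuous_on (snd c ` fst c) (\<lambda>q. ip (u (cinv c q)) (u (cinv c q)))"
    using cdiffD[OF norm_sq_cdiff[OF u c(1)]] c(1)
    by (auto simp: continuous_on_eq_continuous_within intro!: has_derivative_continuous)
  then have "continuous_on (fst c) (\<lambda>p. ip (u p) (u p))"
    using to_chart_cont[OF c(1), of "fst c" UNIV] by auto
  then show "isCont (\<lambda>p. ip (u p) (u p)) p"
    using c chart_open continuous_on_eq_continuous_at by blast
qed

end

section \<open>Volume and charts\<close>

text \<open>
  Cubes adapted to half-spaces: around an interior point the cube is centred (\<open>e\<close> is the vector of
  ones), and at a boundary point it is pushed inwards in the normal direction (that component of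
  \<open>e\<close> is 0). In both cases it is a neighbourhood of \<open>q\<close> relative to \<open>V\<close>.
\<close>

lemma model_open_cubes:
  fixes V :: "(real ^ 'n::finite) set"
  assumes V: "model_open V" and q: "q \<in> V"
  obtains e R0 where "R0 > 0" "\<And>i. 0 \<le> e $ i \<and> e $ i \<le> 1"
    "\<And>R. 0 < R \<Longrightarrow> R \<le> R0 \<Longrightarrow> cube (q - R *\<^sub>R e) (2 * R) \<subseteq> V"
    "\<And>R. 0 < R \<Longrightarrow> V \<inter> ball q R \<subseteq> cube (q - R *\<^sub>R e) (2 * R)"
    "\<And>R x. 0 < R \<Longrightarrow> x \<in> cube (q - R *\<^sub>R e) (2 * R) \<Longrightarrow> norm (x - q) \<le> 2 * real CARD('n) * R"
proof -
  have near: "norm (x - q) \<le> 2 * real CARD('n) * R" if x: "x \<in> cube (q - R *\<^sub>R e) (2 * R)" and R: "0 < R" and e: "\<And>i. 0 \<le> e $ i \<and> e $ i \<le> 1" for x e R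
  proof -
    have "\<bar>(x - q) $ i\<bar> \<le> 2 * R" for i
    proof -
      have "R * e $ i \<le> R * 1" "0 \<le> R * e $ i" using e[of i] R by (auto intro: mult_left_mono)
      moreover have "q $ i - R * e $ i \<le> x $ i" "x $ i \<le> q $ i - R * e $ i + 2 * R" using x by (auto simp: cube_def)
      moreover have "(x - q) $ i = x $ i - q $ i" by simp
      ultimately show ?thesis by linarith
    qed
    then have "(\<Sum>i\<in>UNIV. \<bar>(x - q) $ i\<bar>) \<le> (\<Sum>i\<in>(UNIV::'n set). 2 * R)" by (intro sum_mono) auto
    then show ?thesis using norm_le_l1_cart[of "x - q"] by simp
  qed
  have cmp: "\<bar>(x - q) $ i\<bar> < R" if "x \<in> ball q R" for x R i
    using that component_le_norm_cart[of "x - q" i] by (simp add: dist_norm norm_minus_commute)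
  show thesis
  proof (cases "open V")
    case True
    then obtain r where r: "r > 0" "ball q r \<subseteq> V" using q openE by blast
    define R0 where "R0 = r / (4 * real CARD('n))"
    show thesis
    proof (rule that[of R0 "\<chi> i. 1"])
      show "0 < R0" using r by (simp add: R0_def)
      fix R :: real assume R: "0 < R"
      show "V \<inter> ball q R \<subseteq> cube (q - R *\<^sub>R (\<chi> i. 1)) (2 * R)"
      proof
        fix x assume "x \<in> V \<inter> ball q R"
        then have *: "\<bar>x $ i - q $ i\<bar> < R" for i using cmp[of x R i] by simp
        have "q $ i - R \<le> x $ i \<and> x $ i \<le> q $ i - R + 2 * R" for i using *[of i] by linarith
        then show "x \<in> cube (q - R *\<^sub>R (\<chi> i. 1)) (2 * R)" by (simp add: cube_def)
      qed
      assume "R \<le> R0"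
      then have "2 * real CARD('n) * R \<le> r / 2" using r by (simp add: R0_def field_simps)
      then show "cube (q - R *\<^sub>R (\<chi> i. 1)) (2 * R) \<subseteq> V"
        using near[of _ R "\<chi> i. 1"] R r by (force simp: dist_norm norm_minus_commute)
    qed (use near in auto)
  next
    case False
    then obtain k X where X: "open X" "V = {y. 0 \<le> y $ k} \<inter> X" using V unfolding model_open_def openin_open by blast
    obtain r where r: "r > 0" "ball q r \<subseteq> X" using q X openE by blast
    have qk: "0 \<le> q $ k" using q X by auto
    define R1 where "R1 = r / (4 * real CARD('n))"
    define R0 where "R0 = (if q $ k = 0 then R1 else min R1 (q $ k))"
    define e :: "real ^ 'n" where "e = (\<chi> i. if i = k \<and> q $ k = 0 then 0 else 1)"
    have e: "0 \<le> e $ i \<and> e $ i \<le> 1" for i by (simp add: e_def)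
    show thesis
    proof (rule that[of R0 e])
      show "0 < R0" using r qk by (simp add: R0_def R1_def)
      fix R :: real assume R: "0 < R"
      show "V \<inter> ball q R \<subseteq> cube (q - R *\<^sub>R e) (2 * R)"
      proof
        fix x assume x: "x \<in> V \<inter> ball q R"
        then have *: "\<bar>x $ i - q $ i\<bar> < R" for i using cmp[of x R i] by simp
        have xk: "0 \<le> x $ k" using x X by auto
        have "(q - R *\<^sub>R e) $ i \<le> x $ i \<and> x $ i \<le> (q - R *\<^sub>R e) $ i + 2 * R" for i
        proof (cases "i = k \<and> q $ k = 0")
          case True
          then show ?thesis using *[of i] xk R by (simp add: e_def)
        next
          case False
          then have "e $ i = 1" by (auto simp: e_def)
          then have "(q - R *\<^sub>R e) $ i = q $ i - R" by simp
          then show ?thesis using *[of i] by linarith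
        qed
        then show "x \<in> cube (q - R *\<^sub>R e) (2 * R)" by (simp add: cube_def)
      qed
      assume RR: "R \<le> R0"
      then have RR1: "R \<le> R1" by (auto simp: R0_def split: if_splits)
      then have "2 * real CARD('n) * R \<le> r / 2" using r by (simp add: R1_def field_simps)
      then have 1: "cube (q - R *\<^sub>R e) (2 * R) \<subseteq> X"
        using near[OF _ R e] r by (force simp: dist_norm norm_minus_commute)
      have "0 \<le> (q - R *\<^sub>R e) $ k" using RR R qk by (auto simp: e_def R0_def split: if_splits)
      moreover have "(q - R *\<^sub>R e) $ k \<le> x $ k" if "x \<in> cube (q - R *\<^sub>R e) (2 * R)" for x
        using that unfolding cube_def by blast
      ultimately have "cube (q - R *\<^sub>R e) (2 * R) \<subseteq> {y. 0 \<le> y $ k}" using order_trans by blast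
      then show "cube (q - R *\<^sub>R e) (2 * R) \<subseteq> V" using 1 X by auto
    qed (use e near in auto)
  qed
qed

locale weighted_setting = hermitian_bundle A T \<pi> ip \<Gamma> g
  for A :: "('m::{t2_space, second_countable_topology}, 'n::finite) chart set"
    and T :: "('m, 'e, 'r::finite) triv set" and \<pi> and ip
    and \<Gamma> :: "('m, 'e, 'r) triv \<Rightarrow> ('m, 'n) chart \<Rightarrow> 'm \<Rightarrow> 'n \<Rightarrow> real ^ 'r ^ 'r"
    and g +
  fixes dv :: "'m measure"
  assumes vol: "riemannian_volume A g dv"
    and Lp: "connection_Lp_loc (n_star CARD('n)) A T \<Gamma>" and dim2: "2 \<le> CARD('n)"
begin

lemma sets_dv [simp, measurable_cong]: "sets dv = sets borel"
  using vol by (simp add: riemannian_volume_def)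

lemma space_dv [simp]: "space dv = UNIV"
  using sets_eq_imp_space_eq[OF sets_dv] by simp

definition dens :: "('m, 'n) chart \<Rightarrow> real ^ 'n \<Rightarrow> real" where
  "dens c q = sqrt (det (g c (cinv c q)))"

lemma emeasure_chart: "c \<in> A \<Longrightarrow> B \<in> sets borel \<Longrightarrow> B \<subseteq> fst c \<Longrightarrow>
    emeasure dv B = (\<integral>\<^sup>+q\<in>snd c ` B. ennreal (dens c q) \<partial>lborel)"
  using vol unfolding riemannian_volume_def dens_def by blast

lemma chart_range_borel: "c \<in> A \<Longrightarrow> snd c ` fst c \<in> sets borel"
proof -
  assume "c \<in> A"
  from chart_model[OF this] show ?thesis
    unfolding model_open_def
  proof (elim disjE exE)
    fix k assume "openin (top_of_set {y. 0 \<le> y $ k}) (snd c ` fst c)"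
    moreover have "closed {y :: real ^ 'n. 0 \<le> y $ k}" by (intro closed_Collect_le continuous_intros)
    ultimately show ?thesis unfolding openin_open by auto
  qed auto
qed

lemma cinv_measurable: "c \<in> A \<Longrightarrow> cinv c \<in> borel_measurable (restrict_space borel (snd c ` fst c))"
  by (rule borel_measurable_continuous_on_restrict[OF cinv_cont])

lemma chart_image_borel:
  assumes c: "c \<in> A" and B: "B \<in> sets borel" "B \<subseteq> fst c"
  shows "snd c ` B \<in> sets borel"
proof -
  have "cinv c -` B \<inter> snd c ` fst c \<in> sets (restrict_space borel (snd c ` fst c))"
    using measurable_sets[OF cinv_measurable[OF c] B(1)] by (simp add: space_restrict_space)
  then have "cinv c -` B \<inter> snd c ` fst c \<in> sets borel"
    using chart_range_borel[OF c] by (simp add: sets_restrict_space_iff)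
  moreover have "cinv c -` B \<inter> snd c ` fst c = snd c ` B" using c B by force
  ultimately show ?thesis by simp
qed

lemma pullback_measurable:
  fixes f :: "'m \<Rightarrow> ennreal"
  assumes c: "c \<in> A" and f: "f \<in> borel_measurable borel"
  shows "(\<lambda>q. f (cinv c q) * indicator (snd c ` fst c) q) \<in> borel_measurable borel"
  using measurable_compose[OF cinv_measurable[OF c] f] chart_range_borel[OF c]
  by (simp add: borel_measurable_restrict_space_iff_ennreal)

lemma dens_cont: "c \<in> A \<Longrightarrow> continuous_on (snd c ` fst c) (dens c)"
proof -
  assume c: "c \<in> A"
  have "continuous_on (snd c ` fst c) (\<lambda>q. g c (cinv c q))"
    by (rule continuous_on_compose2[OF metric_cont[OF c] cinv_cont[OF c]]) (use c in auto)
  then show ?thesis unfolding dens_def det_def by (intro continuous_intros)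
qed

lemma dens_pos: "c \<in> A \<Longrightarrow> q \<in> snd c ` fst c \<Longrightarrow> 0 < dens c q"
  unfolding dens_def by (intro real_sqrt_gt_zero pos_def_det metric_pos_def cinv_in)

lemma nn_integral_chart:
  fixes f :: "'m \<Rightarrow> ennreal"
  assumes c: "c \<in> A" and f: "f \<in> borel_measurable borel"
  shows "(\<integral>\<^sup>+p\<in>fst c. f p \<partial>dv) = (\<integral>\<^sup>+q\<in>snd c ` fst c. (f (cinv c q) * ennreal (dens c q)) \<partial>lborel)"
proof -
  let ?V = "snd c ` fst c"
  obtain p0 :: 'm where True by simp
  define ci where "ci q = (if q \<in> ?V then cinv c q else p0)" for q
  define d where "d q = ennreal (if q \<in> ?V then dens c q else 0)" for q
  have Vm [measurable]: "?V \<in> sets borel" by (rule chart_range_borel[OF c])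
  have Um [measurable]: "fst c \<in> sets borel" using chart_open[OF c] by simp
  have cim [measurable]: "ci \<in> borel_measurable borel" unfolding ci_def
    by (rule borel_measurable_continuous_on_if) (use Vm cinv_cont[OF c] in auto)
  have "(\<lambda>q. if q \<in> ?V then dens c q else 0) \<in> borel_measurable borel"
    by (rule borel_measurable_continuous_on_if) (use Vm dens_cont[OF c] in auto)
  then have dm [measurable]: "d \<in> borel_measurable borel" unfolding d_def by simp
  have "density dv (indicator (fst c)) = distr (density lborel d) borel ci"
  proof (rule measure_eqI)
    fix B assume "B \<in> sets (density dv (indicator (fst c)))"
    then have B [measurable]: "B \<in> sets borel" by simp
    have BU: "B \<inter> fst c \<in> sets borel" by measurable
    have "emeasure (density dv (indicator (fst c))) B = (\<integral>\<^sup>+p. indicator (fst c) p * indicator B p \<partial>dv)"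
      by (rule emeasure_density) simp_all
    also have "\<dots> = (\<integral>\<^sup>+p. indicator (B \<inter> fst c) p \<partial>dv)"
      by (rule nn_integral_cong) (auto simp: indicator_def)
    also have "\<dots> = emeasure dv (B \<inter> fst c)" by (rule nn_integral_indicator) (use BU in simp)
    also have "\<dots> = (\<integral>\<^sup>+q\<in>snd c ` (B \<inter> fst c). ennreal (dens c q) \<partial>lborel)"
      by (rule emeasure_chart[OF c BU]) auto
    also have "\<dots> = (\<integral>\<^sup>+q\<in>ci -` B. d q \<partial>lborel)"
    proof (intro nn_integral_cong)
      fix q
      have "q \<in> snd c ` (B \<inter> fst c) \<longleftrightarrow> q \<in> ?V \<and> ci q \<in> B" using c by (auto simp: ci_def)
      then show "ennreal (dens c q) * indicator (snd c ` (B \<inter> fst c)) q = d q * indicator (ci -` B) q"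
        by (auto simp: d_def indicator_def)
    qed
    also have "\<dots> = emeasure (distr (density lborel d) borel ci) B"
      using measurable_sets_borel[OF cim B] by (simp add: emeasure_distr emeasure_density)
    finally show "emeasure (density dv (indicator (fst c))) B = emeasure (distr (density lborel d) borel ci) B" .
  qed simp
  then have "(\<integral>\<^sup>+p. f p \<partial>density dv (indicator (fst c))) = (\<integral>\<^sup>+p. f p \<partial>distr (density lborel d) borel ci)" by simp
  moreover have "(\<integral>\<^sup>+p. f p \<partial>density dv (indicator (fst c))) = (\<integral>\<^sup>+p\<in>fst c. f p \<partial>dv)"
    by (subst nn_integral_density) (use f in \<open>auto simp: mult.commute measurable_cong_sets[OF sets_dv refl]\<close>)
  moreover have "(\<integral>\<^sup>+p. f p \<partial>distr (density lborel d) borel ci) = (\<integral>\<^sup>+q. d q * f (ci q) \<partial>lborel)"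
    using f by (subst nn_integral_distr) (auto simp: nn_integral_density)
  moreover have "(\<integral>\<^sup>+q. d q * f (ci q) \<partial>lborel) = (\<integral>\<^sup>+q\<in>?V. (f (cinv c q) * ennreal (dens c q)) \<partial>lborel)"
    by (intro nn_integral_cong) (auto simp: d_def ci_def mult.commute)
  ultimately show ?thesis by simp
qed

lemma AE_chart:
  assumes c: "c \<in> A" and ae: "AE q in lborel. q \<in> snd c ` fst c \<longrightarrow> P (cinv c q)"
  shows "AE p in dv. p \<in> fst c \<longrightarrow> P p"
proof -
  obtain N where N: "N \<in> null_sets lborel" "{q. \<not> (q \<in> snd c ` fst c \<longrightarrow> P (cinv c q))} \<subseteq> N"
    using ae unfolding eventually_ae_filter by auto
  define B where "B = {p \<in> fst c. snd c p \<in> N}"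
  have cm: "snd c \<in> borel_measurable (restrict_space borel (fst c))"
    by (rule borel_measurable_continuous_on_restrict[OF chart_cont[OF c]])
  have Nb: "N \<in> sets borel" using N(1) by auto
  have "snd c -` N \<inter> fst c \<in> sets (restrict_space borel (fst c))"
    using measurable_sets[OF cm Nb] by (simp add: space_restrict_space)
  then have "snd c -` N \<inter> fst c \<in> sets borel" using chart_open[OF c] by (simp add: sets_restrict_space_iff)
  moreover have "snd c -` N \<inter> fst c = B" by (auto simp: B_def)
  ultimately have Bm: "B \<in> sets borel" by simp
  have sub: "snd c ` B \<subseteq> N" by (auto simp: B_def)
  have "emeasure dv B = (\<integral>\<^sup>+q\<in>snd c ` B. ennreal (dens c q) \<partial>lborel)" by (rule emeasure_chart[OF c Bm]) (auto simp: B_def)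
  also have "\<dots> = (\<integral>\<^sup>+(q :: real ^ 'n). 0 \<partial>lborel)"
  proof (rule nn_integral_cong_AE)
    have "AE q in lborel. q \<notin> N" using N(1) by (rule AE_not_in)
    then show "AE q in lborel. ennreal (dens c q) * indicator (snd c ` B) q = 0"
      by eventually_elim (use sub in \<open>auto simp: indicator_def\<close>)
  qed
  finally have "B \<in> null_sets dv" using Bm by (intro null_setsI) auto
  moreover have "{p \<in> space dv. \<not> (p \<in> fst c \<longrightarrow> P p)} \<subseteq> B" using N(2) c by (force simp: B_def)
  ultimately show ?thesis by (rule AE_I'[rotated 1, rotated -1])
qed

lemma compact_chart_image: "c \<in> A \<Longrightarrow> compact Q \<Longrightarrow> Q \<subseteq> snd c ` fst c \<Longrightarrow> compact (cinv c ` Q)"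
  by (rule compact_continuous_image[OF continuous_on_subset[OF cinv_cont]])

text \<open>
  On compact sets the volume and the Lebesgue measure of the chart are comparable, since the density is
  continuous and positive.
\<close>

lemma nn_integral_compact_le:
  fixes f :: "'m \<Rightarrow> ennreal"
  assumes c: "c \<in> A" and Q: "compact Q" "Q \<subseteq> snd c ` fst c"
  obtains k where "0 < k"
    "\<And>f. f \<in> borel_measurable borel \<Longrightarrow> (\<integral>\<^sup>+q\<in>Q. f (cinv c q) \<partial>lborel) \<le> ennreal k * (\<integral>\<^sup>+p\<in>cinv c ` Q. f p \<partial>dv)"
    "\<And>f. f \<in> borel_measurable borel \<Longrightarrow> (\<integral>\<^sup>+p\<in>cinv c ` Q. f p \<partial>dv) \<le> ennreal k * (\<integral>\<^sup>+q\<in>Q. f (cinv c q) \<partial>lborel)"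
proof -
  have dc: "continuous_on Q (dens c)" by (rule continuous_on_subset[OF dens_cont[OF c] Q(2)])
  have dp: "\<And>q. q \<in> Q \<Longrightarrow> 0 < dens c q" using dens_pos[OF c] Q by auto
  obtain m1 :: real where m1: "0 \<le> m1" "\<And>q. q \<in> Q \<Longrightarrow> \<bar>dens c q\<bar> \<le> m1"
    by (rule compact_family_bound[OF Q(1), of "\<lambda>_::bool. dens c"]) (use dc in \<open>auto dest: that\<close>)
  have ic: "continuous_on Q (\<lambda>q. inverse (dens c q))"
    by (rule continuous_on_inverse[OF dc]) (use dp in force)
  obtain m2 :: real where m2: "0 \<le> m2" "\<And>q. q \<in> Q \<Longrightarrow> \<bar>inverse (dens c q)\<bar> \<le> m2"
    by (rule compact_family_bound[OF Q(1), of "\<lambda>_::bool. (\<lambda>q. inverse (dens c q))"])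
      (use ic in \<open>auto dest: that\<close>)
  define k where "k = m1 + m2 + 1"
  have k: "k > 0" using m1 m2 by (simp add: k_def)
  have dk: "dens c q \<le> k" "1 \<le> k * dens c q" if "q \<in> Q" for q
  proof -
    show "dens c q \<le> k" using m1(2)[OF that] m2(1) by (simp add: k_def)
    have "inverse (dens c q) \<le> k" unfolding k_def using order_trans[OF abs_ge_self m2(2)[OF that]] m1(1) by linarith
    then have "inverse (dens c q) * dens c q \<le> k * dens c q" using dp[OF that] by (intro mult_right_mono) auto
    then show "1 \<le> k * dens c q" using dp[OF that] by simp
  qed
  have Km [measurable]: "cinv c ` Q \<in> sets borel" using compact_chart_image[OF c Q] by (simp add: compact_imp_closed borel_closed)
  have eq: "(\<integral>\<^sup>+p\<in>cinv c ` Q. f p \<partial>dv) = (\<integral>\<^sup>+q\<in>Q. (f (cinv c q) * ennreal (dens c q)) \<partial>lborel)"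
    if f: "f \<in> borel_measurable borel" for f :: "'m \<Rightarrow> ennreal"
  proof -
    have "(\<integral>\<^sup>+p\<in>cinv c ` Q. f p \<partial>dv) = (\<integral>\<^sup>+p\<in>fst c. (f p * indicator (cinv c ` Q) p) \<partial>dv)"
      using Q c by (intro nn_integral_cong) (auto simp: indicator_def)
    also have "\<dots> = (\<integral>\<^sup>+q\<in>snd c ` fst c. (f (cinv c q) * indicator (cinv c ` Q) (cinv c q) * ennreal (dens c q)) \<partial>lborel)"
    proof (rule nn_integral_chart[OF c])
      show "(\<lambda>p. f p * indicator (cinv c ` Q) p) \<in> borel_measurable borel" using f Km by simp
    qed
    also have "\<dots> = (\<integral>\<^sup>+q\<in>Q. (f (cinv c q) * ennreal (dens c q)) \<partial>lborel)"
    proof (intro nn_integral_cong)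
      fix q
      have "cinv c q \<in> cinv c ` Q \<longleftrightarrow> q \<in> Q" if "q \<in> snd c ` fst c"
      proof
        assume "cinv c q \<in> cinv c ` Q"
        then obtain q' where "q' \<in> Q" "cinv c q = cinv c q'" by blast
        then show "q \<in> Q" using chart_cinv[OF c that] chart_cinv[OF c, of q'] Q(2) by auto
      qed auto
      then show "f (cinv c q) * indicator (cinv c ` Q) (cinv c q) * ennreal (dens c q) * indicator (snd c ` fst c) q
          = f (cinv c q) * ennreal (dens c q) * indicator Q q"
        using Q by (auto simp: indicator_def)
    qed
    finally show ?thesis .
  qed
  have Qm [measurable]: "Q \<in> sets borel" using Q by (simp add: compact_imp_closed borel_closed)
  have fm: "(\<lambda>q. f (cinv c q) * indicator Q q) \<in> borel_measurable borel" if "f \<in> borel_measurable borel" for f :: "'m \<Rightarrow> ennreal"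
  proof -
    have "(\<lambda>q. f (cinv c q) * indicator (snd c ` fst c) q * indicator Q q) \<in> borel_measurable borel"
      using pullback_measurable[OF c that] by measurable
    also have "(\<lambda>q. f (cinv c q) * indicator (snd c ` fst c) q * indicator Q q) = (\<lambda>q. f (cinv c q) * indicator Q q)"
      using Q by (intro ext) (auto simp: indicator_def)
    finally show ?thesis .
  qed
  have dm: "(\<lambda>q. ennreal (dens c q) * indicator Q q) \<in> borel_measurable borel"
  proof -
    have "(\<lambda>q. if q \<in> Q then dens c q else 0) \<in> borel_measurable borel"
      by (rule borel_measurable_continuous_on_if) (use dc Qm in auto)
    then have "(\<lambda>q. ennreal (if q \<in> Q then dens c q else 0)) \<in> borel_measurable borel" by simp
    also have "(\<lambda>q. ennreal (if q \<in> Q then dens c q else 0)) = (\<lambda>q. ennreal (dens c q) * indicator Q q)" by (auto simp: indicator_def)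
    finally show ?thesis .
  qed
  show thesis
  proof (rule that[OF k])
    fix f :: "'m \<Rightarrow> ennreal" assume f: "f \<in> borel_measurable borel"
    have "(\<lambda>q. (f (cinv c q) * indicator Q q) * (ennreal (dens c q) * indicator Q q)) \<in> borel_measurable borel"
      using fm[OF f] dm by measurable
    also have "(\<lambda>q. (f (cinv c q) * indicator Q q) * (ennreal (dens c q) * indicator Q q)) = (\<lambda>q. f (cinv c q) * ennreal (dens c q) * indicator Q q)"
      by (auto simp: indicator_def)
    finally have m: "(\<lambda>q. f (cinv c q) * ennreal (dens c q) * indicator Q q) \<in> borel_measurable borel" .
    have "(\<integral>\<^sup>+q\<in>Q. f (cinv c q) \<partial>lborel) \<le> (\<integral>\<^sup>+q. ennreal k * (f (cinv c q) * ennreal (dens c q) * indicator Q q) \<partial>lborel)"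
    proof (intro nn_integral_mono)
      fix q
      show "f (cinv c q) * indicator Q q \<le> ennreal k * (f (cinv c q) * ennreal (dens c q) * indicator Q q)"
      proof (cases "q \<in> Q")
        case True
        have "f (cinv c q) * 1 \<le> f (cinv c q) * ennreal (k * dens c q)"
          by (intro mult_left_mono) (use dk(2)[OF True] in \<open>auto simp: ennreal_1[symmetric] simp del: ennreal_1 intro: ennreal_leI\<close>)
        then show ?thesis using True k dp[OF True] by (simp add: ennreal_mult mult_ac)
      qed simp
    qed
    also have "\<dots> = ennreal k * (\<integral>\<^sup>+p\<in>cinv c ` Q. f p \<partial>dv)" unfolding eq[OF f] using m by (intro nn_integral_cmult) simp
    finally show "(\<integral>\<^sup>+q\<in>Q. f (cinv c q) \<partial>lborel) \<le> ennreal k * (\<integral>\<^sup>+p\<in>cinv c ` Q. f p \<partial>dv)" .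
    have "(\<integral>\<^sup>+p\<in>cinv c ` Q. f p \<partial>dv) \<le> (\<integral>\<^sup>+q. ennreal k * (f (cinv c q) * indicator Q q) \<partial>lborel)"
      unfolding eq[OF f]
    proof (intro nn_integral_mono)
      fix q
      show "f (cinv c q) * ennreal (dens c q) * indicator Q q \<le> ennreal k * (f (cinv c q) * indicator Q q)"
      proof (cases "q \<in> Q")
        case True
        have "ennreal (dens c q) * f (cinv c q) \<le> ennreal k * f (cinv c q)"
          by (intro mult_right_mono ennreal_leI dk(1)[OF True]) simp
        then show ?thesis using True by (simp add: mult.commute)
      qed simp
    qed
    also have "\<dots> = ennreal k * (\<integral>\<^sup>+q\<in>Q. f (cinv c q) \<partial>lborel)" using fm[OF f] by (intro nn_integral_cmult) simp
    finally show "(\<integral>\<^sup>+p\<in>cinv c ` Q. f p \<partial>dv) \<le> ennreal k * (\<integral>\<^sup>+q\<in>Q. f (cinv c q) \<partial>lborel)" .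
  qed
qed

end

section \<open>Propagation of control\<close>

text \<open>
  The constant is first moved to the measurable side. In the application \<open>D\<close> is \<open>|\<nabla>u|\<^sup>2\<close>,
  which is measurable for the completed measure only, as the connection coefficients are, and a
  constant cannot be pulled out of its integral directly.
\<close>

lemma nn_integral_le_cmult_AE:
  assumes [measurable]: "h \<in> borel_measurable M" and C: "0 < C" and ae: "AE p in M. h p \<le> ennreal C * D p"
  shows "(\<integral>\<^sup>+p. h p \<partial>M) \<le> ennreal C * (\<integral>\<^sup>+p. D p \<partial>M)"
proof -
  have one: "ennreal C * ennreal (1 / C) = 1" using C by (simp add: ennreal_mult[symmetric])
  have "(\<integral>\<^sup>+p. h p \<partial>M) = ennreal C * (\<integral>\<^sup>+p. ennreal (1 / C) * h p \<partial>M)"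
  proof -
    have "(\<integral>\<^sup>+p. ennreal (1 / C) * h p \<partial>M) = ennreal (1 / C) * (\<integral>\<^sup>+p. h p \<partial>M)" by (rule nn_integral_cmult) simp
    then show ?thesis by (simp only: mult.assoc[symmetric] one mult_1)
  qed
  also have "(\<integral>\<^sup>+p. ennreal (1 / C) * h p \<partial>M) \<le> (\<integral>\<^sup>+p. D p \<partial>M)"
  proof (rule nn_integral_mono_AE)
    show "AE p in M. ennreal (1 / C) * h p \<le> D p" using ae
    proof eventually_elim
      case (elim p)
      have "ennreal (1 / C) * h p \<le> ennreal (1 / C) * (ennreal C * D p)" by (intro mult_left_mono elim) simp
      also have "\<dots> = (ennreal C * ennreal (1 / C)) * D p" by (simp only: mult_ac)
      also have "\<dots> = D p" by (simp only: one mult_1)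
      finally show ?case .
    qed
  qed
  finally show ?thesis by (simp add: mult_left_mono)
qed

lemma power_sum_bound:
  fixes x :: "'i \<Rightarrow> real"
  assumes I: "finite I" and x: "\<And>i. i \<in> I \<Longrightarrow> 0 \<le> x i" and s: "real n \<le> s" and n: "0 < n"
  shows "(1 + (\<Sum>i\<in>I. x i)) ^ n \<le> (1 + real (card I)) ^ n * (1 + (\<Sum>i\<in>I. 1 + x i powr s))"
proof -
  define M where "M = Max (insert 1 (x ` I))"
  have fin: "finite (insert 1 (x ` I))" using I by simp
  have M1: "1 \<le> M" unfolding M_def by (rule Max_ge[OF fin]) simp
  have xM: "x i \<le> M" if "i \<in> I" for i unfolding M_def by (rule Max_ge[OF fin]) (use that in simp)
  have "1 + (\<Sum>i\<in>I. x i) \<le> M + (\<Sum>i\<in>I. M)" by (intro add_mono M1 sum_mono xM)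
  also have "\<dots> = (1 + real (card I)) * M" by (simp add: algebra_simps)
  finally have "(1 + (\<Sum>i\<in>I. x i)) ^ n \<le> ((1 + real (card I)) * M) ^ n"
    by (intro power_mono) (auto intro!: add_nonneg_nonneg sum_nonneg x)
  also have "\<dots> = (1 + real (card I)) ^ n * M ^ n" by (rule power_mult_distrib)
  also have "M ^ n \<le> 1 + (\<Sum>i\<in>I. 1 + x i powr s)"
  proof -
    have nn: "0 \<le> (\<Sum>i\<in>I. 1 + x i powr s)" by (intro sum_nonneg) auto
    have "M \<in> insert 1 (x ` I)" unfolding M_def by (rule Max_in[OF fin]) simp
    then consider "M = 1" | i where "i \<in> I" "M = x i" by auto
    then show ?thesis
    proof cases
      case 1 then show ?thesis using nn by simp
    next
      case (2 i)
      have "M ^ n = M powr real n" using M1 by (simp add: powr_realpow)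
      also have "\<dots> \<le> M powr s" using M1 s by (intro powr_mono) auto
      also have "\<dots> \<le> 1 + x i powr s" using 2 by simp
      also have "\<dots> \<le> (\<Sum>i\<in>I. 1 + x i powr s)" by (rule member_le_sum) (use 2 I in auto)
      finally show ?thesis by simp
    qed
  qed
  finally show ?thesis by (simp add: mult_left_mono)
qed

lemma n_star_ge: "real n \<le> n_star n"
  by (simp add: n_star_def field_simps)

context weighted_setting
begin

text \<open>
  A Borel version of the potential. Local integrability of the coefficients to the power \<open>n\<^sup>*\<close>
  with \<open>n\<^sup>* \<ge> n\<close> makes its \<open>n\<close>-th power integrable.
\<close>

lemma potential_borel:
  assumes c: "c \<in> A" and t: "t \<in> T" and Q: "compact Q" "Q \<subseteq> snd c ` (fst c \<inter> fst t)" and C: "0 \<le> C"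
  obtains \<gamma> :: "real ^ 'n \<Rightarrow> real" where "\<gamma> \<in> borel_measurable borel" "\<And>q. 0 \<le> \<gamma> q"
    "AE q in lborel. q \<in> Q \<longrightarrow> \<gamma> q = C * (1 + (\<Sum>i\<in>UNIV. norm (\<Gamma> t c (cinv c q) i)))"
    "(\<integral>\<^sup>+q\<in>Q. ennreal (\<gamma> q ^ CARD('n)) \<partial>lborel) < top"
proof -
  let ?S = "snd c ` (fst c \<inter> fst t)" and ?s = "n_star CARD('n)" and ?n = "CARD('n)"
  define G where "G i q = norm (\<Gamma> t c (cinv c q) i)" for i q
  have QV: "Q \<subseteq> snd c ` fst c" using Q by auto
  have QK: "snd c ` (cinv c ` Q) = Q" using QV c by (force simp: image_image)
  have KK: "compact (cinv c ` Q)" "cinv c ` Q \<subseteq> fst c \<inter> fst t"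
    using compact_chart_image[OF c Q(1) QV] Q(2) c by auto
  have L: "set_borel_measurable lebesgue ?S (\<lambda>q. \<Gamma> t c (cinv c q) i)"
    "set_integrable lebesgue Q (\<lambda>q. G i q powr ?s)" for i
    using Lp c t KK QK unfolding connection_Lp_loc_def G_def by metis+
  have Qm [measurable]: "Q \<in> sets borel" using Q by (simp add: compact_imp_closed borel_closed)
  have QmL: "Q \<in> sets lebesgue" by (rule sets_completionI_sets) simp
  have Gm: "(\<lambda>q. indicator Q q * G i q) \<in> borel_measurable lebesgue" for i
  proof -
    have "(\<lambda>q. indicator Q q * norm (indicator ?S q *\<^sub>R \<Gamma> t c (cinv c q) i)) \<in> borel_measurable lebesgue"
      using measurable_compose[OF L(1)[of i, unfolded set_borel_measurable_def] borel_measurable_norm] QmL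
      by (intro borel_measurable_times borel_measurable_indicator)
    also have "(\<lambda>q. indicator Q q * norm (indicator ?S q *\<^sub>R \<Gamma> t c (cinv c q) i)) = (\<lambda>q. indicator Q q * G i q)"
      using Q(2) by (intro ext) (auto simp: indicator_def G_def)
    finally show ?thesis .
  qed
  define \<gamma>1 where "\<gamma>1 q = C * (indicator Q q + (\<Sum>i\<in>UNIV. indicator Q q * G i q))" for q
  have m1: "\<gamma>1 \<in> borel_measurable lebesgue"
  proof -
    have s: "(\<lambda>q. \<Sum>i\<in>UNIV. indicator Q q * G i q) \<in> borel_measurable lebesgue"
      by (rule borel_measurable_sum) (rule Gm)
    show ?thesis unfolding \<gamma>1_def
      by (rule borel_measurable_times[OF borel_measurable_const borel_measurable_add[OF borel_measurable_indicator[OF QmL] s]])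
  qed
  obtain \<gamma>2 where \<gamma>2: "\<gamma>2 \<in> borel_measurable lborel" "AE q in lborel. \<gamma>1 q = \<gamma>2 q"
    using completion_ex_borel_measurable_real[OF m1] by blast
  have \<gamma>1: "\<gamma>1 q = C * (1 + (\<Sum>i\<in>UNIV. G i q))" "0 \<le> \<gamma>1 q" if "q \<in> Q" for q
    using that C by (auto simp: \<gamma>1_def G_def intro!: mult_nonneg_nonneg add_nonneg_nonneg sum_nonneg)
  define B where "B = C ^ ?n * (1 + real ?n) ^ ?n"
  have B0: "0 \<le> B" using C by (simp add: B_def)
  have eq: "(\<integral>\<^sup>+q\<in>Q. ennreal (\<bar>\<gamma>2 q\<bar> ^ ?n) \<partial>lborel) = (\<integral>\<^sup>+q\<in>Q. ennreal (\<gamma>1 q ^ ?n) \<partial>lborel)"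
  proof (rule nn_integral_cong_AE)
    show "AE q in lborel. ennreal (\<bar>\<gamma>2 q\<bar> ^ ?n) * indicator Q q = ennreal (\<gamma>1 q ^ ?n) * indicator Q q"
      using \<gamma>2(2)
    proof eventually_elim
      case (elim q)
      then show ?case using \<gamma>1(2)[of q] by (cases "q \<in> Q") auto
    qed
  qed
  have "(\<integral>\<^sup>+q\<in>Q. ennreal (\<gamma>1 q ^ ?n) \<partial>lborel) = (\<integral>\<^sup>+q\<in>Q. ennreal (\<gamma>1 q ^ ?n) \<partial>lebesgue)"
    by (rule nn_integral_completion[symmetric])
  also have "\<dots> \<le> (\<integral>\<^sup>+q. ennreal (norm (indicator Q q *\<^sub>R (B * (1 + (\<Sum>i\<in>UNIV. 1 + G i q powr ?s))))) \<partial>lebesgue)"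
  proof (intro nn_integral_mono)
    fix q
    show "ennreal (\<gamma>1 q ^ ?n) * indicator Q q \<le> ennreal (norm (indicator Q q *\<^sub>R (B * (1 + (\<Sum>i\<in>UNIV. 1 + G i q powr ?s)))))"
    proof (cases "q \<in> Q")
      case True
      have "\<gamma>1 q ^ ?n = C ^ ?n * (1 + (\<Sum>i\<in>UNIV. G i q)) ^ ?n" unfolding \<gamma>1(1)[OF True] by (rule power_mult_distrib)
      also have "\<dots> \<le> C ^ ?n * ((1 + real ?n) ^ ?n * (1 + (\<Sum>i\<in>UNIV. 1 + G i q powr ?s)))"
        by (intro mult_left_mono power_sum_bound n_star_ge) (use C in \<open>auto simp: G_def\<close>)
      finally have "\<gamma>1 q ^ ?n \<le> \<bar>B * (1 + (\<Sum>i\<in>UNIV. 1 + G i q powr ?s))\<bar>" by (simp add: B_def mult.assoc)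
      then show ?thesis using True by (simp add: ennreal_leI)
    qed simp
  qed
  also have "\<dots> < top"
  proof -
    have one: "set_integrable lebesgue Q (\<lambda>q. 1 :: real)"
    proof -
      have "Q \<in> lmeasurable" using Q(1) by (rule lmeasurable_compact)
      then show ?thesis unfolding set_integrable_def by (simp add: fmeasurable_def)
    qed
    have i1: "integrable lebesgue (\<lambda>q. indicator Q q :: real)" using one by (simp add: set_integrable_def)
    have i2: "integrable lebesgue (\<lambda>q. indicator Q q *\<^sub>R (G i q powr ?s))" for i using L(2)[of i] by (simp only: set_integrable_def)
    have "integrable lebesgue (\<lambda>q. B * (indicator Q q + (\<Sum>i\<in>UNIV. indicator Q q + indicator Q q *\<^sub>R (G i q powr ?s))))"
      by (intro integrable_mult_right Bochner_Integration.integrable_add Bochner_Integration.integrable_sum i1 i2)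
    also have "(\<lambda>q. B * (indicator Q q + (\<Sum>i\<in>UNIV. indicator Q q + indicator Q q *\<^sub>R (G i q powr ?s))))
       = (\<lambda>q. indicator Q q *\<^sub>R (B * (1 + (\<Sum>i\<in>UNIV. 1 + G i q powr ?s))))"
      by (intro ext) (simp add: indicator_def)
    finally have "set_integrable lebesgue Q (\<lambda>q. B * (1 + (\<Sum>i\<in>UNIV. 1 + G i q powr ?s)))"
      unfolding set_integrable_def .
    then show ?thesis unfolding set_integrable_def integrable_iff_bounded by simp
  qed
  finally have fin: "(\<integral>\<^sup>+q\<in>Q. ennreal (\<bar>\<gamma>2 q\<bar> ^ ?n) \<partial>lborel) < top" unfolding eq .
  show thesis
  proof (rule that[of "\<lambda>q. \<bar>\<gamma>2 q\<bar>"])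
    show "(\<lambda>q. \<bar>\<gamma>2 q\<bar>) \<in> borel_measurable borel" using \<gamma>2(1) by simp
    show "AE q in lborel. q \<in> Q \<longrightarrow> \<bar>\<gamma>2 q\<bar> = C * (1 + (\<Sum>i\<in>UNIV. norm (\<Gamma> t c (cinv c q) i)))"
      using \<gamma>2(2)
    proof eventually_elim
      case (elim q)
      then show ?case using \<gamma>1[of q] by (auto simp: G_def)
    qed
  qed (use fin in auto)
qed

text \<open>
  Small cubes at a point have small potential, by continuity from above of the finite measure with
  density \<open>h\<close>: the intersection of the cubes is the null set of the centre.
\<close>

lemma small_cube:
  fixes q e :: "real ^ 'n" and h :: "real ^ 'n \<Rightarrow> ennreal"
  assumes R0: "0 < R0" and e: "\<And>i. 0 \<le> e $ i \<and> e $ i \<le> 1"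
    and near: "\<And>R x. 0 < R \<Longrightarrow> x \<in> cube (q - R *\<^sub>R e) (2 * R) \<Longrightarrow> norm (x - q) \<le> 2 * real CARD('n) * R"
    and h [measurable]: "h \<in> borel_measurable borel" and fin: "(\<integral>\<^sup>+x\<in>cube (q - R0 *\<^sub>R e) (2 * R0). h x \<partial>lborel) < top"
    and eps: "0 < \<epsilon>"
  obtains R where "0 < R" "R \<le> R0" "(\<integral>\<^sup>+x\<in>cube (q - R *\<^sub>R e) (2 * R). h x \<partial>lborel) \<le> ennreal \<epsilon>"
proof -
  define r where "r k = R0 / real (Suc k)" for k
  define X where "X k = cube (q - r k *\<^sub>R e) (2 * r k)" for k
  have r: "0 < r k" "r k \<le> R0" for k using R0 by (auto simp: r_def divide_le_eq mult_le_cancel_left1)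
  have mono: "cube (q - a *\<^sub>R e) (2 * a) \<subseteq> cube (q - b *\<^sub>R e) (2 * b)" if ab: "a \<le> b" for a b
  proof
    fix x assume x: "x \<in> cube (q - a *\<^sub>R e) (2 * a)"
    have "q $ i - b * e $ i \<le> x $ i \<and> x $ i \<le> q $ i - b * e $ i + 2 * b" for i
    proof -
      have "q $ i - a * e $ i \<le> x $ i" "x $ i \<le> q $ i - a * e $ i + 2 * a" using x by (auto simp: cube_def)
      moreover have "(b - a) * e $ i \<le> b - a" "0 \<le> (b - a) * e $ i" using ab e[of i] by (auto simp: mult_left_le)
      moreover have "(b - a) * e $ i = b * e $ i - a * e $ i" by (rule left_diff_distrib)
      ultimately show ?thesis using ab by (intro conjI) linarith+
    qed
    then show "x \<in> cube (q - b *\<^sub>R e) (2 * b)" by (simp add: cube_def)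
  qed
  define N where "N = density lborel (\<lambda>x. h x * indicator (cube (q - R0 *\<^sub>R e) (2 * R0)) x)"
  have hm: "(\<lambda>x. h x * indicator (cube (q - R0 *\<^sub>R e) (2 * R0)) x) \<in> borel_measurable lborel" by measurable
  have XR: "X k \<subseteq> cube (q - R0 *\<^sub>R e) (2 * R0)" for k unfolding X_def by (rule mono[OF r(2)])
  have NX: "emeasure N (X k) = (\<integral>\<^sup>+x\<in>X k. h x \<partial>lborel)" for k
  proof -
    have "emeasure N (X k) = (\<integral>\<^sup>+x\<in>X k. (h x * indicator (cube (q - R0 *\<^sub>R e) (2 * R0)) x) \<partial>lborel)"
      unfolding N_def by (rule emeasure_density[OF hm]) (simp add: X_def)
    also have "\<dots> = (\<integral>\<^sup>+x\<in>X k. h x \<partial>lborel)"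
      using XR[of k] by (intro nn_integral_cong) (auto simp: indicator_def)
    finally show ?thesis .
  qed
  have "(\<lambda>k. emeasure N (X k)) \<longlonglongrightarrow> emeasure N (\<Inter>k. X k)"
  proof (rule Lim_emeasure_decseq)
    show "range X \<subseteq> sets N" by (auto simp: N_def X_def)
    show "decseq X" unfolding decseq_def X_def
    proof (intro allI impI mono)
      fix m n :: nat assume "m \<le> n" then show "r n \<le> r m" using R0 by (simp add: r_def frac_le)
    qed
    show "emeasure N (X k) \<noteq> \<infinity>" for k
    proof -
      have "emeasure N (X k) \<le> (\<integral>\<^sup>+x\<in>cube (q - R0 *\<^sub>R e) (2 * R0). h x \<partial>lborel)"
        unfolding NX using XR[of k] by (intro nn_integral_mono) (auto simp: indicator_def)
      then show ?thesis using fin by (auto simp: top_unique)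
    qed
  qed
  moreover have "emeasure N (\<Inter>k. X k) = 0"
  proof -
    have "(\<Inter>k. X k) \<subseteq> {q}"
    proof
      fix x assume x: "x \<in> (\<Inter>k. X k)"
      have n1: "norm (x - q) \<le> 2 * real CARD('n) * r k" for k using near[OF r(1)[of k]] x by (auto simp: X_def)
      have n2: "(\<lambda>k. 2 * real CARD('n) * r k) \<longlonglongrightarrow> 2 * real CARD('n) * 0"
        unfolding r_def by (intro tendsto_mult tendsto_const LIMSEQ_Suc[OF lim_const_over_n])
      have "norm (x - q) \<le> 2 * real CARD('n) * 0" by (rule LIMSEQ_le_const[OF n2]) (use n1 in blast)
      then show "x \<in> {q}" by simp
    qed
    then have "emeasure N (\<Inter>k. X k) \<le> emeasure N {q}" by (rule emeasure_mono) (simp add: N_def)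
    also have "emeasure N {q} = 0"
    proof -
      have "emeasure N {q} = (\<integral>\<^sup>+x\<in>{q}. (h x * indicator (cube (q - R0 *\<^sub>R e) (2 * R0)) x) \<partial>lborel)"
        unfolding N_def by (rule emeasure_density[OF hm]) simp
      also have "\<dots> = 0" by (rule nn_integral_null_set) (simp add: null_sets_def)
      finally show ?thesis .
    qed
    finally show ?thesis by simp
  qed
  ultimately have "(\<lambda>k. emeasure N (X k)) \<longlonglongrightarrow> 0" by simp
  then have "eventually (\<lambda>k. emeasure N (X k) < ennreal \<epsilon>) sequentially"
    by (rule order_tendstoD(2)) (use eps in simp)
  then obtain k where "emeasure N (X k) < ennreal \<epsilon>" by (auto simp: eventually_sequentially)
  then show thesis using that[of "r k"] r[of k] NX[of k] by (simp add: X_def less_imp_le)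
qed

definition admissible :: "('m \<Rightarrow> 'e) \<Rightarrow> bool" where
  "admissible u \<longleftrightarrow> C1_section_on A \<pi> T UNIV u \<and> compact (section_support ip u)"

definition energy :: "('m \<Rightarrow> 'e) \<Rightarrow> ennreal" where
  "energy u = (\<integral>\<^sup>+p. ennreal (nabla_norm_sq A g T \<pi> ip \<Gamma> u p) \<partial>dv)"

text \<open>
  An open set on which the inequality holds with a constant; the weight is assembled from these.
\<close>

definition controlled :: "'m set \<Rightarrow> bool" where
  "controlled U \<longleftrightarrow> open U \<and> (\<exists>C\<ge>0. \<forall>u. admissible u \<longrightarrow> (\<integral>\<^sup>+p\<in>U. ennreal (ip (u p) (u p)) \<partial>dv) \<le> ennreal C * energy u)"

lemma norm_sq_measurable: "C1_section_on A \<pi> T UNIV u \<Longrightarrow> (\<lambda>p. ip (u p) (u p)) \<in> borel_measurable borel"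
  by (rule borel_measurable_continuous_onI[OF norm_sq_cont])

lemma cube_compact: "compact (cube a r)" by (simp add: cube_eq_cbox)

lemma line_derivative:
  assumes u: "C1_section_on A \<pi> T UNIV u" and c: "c \<in> A" and Q: "cube a r \<subseteq> snd c ` fst c" and x: "x \<in> cube a r"
  shows "((\<lambda>t. ip (u (cinv c (updv x i t))) (u (cinv c (updv x i t)))) has_real_derivative
     cderiv c (\<lambda>p. ip (u p) (u p)) (cinv c x) (axis i 1)) (at (x $ i) within {a$i..a$i+r})"
proof -
  let ?F = "\<lambda>q. ip (u (cinv c q)) (u (cinv c q))" and ?V = "snd c ` fst c" and ?I = "{a$i..a$i+r}"
  let ?D = "cderiv c (\<lambda>p. ip (u p) (u p)) (cinv c x)"
  have xV: "x \<in> ?V" using x Q by auto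
  have xx: "snd c (cinv c x) = x" by (rule chart_cinv[OF c xV])
  have ux: "updv x i (x $ i) = x" by (simp add: updv_def vec_eq_iff)
  have "updv x i ` ?I \<subseteq> cube a r" using x by (auto simp: cube_def updv_def)
  then have sub: "updv x i ` ?I \<subseteq> ?V" using Q by auto
  have cd: "cdiff c (\<lambda>p. ip (u p) (u p)) (cinv c x)" by (rule norm_sq_cdiff[OF u c cinv_in[OF c xV]])
  have "(?F has_derivative ?D) (at x within ?V)" using cdiffD[OF cd] unfolding xx .
  then have "(?F has_derivative ?D) (at (updv x i (x $ i)) within updv x i ` ?I)"
    unfolding ux by (rule has_derivative_subset[OF _ sub])
  moreover have "(updv x i has_derivative (\<lambda>h. h *\<^sub>R axis i 1)) (at (x $ i) within ?I)"
  proof -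
    have eq: "updv x i = (\<lambda>t. x + (t - x $ i) *\<^sub>R axis i 1)" by (auto simp: updv_def vec_eq_iff axis_def)
    show ?thesis unfolding eq by (auto intro!: derivative_eq_intros)
  qed
  ultimately have "(?F \<circ> updv x i has_derivative ?D \<circ> (\<lambda>h. h *\<^sub>R axis i 1)) (at (x $ i) within ?I)"
    by (rule diff_chain_within[rotated])
  moreover have "?D \<circ> (\<lambda>h. h *\<^sub>R axis i 1) = (*) (?D (axis i 1))"
    using linear_cmul[OF cderiv_linear[OF cd]] by (auto simp: fun_eq_iff)
  ultimately show ?thesis by (simp add: has_field_derivative_def o_def)
qed

text \<open>
  Limit points of controlled sets lie in controlled sets. Choose a cube at \<open>p\<close> so small that the
  potential is small in \<open>L\<^sup>n\<close>. It meets a controlled set \<open>U\<close> near some point \<open>z\<close>, and halving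
  the cube towards \<open>z\<close> often enough ends inside \<open>U\<close>; so \<open>|u|\<^sup>2\<close> is controlled on the whole
  cube. The number of halvings, and with it the constant, depends on \<open>U\<close> but not on \<open>u\<close>.
\<close>

lemma controlled_step:
  assumes acc: "\<And>X. open X \<Longrightarrow> p \<in> X \<Longrightarrow> \<exists>U. controlled U \<and> U \<inter> X \<noteq> {}"
  shows "\<exists>U. controlled U \<and> p \<in> U"
proof -
  let ?n = "CARD('n)"
  obtain c where c: "c \<in> A" "p \<in> fst c" using charts_cover by blast
  obtain t where t: "t \<in> T" "p \<in> fst t" using trivs_cover by blast
  let ?S = "snd c ` (fst c \<inter> fst t)" and ?V = "snd c ` fst c"
  define q where "q = snd c p"
  have qS: "q \<in> ?S" using c t by (auto simp: q_def)
  have mS: "model_open ?S" by (rule chart_image_model[OF c(1) triv_open[OF t(1)]])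
  obtain e R0 where R0: "R0 > 0" and e: "\<And>i. 0 \<le> e $ i \<and> e $ i \<le> 1"
    and cS: "\<And>R. 0 < R \<Longrightarrow> R \<le> R0 \<Longrightarrow> cube (q - R *\<^sub>R e) (2 * R) \<subseteq> ?S"
    and cn: "\<And>R. 0 < R \<Longrightarrow> ?S \<inter> ball q R \<subseteq> cube (q - R *\<^sub>R e) (2 * R)"
    and near: "\<And>R x. 0 < R \<Longrightarrow> x \<in> cube (q - R *\<^sub>R e) (2 * R) \<Longrightarrow> norm (x - q) \<le> 2 * real CARD('n) * R"
    by (rule model_open_cubes[OF mS qS]) blast
  define Q0 where "Q0 = cube (q - R0 *\<^sub>R e) (2 * R0)"
  have Q0: "compact Q0" "Q0 \<subseteq> ?S" using cS[OF R0] by (auto simp: Q0_def cube_compact)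
  then have K0: "compact (cinv c ` Q0)" "cinv c ` Q0 \<subseteq> fst c \<inter> fst t"
    using compact_chart_image[OF c(1) Q0(1)] c by auto
  obtain C0 where C0: "0 \<le> C0"
    "\<And>u p. C1_section_on A \<pi> T UNIV u \<Longrightarrow> p \<in> cinv c ` Q0 \<Longrightarrow>
       (\<Sum>i\<in>UNIV. \<bar>cderiv c (\<lambda>p. ip (u p) (u p)) p (axis i 1)\<bar>)
        \<le> C0 * (1 + (\<Sum>i\<in>UNIV. norm (\<Gamma> t c p i))) * ip (u p) (u p) + C0 * nabla_norm_sq A g T \<pi> ip \<Gamma> u p"
    by (rule local_gradient_bound[OF c(1) t(1) K0]) blast
  obtain \<gamma> where \<gamma>: "\<gamma> \<in> borel_measurable borel" "\<And>q. 0 \<le> \<gamma> q"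
    "AE q in lborel. q \<in> Q0 \<longrightarrow> \<gamma> q = C0 * (1 + (\<Sum>i\<in>UNIV. norm (\<Gamma> t c (cinv c q) i)))"
    "(\<integral>\<^sup>+q\<in>Q0. ennreal (\<gamma> q ^ ?n) \<partial>lborel) < top"
    by (rule potential_borel[OF c(1) t(1) Q0 C0(1)]) blast
  \<comment> \<open>the smallness threshold of the propagation inequality\<close>
  define eps where "eps = (1 / (2 * (1 + real ?n * 2 ^ ?n))) ^ ?n"
  have eps: "eps > 0" unfolding eps_def by (intro zero_less_power divide_pos_pos mult_pos_pos add_pos_nonneg) auto
  have gm: "(\<lambda>x. ennreal (\<gamma> x ^ ?n)) \<in> borel_measurable borel" using \<gamma>(1) by measurable
  obtain R where R: "0 < R" "R \<le> R0" "(\<integral>\<^sup>+x\<in>cube (q - R *\<^sub>R e) (2 * R). ennreal (\<gamma> x ^ ?n) \<partial>lborel) \<le> ennreal eps"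
    by (rule small_cube[OF R0 e near gm \<gamma>(4)[unfolded Q0_def] eps])
  define a r where "a = q - R *\<^sub>R e" and "r = 2 * R"
  define Q where "Q = cube a r"
  have r: "r > 0" using R by (simp add: r_def)
  have QS: "Q \<subseteq> ?S" using cS[OF R(1,2)] by (simp add: Q_def a_def r_def)
  then have QV: "Q \<subseteq> ?V" by auto
  have Qc: "compact Q" by (simp add: Q_def cube_compact)
  have QQ0: "Q \<subseteq> Q0"
  proof
    fix x assume x: "x \<in> Q"
    have "q $ i - R0 * e $ i \<le> x $ i \<and> x $ i \<le> q $ i - R0 * e $ i + 2 * R0" for i
    proof -
      have "q $ i - R * e $ i \<le> x $ i" "x $ i \<le> q $ i - R * e $ i + 2 * R" using x by (auto simp: cube_def Q_def a_def r_def)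
      moreover have "(R0 - R) * e $ i \<le> R0 - R" "0 \<le> (R0 - R) * e $ i" using R e[of i] by (auto simp: mult_left_le)
      moreover have "(R0 - R) * e $ i = R0 * e $ i - R * e $ i" by (rule left_diff_distrib)
      ultimately show ?thesis using R(2) by (intro conjI) linarith+
    qed
    then show "x \<in> Q0" by (simp add: cube_def Q0_def)
  qed
  define K where "K = cinv c ` Q"
  have K: "compact K" "K \<subseteq> fst c \<inter> fst t" "K \<subseteq> cinv c ` Q0" "snd c ` K \<subseteq> Q"
    using compact_chart_image[OF c(1) Qc QV] QS QQ0 c by (auto simp: K_def)
  have Km [measurable]: "K \<in> sets borel" using K(1) by (simp add: compact_imp_closed borel_closed)
  define X where "X = (fst c \<inter> fst t) \<inter> snd c -` ball q R"
  have X: "open X" unfolding X_def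
    by (intro continuous_open_preimage continuous_on_subset[OF chart_cont[OF c(1)]] open_Int chart_open triv_open c t) auto
  have pX: "p \<in> X" using c t R by (auto simp: X_def q_def)
  have XK: "X \<subseteq> K"
  proof
    fix y assume y: "y \<in> X"
    then have "snd c y \<in> ?S \<inter> ball q R" by (auto simp: X_def)
    then have "snd c y \<in> Q" using cn[OF R(1)] by (auto simp: Q_def a_def r_def)
    then have "cinv c (snd c y) \<in> K" by (auto simp: K_def)
    then show "y \<in> K" using y c by (auto simp: X_def)
  qed
  obtain U where U: "controlled U" "U \<inter> X \<noteq> {}" using acc[OF X pX] by blast
  obtain z where z: "z \<in> U" "z \<in> X" using U by blast
  obtain CU where CU: "0 \<le> CU" "\<And>u. admissible u \<Longrightarrow> (\<integral>\<^sup>+p\<in>U. ennreal (ip (u p) (u p)) \<partial>dv) \<le> ennreal CU * energy u"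
    and Uo: "open U" using U(1) unfolding controlled_def by blast
  define s where "s = snd c z"
  have zc: "z \<in> fst c" using z by (auto simp: X_def)
  have sQ: "s \<in> Q" using XK z(2) K(4) by (auto simp: s_def)
  obtain Z where Z: "open Z" "snd c ` (fst c \<inter> U) = ?V \<inter> Z" by (rule chart_image_open[OF c(1) Uo])
  have "s \<in> Z" using Z z zc by (auto simp: s_def)
  then obtain d where d: "d > 0" "ball s d \<subseteq> Z" using Z(1) openE by blast
  have lim: "(\<lambda>k. real ?n * ((1/2) ^ k * r)) \<longlonglongrightarrow> real ?n * (0 * r)"
    by (intro tendsto_mult tendsto_const LIMSEQ_power_zero) auto
  have "eventually (\<lambda>k. real ?n * ((1/2) ^ k * r) < d) sequentially"
    by (rule order_tendstoD(2)[OF lim]) (use d in simp)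
  then obtain k where k: "real ?n * ((1/2) ^ k * r) < d" by (auto simp: eventually_sequentially)
  define Sh where "Sh = shrunk a r s ((1/2)^k)"
  have ShQ: "Sh \<subseteq> Q"
    using shrunk_subset[of s a r "(1/2)^k" 1] sQ unfolding Sh_def Q_def by (simp add: shrunk_1 power_le_one)
  have ShU: "cinv c ` Sh \<subseteq> U"
  proof
    fix w assume "w \<in> cinv c ` Sh"
    then obtain x where x: "x \<in> Sh" "w = cinv c x" by blast
    have "\<bar>(x - s) $ i\<bar> \<le> (1/2)^k * r" for i
    proof -
      let ?l = "(1/2::real)^k"
      have sc: "a $ i \<le> s $ i" "s $ i \<le> a $ i + r" using sQ by (auto simp: Q_def cube_def)
      have "(1 - ?l) * s $ i + ?l * a $ i \<le> x $ i" "x $ i \<le> (1 - ?l) * s $ i + ?l * a $ i + ?l * r"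
        using x(1) by (auto simp: Sh_def shrunk_def cube_def)
      moreover have "(1 - ?l) * s $ i + ?l * a $ i = s $ i + ?l * (a $ i - s $ i)" by (simp add: algebra_simps)
      moreover have "?l * (- r) \<le> ?l * (a $ i - s $ i)" "?l * (a $ i - s $ i) \<le> ?l * 0" using sc by (intro mult_left_mono; simp)+
      ultimately show ?thesis by (simp add: abs_le_iff)
    qed
    then have "(\<Sum>i\<in>UNIV. \<bar>(x - s) $ i\<bar>) \<le> (\<Sum>i\<in>(UNIV::'n set). (1/2)^k * r)" by (intro sum_mono) auto
    then have "norm (x - s) < d" using norm_le_l1_cart[of "x - s"] k by simp
    then have "x \<in> ?V \<inter> Z" using d x ShQ QV by (auto simp: dist_norm norm_minus_commute subset_iff)
    then have "x \<in> snd c ` (fst c \<inter> U)" using Z by simp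
    then show "w \<in> U" using x c by auto
  qed
  have Shc: "compact Sh" by (simp add: Sh_def shrunk_def cube_compact)
  obtain k1 where k1: "0 < k1"
    "\<And>f. f \<in> borel_measurable borel \<Longrightarrow> (\<integral>\<^sup>+q\<in>Q. f (cinv c q) \<partial>lborel) \<le> ennreal k1 * (\<integral>\<^sup>+p\<in>K. f p \<partial>dv)"
    "\<And>f. f \<in> borel_measurable borel \<Longrightarrow> (\<integral>\<^sup>+p\<in>K. f p \<partial>dv) \<le> ennreal k1 * (\<integral>\<^sup>+q\<in>Q. f (cinv c q) \<partial>lborel)"
    unfolding K_def by (rule nn_integral_compact_le[OF c(1) Qc QV]) blast
  obtain k2 where k2: "0 < k2"
    "\<And>f. f \<in> borel_measurable borel \<Longrightarrow> (\<integral>\<^sup>+q\<in>Sh. f (cinv c q) \<partial>lborel) \<le> ennreal k2 * (\<integral>\<^sup>+p\<in>cinv c ` Sh. f p \<partial>dv)"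
    by (rule nn_integral_compact_le[OF c(1) Shc]) (use ShQ QV in blast)+
  define A1 :: real where "A1 = (2 * 2 ^ ?n) ^ k"
  define A2 :: real where "A2 = real k * (2 * 2 ^ ?n) ^ k * (2 * real ?n * 2 ^ ?n * r)"
  define Cf where "Cf = k1 * (A1 * (k2 * CU) + A2 * (k1 * (C0 + 1)))"
  have A0: "0 \<le> A1" "0 \<le> A2" using r by (auto simp: A1_def A2_def)
  have Cf0: "0 \<le> Cf" unfolding Cf_def using A0 k1(1) k2(1) CU(1) C0(1) by (intro mult_nonneg_nonneg add_nonneg_nonneg) auto
  have "controlled X" unfolding controlled_def
  proof (intro conjI X exI[of _ Cf] allI impI Cf0)
    fix u assume adm: "admissible u"
    then have u: "C1_section_on A \<pi> T UNIV u" by (simp add: admissible_def)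
    let ?F = "\<lambda>p. ip (u p) (u p)" and ?E = "energy u"
    define f where "f q = ?F (cinv c q)" for q
    define f' where "f' i q = cderiv c ?F (cinv c q) (axis i 1)" for i q
    have Fm: "(\<lambda>p. ennreal (?F p)) \<in> borel_measurable borel" using norm_sq_measurable[OF u] by simp
    have f0: "0 \<le> f q" for q unfolding f_def by (rule norm_sq_nonneg[OF u])
    have fc: "continuous_on Q f" unfolding f_def
      by (rule continuous_on_compose2[OF norm_sq_cont[OF u] continuous_on_subset[OF cinv_cont[OF c(1)] QV]]) auto
    have f'c: "continuous_on Q (f' i)" for i unfolding f'_def
      by (rule continuous_on_subset[OF norm_sq_cont_deriv[OF u c(1) t(1)] QS])
    have "(\<integral>\<^sup>+x\<in>cube a r. ennreal (f x) \<partial>lborel) \<le> ennreal (2 * 2 ^ ?n) ^ k * (\<integral>\<^sup>+x\<in>shrunk a r s ((1/2)^k). ennreal (f x) \<partial>lborel)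
            + of_nat k * ennreal (2 * 2 ^ ?n) ^ k * ennreal (2 * real ?n * 2 ^ ?n * r) *
               (\<integral>\<^sup>+x\<in>cube a r. ennreal ((\<Sum>i\<in>UNIV. \<bar>f' i x\<bar>) - \<gamma> x * f x) \<partial>lborel)"
    proof (rule cube_propagation_C1[OF r])
      show "s \<in> cube a r" "continuous_on (cube a r) f" "\<And>i. continuous_on (cube a r) (f' i)" using sQ fc f'c by (simp_all add: Q_def)
      show "((\<lambda>t. f (updv x i t)) has_real_derivative f' i x) (at (x $ i) within {a$i..a$i+r})" if "x \<in> cube a r" for x i
        unfolding f_def f'_def by (rule line_derivative[OF u c(1) QV[unfolded Q_def] that])
      show "(\<integral>\<^sup>+x\<in>cube a r. ennreal (\<gamma> x ^ ?n) \<partial>lborel) \<le> ennreal ((1 / (2 * (1 + real ?n * 2 ^ ?n))) ^ ?n)"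
        using R(3) by (simp add: eps_def a_def r_def)
    qed (use f0 \<gamma> in auto)
    also have "ennreal (2 * 2 ^ ?n) ^ k = ennreal A1" unfolding A1_def by (rule ennreal_power) simp
    also have "of_nat k * ennreal A1 * ennreal (2 * real ?n * 2 ^ ?n * r) = ennreal A2"
      using r by (simp add: A1_def A2_def ennreal_of_nat_eq_real_of_nat ennreal_mult[symmetric])
    finally have main: "(\<integral>\<^sup>+x\<in>Q. ennreal (f x) \<partial>lborel) \<le> ennreal A1 * (\<integral>\<^sup>+x\<in>Sh. ennreal (f x) \<partial>lborel)
       + ennreal A2 * (\<integral>\<^sup>+x\<in>Q. ennreal ((\<Sum>i\<in>UNIV. \<bar>f' i x\<bar>) - \<gamma> x * f x) \<partial>lborel)"
      by (simp add: Q_def Sh_def)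
    have I1: "(\<integral>\<^sup>+x\<in>Sh. ennreal (f x) \<partial>lborel) \<le> ennreal (k2 * CU) * ?E"
    proof -
      have "(\<integral>\<^sup>+x\<in>Sh. ennreal (f x) \<partial>lborel) \<le> ennreal k2 * (\<integral>\<^sup>+p\<in>cinv c ` Sh. ennreal (?F p) \<partial>dv)"
        unfolding f_def by (rule k2(2)[OF Fm])
      also have "\<dots> \<le> ennreal k2 * (\<integral>\<^sup>+p\<in>U. ennreal (?F p) \<partial>dv)"
        using ShU by (intro mult_left_mono nn_integral_mono) (auto simp: indicator_def)
      also have "\<dots> \<le> ennreal k2 * (ennreal CU * ?E)" by (intro mult_left_mono CU(2)[OF adm]) simp
      finally show ?thesis using k2(1) CU(1) by (simp add: ennreal_mult mult.assoc)
    qed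
    define h where "h p = ennreal (if p \<in> K then (\<Sum>i\<in>UNIV. \<bar>cderiv c ?F p (axis i 1)\<bar>) - \<gamma> (snd c p) * ?F p else 0)" for p
    have hm: "h \<in> borel_measurable borel"
    proof -
      have dK: "continuous_on K (\<lambda>p. cderiv c ?F p (axis i 1))" for i
        by (rule to_chart_cont[OF c(1) K(2)]) (rule norm_sq_cont_deriv[OF u c(1) t(1)])
      have "(\<lambda>p. if p \<in> K then (\<Sum>i\<in>UNIV. \<bar>cderiv c ?F p (axis i 1)\<bar>) else 0) \<in> borel_measurable borel"
        by (rule borel_measurable_continuous_on_if) (use Km in \<open>auto intro!: continuous_intros dK\<close>)
      moreover have "(\<lambda>p. if p \<in> K then snd c p else 0) \<in> borel_measurable borel"
        by (rule borel_measurable_continuous_on_if) (use Km K(2) in \<open>auto intro!: continuous_on_subset[OF chart_cont[OF c(1)]]\<close>)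
      then have "(\<lambda>p. \<gamma> (if p \<in> K then snd c p else 0)) \<in> borel_measurable borel" by (rule measurable_compose[OF _ \<gamma>(1)])
      moreover have "(\<lambda>p. indicator K p * ?F p) \<in> borel_measurable borel" using norm_sq_measurable[OF u] by simp
      ultimately have "(\<lambda>p. ennreal ((if p \<in> K then (\<Sum>i\<in>UNIV. \<bar>cderiv c ?F p (axis i 1)\<bar>) else 0) - \<gamma> (if p \<in> K then snd c p else 0) * (indicator K p * ?F p))) \<in> borel_measurable borel"
        by simp
      also have "(\<lambda>p. ennreal ((if p \<in> K then (\<Sum>i\<in>UNIV. \<bar>cderiv c ?F p (axis i 1)\<bar>) else 0) - \<gamma> (if p \<in> K then snd c p else 0) * (indicator K p * ?F p))) = h"
        by (auto simp: h_def)
      finally show ?thesis .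
    qed
    have I2: "(\<integral>\<^sup>+x\<in>Q. ennreal ((\<Sum>i\<in>UNIV. \<bar>f' i x\<bar>) - \<gamma> x * f x) \<partial>lborel) \<le> ennreal (k1 * (C0 + 1)) * ?E"
    proof -
      have "(\<integral>\<^sup>+x\<in>Q. ennreal ((\<Sum>i\<in>UNIV. \<bar>f' i x\<bar>) - \<gamma> x * f x) \<partial>lborel) = (\<integral>\<^sup>+x\<in>Q. h (cinv c x) \<partial>lborel)"
      proof (intro nn_integral_cong)
        fix x
        show "ennreal ((\<Sum>i\<in>UNIV. \<bar>f' i x\<bar>) - \<gamma> x * f x) * indicator Q x = h (cinv c x) * indicator Q x"
        proof (cases "x \<in> Q")
          case True
          then have "cinv c x \<in> K" "snd c (cinv c x) = x" using QV c by (auto simp: K_def intro!: chart_cinv)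
          then show ?thesis by (simp add: h_def f_def f'_def)
        qed simp
      qed
      also have "\<dots> \<le> ennreal k1 * (\<integral>\<^sup>+p\<in>K. h p \<partial>dv)" by (rule k1(2)[OF hm])
      also have "(\<integral>\<^sup>+p\<in>K. h p \<partial>dv) \<le> (\<integral>\<^sup>+p. h p \<partial>dv)" by (intro nn_integral_mono) (simp add: indicator_def)
      also have "(\<integral>\<^sup>+p. h p \<partial>dv) \<le> ennreal (C0 + 1) * ?E"
        unfolding energy_def
      proof (rule nn_integral_le_cmult_AE)
        show "h \<in> borel_measurable dv" using hm by simp
        show "0 < C0 + 1" using C0 by simp
        have "AE q in lborel. q \<in> ?V \<longrightarrow> (cinv c q \<in> K \<longrightarrow> \<gamma> (snd c (cinv c q)) = C0 * (1 + (\<Sum>i\<in>UNIV. norm (\<Gamma> t c (cinv c q) i))))"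
          using \<gamma>(3)
        proof eventually_elim
          case (elim q)
          show ?case
          proof (intro impI)
            assume q: "q \<in> ?V" "cinv c q \<in> K"
            have "snd c (cinv c q) = q" by (rule chart_cinv[OF c(1) q(1)])
            moreover have "snd c (cinv c q) \<in> Q0" using imageI[OF q(2), of "snd c"] K(4) QQ0 by blast
            ultimately show "\<gamma> (snd c (cinv c q)) = C0 * (1 + (\<Sum>i\<in>UNIV. norm (\<Gamma> t c (cinv c q) i)))" using elim by simp
          qed
        qed
        from AE_chart[OF c(1), of "\<lambda>p. p \<in> K \<longrightarrow> \<gamma> (snd c p) = C0 * (1 + (\<Sum>i\<in>UNIV. norm (\<Gamma> t c p i)))", OF this]
        show "AE p in dv. h p \<le> ennreal (C0 + 1) * ennreal (nabla_norm_sq A g T \<pi> ip \<Gamma> u p)"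
        proof eventually_elim
          case (elim p)
          show ?case
          proof (cases "p \<in> K")
            case True
            then have pc: "p \<in> fst c" "p \<in> fst t" using K(2) by auto
            have D0: "0 \<le> nabla_norm_sq A g T \<pi> ip \<Gamma> u p" by (rule nabla_bound(2)[OF u c(1) t(1) pc])
            have "(\<Sum>i\<in>UNIV. \<bar>cderiv c ?F p (axis i 1)\<bar>) \<le> \<gamma> (snd c p) * ?F p + C0 * nabla_norm_sq A g T \<pi> ip \<Gamma> u p"
              using C0(2)[OF u, of p] elim pc True K(3) by auto
            then have "(\<Sum>i\<in>UNIV. \<bar>cderiv c ?F p (axis i 1)\<bar>) - \<gamma> (snd c p) * ?F p \<le> (C0 + 1) * nabla_norm_sq A g T \<pi> ip \<Gamma> u p"
              using D0 by (simp add: distrib_right)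
            then have "h p \<le> ennreal ((C0 + 1) * nabla_norm_sq A g T \<pi> ip \<Gamma> u p)" using True by (simp add: h_def ennreal_leI)
            then show ?thesis using C0(1) D0 by (simp add: ennreal_mult)
          qed (simp add: h_def)
        qed
      qed
      finally show ?thesis using k1(1) C0(1) by (simp add: ennreal_mult mult.assoc mult_left_mono)
    qed
    have "(\<integral>\<^sup>+p\<in>X. ennreal (?F p) \<partial>dv) \<le> (\<integral>\<^sup>+p\<in>K. ennreal (?F p) \<partial>dv)"
      using XK by (intro nn_integral_mono) (auto simp: indicator_def)
    also have "\<dots> \<le> ennreal k1 * (\<integral>\<^sup>+x\<in>Q. ennreal (f x) \<partial>lborel)" unfolding f_def by (rule k1(3)[OF Fm])
    also have "\<dots> \<le> ennreal k1 * (ennreal A1 * (ennreal (k2 * CU) * ?E) + ennreal A2 * (ennreal (k1 * (C0 + 1)) * ?E))"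
      by (intro mult_left_mono order_trans[OF main] add_mono I1 I2) auto
    also have "\<dots> = ennreal Cf * ?E"
    proof -
      have n: "0 \<le> k2 * CU" "0 \<le> k1 * (C0 + 1)" using k1(1) k2(1) CU(1) C0(1) by auto
      have "ennreal Cf = ennreal k1 * (ennreal A1 * ennreal (k2 * CU) + ennreal A2 * ennreal (k1 * (C0 + 1)))"
        unfolding Cf_def using k1(1) A0 n by (simp add: ennreal_mult ennreal_plus)
      then show ?thesis by (simp add: distrib_left distrib_right mult.assoc)
    qed
    finally show "(\<integral>\<^sup>+p\<in>X. ennreal (?F p) \<partial>dv) \<le> ennreal Cf * ?E" .
  qed
  then show ?thesis using pX by blast
qed

end

section \<open>From controlled sets to a weight\<close>

context weighted_setting
begin

text \<open>
  The union of the controlled sets is open by definition and closed by the previous step.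
\<close>

lemma controlled_everywhere:
  assumes conn: "connected (UNIV :: 'm set)" and U0: "controlled U0" "U0 \<noteq> {}"
  shows "\<exists>U. controlled U \<and> p \<in> U"
proof -
  define G where "G = \<Union>{U. controlled U}"
  have oG: "open G" unfolding G_def by (intro open_Union) (auto simp: controlled_def)
  have "closure G \<subseteq> G"
  proof
    fix p assume p: "p \<in> closure G"
    have "\<exists>U. controlled U \<and> p \<in> U"
    proof (rule controlled_step)
      fix X assume "open X" "p \<in> X"
      then have "X \<inter> G \<noteq> {}" using p open_Int_closure_eq_empty by blast
      then show "\<exists>U. controlled U \<and> U \<inter> X \<noteq> {}" unfolding G_def by blast
    qed
    then show "p \<in> G" by (auto simp: G_def)
  qed
  then have "closed G" by (simp add: closure_subset_eq)
  then have "open (- G)" by (rule open_Compl)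
  then have "G \<inter> UNIV = {} \<or> (- G) \<inter> UNIV = {}"
    using connectedD[OF conn oG] by auto
  moreover have "G \<noteq> {}" using U0 by (auto simp: G_def)
  ultimately have "p \<in> G" by auto
  then show ?thesis by (auto simp: G_def)
qed

lemma finite_volume_nbhd:
  obtains X where "open X" "p \<in> X" "emeasure dv X < top"
proof -
  obtain c where c: "c \<in> A" "p \<in> fst c" using charts_cover by blast
  let ?V = "snd c ` fst c"
  have qV: "snd c p \<in> ?V" using c by auto
  obtain e R0 where R0: "R0 > 0"
    and cS: "cube (snd c p - R0 *\<^sub>R e) (2 * R0) \<subseteq> ?V" and cn: "?V \<inter> ball (snd c p) R0 \<subseteq> cube (snd c p - R0 *\<^sub>R e) (2 * R0)"
    by (rule model_open_cubes[OF chart_model[OF c(1)] qV]) blast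
  define Q where "Q = cube (snd c p - R0 *\<^sub>R e) (2 * R0)"
  obtain k where k: "\<And>f. f \<in> borel_measurable borel \<Longrightarrow> (\<integral>\<^sup>+p\<in>cinv c ` Q. f p \<partial>dv) \<le> ennreal k * (\<integral>\<^sup>+q\<in>Q. f (cinv c q) \<partial>lborel)"
    by (rule nn_integral_compact_le[OF c(1), of Q]) (use cS in \<open>auto simp: Q_def cube_compact\<close>)
  define X where "X = fst c \<inter> snd c -` ball (snd c p) R0"
  show thesis
  proof (rule that)
    show "open X" unfolding X_def by (intro continuous_open_preimage chart_cont chart_open c) auto
    show "p \<in> X" using c R0 by (simp add: X_def)
    have XK: "X \<subseteq> cinv c ` Q"
    proof
      fix y assume y: "y \<in> X"
      then have "snd c y \<in> Q" using cn by (auto simp: X_def Q_def)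
      then have "cinv c (snd c y) \<in> cinv c ` Q" by blast
      then show "y \<in> cinv c ` Q" using y c by (auto simp: X_def)
    qed
    have Km: "cinv c ` Q \<in> sets borel"
      using compact_chart_image[OF c(1) cube_compact] cS by (simp add: Q_def compact_imp_closed borel_closed)
    have "emeasure dv X \<le> emeasure dv (cinv c ` Q)" using XK Km by (intro emeasure_mono) auto
    also have "\<dots> = (\<integral>\<^sup>+p\<in>cinv c ` Q. 1 \<partial>dv)" using Km by simp
    also have "\<dots> \<le> ennreal k * (\<integral>\<^sup>+q\<in>Q. 1 \<partial>lborel)" by (rule k) simp
    also have "\<dots> < top"
    proof -
      have "emeasure lborel Q < top" using emeasure_lborel_cbox_finite unfolding Q_def cube_eq_cbox by (simp add: less_top)
      then show ?thesis by (simp add: ennreal_mult_less_top Q_def)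
    qed
    finally show "emeasure dv X < top" .
  qed
qed

lemma emeasure_compact_finite:
  assumes K: "compact K" shows "emeasure dv K < top"
proof -
  have "\<exists>X. open X \<and> p \<in> X \<and> emeasure dv X < top" for p using finite_volume_nbhd by metis
  then obtain X where X: "\<And>p. open (X p)" "\<And>p. p \<in> X p" "\<And>p. emeasure dv (X p) < top" by metis
  obtain I where I0: "I \<subseteq> UNIV" "finite I" "K \<subseteq> (\<Union>p\<in>I. X p)"
  proof (rule compactE_image[OF K, of UNIV X])
    show "open (X p)" for p by (rule X(1))
    show "K \<subseteq> (\<Union>p\<in>UNIV. X p)" using X(2) by auto
  qed (rule that)
  note I = I0(2,3)
  have "emeasure dv K \<le> emeasure dv (\<Union>p\<in>I. X p)"
    by (rule emeasure_mono[OF I(2)]) (use X(1) in \<open>auto intro!: borel_open open_UN\<close>)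
  also have "\<dots> \<le> (\<Sum>p\<in>I. emeasure dv (X p))" by (rule emeasure_subadditive_finite) (use I X(1) in auto)
  also have "\<dots> < top"
  proof -
    have "(\<Sum>p\<in>J. emeasure dv (X p)) < top" if "finite J" for J
      using that by induction (simp_all add: X(3))
    then show ?thesis using I(1) .
  qed
  finally show ?thesis .
qed

text \<open>
  Countably many controlled sets cover the manifold. Weighted with a convergent series their constants
  add up to at most 1. The resulting weight is at most 1, hence locally integrable, and on a compact
  set it is bounded below by the smallest of finitely many positive coefficients.
\<close>

lemma weight_exists:
  assumes all: "\<And>p. \<exists>U. controlled U \<and> p \<in> U"
  shows "\<exists>w :: 'm \<Rightarrow> real.
           w \<in> borel_measurable dv \<and>
           (\<forall>K. compact K \<longrightarrow> set_integrable dv K w) \<and>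
           (\<forall>\<Omega>. compact (closure \<Omega>) \<longrightarrow> 0 < ess_inf_on dv \<Omega> w) \<and>
           (\<forall>u. admissible u \<longrightarrow> (\<integral>\<^sup>+p. ennreal (ip (u p) (u p) * w p) \<partial>dv) \<le> energy u)"
proof -
  obtain \<U> where \<U>: "\<U> \<subseteq> {U. controlled U}" "countable \<U>" "\<Union>\<U> = \<Union>{U. controlled U}"
    by (rule Lindelof[of "{U. controlled U}"]) (auto simp: controlled_def)
  have cover: "\<Union>\<U> = UNIV" using \<U>(3) all by auto
  then have ne: "\<U> \<noteq> {}" by auto
  define U where "U k = from_nat_into \<U> k" for k
  have U: "controlled (U k)" for k unfolding U_def using subsetD[OF \<U>(1) from_nat_into[OF ne]] by simp
  have Ucov: "\<exists>k. p \<in> U k" for p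
  proof -
    have "p \<in> \<Union>\<U>" by (simp only: cover UNIV_I)
    then obtain V where "V \<in> \<U>" "p \<in> V" by (rule UnionE)
    moreover obtain k where "from_nat_into \<U> k = V" using from_nat_into_surj[OF \<U>(2) \<open>V \<in> \<U>\<close>] by blast
    ultimately show ?thesis by (auto simp: U_def)
  qed
  have Uo: "open (U k)" for k using U by (simp add: controlled_def)
  have "\<exists>C\<ge>0. \<forall>u. admissible u \<longrightarrow> (\<integral>\<^sup>+p\<in>U k. ennreal (ip (u p) (u p)) \<partial>dv) \<le> ennreal C * energy u" for k
    using U unfolding controlled_def by blast
  then have "\<forall>k. \<exists>C. 0 \<le> C \<and> (\<forall>u. admissible u \<longrightarrow> (\<integral>\<^sup>+p\<in>U k. ennreal (ip (u p) (u p)) \<partial>dv) \<le> ennreal C * energy u)"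
    by blast
  from choice[OF this] obtain C where "\<forall>k. 0 \<le> C k \<and> (\<forall>u. admissible u \<longrightarrow> (\<integral>\<^sup>+p\<in>U k. ennreal (ip (u p) (u p)) \<partial>dv) \<le> ennreal (C k) * energy u)" ..
  then have C: "\<And>k. 0 \<le> C k" "\<And>k u. admissible u \<Longrightarrow> (\<integral>\<^sup>+p\<in>U k. ennreal (ip (u p) (u p)) \<partial>dv) \<le> ennreal (C k) * energy u"
    by simp_all
  define a where "a k = (1/2) ^ Suc k / (1 + C k)" for k
  have a0: "0 < a k" for k unfolding a_def using C(1)[of k] by (intro divide_pos_pos) auto
  have a1: "a k \<le> (1/2) ^ Suc k" for k unfolding a_def
  proof -
    have "(1/2::real) ^ Suc k / (1 + C k) \<le> (1/2) ^ Suc k / 1"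
      using C(1)[of k] by (intro divide_left_mono) simp_all
    then show "(1/2::real) ^ Suc k / (1 + C k) \<le> (1/2) ^ Suc k" by simp
  qed
  have geo: "(\<lambda>k. (1/2::real) ^ Suc k) sums 1" by (rule power_half_series)
  define w where "w p = (\<Sum>k. a k * indicator (U k) p)" for p
  have sm: "summable (\<lambda>k. a k * indicator (U k) p)" for p
    by (rule summable_comparison_test'[OF sums_summable[OF geo], of 0])
      (use a1 less_imp_le[OF a0] in \<open>simp add: indicator_def\<close>)
  have w0: "0 \<le> w p" for p unfolding w_def by (rule suminf_nonneg[OF sm]) (simp add: less_imp_le[OF a0])
  have w1: "w p \<le> 1" for p
  proof -
    have "w p \<le> (\<Sum>k. (1/2::real) ^ Suc k)" unfolding w_def
      by (rule suminf_le[OF _ sm sums_summable[OF geo]]) (use a1 in \<open>simp add: indicator_def\<close>)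
    then show ?thesis using geo by (simp add: sums_iff)
  qed
  have wa: "a k \<le> w p" if "p \<in> U k" for k p

  proof -
    have "(\<Sum>k\<in>{k}. a k * indicator (U k) p) \<le> w p" unfolding w_def
      by (rule sum_le_suminf[OF sm]) (simp_all add: less_imp_le[OF a0])
    then show ?thesis using that by simp
  qed
  have wm: "w \<in> borel_measurable dv"
    unfolding w_def by (intro borel_measurable_suminf borel_measurable_times borel_measurable_const borel_measurable_indicator) (simp add: Uo)
  show ?thesis
  proof (intro exI[of _ w] conjI allI impI wm)
    fix K :: "'m set" assume K: "compact K"
    have Km: "K \<in> sets dv" using K by (simp add: compact_imp_closed borel_closed)
    have one: "integrable dv (\<lambda>p. indicator K p :: real)"
      using Km emeasure_compact_finite[OF K] by (intro integrable_real_indicator) simp_all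
    show "set_integrable dv K w" unfolding set_integrable_def
    proof (rule Bochner_Integration.integrable_bound[OF one])
      show "(\<lambda>p. indicator K p *\<^sub>R w p) \<in> borel_measurable dv" using wm Km by (intro borel_measurable_scaleR borel_measurable_indicator)
      show "AE p in dv. norm (indicator K p *\<^sub>R w p) \<le> norm (indicator K p :: real)"
        using w0 w1 by (intro AE_I2) (auto simp: indicator_def)
    qed
  next
    fix \<Omega> :: "'m set" assume O: "compact (closure \<Omega>)"
    obtain I where I0: "I \<subseteq> UNIV" "finite I" "closure \<Omega> \<subseteq> (\<Union>k\<in>I. U k)"
    proof (rule compactE_image[OF O, of UNIV U])
      show "open (U k)" for k by (rule Uo)
      show "closure \<Omega> \<subseteq> (\<Union>k\<in>UNIV. U k)" using Ucov by auto
    qed (rule that)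
    note I = I0(2,3)
    define m where "m = Min (insert 1 (a ` I))"
    have m0: "0 < m"
    proof -
      have "m \<in> insert 1 (a ` I)" unfolding m_def by (rule Min_in) (use I(1) in simp_all)
      then show ?thesis
      proof (rule insertE)
        assume "m \<in> a ` I"
        then obtain k where "m = a k" by (rule imageE)
        then show ?thesis using a0[of k] by simp
      qed simp
    qed
    have "m \<le> w p" if "p \<in> \<Omega>" for p
    proof -
      have "p \<in> (\<Union>k\<in>I. U k)" by (rule subsetD[OF I(2) subsetD[OF closure_subset that]])
      then obtain k where k: "k \<in> I" "p \<in> U k" by (rule UN_E)
      have "m \<le> a k" unfolding m_def using I(1) k by (intro Min_le) auto
      then show ?thesis using wa[OF k(2)] by simp
    qed
    then have "ereal m \<in> {a. AE p in dv. p \<in> \<Omega> \<longrightarrow> a \<le> ereal (w p)}" by (intro CollectI AE_I2 impI) simp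
    then have "ereal m \<le> ess_inf_on dv \<Omega> w" unfolding ess_inf_on_def by (rule Sup_upper)
    then show "0 < ess_inf_on dv \<Omega> w" using m0 less_le_trans[of 0 "ereal m"] by simp
  next
    fix u assume adm: "admissible u"
    then have u: "C1_section_on A \<pi> T UNIV u" by (simp add: admissible_def)
    let ?F = "\<lambda>p. ip (u p) (u p)"
    have F0: "0 \<le> ?F p" for p by (rule norm_sq_nonneg[OF u])
    have Fm: "(\<lambda>p. ennreal (?F p)) \<in> borel_measurable dv" using norm_sq_measurable[OF u] by simp
    have "ennreal (?F p * w p) = (\<Sum>k. ennreal (a k) * (ennreal (?F p) * indicator (U k) p))" for p
    proof -
      have "(\<Sum>k. ennreal (a k) * (ennreal (?F p) * indicator (U k) p)) = (\<Sum>k. ennreal (?F p) * ennreal (a k * indicator (U k) p))"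
        by (intro suminf_cong) (simp add: indicator_def mult.commute)
      also have "\<dots> = ennreal (?F p) * (\<Sum>k. ennreal (a k * indicator (U k) p))" by (rule ennreal_suminf_cmult)
      also have "(\<Sum>k. ennreal (a k * indicator (U k) p)) = ennreal (w p)"
        unfolding w_def by (rule suminf_ennreal2[OF _ sm]) (simp add: less_imp_le[OF a0])
      finally show ?thesis using F0 w0 by (simp add: ennreal_mult)
    qed
    then have "(\<integral>\<^sup>+p. ennreal (?F p * w p) \<partial>dv) = (\<integral>\<^sup>+p. (\<Sum>k. ennreal (a k) * (ennreal (?F p) * indicator (U k) p)) \<partial>dv)" by simp
    also have "\<dots> = (\<Sum>k. \<integral>\<^sup>+p. ennreal (a k) * (ennreal (?F p) * indicator (U k) p) \<partial>dv)"
      by (rule nn_integral_suminf) (use Fm Uo in \<open>intro borel_measurable_times_ennreal borel_measurable_const borel_measurable_indicator; simp\<close>)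
    also have "\<dots> \<le> (\<Sum>k. ennreal ((1/2) ^ Suc k) * energy u)"
    proof (rule suminf_le)
      fix k
      have "(\<integral>\<^sup>+p. ennreal (a k) * (ennreal (?F p) * indicator (U k) p) \<partial>dv) = ennreal (a k) * (\<integral>\<^sup>+p\<in>U k. ennreal (?F p) \<partial>dv)"
        by (rule nn_integral_cmult) (use Fm Uo in \<open>intro borel_measurable_times_ennreal borel_measurable_indicator; simp\<close>)
      also have "\<dots> \<le> ennreal (a k) * (ennreal (C k) * energy u)" by (intro mult_left_mono C(2)[OF adm]) simp
      also have "\<dots> = ennreal (a k * C k) * energy u" using a0[of k] C(1)[of k] by (simp add: ennreal_mult mult.assoc)
      also have "\<dots> \<le> ennreal ((1/2) ^ Suc k) * energy u"
      proof (intro mult_right_mono ennreal_leI)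
        have "C k / (1 + C k) \<le> 1" using C(1)[of k] by simp
        then have "(1/2) ^ Suc k * (C k / (1 + C k)) \<le> (1/2) ^ Suc k * 1" by (intro mult_left_mono) auto
        then show "a k * C k \<le> (1/2) ^ Suc k" by (simp add: a_def)
      qed simp
      finally show "(\<integral>\<^sup>+p. ennreal (a k) * (ennreal (?F p) * indicator (U k) p) \<partial>dv) \<le> ennreal ((1/2) ^ Suc k) * energy u" .
    qed simp_all
    also have "\<dots> = (\<Sum>k. ennreal ((1/2) ^ Suc k)) * energy u" by (rule ennreal_suminf_multc)
    also have "(\<Sum>k. ennreal ((1/2) ^ Suc k)) = 1"
    proof -
      have "(\<Sum>k. ennreal ((1/2) ^ Suc k)) = ennreal 1"
        by (rule suminf_ennreal_eq[OF _ geo]) (rule zero_le_power, simp)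
      then show ?thesis by (simp only: ennreal_1)
    qed
    finally show "(\<integral>\<^sup>+p. ennreal (?F p * w p) \<partial>dv) \<le> energy u" by (simp only: mult_1)
  qed
qed

end

section \<open>The coordinates of the end\<close>

text \<open>
  From an estimate for the measures of small sets to one for integrals. It suffices to know the estimate
  within the members of an open cover, so that it may be verified in charts: by second countability a
  Borel set is a countable disjoint union of pieces that lie in members of the cover.
\<close>

lemma nn_integral_le_by_image:
  fixes \<psi> :: "'a::topological_space \<Rightarrow> 'b::second_countable_topology" and f w :: "'b \<Rightarrow> ennreal"
  assumes M: "sets M = sets borel" and N: "sets N = sets borel"
    and E: "E \<in> sets borel" and D: "D \<in> sets borel" and \<psi>: "continuous_on E \<psi>" "\<And>a. a \<in> E \<Longrightarrow> \<psi> a \<in> D"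
    and \<U>: "\<And>U. U \<in> \<U> \<Longrightarrow> open U" "\<Union>\<U> = UNIV"
    and w: "(\<lambda>b. w b * indicator D b) \<in> borel_measurable borel"
    and le: "\<And>B U. B \<in> sets borel \<Longrightarrow> B \<subseteq> D \<Longrightarrow> U \<in> \<U> \<Longrightarrow> B \<subseteq> U \<Longrightarrow>
       emeasure M (E \<inter> \<psi> -` B) \<le> (\<integral>\<^sup>+b\<in>B. w b \<partial>N)"
    and f: "f \<in> borel_measurable borel"
  shows "(\<integral>\<^sup>+a\<in>E. f (\<psi> a) \<partial>M) \<le> (\<integral>\<^sup>+b\<in>D. (w b * f b) \<partial>N)"
proof -
  obtain b0 :: 'b where True by simp
  define \<psi>' where "\<psi>' a = (if a \<in> E then \<psi> a else b0)" for a
  have m\<psi>: "\<psi>' \<in> borel_measurable borel" unfolding \<psi>'_def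
    by (rule borel_measurable_continuous_on_if[OF E \<psi>(1)]) simp
  have m\<psi>M: "\<psi>' \<in> measurable M borel" using m\<psi> measurable_cong_sets[OF M refl] by blast
  define \<mu> where "\<mu> = distr (density M (indicator E)) borel \<psi>'"
  define \<nu> where "\<nu> = density N (\<lambda>b. w b * indicator D b)"
  have wN: "(\<lambda>b. w b * indicator D b) \<in> borel_measurable N" using w measurable_cong_sets[OF N refl] by blast
  have EM: "E \<in> sets M" using E M by simp
  have iE: "(indicator E :: 'a \<Rightarrow> ennreal) \<in> borel_measurable M" using EM by simp
  have m\<psi>D: "\<psi>' \<in> measurable (density M (indicator E)) borel" using m\<psi>M by simp
  have sp: "space M = UNIV" using sets_eq_imp_space_eq[OF M] by simp
  have \<mu>: "emeasure \<mu> B = emeasure M (E \<inter> \<psi> -` B)" if B: "B \<in> sets borel" for B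
  proof -
    have pre: "\<psi>' -` B \<in> sets M" using measurable_sets[OF m\<psi>M B] sp by simp
    have "emeasure \<mu> B = emeasure (density M (indicator E)) (\<psi>' -` B)"
      unfolding \<mu>_def using emeasure_distr[OF m\<psi>D B] sp by simp
    also have "\<dots> = (\<integral>\<^sup>+a. indicator E a * indicator (\<psi>' -` B) a \<partial>M)" by (rule emeasure_density[OF iE pre])
    also have "\<dots> = (\<integral>\<^sup>+a. indicator (E \<inter> \<psi>' -` B) a \<partial>M)"
      by (intro nn_integral_cong) (simp add: indicator_def)
    also have "\<dots> = emeasure M (E \<inter> \<psi>' -` B)" by (rule nn_integral_indicator) (use EM pre in simp)
    also have "E \<inter> \<psi>' -` B = E \<inter> \<psi> -` B" by (auto simp: \<psi>'_def)
    finally show ?thesis .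
  qed
  have \<nu>: "emeasure \<nu> B = (\<integral>\<^sup>+b\<in>B \<inter> D. w b \<partial>N)" if B: "B \<in> sets borel" for B
  proof -
    have "emeasure \<nu> B = (\<integral>\<^sup>+b. w b * indicator D b * indicator B b \<partial>N)"
      unfolding \<nu>_def by (rule emeasure_density[OF wN]) (use B N in simp)
    also have "\<dots> = (\<integral>\<^sup>+b\<in>B \<inter> D. w b \<partial>N)" by (intro nn_integral_cong) (auto simp: indicator_def)
    finally show ?thesis .
  qed
  have s\<mu>: "sets \<mu> = sets borel" and s\<nu>: "sets \<nu> = sets borel" by (simp_all add: \<mu>_def \<nu>_def N)
  have loc: "emeasure \<mu> B \<le> emeasure \<nu> B" if B: "B \<in> sets borel" and U: "U \<in> \<U>" "B \<subseteq> U" for B U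
  proof -
    have "E \<inter> \<psi> -` B = E \<inter> \<psi> -` (B \<inter> D)" using \<psi>(2) by auto
    then show ?thesis unfolding \<mu>[OF B] \<nu>[OF B] using le[of "B \<inter> D" U] B D U by auto
  qed
  obtain \<V> where \<V>: "\<V> \<subseteq> \<U>" "countable \<V>" "\<Union>\<V> = \<Union>\<U>" by (rule Lindelof[of \<U>]) (use \<U>(1) in auto)
  have ne: "\<V> \<noteq> {}" using \<V>(3) \<U>(2) by auto
  define U where "U k = from_nat_into \<V> k" for k
  have U: "U k \<in> \<U>" for k unfolding U_def using subsetD[OF \<V>(1) from_nat_into[OF ne]] .
  have Ucov: "(\<Union>k. U k) = UNIV" unfolding U_def using range_from_nat_into[OF ne \<V>(2)] \<V>(3) \<U>(2) by simp
  have Um: "range U \<subseteq> sets borel" using U \<U>(1) by auto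
  have Pm: "disjointed U k \<in> sets borel" for k using sets.range_disjointed_sets[OF Um] by auto
  have all: "emeasure \<mu> B \<le> emeasure \<nu> B" if B: "B \<in> sets borel" for B
  proof -
    have BP: "(\<Union>k. B \<inter> disjointed U k) = B" using UN_disjointed_eq[of U] Ucov by auto
    have dis: "disjoint_family (\<lambda>k. B \<inter> disjointed U k)" using disjoint_family_disjointed[of U]
      by (auto simp: disjoint_family_on_def)
    have m: "B \<inter> disjointed U k \<in> sets borel" for k using B Pm[of k] by (rule sets.Int)
    have "emeasure \<mu> B = (\<Sum>k. emeasure \<mu> (B \<inter> disjointed U k))"
      by (subst (1) BP[symmetric], rule suminf_emeasure[symmetric]) (use m dis s\<mu> in auto)
    also have "\<dots> \<le> (\<Sum>k. emeasure \<nu> (B \<inter> disjointed U k))"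
    proof (rule suminf_le)
      fix k show "emeasure \<mu> (B \<inter> disjointed U k) \<le> emeasure \<nu> (B \<inter> disjointed U k)"
        by (rule loc[OF m U[of k]]) (use disjointed_subset[of U k] in auto)
    qed simp_all
    also have "\<dots> = emeasure \<nu> B"
      by (subst (2) BP[symmetric], rule suminf_emeasure) (use m dis s\<nu> in auto)
    finally show ?thesis .
  qed
  have leM: "\<mu> \<le> \<nu>" by (rule le_measure[THEN iffD2]) (use s\<mu> s\<nu> all in auto)
  have "(\<integral>\<^sup>+a\<in>E. f (\<psi> a) \<partial>M) = (\<integral>\<^sup>+a. indicator E a * f (\<psi>' a) \<partial>M)"
    by (intro nn_integral_cong) (auto simp: \<psi>'_def indicator_def)
  also have "\<dots> = (\<integral>\<^sup>+a. f (\<psi>' a) \<partial>density M (indicator E))"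
    by (rule nn_integral_density[symmetric, OF iE]) (rule measurable_compose[OF m\<psi>M f])
  also have "\<dots> = (\<integral>\<^sup>+b. f b \<partial>\<mu>)" unfolding \<mu>_def by (rule nn_integral_distr[symmetric, OF m\<psi>D]) (use f in simp)
  also have "\<dots> \<le> (\<integral>\<^sup>+b. f b \<partial>\<nu>)" by (rule nn_integral_mono_measure) (use s\<mu> s\<nu> leM in auto)
  also have "\<dots> = (\<integral>\<^sup>+b. w b * indicator D b * f b \<partial>N)" unfolding \<nu>_def
    by (rule nn_integral_density[OF wN]) (use f measurable_cong_sets[OF N refl] in blast)
  also have "\<dots> = (\<integral>\<^sup>+b\<in>D. (w b * f b) \<partial>N)" by (intro nn_integral_cong) (simp add: mult_ac)
  finally show ?thesis .
qed

locale end_setting = weighted_setting A T \<pi> ip \<Gamma> g dv + N: manifold AN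
  for A :: "('m::{t2_space, second_countable_topology}, 'n::finite) chart set"
    and T :: "('m, 'e, 'r::finite) triv set" and \<pi> and ip
    and \<Gamma> :: "('m, 'e, 'r) triv \<Rightarrow> ('m, 'n) chart \<Rightarrow> 'm \<Rightarrow> 'n \<Rightarrow> real ^ 'r ^ 'r"
    and g and dv and AN :: "('k::{t2_space, second_countable_topology}, 'l::finite) chart set" +
  fixes h :: "('k, 'l) chart \<Rightarrow> 'k \<Rightarrow> real ^ 'l ^ 'l" and W :: "'m set" and x0 :: real
    and x :: "'m \<Rightarrow> real" and y :: "'m \<Rightarrow> 'k"
  assumes dimN: "CARD('n) = CARD('l) + 1"
    and hyp_end: "weakly_hyperboloidal_end A g AN h W x0 x y"
begin

lemma end_diffeo: "end_diffeomorphism A AN W x0 x y" and x0_pos: "0 < x0"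
  using hyp_end unfolding weakly_hyperboloidal_end_def by simp_all

definition Psi :: "real \<times> 'k \<Rightarrow> 'm" where "Psi = end_inv W x y"

lemma end_homeo: "homeomorphism W ({0<..<x0} \<times> UNIV) (\<lambda>p. (x p, y p)) Psi"
  using end_diffeo unfolding end_diffeomorphism_def Psi_def by (rule conjunct1)

lemma Psi_end: "0 < s \<Longrightarrow> s < x0 \<Longrightarrow> Psi (s, k) \<in> W" "0 < s \<Longrightarrow> s < x0 \<Longrightarrow> x (Psi (s, k)) = s"
  "0 < s \<Longrightarrow> s < x0 \<Longrightarrow> y (Psi (s, k)) = k"
proof -
  assume s: "0 < s" "s < x0"
  then have sk: "(s, k) \<in> {0<..<x0} \<times> UNIV" by simp
  show "Psi (s, k) \<in> W" using end_homeo sk unfolding homeomorphism_def by blast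
  have "(x (Psi (s, k)), y (Psi (s, k))) = (s, k)" by (rule homeomorphism_apply2[OF end_homeo sk])
  then show "x (Psi (s, k)) = s" "y (Psi (s, k)) = k" by simp_all
qed

lemma end_Psi: "p \<in> W \<Longrightarrow> Psi (x p, y p) = p" "p \<in> W \<Longrightarrow> 0 < x p" "p \<in> W \<Longrightarrow> x p < x0"
proof -
  assume p: "p \<in> W"
  show "Psi (x p, y p) = p" by (rule homeomorphism_apply1[OF end_homeo p])
  have "(x p, y p) \<in> {0<..<x0} \<times> UNIV" by (subst homeomorphism_image1[OF end_homeo, symmetric]) (rule imageI[OF p])
  then show "0 < x p" "x p < x0" by simp_all
qed

lemma end_cont: "continuous_on W x" "continuous_on W y" "continuous_on ({0<..<x0} \<times> UNIV) Psi"
proof -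
  have c: "continuous_on W (\<lambda>p. (x p, y p))" by (rule homeomorphism_cont1[OF end_homeo])
  show "continuous_on W x" using continuous_on_fst[OF c] by simp
  show "continuous_on W y" using continuous_on_snd[OF c] by simp
  show "continuous_on ({0<..<x0} \<times> UNIV) Psi" by (rule homeomorphism_cont2[OF end_homeo])
qed

text \<open>
  Components of an open subset of a manifold are open because manifolds are locally connected; the
  adapted cubes are connected neighbourhoods also at boundary points.
\<close>

lemma end_open: "open W"
proof -
  obtain C where C: "compact C" "W \<in> components (UNIV - C)"
    using hyp_end unfolding weakly_hyperboloidal_end_def by metis
  have cl: "open (- C)" using compact_imp_closed[OF C(1)] by (simp add: open_Compl)
  show ?thesis
  proof (subst open_subopen, rule ballI)
    fix p assume p: "p \<in> W"
    then have pC: "p \<in> - C" using in_components_subset[OF C(2)] by auto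
    obtain c where c: "c \<in> A" "p \<in> fst c" using charts_cover by blast
    let ?V = "snd c ` (fst c \<inter> - C)"
    have mV: "model_open ?V" by (rule chart_image_model[OF c(1) cl])
    have qV: "snd c p \<in> ?V" using c pC by auto
    obtain e R0 where R0: "R0 > 0" and e: "\<And>i. 0 \<le> e $ i \<and> e $ i \<le> 1"
      and cS: "\<And>R. 0 < R \<Longrightarrow> R \<le> R0 \<Longrightarrow> cube (snd c p - R *\<^sub>R e) (2 * R) \<subseteq> ?V"
      and cn: "\<And>R. 0 < R \<Longrightarrow> ?V \<inter> ball (snd c p) R \<subseteq> cube (snd c p - R *\<^sub>R e) (2 * R)"
      and near: "\<And>R x. 0 < R \<Longrightarrow> x \<in> cube (snd c p - R *\<^sub>R e) (2 * R) \<Longrightarrow> norm (x - snd c p) \<le> 2 * real CARD('n) * R"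
      by (rule model_open_cubes[OF mV qV]) blast
    let ?Q = "cube (snd c p - R0 *\<^sub>R e) (2 * R0)"
    have QV: "?Q \<subseteq> ?V" by (rule cS[OF R0 order_refl])
    then have QV': "?Q \<subseteq> snd c ` fst c" by auto
    have con: "connected (cinv c ` ?Q)"
      by (rule connected_continuous_image[OF continuous_on_subset[OF cinv_cont[OF c(1)] QV']])
        (simp add: cube_eq_cbox convex_connected)
    have sub: "cinv c ` ?Q \<subseteq> UNIV - C"
    proof
      fix a assume "a \<in> cinv c ` ?Q"
      then obtain b where b: "b \<in> ?Q" "a = cinv c b" by (rule imageE)
      obtain p' where p': "p' \<in> fst c \<inter> - C" "b = snd c p'" using subsetD[OF QV b(1)] by (rule imageE)
      then show "a \<in> UNIV - C" using b c by simp
    qed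
    let ?O = "fst c \<inter> - C \<inter> snd c -` ball (snd c p) R0"
    have Oo: "open ?O"
      by (rule continuous_open_preimage[OF continuous_on_subset[OF chart_cont[OF c(1)]]])
        (use chart_open[OF c(1)] cl in auto)
    have OQ: "?O \<subseteq> cinv c ` ?Q"
    proof
      fix a assume a: "a \<in> ?O"
      have "snd c a \<in> ?Q" using cn[OF R0] a by auto
      then have "cinv c (snd c a) \<in> cinv c ` ?Q" by (rule imageI)
      then show "a \<in> cinv c ` ?Q" using a c by simp
    qed
    have pO: "p \<in> ?O" using c pC R0 by simp
    have "cinv c ` ?Q \<subseteq> W"
      by (rule components_maximal[OF C(2) con sub]) (use p subsetD[OF OQ pO] in blast)
    then show "\<exists>S. open S \<and> p \<in> S \<and> S \<subseteq> W" using Oo pO OQ by (intro exI[of _ ?O]) auto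
  qed
qed

lemma N_chart_open: "d \<in> AN \<Longrightarrow> open (snd d ` fst d)"
proof -
  assume d: "d \<in> AN"
  have "manifold_boundary AN = {}" using hyp_end unfolding weakly_hyperboloidal_end_def by simp
  then have "snd d p \<in> interior (snd d ` fst d)" if "p \<in> fst d" for p
    using that d unfolding manifold_boundary_def by blast
  then have "snd d ` fst d \<subseteq> interior (snd d ` fst d)" by auto
  then show ?thesis using interior_subset[of "snd d ` fst d"] open_interior[of "snd d ` fst d"] by (simp add: subset_antisym)
qed

lemma piece_open: "d \<in> AN \<Longrightarrow> open (W \<inter> y -` fst d)"
  by (rule continuous_open_preimage[OF end_cont(2) end_open N.chart_open])

lemma end_cdiff:
  assumes c: "c \<in> A" and d: "d \<in> AN" and p: "p \<in> fst c \<inter> (W \<inter> y -` fst d)"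
  shows "cdiff c x p" "cdiff c (\<lambda>p. snd d (y p)) p"
    "cdiff c (\<lambda>p. (x p, snd d (y p))) p"
    "cderiv c (\<lambda>p. (x p, snd d (y p))) p v = (cderiv c x p v, cderiv c (\<lambda>p. snd d (y p)) p v)"
proof -
  have "smooth_on ((\<lambda>p. (x p, snd d (y p))) \<circ> cinv c) (snd c ` (fst c \<inter> W \<inter> y -` fst d))"
    using end_diffeo c d unfolding end_diffeomorphism_def by blast
  then have "Ck_on 1 ((\<lambda>p. (x p, snd d (y p))) \<circ> cinv c) (snd c ` (fst c \<inter> W \<inter> y -` fst d))"
    unfolding smooth_on_def by (rule spec)
  then have Ck: "Ck_on 1 (\<lambda>q. (\<lambda>p. (x p, snd d (y p))) (cinv c q)) (snd c ` (fst c \<inter> (W \<inter> y -` fst d)))"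
    by (simp only: o_def Int_assoc)
  show cd: "cdiff c (\<lambda>p. (x p, snd d (y p))) p" by (rule Ck1_cdiff(1)[OF c piece_open[OF d] Ck p])
  have pc: "p \<in> fst c" using p by simp
  note a = cderiv_eqI[OF c pc has_derivative_fst[OF cdiffD[OF cd], unfolded fst_conv]]
  note b = cderiv_eqI[OF c pc has_derivative_snd[OF cdiffD[OF cd], unfolded snd_conv]]
  show "cdiff c x p" by (rule a(1))
  show "cdiff c (\<lambda>p. snd d (y p)) p" by (rule b(1))
  show "cderiv c (\<lambda>p. (x p, snd d (y p))) p v = (cderiv c x p v, cderiv c (\<lambda>p. snd d (y p)) p v)"
    unfolding a(2) b(2) by simp
qed

definition Psd :: "('k, 'l) chart \<Rightarrow> real \<times> (real ^ 'l) \<Rightarrow> 'm" where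
  "Psd d q = Psi (fst q, cinv d (snd q))"

lemma Psd_cont: "d \<in> AN \<Longrightarrow> continuous_on ({0<..<x0} \<times> snd d ` fst d) (Psd d)"
  unfolding Psd_def
  by (rule continuous_on_compose2[OF end_cont(3)])
    (auto intro!: continuous_intros continuous_on_compose2[OF N.cinv_cont])

definition Gdom :: "('m, 'n) chart \<Rightarrow> ('k, 'l) chart \<Rightarrow> (real \<times> (real ^ 'l)) set" where
  "Gdom c d = ({0<..<x0} \<times> snd d ` fst d) \<inter> Psd d -` fst c"

lemma Gdom_open: "c \<in> A \<Longrightarrow> d \<in> AN \<Longrightarrow> open (Gdom c d)"
  unfolding Gdom_def
  by (rule continuous_open_preimage[OF Psd_cont]) (auto intro: open_Times N_chart_open chart_open)

lemma Gdom_image: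
  assumes c: "c \<in> A" and d: "d \<in> AN"
  shows "(\<lambda>p. (x p, snd d (y p))) ` (fst c \<inter> W \<inter> y -` fst d) = Gdom c d"
proof (intro subset_antisym subsetI)
  fix q assume "q \<in> (\<lambda>p. (x p, snd d (y p))) ` (fst c \<inter> W \<inter> y -` fst d)"
  then obtain p where p: "p \<in> fst c \<inter> W \<inter> y -` fst d" "q = (x p, snd d (y p))" by (rule imageE[OF _ that[rotated]])
  then show "q \<in> Gdom c d" using end_Psi[of p] d by (simp add: Gdom_def Psd_def)
next
  fix q assume q: "q \<in> Gdom c d"
  then have s: "0 < fst q" "fst q < x0" "snd q \<in> snd d ` fst d" "Psd d q \<in> fst c" by (auto simp: Gdom_def)
  have k: "cinv d (snd q) \<in> fst d" "snd d (cinv d (snd q)) = snd q" using d s(3) by (simp_all add: N.cinv_in)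
  have "q = (x (Psd d q), snd d (y (Psd d q)))" unfolding Psd_def Psi_end(2,3)[OF s(1,2)] k(2) by simp
  moreover have "Psd d q \<in> fst c \<inter> W \<inter> y -` fst d"
    using s(4) Psi_end(1,3)[OF s(1,2)] k(1) by (simp add: Psd_def)
  ultimately show "q \<in> (\<lambda>p. (x p, snd d (y p))) ` (fst c \<inter> W \<inter> y -` fst d)" by (rule image_eqI)
qed

text \<open>
  The inverse of the diffeomorphism in coordinates. The domain is open because the cross-section has no
  boundary, so these are derivatives in the ordinary sense.
\<close>

lemma inverse_coordinates_C1:
  assumes c: "c \<in> A" and d: "d \<in> AN"
  obtains G' where "\<And>q. q \<in> Gdom c d \<Longrightarrow> ((\<lambda>q. snd c (Psd d q)) has_derivative G' q) (at q)"
    "\<And>v. continuous_on (Gdom c d) (\<lambda>q. G' q v)"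
proof -
  have "smooth_on (\<lambda>(s, z). snd c (end_inv W x y (s, cinv d z))) ((\<lambda>p. (x p, snd d (y p))) ` (fst c \<inter> W \<inter> y -` fst d))"
    using end_diffeo c d unfolding end_diffeomorphism_def by blast
  moreover have "(\<lambda>(s, z). snd c (end_inv W x y (s, cinv d z))) = (\<lambda>q. snd c (Psd d q))"
    by (simp add: fun_eq_iff Psd_def Psi_def)
  ultimately have "smooth_on (\<lambda>q. snd c (Psd d q)) (Gdom c d)" using Gdom_image[OF c d] by simp
  then have "Ck_on (Suc 0) (\<lambda>q. snd c (Psd d q)) (Gdom c d)" unfolding smooth_on_def by (rule spec)
  then obtain G' where G': "\<forall>q\<in>Gdom c d. ((\<lambda>q. snd c (Psd d q)) has_derivative G' q) (at q within Gdom c d)"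
    "\<forall>v. continuous_on (Gdom c d) (\<lambda>q. G' q v)" by (simp only: Ck_on.simps) blast
  show thesis
  proof (rule that)
    fix q assume q: "q \<in> Gdom c d"
    then show "((\<lambda>q. snd c (Psd d q)) has_derivative G' q) (at q)"
      using G'(1) at_within_open[OF q Gdom_open[OF c d]] by auto
  qed (use G'(2) in blast)
qed

end

section \<open>Comparison of volumes in the end\<close>

text \<open>
  A coordinate half-tube of the end: \<open>0 < x < e\<close> over a ball in a chart of the cross-section. The
  metric comparison is recorded only as far as it is used: from above for vectors along the
  \<open>x\<close>-lines, and from below against the Euclidean metric of the coordinates, the metric of the
  cross-section being comparable to it on a compact ball.
\<close>

locale end_chart = end_setting A T \<pi> ip \<Gamma> g dv AN h W x0 x y
  for A :: "('m::{t2_space, second_countable_topology}, 'n::finite) chart set"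
    and T :: "('m, 'e, 'r::finite) triv set" and \<pi> and ip
    and \<Gamma> :: "('m, 'e, 'r) triv \<Rightarrow> ('m, 'n) chart \<Rightarrow> 'm \<Rightarrow> 'n \<Rightarrow> real ^ 'r ^ 'r"
    and g and dv and AN :: "('k::{t2_space, second_countable_topology}, 'l::finite) chart set"
    and h and W and x0 and x and y +
  fixes d :: "('k, 'l) chart" and z0 :: "real ^ 'l" and r e \<Lambda> \<kappa> \<theta> :: real
  assumes d: "d \<in> AN" and r: "0 < r" and ball_sub: "ball z0 r \<subseteq> snd d ` fst d"
    and e: "0 < e" "e \<le> x0" and lam: "0 < \<Lambda>" and kap: "0 < \<kappa>"
    and upper: "\<And>c p v. c \<in> A \<Longrightarrow> p \<in> fst c \<Longrightarrow> p \<in> W \<Longrightarrow> y p \<in> fst d \<Longrightarrow>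
       cderiv c (\<lambda>p. snd d (y p)) p v = 0 \<Longrightarrow> v \<bullet> (g c p *v v) \<le> \<Lambda> * (cderiv c x p v)\<^sup>2 / (x p)\<^sup>2"
    and lower: "\<And>c p v. c \<in> A \<Longrightarrow> p \<in> fst c \<Longrightarrow> p \<in> W \<Longrightarrow> y p \<in> fst d \<Longrightarrow> snd d (y p) \<in> ball z0 r \<Longrightarrow>
       \<kappa> / (x p)\<^sup>2 * ((cderiv c x p v)\<^sup>2 + (norm (cderiv c (\<lambda>p. snd d (y p)) p v))\<^sup>2) \<le> v \<bullet> (g c p *v v)"
    and sym_small: "AE p in dv. p \<in> W \<and> x p < e \<longrightarrow> end_symmetric_norm A T \<pi> ip \<Gamma> W x y p \<le> \<theta>"
    and theta: "\<theta> < (real CARD('n) - 1) / 2"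
begin

definition E0 :: "(real \<times> (real ^ 'l)) set" where "E0 = {0<..<e} \<times> ball z0 r"
definition Ps :: "real \<times> (real ^ 'l) \<Rightarrow> 'm" where "Ps = Psd d"
definition Ph :: "'m \<Rightarrow> real \<times> (real ^ 'l)" where "Ph p = (x p, snd d (y p))"
definition Ds :: "'m set" where "Ds = (W \<inter> y -` fst d) \<inter> Ph -` E0"

lemma E0_open: "open E0" by (simp add: E0_def open_Times)

lemma E0_sub: "E0 \<subseteq> {0<..<x0} \<times> snd d ` fst d" using ball_sub e by (auto simp: E0_def)

lemma Ps_Ph: "p \<in> Ds \<Longrightarrow> Ps (Ph p) = p" "p \<in> Ds \<Longrightarrow> Ph p \<in> E0"
  using end_Psi(1)[of p] d by (auto simp: Ds_def Ps_def Ph_def Psd_def)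

lemma Ph_Ps: assumes q: "q \<in> E0" shows "Ph (Ps q) = q" "Ps q \<in> Ds" "y (Ps q) = cinv d (snd q)" "x (Ps q) = fst q"
proof -
  have s: "0 < fst q" "fst q < x0" "snd q \<in> snd d ` fst d" using subsetD[OF E0_sub q] by auto
  have k: "cinv d (snd q) \<in> fst d" "snd d (cinv d (snd q)) = snd q" using d s(3) by (simp_all add: N.cinv_in)
  show yy: "y (Ps q) = cinv d (snd q)" and xx: "x (Ps q) = fst q" using Psi_end(2,3)[OF s(1,2)] by (simp_all add: Ps_def Psd_def)
  show *: "Ph (Ps q) = q" unfolding Ph_def xx yy k(2) by simp
  have "Ps q \<in> W" using Psi_end(1)[OF s(1,2)] by (simp add: Ps_def Psd_def)
  then show "Ps q \<in> Ds" using k yy q * by (simp add: Ds_def)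
qed

lemma Ps_cont: "continuous_on E0 Ps"
  unfolding Ps_def by (rule continuous_on_subset[OF Psd_cont[OF d] E0_sub])

lemma Ph_cont': "continuous_on (W \<inter> y -` fst d) Ph"
  unfolding Ph_def
  by (intro continuous_on_Pair continuous_on_subset[OF end_cont(1)]
      continuous_on_compose2[OF N.chart_cont[OF d] continuous_on_subset[OF end_cont(2)]]) auto

lemma Ph_cont: "continuous_on Ds Ph"
  by (rule continuous_on_subset[OF Ph_cont']) (auto simp: Ds_def)

lemma Ds_open: "open Ds"
  unfolding Ds_def by (rule continuous_open_preimage[OF Ph_cont' piece_open[OF d] E0_open])

lemma Ds_x: "p \<in> Ds \<Longrightarrow> 0 < x p" "p \<in> Ds \<Longrightarrow> x p < e" "p \<in> Ds \<Longrightarrow> p \<in> W" "p \<in> Ds \<Longrightarrow> y p \<in> fst d"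
  "p \<in> Ds \<Longrightarrow> snd d (y p) \<in> ball z0 r"
  by (auto simp: Ds_def Ph_def E0_def)

lemma Ph_cdiff:
  assumes c: "c \<in> A" and p: "p \<in> fst c" "p \<in> Ds"
  shows "cdiff c Ph p" "cderiv c Ph p v = (cderiv c x p v, cderiv c (\<lambda>p. snd d (y p)) p v)"
proof -
  have p': "p \<in> fst c \<inter> (W \<inter> y -` fst d)" using p by (auto simp: Ds_def)
  have "Ph = (\<lambda>p. (x p, snd d (y p)))" by (simp add: fun_eq_iff Ph_def)
  then show "cdiff c Ph p" "cderiv c Ph p v = (cderiv c x p v, cderiv c (\<lambda>p. snd d (y p)) p v)"
    using end_cdiff(3,4)[OF c d p'] by simp_all
qed

lemma Ph_image: "B \<subseteq> Ds \<Longrightarrow> E0 \<inter> Ps -` B = Ph ` B"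
proof (intro subset_antisym subsetI)
  fix q assume "B \<subseteq> Ds" and q: "q \<in> E0 \<inter> Ps -` B"
  then show "q \<in> Ph ` B" using Ph_Ps(1)[of q] by (intro image_eqI[of _ _ "Ps q"]) auto
next
  fix q assume B: "B \<subseteq> Ds" and "q \<in> Ph ` B"
  then obtain p where "p \<in> B" "q = Ph p" by (elim imageE)
  then show "q \<in> E0 \<inter> Ps -` B" using B Ps_Ph[of p] by auto
qed

lemma Ps_image: "X \<subseteq> E0 \<Longrightarrow> Ds \<inter> Ph -` X = Ps ` X"
proof (intro subset_antisym subsetI)
  fix p assume "X \<subseteq> E0" and p: "p \<in> Ds \<inter> Ph -` X"
  then show "p \<in> Ps ` X" using Ps_Ph(1)[of p] by (intro image_eqI[of _ _ "Ph p"]) auto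
next
  fix p assume X: "X \<subseteq> E0" and "p \<in> Ps ` X"
  then obtain q where "q \<in> X" "p = Ps q" by (elim imageE)
  then show "p \<in> Ds \<inter> Ph -` X" using X Ph_Ps[of q] by auto
qed

lemma borel_preimage:
  fixes f :: "'a::topological_space \<Rightarrow> 'b::topological_space"
  assumes "open X" "continuous_on X f" "B \<in> sets borel"
  shows "X \<inter> f -` B \<in> sets borel"
proof -
  have "f \<in> measurable (restrict_space borel X) borel" by (rule borel_measurable_continuous_on_restrict[OF assms(2)])
  from measurable_sets[OF this assms(3)] have "f -` B \<inter> X \<in> sets (restrict_space borel X)" by (simp add: space_restrict_space)
  then have "f -` B \<inter> X \<in> sets borel" using assms(1) by (simp add: sets_restrict_space_iff)
  then show ?thesis by (simp add: Int_commute)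
qed

lemma Ph_image_borel: "B \<in> sets borel \<Longrightarrow> B \<subseteq> Ds \<Longrightarrow> Ph ` B \<in> sets borel"
  using borel_preimage[OF E0_open Ps_cont, of B] Ph_image[of B] by simp

lemma Ps_image_borel: "X \<in> sets borel \<Longrightarrow> X \<subseteq> E0 \<Longrightarrow> Ps ` X \<in> sets borel"
  using borel_preimage[OF Ds_open Ph_cont, of X] Ps_image[of X] by simp

lemma cinv_image_borel:
  assumes c: "c \<in> A" and B: "B \<in> sets borel" "B \<subseteq> snd c ` fst c"
  shows "cinv c ` B \<in> sets borel"
proof -
  have "cinv c ` B = fst c \<inter> snd c -` B"
  proof (intro subset_antisym subsetI)
    fix p assume "p \<in> cinv c ` B"
    then obtain q where "q \<in> B" "p = cinv c q" by (elim imageE)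
    then show "p \<in> fst c \<inter> snd c -` B" using B c cinv_in[OF c, of q] by auto
  next
    fix p assume p: "p \<in> fst c \<inter> snd c -` B"
    then show "p \<in> cinv c ` B" using c by (intro image_eqI[of _ _ "snd c p"]) auto
  qed
  then show ?thesis using borel_preimage[OF chart_open[OF c] chart_cont[OF c] B(1)] by simp
qed

lemma DIM_end: "DIM(real \<times> (real ^ 'l)) = DIM(real ^ 'n)" using dimN by simp

text \<open>
  The volume is at least a constant times \<open>x\<^sup>-\<^sup>n dx dz\<close>. The factor \<open>x ^ n\<close> is kept on the side of
  the manifold, where it comes from the determinant estimate: coordinate lengths are at most a constant
  times \<open>x\<close> times metric lengths.
\<close>

lemma volume_lower_bound:
  obtains K where "0 \<le> K"
    "\<And>f. f \<in> borel_measurable borel \<Longrightarrow>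
      (\<integral>\<^sup>+q\<in>E0. f (Ps q) \<partial>lborel) \<le> (\<integral>\<^sup>+p\<in>Ds. (ennreal (K * x p ^ CARD('n)) * f p) \<partial>dv)"
proof -
  let ?n = "CARD('n)"
  obtain L :: "real \<times> (real ^ 'l) \<Rightarrow> real ^ 'n" and L' where L: "linear L" "linear L'" "\<And>x. L' (L x) = x" "\<And>y. L (L' y) = y"
    "\<And>x. norm (L x) = norm x" "\<And>B. B \<in> sets borel \<Longrightarrow> emeasure lborel (L ` B) = emeasure lborel B"
    "\<And>B. B \<in> sets borel \<Longrightarrow> L ` B \<in> sets borel"
    by (rule basis_isometry_exists[OF DIM_end]) (assumption | rule that)+
  define K where "K = sqrt (fact ?n / \<kappa> ^ ?n)"
  have K0: "0 \<le> K" using kap by (simp add: K_def)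
  have xc: "continuous_on Ds x" by (rule continuous_on_subset[OF end_cont(1)]) (auto simp: Ds_def)
  have wm: "(\<lambda>p. ennreal (K * x p ^ ?n) * indicator Ds p) \<in> borel_measurable borel"
  proof -
    have "(\<lambda>p. if p \<in> Ds then K * x p ^ ?n else 0) \<in> borel_measurable borel"
      by (rule borel_measurable_continuous_on_if) (use Ds_open xc in \<open>auto intro!: continuous_intros\<close>)
    then have "(\<lambda>p. ennreal (if p \<in> Ds then K * x p ^ ?n else 0)) \<in> borel_measurable borel" by simp
    also have "(\<lambda>p. ennreal (if p \<in> Ds then K * x p ^ ?n else 0)) = (\<lambda>p. ennreal (K * x p ^ ?n) * indicator Ds p)"
      by (auto simp: indicator_def)
    finally show ?thesis .
  qed
  have loc: "emeasure lborel (E0 \<inter> Ps -` B) \<le> (\<integral>\<^sup>+p\<in>B. ennreal (K * x p ^ ?n) \<partial>dv)"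
    if B: "B \<in> sets borel" "B \<subseteq> Ds" and U: "U \<in> fst ` A" "B \<subseteq> U" for B U
  proof -
    obtain c where c: "c \<in> A" and Uc: "U = fst c" using U(1) by (elim imageE)
    have Bc: "B \<subseteq> fst c" using U(2) Uc by simp
    let ?S = "snd c ` B" and ?V = "snd c ` fst c" and ?f = "\<lambda>q. Ph (cinv c q)"
    define f' where "f' q = cderiv c Ph (cinv c q)" for q
    define \<rho> where "\<rho> q = (if q \<in> snd c ` (fst c \<inter> Ds) then K * x (cinv c q) ^ ?n * dens c q else 0)" for q
    have SV: "?S \<subseteq> ?V" using Bc by auto
    have Sin: "cinv c q \<in> B" "snd c (cinv c q) = q" if "q \<in> ?S" for q
      using that Bc c by auto
    have Sm: "?S \<in> sets borel" by (rule chart_image_borel[OF c B(1) Bc])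
    have fS: "?f ` ?S = Ph ` B"
    proof -
      have "cinv c ` ?S = B" using Bc c by (force simp: image_image)
      then show ?thesis by (simp only: image_image[of Ph "cinv c" ?S, symmetric])
    qed
    have "emeasure lborel (?f ` ?S) \<le> (\<integral>\<^sup>+q\<in>?S. ennreal (\<rho> q) \<partial>lborel)"
    proof (rule emeasure_image_le[where L = L and f' = f', OF Sm])
      fix q assume q: "q \<in> ?S"
      have p: "cinv c q \<in> fst c" "cinv c q \<in> Ds" using Sin[OF q] Bc B(2) by auto
      have "(?f has_derivative f' q) (at (snd c (cinv c q)) within ?V)"
        unfolding f'_def by (rule cdiffD[OF Ph_cdiff(1)[OF c p]])
      then show "(?f has_derivative f' q) (at q within ?S)"
        unfolding Sin(2)[OF q] by (rule has_derivative_subset[OF _ SV])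
      let ?p = "cinv c q" and ?M = "matrix (\<lambda>v. L (f' q v))"
      have lin: "linear (f' q)" unfolding f'_def by (rule cderiv_linear[OF Ph_cdiff(1)[OF c p]])
      have linL: "linear (\<lambda>v. L (f' q v))" using linear_compose[OF lin L(1)] by (simp add: o_def)
      have x0p: "0 < x ?p" by (rule Ds_x(1)[OF p(2)])
      have k: "0 < \<kappa> / (x ?p)\<^sup>2" using kap x0p by simp
      have Mv: "(?M *v v) \<bullet> (?M *v v) = (cderiv c x ?p v)\<^sup>2 + (norm (cderiv c (\<lambda>p. snd d (y p)) ?p v))\<^sup>2" for v
      proof -
        have "(?M *v v) \<bullet> (?M *v v) = (norm (L (f' q v)))\<^sup>2"
          using matrix_works[OF linL[folded linear_matrix_vector_mul_eq], of v] by (simp add: power2_norm_eq_inner)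
        also have "\<dots> = (norm (f' q v))\<^sup>2" by (simp add: L(5))
        also have "f' q v = (cderiv c x ?p v, cderiv c (\<lambda>p. snd d (y p)) ?p v)" unfolding f'_def by (rule Ph_cdiff(2)[OF c p])
        finally show ?thesis by (simp add: norm_Pair)
      qed
      have "(det ?M)\<^sup>2 \<le> fact ?n / (\<kappa> / (x ?p)\<^sup>2) ^ ?n * det (g c ?p)"
      proof (rule det_lower_bound[OF metric_pos_def[OF c p(1)] k])
        fix v show "\<kappa> / (x ?p)\<^sup>2 * ((?M *v v) \<bullet> (?M *v v)) \<le> v \<bullet> (g c ?p *v v)"
          unfolding Mv by (rule lower[OF c p(1) Ds_x(3)[OF p(2)] Ds_x(4)[OF p(2)] Ds_x(5)[OF p(2)]])
      qed
      also have "fact ?n / (\<kappa> / (x ?p)\<^sup>2) ^ ?n * det (g c ?p) = (fact ?n / \<kappa> ^ ?n) * (x ?p ^ ?n)\<^sup>2 * det (g c ?p)"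
        by (simp add: power_divide power_mult[symmetric] mult.commute)
      finally have "sqrt ((det ?M)\<^sup>2) \<le> sqrt ((fact ?n / \<kappa> ^ ?n) * (x ?p ^ ?n)\<^sup>2 * det (g c ?p))" by (rule real_sqrt_le_mono)
      also have "\<dots> = K * x ?p ^ ?n * dens c q"
        unfolding real_sqrt_mult real_sqrt_abs K_def dens_def using x0p by simp
      also have "\<dots> = \<rho> q"
      proof -
        have "q \<in> snd c ` (fst c \<inter> Ds)" using p Sin(2)[OF q] by (intro image_eqI[of _ _ ?p]) auto
        then show ?thesis by (simp add: \<rho>_def)
      qed
      finally show "\<bar>det ?M\<bar> \<le> \<rho> q" by simp
    next
      fix X assume X: "X \<in> sets borel" "X \<subseteq> ?S"
      have "cinv c ` X \<in> sets borel" by (rule cinv_image_borel[OF c X(1)]) (use X SV in blast)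
      moreover have "cinv c ` X \<subseteq> Ds" using X Sin(1) B(2) by blast
      ultimately have "Ph ` cinv c ` X \<in> sets borel" by (rule Ph_image_borel)
      then show "?f ` X \<in> sets borel" by (simp only: image_image)
    next
      have D1: "fst c \<inter> Ds \<in> sets borel" using chart_open[OF c] Ds_open by auto
      have sub: "snd c ` (fst c \<inter> Ds) \<subseteq> ?V" by auto
      show "\<rho> \<in> borel_measurable borel" unfolding \<rho>_def
      proof (rule borel_measurable_continuous_on_if)
        show "snd c ` (fst c \<inter> Ds) \<in> sets borel" by (rule chart_image_borel[OF c D1]) auto
        have "continuous_on (snd c ` (fst c \<inter> Ds)) (\<lambda>q. x (cinv c q))"
          by (rule continuous_on_compose2[OF xc continuous_on_subset[OF cinv_cont[OF c] sub]]) (use c in auto)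
        then show "continuous_on (snd c ` (fst c \<inter> Ds)) (\<lambda>q. K * x (cinv c q) ^ ?n * dens c q)"
          by (intro continuous_intros continuous_on_subset[OF dens_cont[OF c] sub])
      qed simp
    qed (use L in auto)
    also have "\<dots> = (\<integral>\<^sup>+q\<in>?V. (ennreal (K * x (cinv c q) ^ ?n) * indicator B (cinv c q) * ennreal (dens c q)) \<partial>lborel)"
    proof (rule nn_integral_cong)
      fix q
      show "ennreal (\<rho> q) * indicator ?S q = ennreal (K * x (cinv c q) ^ ?n) * indicator B (cinv c q) * ennreal (dens c q) * indicator ?V q"
      proof (cases "q \<in> ?V")
        case True
        show ?thesis
        proof (cases "cinv c q \<in> B")
          case b: True
          have q: "q = snd c (cinv c q)" using c True by simp
          have "q \<in> ?S" by (subst q) (rule imageI[OF b])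
          moreover have "q \<in> snd c ` (fst c \<inter> Ds)" by (subst q) (rule imageI, use b Bc B(2) in auto)
          moreover have "0 \<le> K * x (cinv c q) ^ ?n" using K0 Ds_x(1)[of "cinv c q"] b B(2) by (auto simp: less_imp_le)
          ultimately show ?thesis using True b by (simp add: \<rho>_def ennreal_mult')
        next
          case False
          then have "q \<notin> ?S" using Sin(1) by blast
          then show ?thesis using False by simp
        qed
      next
        case False
        then have "q \<notin> ?S" using SV by blast
        then show ?thesis using False by simp
      qed
    qed
    also have "\<dots> = (\<integral>\<^sup>+p\<in>fst c. (ennreal (K * x p ^ ?n) * indicator B p) \<partial>dv)"
    proof (rule nn_integral_chart[OF c, symmetric])
      have "(\<lambda>p. ennreal (K * x p ^ ?n) * indicator Ds p * indicator B p) \<in> borel_measurable borel"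
        by (rule borel_measurable_times_ennreal[OF wm]) (use B(1) in simp)
      also have "(\<lambda>p. ennreal (K * x p ^ ?n) * indicator Ds p * indicator B p) = (\<lambda>p. ennreal (K * x p ^ ?n) * indicator B p)"
        using B(2) by (intro ext) (auto simp: indicator_def)
      finally show "(\<lambda>p. ennreal (K * x p ^ ?n) * indicator B p) \<in> borel_measurable borel" .
    qed
    also have "\<dots> = (\<integral>\<^sup>+p\<in>B. ennreal (K * x p ^ ?n) \<partial>dv)"
      using Bc by (intro nn_integral_cong) (auto simp: indicator_def)
    finally show ?thesis unfolding fS Ph_image[OF B(2)] .
  qed
  show thesis
  proof (rule that[OF K0])
    fix f :: "'m \<Rightarrow> ennreal" assume f: "f \<in> borel_measurable borel"
    show "(\<integral>\<^sup>+q\<in>E0. f (Ps q) \<partial>lborel) \<le> (\<integral>\<^sup>+p\<in>Ds. (ennreal (K * x p ^ ?n) * f p) \<partial>dv)"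
    proof (rule nn_integral_le_by_image[where \<U> = "fst ` A", OF _ _ _ _ Ps_cont _ _ _ wm _ f])
      show "\<Union> (fst ` A) = UNIV" using charts_cover by blast
      show "open U" if "U \<in> fst ` A" for U using that chart_open by (elim imageE) simp
      show "emeasure lborel (E0 \<inter> Ps -` B) \<le> (\<integral>\<^sup>+p\<in>B. ennreal (K * x p ^ ?n) \<partial>dv)"
        if "B \<in> sets borel" "B \<subseteq> Ds" "U \<in> fst ` A" "B \<subseteq> U" for B U by (rule loc[OF that])
      show "Ps q \<in> Ds" if "q \<in> E0" for q by (rule Ph_Ps(2)[OF that])
    qed (use E0_open Ds_open in simp_all)
  qed
qed

text \<open>
  The converse comparison is needed only on one small set \<open>U1\<close> away from \<open>x = 0\<close>, where it follows from
  continuity of the derivative of the inverse coordinates.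
\<close>

lemma volume_upper_bound:
  obtains U1 \<sigma> \<tau> K where "open U1" "U1 \<noteq> {}" "0 < \<sigma>" "\<tau> < e" "0 \<le> (K :: real)"
    "\<And>f. f \<in> borel_measurable borel \<Longrightarrow>
      (\<integral>\<^sup>+p\<in>U1. f p \<partial>dv) \<le> ennreal K * (\<integral>\<^sup>+q\<in>{\<sigma>..\<tau>} \<times> ball z0 r. f (Ps q) \<partial>lborel)"
proof -
  let ?n = "CARD('n)"
  obtain L :: "real \<times> (real ^ 'l) \<Rightarrow> real ^ 'n" and L' where L: "linear L" "linear L'" "\<And>x. L' (L x) = x" "\<And>y. L (L' y) = y"
    "\<And>x. norm (L x) = norm x" "\<And>B. B \<in> sets borel \<Longrightarrow> emeasure lborel (L ` B) = emeasure lborel B"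
    "\<And>B. B \<in> sets borel \<Longrightarrow> L ` B \<in> sets borel"
    by (rule basis_isometry_exists[OF DIM_end]) (assumption | rule that)+
  define q1 where "q1 = (e / 2, z0)"
  have q1: "q1 \<in> E0" using e r by (simp add: q1_def E0_def)
  obtain c where c: "c \<in> A" "Ps q1 \<in> fst c" using charts_cover by blast
  obtain G' where G': "\<And>q. q \<in> Gdom c d \<Longrightarrow> ((\<lambda>q. snd c (Psd d q)) has_derivative G' q) (at q)"
    "\<And>v. continuous_on (Gdom c d) (\<lambda>q. G' q v)" by (rule inverse_coordinates_C1[OF c(1) d]) (assumption | rule that)+
  have q1G: "q1 \<in> Gdom c d" using subsetD[OF E0_sub q1] c(2) by (simp add: Gdom_def Ps_def)
  let ?X = "Gdom c d \<inter> ({e/4<..<3*e/4} \<times> ball z0 r)"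
  have "open ?X" using Gdom_open[OF c(1) d] by (intro open_Int open_Times) auto
  moreover have "q1 \<in> ?X" using q1G e r by (simp add: q1_def)
  ultimately have "\<exists>s>0. cball q1 s \<subseteq> ?X" by (metis open_contains_cball)
  then obtain s where s: "0 < s" "cball q1 s \<subseteq> ?X" by blast
  let ?Q = "cball q1 s" and ?O = "ball q1 s"
  have OQ: "?O \<subseteq> ?Q" by auto
  have QE: "?Q \<subseteq> E0" using s(2) e by (auto simp: E0_def)
  have QG: "?Q \<subseteq> Gdom c d" using s(2) by auto
  have PQ: "Ps q \<in> fst c" if "q \<in> ?Q" for q using subsetD[OF QG that] by (simp add: Gdom_def Ps_def)
  obtain m1 where m1: "0 \<le> m1" "\<And>(i::bool) q. q \<in> ?Q \<Longrightarrow> \<bar>dens c (snd c (Ps q))\<bar> \<le> m1"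
  proof (rule compact_family_bound[of ?Q "\<lambda>(_::bool) q. dens c (snd c (Ps q))"])
    have "continuous_on ?Q (\<lambda>q. snd c (Ps q))"
      by (rule continuous_on_compose2[OF chart_cont[OF c(1)] continuous_on_subset[OF Ps_cont QE]]) (use PQ in auto)
    then show "continuous_on ?Q (\<lambda>q. dens c (snd c (Ps q)))"
      by (rule continuous_on_compose2[OF dens_cont[OF c(1)]]) (use PQ in auto)
  qed (auto intro: that)
  obtain m2 where m2: "0 \<le> m2" "\<And>(i :: 'n \<times> 'n) q. q \<in> ?Q \<Longrightarrow> \<bar>G' q (L' (axis (snd i) 1)) $ fst i\<bar> \<le> m2"
    by (rule compact_family_bound[of ?Q "\<lambda>(i :: 'n \<times> 'n) q. G' q (L' (axis (snd i) 1)) $ fst i"])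
      (auto intro!: continuous_on_component continuous_on_subset[OF G'(2) QG] intro: that)
  define C where "C = fact ?n * m2 ^ ?n"
  have C0: "0 \<le> C" using m2 by (simp add: C_def)
  define U1 where "U1 = Ds \<inter> Ph -` ?O"
  have U1o: "open U1" unfolding U1_def by (rule continuous_open_preimage[OF Ph_cont Ds_open]) simp
  have OE: "?O \<subseteq> E0" using OQ QE by auto
  have loc: "emeasure dv (U1 \<inter> Ph -` X) \<le> (\<integral>\<^sup>+q\<in>X. ennreal (m1 * C) \<partial>lborel)"
    if X: "X \<in> sets borel" "X \<subseteq> ?O" for X
  proof -
    have XE: "X \<subseteq> E0" using X OE by auto
    have XQ: "X \<subseteq> ?Q" using X OQ by auto
    have eq: "U1 \<inter> Ph -` X = Ps ` X" using Ps_image[OF XE] X(2) by (auto simp: U1_def)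
    have PX: "Ps ` X \<in> sets borel" by (rule Ps_image_borel[OF X(1) XE])
    have Pc: "Ps ` X \<subseteq> fst c" using PQ XQ by blast
    let ?S = "L ` X" and ?f = "\<lambda>v. snd c (Ps (L' v))"
    have L'S: "L' v \<in> X" if "v \<in> ?S" for v using that L(3) by auto
    have fS: "?f ` ?S = snd c ` Ps ` X" using L(3) by (simp add: image_image)
    have "emeasure lborel (?f ` ?S) \<le> (\<integral>\<^sup>+v\<in>?S. ennreal C \<partial>lborel)"
    proof (rule emeasure_image_le[where L = "\<lambda>v. v" and f' = "\<lambda>v u. G' (L' v) (L' u)", OF L(7)[OF X(1)]])
      fix v assume v: "v \<in> ?S"
      have q: "L' v \<in> X" by (rule L'S[OF v])
      have qG: "L' v \<in> Gdom c d" using q XQ QG by auto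
      have d1: "((\<lambda>q. snd c (Ps q)) has_derivative G' (L' v)) (at (L' v))" unfolding Ps_def by (rule G'(1)[OF qG])
      have dL: "(L' has_derivative L') (at v within ?S)"
        by (rule bounded_linear_imp_has_derivative) (use L(2) in \<open>simp add: linear_conv_bounded_linear\<close>)
      show "(?f has_derivative (\<lambda>u. G' (L' v) (L' u))) (at v within ?S)"
        by (rule has_derivative_compose[OF dL d1])
      show "\<bar>det (matrix (\<lambda>u. G' (L' v) (L' u)))\<bar> \<le> C" unfolding C_def
      proof (rule det_le_entries)
        fix i j :: 'n
        show "\<bar>matrix (\<lambda>u. G' (L' v) (L' u)) $ i $ j\<bar> \<le> m2"
          using m2(2)[of "L' v" "(i, j)"] q XQ by (auto simp: matrix_def)
      qed
    next
      fix B assume B: "B \<in> sets borel" "B \<subseteq> ?S"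
      have "L' ` B = L -` B"
      proof (intro subset_antisym subsetI)
        fix a assume "a \<in> L' ` B" then show "a \<in> L -` B" using L(4) by auto
      next
        fix a assume "a \<in> L -` B" then show "a \<in> L' ` B" using L(3)[of a] by (intro image_eqI[of _ _ "L a"]) simp_all
      qed
      moreover have "L -` B \<in> sets borel"
      proof -
        have "continuous_on UNIV L" using L(1) by (simp add: linear_continuous_on linear_conv_bounded_linear)
        then have "L \<in> borel_measurable borel" by (rule borel_measurable_continuous_onI)
        from measurable_sets[OF this B(1)] show ?thesis by simp
      qed
      ultimately have L'B: "L' ` B \<in> sets borel" by simp
      have L'X: "L' ` B \<subseteq> X" using B L'S by blast
      have "Ps ` L' ` B \<in> sets borel" by (rule Ps_image_borel[OF L'B]) (use L'X XE in blast)
      moreover have "Ps ` L' ` B \<subseteq> fst c" using L'X Pc by blast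
      ultimately have "snd c ` Ps ` L' ` B \<in> sets borel" by (rule chart_image_borel[OF c(1)])
      then show "?f ` B \<in> sets borel" by (simp only: image_image)
    qed (auto simp: linear_id[unfolded id_def])
    also have "\<dots> = ennreal C * emeasure lborel X"
      using L(6)[OF X(1)] L(7)[OF X(1)] by (subst nn_integral_cmult_indicator) auto
    finally have im: "emeasure lborel (snd c ` Ps ` X) \<le> ennreal C * emeasure lborel X" unfolding fS .
    have "emeasure dv (Ps ` X) = (\<integral>\<^sup>+q\<in>snd c ` Ps ` X. ennreal (dens c q) \<partial>lborel)"
      by (rule emeasure_chart[OF c(1) PX Pc])
    also have "\<dots> \<le> (\<integral>\<^sup>+q. ennreal m1 * indicator (snd c ` Ps ` X) q \<partial>lborel)"
    proof (intro nn_integral_mono)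
      fix q
      show "ennreal (dens c q) * indicator (snd c ` Ps ` X) q \<le> ennreal m1 * indicator (snd c ` Ps ` X) q"
      proof (cases "q \<in> snd c ` Ps ` X")
        case True
        then obtain q' where "q' \<in> X" "q = snd c (Ps q')" by (elim imageE) simp
        then have "dens c q \<le> m1" using m1(2)[of q'] XQ by force
        then show ?thesis using True by (simp add: ennreal_leI)
      qed simp
    qed
    also have "\<dots> = ennreal m1 * emeasure lborel (snd c ` Ps ` X)"
      by (rule nn_integral_cmult_indicator) (use chart_image_borel[OF c(1) PX Pc] in simp)
    also have "\<dots> \<le> ennreal m1 * (ennreal C * emeasure lborel X)" by (rule mult_left_mono[OF im]) simp
    also have "\<dots> = (\<integral>\<^sup>+q\<in>X. ennreal (m1 * C) \<partial>lborel)"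
      using m1(1) C0 X(1) by (subst nn_integral_cmult_indicator) (auto simp: ennreal_mult mult.assoc)
    finally show ?thesis unfolding eq .
  qed
  show thesis
  proof (rule that[OF U1o, of "e/4" "3*e/4" "m1 * C"])
    have "Ps q1 \<in> U1" using Ph_Ps[OF q1] s by (simp add: U1_def)
    then show "U1 \<noteq> {}" by auto
    fix f :: "'m \<Rightarrow> ennreal" assume f: "f \<in> borel_measurable borel"
    obtain p0 :: 'm where True by simp
    define F where "F q = f (if q \<in> E0 then Ps q else p0)" for q
    have Fm: "F \<in> borel_measurable borel" unfolding F_def
      by (rule measurable_compose[OF _ f], rule borel_measurable_continuous_on_if) (use E0_open Ps_cont in auto)
    have "(\<integral>\<^sup>+p\<in>U1. F (Ph p) \<partial>dv) \<le> (\<integral>\<^sup>+q\<in>?O. (ennreal (m1 * C) * F q) \<partial>lborel)"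
    proof (rule nn_integral_le_by_image[where \<U> = "{UNIV}" and \<psi> = Ph, OF _ _ _ _ _ _ _ _ _ _ Fm])
      show "continuous_on U1 Ph" by (rule continuous_on_subset[OF Ph_cont]) (auto simp: U1_def)
      show "emeasure dv (U1 \<inter> Ph -` B) \<le> (\<integral>\<^sup>+q\<in>B. ennreal (m1 * C) \<partial>lborel)" if "B \<in> sets borel" "B \<subseteq> ?O" for B
        by (rule loc[OF that])
      show "(\<lambda>b. ennreal (m1 * C) * indicator ?O b) \<in> borel_measurable borel"
        by (intro borel_measurable_times_ennreal borel_measurable_const borel_measurable_indicator) simp
      show "Ph p \<in> ?O" if "p \<in> U1" for p using that by (simp add: U1_def)
    qed (use U1o in simp_all)
    also have "\<dots> \<le> (\<integral>\<^sup>+q. ennreal (m1 * C) * (F q * indicator ({e/4..3*e/4} \<times> ball z0 r) q) \<partial>lborel)"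
    proof (rule nn_integral_mono)
      fix q
      have "q \<in> {e/4..3*e/4} \<times> ball z0 r" if "q \<in> ?O"
      proof -
        have "q \<in> {e/4<..<3*e/4} \<times> ball z0 r" using subsetD[OF s(2) subsetD[OF OQ that]] by (rule IntD2)
        then show ?thesis by (rule rev_subsetD) (intro Sigma_mono, auto)
      qed
      then show "ennreal (m1 * C) * F q * indicator ?O q \<le> ennreal (m1 * C) * (F q * indicator ({e/4..3*e/4} \<times> ball z0 r) q)"
        by (cases "q \<in> ?O") (simp_all add: mult.assoc)
    qed
    also have "\<dots> = ennreal (m1 * C) * (\<integral>\<^sup>+q\<in>{e/4..3*e/4} \<times> ball z0 r. F q \<partial>lborel)"
      by (rule nn_integral_cmult) (use Fm in \<open>intro borel_measurable_times_ennreal borel_measurable_indicator; simp add: borel_Times\<close>)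
    also have "(\<integral>\<^sup>+q\<in>{e/4..3*e/4} \<times> ball z0 r. F q \<partial>lborel) = (\<integral>\<^sup>+q\<in>{e/4..3*e/4} \<times> ball z0 r. f (Ps q) \<partial>lborel)"

    proof (rule nn_integral_cong)
      fix q
      show "F q * indicator ({e/4..3*e/4} \<times> ball z0 r) q = f (Ps q) * indicator ({e/4..3*e/4} \<times> ball z0 r) q"
      proof (cases "q \<in> {e/4..3*e/4} \<times> ball z0 r")
        case True
        then have "q \<in> E0" unfolding E0_def by (rule rev_subsetD) (use e in \<open>intro Sigma_mono, auto\<close>)
        then show ?thesis by (simp add: F_def)
      qed simp
    qed
    finally have "(\<integral>\<^sup>+p\<in>U1. F (Ph p) \<partial>dv) \<le> ennreal (m1 * C) * (\<integral>\<^sup>+q\<in>{e/4..3*e/4} \<times> ball z0 r. f (Ps q) \<partial>lborel)" .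
    moreover have "(\<integral>\<^sup>+p\<in>U1. F (Ph p) \<partial>dv) = (\<integral>\<^sup>+p\<in>U1. f p \<partial>dv)"

    proof (rule nn_integral_cong)
      fix p
      show "F (Ph p) * indicator U1 p = f p * indicator U1 p"
        using Ps_Ph[of p] by (cases "p \<in> U1") (simp_all add: F_def U1_def)
    qed
    ultimately show "(\<integral>\<^sup>+p\<in>U1. f p \<partial>dv) \<le> ennreal (m1 * C) * (\<integral>\<^sup>+q\<in>{e/4..3*e/4} \<times> ball z0 r. f (Ps q) \<partial>lborel)" by simp
  qed (use e m1 C0 in auto)
qed

end

section \<open>The Hardy inequality in the end\<close>

text \<open>
  Tonelli's theorem with the real variable as the inner one.
\<close>

lemma nn_integral_rectangle:
  fixes \<phi> :: "real \<times> 'b::euclidean_space \<Rightarrow> ennreal"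
  assumes \<phi>: "\<phi> \<in> borel_measurable borel" and S: "S \<in> sets borel" and B: "B \<in> sets borel"
  shows "(\<integral>\<^sup>+q\<in>S \<times> B. \<phi> q \<partial>lborel) = (\<integral>\<^sup>+z\<in>B. (\<integral>\<^sup>+s\<in>S. \<phi> (s, z) \<partial>lborel) \<partial>lborel)"
    and "(\<lambda>z. (\<integral>\<^sup>+s\<in>S. \<phi> (s, z) \<partial>lborel) * indicator B z) \<in> borel_measurable borel"
proof -
  have m: "(\<lambda>q. \<phi> q * indicator (S \<times> B) q) \<in> borel_measurable (lborel \<Otimes>\<^sub>M lborel)"
    unfolding lborel_prod using \<phi> S B by (intro borel_measurable_times_ennreal borel_measurable_indicator) (simp_all add: borel_Times)
  have \<phi>': "\<phi> \<in> borel_measurable (borel \<Otimes>\<^sub>M borel)" using \<phi> by (simp only: borel_prod)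
  have in_eq: "(\<integral>\<^sup>+s. \<phi> (s, z) * indicator (S \<times> B) (s, z) \<partial>lborel) = (\<integral>\<^sup>+s\<in>S. \<phi> (s, z) \<partial>lborel) * indicator B z" for z
    by (cases "z \<in> B") (simp_all add: indicator_def)
  have "(\<integral>\<^sup>+q\<in>S \<times> B. \<phi> q \<partial>lborel) = (\<integral>\<^sup>+q. \<phi> q * indicator (S \<times> B) q \<partial>(lborel \<Otimes>\<^sub>M lborel))"
    unfolding lborel_prod ..
  also have "\<dots> = (\<integral>\<^sup>+z. (\<integral>\<^sup>+s. \<phi> (s, z) * indicator (S \<times> B) (s, z) \<partial>lborel) \<partial>lborel)"
    by (rule lborel_pair.nn_integral_snd[OF m, symmetric])
  finally show "(\<integral>\<^sup>+q\<in>S \<times> B. \<phi> q \<partial>lborel) = (\<integral>\<^sup>+z\<in>B. (\<integral>\<^sup>+s\<in>S. \<phi> (s, z) \<partial>lborel) \<partial>lborel)"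
    unfolding in_eq .
  note [measurable] = \<phi>' S B
  show "(\<lambda>z. (\<integral>\<^sup>+s\<in>S. \<phi> (s, z) \<partial>lborel) * indicator B z) \<in> borel_measurable borel" by measurable
qed

context end_chart
begin

text \<open>
  The chain rule along the \<open>x\<close>-lines. The function \<open>\<Phi>\<close> is differentiable in a chart, which may be a
  half-space; differentiating the composition with the line avoids any assumption on the position of
  the point relative to the boundary.
\<close>

lemma along_x:
  fixes \<Phi> :: "'m \<Rightarrow> 'b::real_normed_vector"
  assumes c: "c \<in> A" and q: "q \<in> E0" "Ps q \<in> fst c"
  shows "\<And>G'. ((\<lambda>q. snd c (Psd d q)) has_derivative G' q) (at q) \<Longrightarrow> partial_x W x y c (Ps q) = G' q (1, 0)"
    and "cdiff c \<Phi> (Ps q) \<Longrightarrow>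
      ((\<lambda>s. \<Phi> (Ps (s, snd q))) has_vector_derivative cderiv c \<Phi> (Ps q) (partial_x W x y c (Ps q))) (at (fst q))"
proof -
  have qG: "q \<in> Gdom c d" using subsetD[OF E0_sub q(1)] q(2) by (simp add: Gdom_def Ps_def)
  let ?\<gamma> = "\<lambda>s. snd c (Psd d (s, snd q))"
  have path: "(?\<gamma> has_derivative (\<lambda>t. G' q (t, 0))) (at (fst q))" "G' q (t, 0) = t *\<^sub>R G' q (1, 0)" "partial_x W x y c (Ps q) = G' q (1, 0)"
    if G': "((\<lambda>q. snd c (Psd d q)) has_derivative G' q) (at q)" for G' t
  proof -
    have d1: "((\<lambda>s. (s, snd q)) has_derivative (\<lambda>t. (t, 0))) (at (fst q))" by (auto intro!: derivative_eq_intros)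
    have dq: "((\<lambda>q. snd c (Psd d q)) has_derivative G' q) (at ((\<lambda>s. (s, snd q)) (fst q)))" using G' by simp
    show der: "(?\<gamma> has_derivative (\<lambda>t. G' q (t, 0))) (at (fst q))" by (rule has_derivative_compose[OF d1 dq])
    have lin: "linear (G' q)" by (rule has_derivative_linear[OF G'])
    have sc: "G' q (t, 0) = t *\<^sub>R G' q (1, 0)" for t using linear_cmul[OF lin, of t "(1, 0)"] by simp
    then show "G' q (t, 0) = t *\<^sub>R G' q (1, 0)" .
    have "(?\<gamma> has_vector_derivative G' q (1, 0)) (at (fst q))"
      unfolding has_vector_derivative_def by (rule has_derivative_eq_rhs[OF der]) (rule ext, rule sc)
    then have "vector_derivative ?\<gamma> (at (fst q)) = G' q (1, 0)" by (rule vector_derivative_at)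
    then show "partial_x W x y c (Ps q) = G' q (1, 0)"
      unfolding partial_x_def Ph_Ps(3,4)[OF q(1)] by (simp add: Psd_def Psi_def)
  qed
  show "partial_x W x y c (Ps q) = G' q (1, 0)" if "((\<lambda>q. snd c (Psd d q)) has_derivative G' q) (at q)" for G'
    by (rule path(3)[of G', OF that])
  assume cd: "cdiff c \<Phi> (Ps q)"
  obtain G' where G': "\<And>q. q \<in> Gdom c d \<Longrightarrow> ((\<lambda>q. snd c (Psd d q)) has_derivative G' q) (at q)"
    "\<And>v. continuous_on (Gdom c d) (\<lambda>q. G' q v)" by (rule inverse_coordinates_C1[OF c d]) (assumption | rule that)+
  note pth = path[of G', OF G'(1)[OF qG]]
  define I where "I = (\<lambda>s. (s, snd q)) -` Gdom c d"
  have Io: "open I" unfolding I_def by (rule open_vimage[OF Gdom_open[OF c d]]) (intro continuous_intros)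
  have qI: "fst q \<in> I" using qG by (simp add: I_def)
  have inV: "Psd d (s, snd q) \<in> fst c" if "s \<in> I" for s using that by (simp add: I_def Gdom_def)
  have "((\<lambda>w. \<Phi> (cinv c w)) has_derivative cderiv c \<Phi> (Ps q)) (at (?\<gamma> (fst q)) within snd c ` fst c)"
    using cdiffD[OF cd] by (simp add: Ps_def)
  then have "((\<lambda>w. \<Phi> (cinv c w)) has_derivative cderiv c \<Phi> (Ps q)) (at (?\<gamma> (fst q)) within ?\<gamma> ` I)"
    by (rule has_derivative_subset) (use inV in blast)
  from has_derivative_in_compose[OF has_derivative_at_withinI[OF pth(1)] this]
  have "((\<lambda>s. \<Phi> (cinv c (?\<gamma> s))) has_derivative (\<lambda>t. cderiv c \<Phi> (Ps q) (G' q (t, 0)))) (at (fst q) within I)" .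
  then have "((\<lambda>s. \<Phi> (Ps (s, snd q))) has_derivative (\<lambda>t. cderiv c \<Phi> (Ps q) (G' q (t, 0)))) (at (fst q) within I)"
    by (rule has_derivative_transform[rotated -1]) (use qI inV c in \<open>auto simp: Ps_def\<close>)
  then have D: "((\<lambda>s. \<Phi> (Ps (s, snd q))) has_derivative (\<lambda>t. cderiv c \<Phi> (Ps q) (G' q (t, 0)))) (at (fst q))"
    unfolding at_within_open[OF qI Io] .
  have eq: "cderiv c \<Phi> (Ps q) (G' q (t, 0)) = t *\<^sub>R cderiv c \<Phi> (Ps q) (partial_x W x y c (Ps q))" for t
    unfolding pth(2)[of t] pth(3) by (rule linear_cmul[OF cderiv_linear[OF cd]])
  show "((\<lambda>s. \<Phi> (Ps (s, snd q))) has_vector_derivative cderiv c \<Phi> (Ps q) (partial_x W x y c (Ps q))) (at (fst q))"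
    unfolding has_vector_derivative_def by (rule has_derivative_eq_rhs[OF D]) (rule ext, rule eq)
qed

text \<open>
  Since \<open>x\<close> grows with unit speed along its lines and the other coordinates are constant, the metric
  comparison bounds the squared length of this vector by \<open>\<Lambda> / x\<^sup>2\<close>.
\<close>

lemma partial_x_length:
  assumes c: "c \<in> A" and p: "p \<in> fst c" "p \<in> Ds"
  defines "v \<equiv> partial_x W x y c p"
  shows "v \<bullet> (g c p *v v) \<le> \<Lambda> / (x p)\<^sup>2"
proof -
  define q where "q = Ph p"
  have q: "q \<in> E0" "Ps q = p" using Ps_Ph[OF p(2)] by (simp_all add: q_def)
  have pc: "Ps q \<in> fst c" using p q by simp
  have cd: "cdiff c Ph (Ps q)" unfolding q(2) by (rule Ph_cdiff(1)[OF c p])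
  have q1: "fst q \<in> {0<..<e}" "snd q \<in> ball z0 r" using q(1) unfolding E0_def by auto
  have "((\<lambda>s. Ph (Ps (s, snd q))) has_vector_derivative cderiv c Ph p v) (at (fst q))"
    using along_x(2)[OF c q(1) pc cd] unfolding q(2) v_def .
  moreover have "((\<lambda>s. Ph (Ps (s, snd q))) has_vector_derivative (1, 0)) (at (fst q))"
  proof (rule has_vector_derivative_transform_within_open[where S = "{0<..<e}"])
    show "((\<lambda>s. (s, snd q)) has_vector_derivative (1, 0)) (at (fst q))"
      unfolding has_vector_derivative_def by (auto intro!: derivative_eq_intros)
    show "(s, snd q) = Ph (Ps (s, snd q))" if "s \<in> {0<..<e}" for s
      using Ph_Ps(1)[of "(s, snd q)"] that q1 by (simp add: E0_def)
  qed (use q1 in auto)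
  ultimately have "cderiv c Ph p v = (1, 0)" by (rule vector_derivative_unique_at)
  then have "cderiv c x p v = 1" "cderiv c (\<lambda>p. snd d (y p)) p v = 0" unfolding Ph_cdiff(2)[OF c p] by simp_all
  then show ?thesis using upper[OF c p(1) Ds_x(3)[OF p(2)] Ds_x(4)[OF p(2)], of v] by simp
qed

text \<open>
  The derivative of \<open>|u|\<^sup>2\<close> along the \<open>x\<close>-line, written in the chart in which the decay condition is
  stated.
\<close>

definition H :: "('m \<Rightarrow> 'e) \<Rightarrow> 'm \<Rightarrow> real" where
  "H u p = cderiv (chart_at A p) (\<lambda>p. ip (u p) (u p)) p (partial_x W x y (chart_at A p) p)"

lemma norm_sq_along_x:
  assumes u: "C1_section_on A \<pi> T UNIV u" and q: "q \<in> E0"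
  shows "((\<lambda>s. ip (u (Ps (s, snd q))) (u (Ps (s, snd q)))) has_real_derivative H u (Ps q)) (at (fst q))"
  unfolding has_real_derivative_iff_has_vector_derivative H_def
  by (rule along_x(2)[OF chart_at(1) q chart_at(2) norm_sq_cdiff[OF u chart_at(1) chart_at(2)]])

text \<open>
  The chart used in the definition jumps from point to point. In a fixed chart and trivialization the
  same derivative is visibly continuous, and it does not depend on the chart, being the derivative of a
  function of one variable.
\<close>

lemma H_cont:
  assumes u: "C1_section_on A \<pi> T UNIV u"
  shows "continuous_on E0 (\<lambda>q. H u (Ps q))" and "continuous_on Ds (H u)"
proof -
  show *: "continuous_on E0 (\<lambda>q. H u (Ps q))"
  proof (subst continuous_on_eq_continuous_at[OF E0_open], rule ballI)
    fix q assume q: "q \<in> E0"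
    let ?F = "\<lambda>p. ip (u p) (u p)"
    obtain c where c: "c \<in> A" "Ps q \<in> fst c" using charts_cover by blast
    obtain t where t: "t \<in> T" "Ps q \<in> fst t" using trivs_cover by blast
    obtain G' where G': "\<And>q. q \<in> Gdom c d \<Longrightarrow> ((\<lambda>q. snd c (Psd d q)) has_derivative G' q) (at q)"
      "\<And>v. continuous_on (Gdom c d) (\<lambda>q. G' q v)" by (rule inverse_coordinates_C1[OF c(1) d]) (assumption | rule that)+
    define X where "X = (E0 \<inter> Gdom c d) \<inter> Ps -` fst t"
    have Xo: "open X" unfolding X_def
      by (rule continuous_open_preimage[OF continuous_on_subset[OF Ps_cont] open_Int[OF E0_open Gdom_open[OF c(1) d]] triv_open[OF t(1)]]) auto
    have qG: "q \<in> Gdom c d" using subsetD[OF E0_sub q] c(2) by (simp add: Gdom_def Ps_def)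
    have qX: "q \<in> X" using q qG t by (simp add: X_def)
    have XD: "a \<in> E0" "a \<in> Gdom c d" "Ps a \<in> fst c" "Ps a \<in> fst t" if "a \<in> X" for a
      using that by (auto simp: X_def Gdom_def Ps_def)
    have XE: "X \<subseteq> E0" and XG: "X \<subseteq> Gdom c d" using XD by auto
    have sc: "continuous_on X (\<lambda>a. snd c (Ps a))"
      by (rule continuous_on_compose2[OF chart_cont[OF c(1)] continuous_on_subset[OF Ps_cont XE]]) (use XD in auto)
    have dc: "continuous_on X (\<lambda>a. cderiv c ?F (Ps a) v)" for v
    proof -
      have "continuous_on X (\<lambda>a. cderiv c ?F (cinv c (snd c (Ps a))) v)"
        by (rule continuous_on_compose2[OF norm_sq_cont_deriv[OF u c(1) t(1)] sc]) (use XD in blast)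
      then show ?thesis
        by (rule continuous_on_cong[THEN iffD1, rotated 2]) (use XD c in auto)
    qed
    have "continuous_on X (\<lambda>a. \<Sum>i\<in>UNIV. G' a (1, 0) $ i * cderiv c ?F (Ps a) (axis i 1))"
      by (intro continuous_on_sum continuous_on_mult continuous_on_component dc continuous_on_subset[OF G'(2) XG])
    moreover have "(\<Sum>i\<in>UNIV. G' a (1, 0) $ i * cderiv c ?F (Ps a) (axis i 1)) = H u (Ps a)" if a: "a \<in> X" for a
    proof -
      note cd = norm_sq_cdiff[OF u c(1) XD(3)[OF a]]
      have "(\<Sum>i\<in>UNIV. G' a (1, 0) $ i * cderiv c ?F (Ps a) (axis i 1)) = cderiv c ?F (Ps a) (G' a (1, 0))"
        by (rule linear_form_expand[OF cderiv_linear[OF cd], symmetric])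
      also have "\<dots> = cderiv c ?F (Ps a) (partial_x W x y c (Ps a))"
        by (rule arg_cong[OF along_x(1)[where G' = G', OF c(1) XD(1)[OF a] XD(3)[OF a] G'(1)[OF XD(2)[OF a]], symmetric]])
      also have "\<dots> = H u (Ps a)"
        by (rule vector_derivative_unique_at[OF along_x(2)[OF c(1) XD(1)[OF a] XD(3)[OF a] cd]
            norm_sq_along_x[OF u XD(1)[OF a], unfolded has_real_derivative_iff_has_vector_derivative]])
      finally show ?thesis .
    qed
    ultimately have "continuous_on X (\<lambda>q. H u (Ps q))" using continuous_on_cong[OF refl, of X] by (metis (no_types, lifting))
    then show "isCont (\<lambda>q. H u (Ps q)) q" using continuous_on_eq_continuous_at[OF Xo] qX by blast
  qed
  have "continuous_on Ds (\<lambda>p. H u (Ps (Ph p)))"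
    by (rule continuous_on_compose2[OF * Ph_cont]) (use Ps_Ph(2) in auto)
  then show "continuous_on Ds (H u)" by (rule continuous_on_cong[THEN iffD1, rotated 2]) (simp_all add: Ps_Ph)
qed

text \<open>
  The differential inequality for the Hardy argument. The symmetric part contributes at most
  \<open>2 \<theta> |u|\<^sup>2\<close>, and Young's inequality with a parameter \<open>\<delta>\<close> splits the term with \<open>|\<nabla>u|\<close>.
\<close>

lemma radial_derivative_bound:
  assumes u: "C1_section_on A \<pi> T UNIV u" and \<delta>: "0 < \<delta>"
  shows "AE p in dv. p \<in> Ds \<longrightarrow>
    x p * \<bar>H u p\<bar> - (2 * \<theta> + \<delta>) * ip (u p) (u p) \<le> \<Lambda> / \<delta> * nabla_norm_sq A g T \<pi> ip \<Gamma> u p"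
  using sym_small
proof eventually_elim
  case (elim p)
  show ?case
  proof
    assume p: "p \<in> Ds"
    let ?c = "chart_at A p" and ?F = "ip (u p) (u p)" and ?D = "nabla_norm_sq A g T \<pi> ip \<Gamma> u p"
    let ?v = "partial_x W x y ?c p"
    let ?op = "fibre_opnorm \<pi> ip p (symmetric_part A T \<pi> ip \<Gamma> ?c p ?v)"
    note c = chart_at[of p]
    have xp: "0 < x p" by (rule Ds_x(1)[OF p])
    have F0: "0 \<le> ?F" by (rule norm_sq_nonneg[OF u])
    obtain t where t: "t \<in> T" "p \<in> fst t" using trivs_cover by blast
    have D0: "0 \<le> ?D" by (rule nabla_bound(2)[OF u c(1) t(1) c(2) t(2)])
    have op: "x p * ?op \<le> \<theta>"
      using elim Ds_x(2,3)[OF p] xp by (simp add: end_symmetric_norm_def Let_def)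
    let ?b = "sqrt (\<Lambda> * ?D)"
    have b: "x p * sqrt ((?v \<bullet> (g ?c p *v ?v)) * ?D) \<le> ?b"
    proof -
      have "x p * sqrt ((?v \<bullet> (g ?c p *v ?v)) * ?D) = sqrt ((x p)\<^sup>2 * (?v \<bullet> (g ?c p *v ?v)) * ?D)"
        using xp by (simp add: real_sqrt_mult)
      also have "\<dots> \<le> ?b"
      proof (rule real_sqrt_le_mono[OF mult_right_mono[OF _ D0]])
        have "(x p)\<^sup>2 * (?v \<bullet> (g ?c p *v ?v)) \<le> (x p)\<^sup>2 * (\<Lambda> / (x p)\<^sup>2)"
          by (rule mult_left_mono[OF partial_x_length[OF c p]]) simp
        then show "(x p)\<^sup>2 * (?v \<bullet> (g ?c p *v ?v)) \<le> \<Lambda>" using xp by simp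
      qed
      finally show ?thesis .
    qed
    have young: "2 * sqrt ?F * ?b \<le> \<delta> * ?F + \<Lambda> / \<delta> * ?D"
    proof -
      have sq: "(sqrt ?F)\<^sup>2 = ?F" "?b\<^sup>2 = \<Lambda> * ?D" using F0 D0 lam by simp_all
      have "0 \<le> (\<delta> * sqrt ?F - ?b)\<^sup>2" by simp
      also have "\<dots> = \<delta>\<^sup>2 * (sqrt ?F)\<^sup>2 - 2 * \<delta> * sqrt ?F * ?b + ?b\<^sup>2" by (simp add: power2_diff power_mult_distrib algebra_simps)
      finally have "\<delta> * (2 * sqrt ?F * ?b) \<le> \<delta>\<^sup>2 * ?F + \<Lambda> * ?D" unfolding sq by (simp add: algebra_simps)
      also have "\<dots> = \<delta> * (\<delta> * ?F + \<Lambda> / \<delta> * ?D)" using \<delta> by (simp add: field_simps power2_eq_square)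
      finally show ?thesis using \<delta> by simp
    qed
    have "\<bar>H u p\<bar> \<le> 2 * sqrt ?F * sqrt ((?v \<bullet> (g ?c p *v ?v)) * ?D) + 2 * ?op * ?F"
      unfolding H_def by (rule derivative_symmetric_bound[OF u c])
    then have "x p * \<bar>H u p\<bar> \<le> x p * (2 * sqrt ?F * sqrt ((?v \<bullet> (g ?c p *v ?v)) * ?D) + 2 * ?op * ?F)"
      by (rule mult_left_mono) (use xp in simp)
    also have "\<dots> = 2 * sqrt ?F * (x p * sqrt ((?v \<bullet> (g ?c p *v ?v)) * ?D)) + 2 * (x p * ?op) * ?F"
      by (simp add: algebra_simps)
    also have "\<dots> \<le> 2 * sqrt ?F * ?b + 2 * \<theta> * ?F"
    proof (rule add_mono)
      show "2 * sqrt ?F * (x p * sqrt ((?v \<bullet> (g ?c p *v ?v)) * ?D)) \<le> 2 * sqrt ?F * ?b"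
        by (rule mult_left_mono[OF b]) (use F0 in simp)
      show "2 * (x p * ?op) * ?F \<le> 2 * \<theta> * ?F" by (rule mult_right_mono[OF _ F0]) (use op in simp)
    qed
    finally show "x p * \<bar>H u p\<bar> - (2 * \<theta> + \<delta>) * ?F \<le> \<Lambda> / \<delta> * ?D"
      using young by (simp add: algebra_simps)
  qed
qed

text \<open>
  The Hardy inequality requires a finite left-hand side; compactness of the support provides it.
\<close>

lemma norm_sq_integral_finite:
  assumes u: "admissible u" shows "(\<integral>\<^sup>+p. ennreal (ip (u p) (u p)) \<partial>dv) < top"
proof -
  let ?S = "section_support ip u" and ?F = "\<lambda>p. ip (u p) (u p)"
  have u1: "C1_section_on A \<pi> T UNIV u" and S: "compact ?S" using u by (simp_all add: admissible_def)
  have Sm: "?S \<in> sets dv" using S by (simp add: compact_imp_closed borel_closed)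
  obtain m where m: "0 \<le> m" "\<And>(i::bool) p. p \<in> ?S \<Longrightarrow> \<bar>?F p\<bar> \<le> m"
    by (rule compact_family_bound[OF S, of "\<lambda>(_::bool) p. ?F p"])
      (auto intro: continuous_on_subset[OF norm_sq_cont[OF u1]] that)
  have "(\<integral>\<^sup>+p. ennreal (?F p) \<partial>dv) \<le> (\<integral>\<^sup>+p. ennreal m * indicator ?S p \<partial>dv)"
  proof (rule nn_integral_mono)
    fix p
    show "ennreal (?F p) \<le> ennreal m * indicator ?S p"
    proof (cases "p \<in> ?S")
      case True
      then show ?thesis using m(2)[of p] by (simp add: ennreal_leI)
    next
      case False
      then have "?F p = 0" using closure_subset[of "{p. ?F p \<noteq> 0}"] by (auto simp: section_support_def)
      then show ?thesis by simp
    qed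
  qed
  also have "\<dots> = ennreal m * emeasure dv ?S" by (rule nn_integral_cmult_indicator[OF Sm])
  also have "\<dots> < top" using emeasure_compact_finite[OF S] by (simp add: ennreal_mult_less_top)
  finally show ?thesis .
qed

text \<open>
  On almost every \<open>x\<close>-line the Hardy inequality applies with \<open>m = n - 1\<close> and
  \<open>\<alpha> = 2 \<theta> + \<delta> < n - 1\<close>. Integration over the cross-section and the volume comparisons turn it into
  an inequality on the manifold, with right-hand side a multiple of the energy.
\<close>

lemma end_controlled:
  obtains U where "controlled U" "U \<noteq> {}"
proof -
  let ?n = "CARD('n)" and ?m = "CARD('l)"
  have nm: "?n = Suc ?m" using dimN by simp
  obtain K1 where K1: "0 \<le> K1" "\<And>f. f \<in> borel_measurable borel \<Longrightarrow>
      (\<integral>\<^sup>+q\<in>E0. f (Ps q) \<partial>lborel) \<le> (\<integral>\<^sup>+p\<in>Ds. (ennreal (K1 * x p ^ ?n) * f p) \<partial>dv)"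
    by (rule volume_lower_bound) (assumption | rule that)+
  obtain U1 \<sigma> \<tau> K2 where U1: "open U1" "U1 \<noteq> {}" "0 < \<sigma>" "\<tau> < e" "0 \<le> (K2 :: real)"
    "\<And>f. f \<in> borel_measurable borel \<Longrightarrow>
      (\<integral>\<^sup>+p\<in>U1. f p \<partial>dv) \<le> ennreal K2 * (\<integral>\<^sup>+q\<in>{\<sigma>..\<tau>} \<times> ball z0 r. f (Ps q) \<partial>lborel)"
    by (rule volume_upper_bound) (assumption | rule that)+
  \<comment> \<open>any \<open>\<delta>\<close> below twice this gap makes \<open>\<alpha> < n - 1\<close>\<close>
  define \<delta> where "\<delta> = (real ?n - 1) / 2 - \<theta>"
  define \<alpha> where "\<alpha> = 2 * \<theta> + \<delta>"
  have \<delta>: "0 < \<delta>" using theta by (simp add: \<delta>_def)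
  have \<alpha>: "\<alpha> < real ?m" using theta nm by (simp add: \<alpha>_def \<delta>_def field_simps)
  \<comment> \<open>\<open>K1 + 1\<close> instead of \<open>K1\<close> keeps the constant positive, so that it can be divided by\<close>
  define c1 where "c1 = (K1 + 1) * (\<Lambda> / \<delta>)"
  have c1: "0 < c1" using K1(1) lam \<delta> by (simp add: c1_def)
  define \<beta> where "\<beta> = real ?m - \<alpha>"
  have \<beta>: "0 < \<beta>" using \<alpha> by (simp add: \<beta>_def)
  have sub: "{\<sigma>..\<tau>} \<times> ball z0 r \<subseteq> E0" unfolding E0_def using U1(3,4) by (intro Sigma_mono) auto
  have bound: "(\<integral>\<^sup>+p\<in>U1. ennreal (ip (u p) (u p)) \<partial>dv) \<le> ennreal (K2 * e ^ ?n * (c1 / \<beta>)) * energy u"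
    if adm: "admissible u" for u
  proof -
    have u: "C1_section_on A \<pi> T UNIV u" using adm by (simp add: admissible_def)
    define F where "F p = ip (u p) (u p)" for p
    have F0: "0 \<le> F p" for p unfolding F_def by (rule norm_sq_nonneg[OF u])
    have Fc: "continuous_on UNIV F" unfolding F_def by (rule norm_sq_cont[OF u])
    have xc: "continuous_on Ds x" by (rule continuous_on_subset[OF end_cont(1)]) (auto simp: Ds_def)
    have xn: "x p ^ ?n \<noteq> 0" if "p \<in> Ds" for p using Ds_x(1)[OF that] by simp
    have DsB: "Ds \<in> sets borel" using Ds_open by simp
    define fF where "fF p = ennreal (if p \<in> Ds then F p / x p ^ ?n else 0)" for p
    define fR where "fR p = ennreal (if p \<in> Ds then (x p * \<bar>H u p\<bar> - \<alpha> * F p) / x p ^ ?n else 0)" for p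
    have "continuous_on Ds (\<lambda>p. F p / x p ^ ?n)"
      by (intro continuous_on_divide continuous_on_power xc continuous_on_subset[OF Fc]) (use xn in auto)
    then have "(\<lambda>p. if p \<in> Ds then F p / x p ^ ?n else 0) \<in> borel_measurable borel"
      by (rule borel_measurable_continuous_on_if[OF DsB]) simp
    then have fFm: "fF \<in> borel_measurable borel" unfolding fF_def by simp
    have "continuous_on Ds (\<lambda>p. (x p * \<bar>H u p\<bar> - \<alpha> * F p) / x p ^ ?n)"
      by (intro continuous_on_divide continuous_on_diff continuous_on_mult continuous_on_rabs H_cont(2)[OF u]
          continuous_on_const continuous_on_power xc continuous_on_subset[OF Fc]) (use xn in auto)
    then have "(\<lambda>p. if p \<in> Ds then (x p * \<bar>H u p\<bar> - \<alpha> * F p) / x p ^ ?n else 0) \<in> borel_measurable borel"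
      by (rule borel_measurable_continuous_on_if[OF DsB]) simp
    then have fRm: "fR \<in> borel_measurable borel" unfolding fR_def by simp
    obtain p0 :: 'm where True by simp
    \<comment> \<open>an everywhere defined Borel extension; its values outside \<open>E0\<close> never enter\<close>
    define Ps' where "Ps' q = (if q \<in> E0 then Ps q else p0)" for q
    have Ps'm: "Ps' \<in> borel_measurable borel" unfolding Ps'_def
      by (rule borel_measurable_continuous_on_if) (use E0_open Ps_cont in simp_all)
    define gF gR where "gF q = fF (Ps' q)" and "gR q = fR (Ps' q)" for q
    have gm: "gF \<in> borel_measurable borel" "gR \<in> borel_measurable borel"
      unfolding gF_def gR_def by (rule measurable_compose[OF Ps'm fFm], rule measurable_compose[OF Ps'm fRm])
    have gF: "gF q = ennreal (F (Ps q) / fst q ^ ?n)" and gR: "gR q = ennreal ((fst q * \<bar>H u (Ps q)\<bar> - \<alpha> * F (Ps q)) / fst q ^ ?n)"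
      if "q \<in> E0" for q using that Ph_Ps(2,4)[OF that] by (simp_all add: gF_def gR_def fF_def fR_def Ps'_def)
    have E0F: "(\<integral>\<^sup>+q\<in>E0. gF q \<partial>lborel) < top"
    proof -
      have "(\<integral>\<^sup>+q\<in>E0. gF q \<partial>lborel) = (\<integral>\<^sup>+q\<in>E0. fF (Ps q) \<partial>lborel)"
        by (intro nn_integral_cong) (simp add: gF_def Ps'_def indicator_def)
      also have "\<dots> \<le> (\<integral>\<^sup>+p\<in>Ds. (ennreal (K1 * x p ^ ?n) * fF p) \<partial>dv)" by (rule K1(2)[OF fFm])
      also have "\<dots> \<le> (\<integral>\<^sup>+p. ennreal K1 * ennreal (F p) \<partial>dv)"
      proof (rule nn_integral_mono)
        fix p show "ennreal (K1 * x p ^ ?n) * fF p * indicator Ds p \<le> ennreal K1 * ennreal (F p)"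
        proof (cases "p \<in> Ds")
          case True
          have "ennreal (K1 * x p ^ ?n) * fF p = ennreal (K1 * x p ^ ?n * (F p / x p ^ ?n))"
            using True K1(1) Ds_x(1)[OF True] F0[of p] by (simp add: fF_def ennreal_mult[symmetric] less_imp_le)
          also have "K1 * x p ^ ?n * (F p / x p ^ ?n) = K1 * F p" using xn[OF True] by simp
          finally show ?thesis using True K1(1) F0[of p] by (simp add: ennreal_mult)
        qed simp
      qed
      also have "\<dots> = ennreal K1 * (\<integral>\<^sup>+p. ennreal (F p) \<partial>dv)"
        by (rule nn_integral_cmult) (use norm_sq_measurable[OF u] in \<open>simp add: F_def\<close>)
      also have "\<dots> < top" using norm_sq_integral_finite[OF adm] by (simp add: ennreal_mult_less_top F_def)
      finally show ?thesis .
    qed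
    have E0R: "(\<integral>\<^sup>+q\<in>E0. gR q \<partial>lborel) \<le> ennreal c1 * energy u"
    proof -
      have "(\<integral>\<^sup>+q\<in>E0. gR q \<partial>lborel) = (\<integral>\<^sup>+q\<in>E0. fR (Ps q) \<partial>lborel)"
        by (intro nn_integral_cong) (simp add: gR_def Ps'_def indicator_def)
      also have "\<dots> \<le> (\<integral>\<^sup>+p\<in>Ds. (ennreal (K1 * x p ^ ?n) * fR p) \<partial>dv)" by (rule K1(2)[OF fRm])
      also have "\<dots> \<le> (\<integral>\<^sup>+p. ennreal (K1 + 1) * (ennreal (x p ^ ?n) * indicator Ds p * fR p) \<partial>dv)"
      proof (rule nn_integral_mono)
        fix p show "ennreal (K1 * x p ^ ?n) * fR p * indicator Ds p \<le> ennreal (K1 + 1) * (ennreal (x p ^ ?n) * indicator Ds p * fR p)"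
        proof (cases "p \<in> Ds")
          case True
          have "ennreal (K1 * x p ^ ?n) \<le> ennreal ((K1 + 1) * x p ^ ?n)"
            by (intro ennreal_leI mult_right_mono) (use Ds_x(1)[OF True] in \<open>simp_all add: less_imp_le\<close>)
          also have "\<dots> = ennreal (K1 + 1) * ennreal (x p ^ ?n)"
            using K1(1) Ds_x(1)[OF True] by (simp add: ennreal_mult less_imp_le)
          finally have "ennreal (K1 * x p ^ ?n) * fR p \<le> ennreal (K1 + 1) * ennreal (x p ^ ?n) * fR p" by (rule mult_right_mono) simp
          then show ?thesis using True by (simp add: mult.assoc)
        qed simp
      qed
      also have "\<dots> \<le> ennreal c1 * (\<integral>\<^sup>+p. ennreal (nabla_norm_sq A g T \<pi> ip \<Gamma> u p) \<partial>dv)"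
      proof (rule nn_integral_le_cmult_AE[OF _ c1])
        have fRdv: "fR \<in> borel_measurable dv" using fRm measurable_cong_sets[OF sets_dv refl] by blast
        have "(\<lambda>p. if p \<in> Ds then x p ^ ?n else 0) \<in> borel_measurable borel"
          by (rule borel_measurable_continuous_on_if[OF DsB continuous_on_power[OF xc]]) simp
        then have "(\<lambda>p. ennreal (if p \<in> Ds then x p ^ ?n else 0)) \<in> borel_measurable borel" by simp
        also have "(\<lambda>p. ennreal (if p \<in> Ds then x p ^ ?n else 0)) = (\<lambda>p. ennreal (x p ^ ?n) * indicator Ds p)"
          by (intro ext) (simp add: indicator_def)
        finally have "(\<lambda>p. ennreal (x p ^ ?n) * indicator Ds p) \<in> borel_measurable dv"
          using measurable_cong_sets[OF sets_dv refl] by blast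
        then show "(\<lambda>p. ennreal (K1 + 1) * (ennreal (x p ^ ?n) * indicator Ds p * fR p)) \<in> borel_measurable dv"
          by (rule borel_measurable_times_ennreal[OF borel_measurable_const borel_measurable_times_ennreal[OF _ fRdv]])
        show "AE p in dv. ennreal (K1 + 1) * (ennreal (x p ^ ?n) * indicator Ds p * fR p)
            \<le> ennreal c1 * ennreal (nabla_norm_sq A g T \<pi> ip \<Gamma> u p)"
          using radial_derivative_bound[OF u \<delta>]
        proof eventually_elim
          case (elim p)
          show ?case
          proof (cases "p \<in> Ds")
            case True
            have le: "x p * \<bar>H u p\<bar> - \<alpha> * F p \<le> \<Lambda> / \<delta> * nabla_norm_sq A g T \<pi> ip \<Gamma> u p"
              using elim True by (simp add: \<alpha>_def F_def)
            have "ennreal (x p ^ ?n) * fR p = ennreal (x p ^ ?n * ((x p * \<bar>H u p\<bar> - \<alpha> * F p) / x p ^ ?n))"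
              using True Ds_x(1)[OF True] by (simp add: fR_def ennreal_mult'[symmetric] less_imp_le del: times_divide_eq_right)
            also have "x p ^ ?n * ((x p * \<bar>H u p\<bar> - \<alpha> * F p) / x p ^ ?n) = x p * \<bar>H u p\<bar> - \<alpha> * F p" using xn[OF True] by simp
            also have "ennreal (x p * \<bar>H u p\<bar> - \<alpha> * F p) \<le> ennreal (\<Lambda> / \<delta> * nabla_norm_sq A g T \<pi> ip \<Gamma> u p)" by (rule ennreal_leI[OF le])
            also have "\<dots> = ennreal (\<Lambda> / \<delta>) * ennreal (nabla_norm_sq A g T \<pi> ip \<Gamma> u p)"
              by (rule ennreal_mult') (use lam \<delta> in simp)
            finally have "ennreal (K1 + 1) * (ennreal (x p ^ ?n) * fR p) \<le> ennreal (K1 + 1) * (ennreal (\<Lambda> / \<delta>) * ennreal (nabla_norm_sq A g T \<pi> ip \<Gamma> u p))"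
              by (rule mult_left_mono) simp
            also have "\<dots> = ennreal c1 * ennreal (nabla_norm_sq A g T \<pi> ip \<Gamma> u p)"
              unfolding c1_def using K1(1) lam \<delta> by (subst ennreal_mult) (simp_all add: mult.assoc)
            finally show ?thesis using True by simp
          qed simp
        qed
      qed
      finally show ?thesis by (simp only: energy_def)
    qed
    define I J G where "I z = (\<integral>\<^sup>+s\<in>{\<sigma>..\<tau>}. gF (s, z) \<partial>lborel)" and "J z = (\<integral>\<^sup>+s\<in>{0<..<e}. gR (s, z) \<partial>lborel)"
      and "G z = (\<integral>\<^sup>+s\<in>{0<..<e}. gF (s, z) \<partial>lborel)" for z
    have eB: "{0<..<e} \<in> sets borel" "{\<sigma>..\<tau>} \<in> sets borel" "ball z0 r \<in> sets borel" by simp_all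
    note fubI = nn_integral_rectangle[OF gm(1) eB(2,3), folded I_def]
    note fubJ = nn_integral_rectangle[OF gm(2) eB(1,3), folded J_def E0_def]
    note fubG = nn_integral_rectangle[OF gm(1) eB(1,3), folded G_def E0_def]
    have "AE z in lborel. G z * indicator (ball z0 r) z \<noteq> \<infinity>"
      by (rule nn_integral_PInf_AE) (use fubG E0F in simp_all)
    then have hardy: "AE z in lborel. ennreal \<beta> * (I z * indicator (ball z0 r) z) \<le> J z * indicator (ball z0 r) z"
    proof eventually_elim
      case (elim z)
      show ?case
      proof (cases "z \<in> ball z0 r")
        case True
        have inE: "(s, z) \<in> E0" if "s \<in> {0<..<e}" for s using that True by (simp add: E0_def)
        have "ennreal (real ?m - \<alpha>) * (\<integral>\<^sup>+s\<in>{\<sigma>..\<tau>}. ennreal (F (Ps (s, z)) / s ^ Suc ?m) \<partial>lborel)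
           \<le> (\<integral>\<^sup>+s\<in>{0<..<e}. ennreal ((s * \<bar>H u (Ps (s, z))\<bar> - \<alpha> * F (Ps (s, z))) / s ^ Suc ?m) \<partial>lborel)"
        proof (rule hardy_interval[OF F0 _ _ \<alpha> _ U1(3,4)])
          show "((\<lambda>s. F (Ps (s, z))) has_real_derivative H u (Ps (s, z))) (at s)" if "s \<in> {0<..<e}" for s
            using norm_sq_along_x[OF u inE[OF that]] by (simp add: F_def)
          show "continuous_on {0<..<e} (\<lambda>s. H u (Ps (s, z)))"
            by (rule continuous_on_compose2[OF H_cont(1)[OF u]]) (use inE in \<open>auto intro!: continuous_intros\<close>)
          have "(\<integral>\<^sup>+s\<in>{0<..<e}. ennreal (F (Ps (s, z)) / s ^ Suc ?m) \<partial>lborel) = G z"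
            unfolding G_def by (intro nn_integral_cong) (use gF[OF inE] in \<open>simp add: indicator_def nm\<close>)
          then show "(\<integral>\<^sup>+s\<in>{0<..<e}. ennreal (F (Ps (s, z)) / s ^ Suc ?m) \<partial>lborel) < top"
            using elim True by (simp add: less_top)
        qed
        moreover have "(\<integral>\<^sup>+s\<in>{\<sigma>..\<tau>}. ennreal (F (Ps (s, z)) / s ^ Suc ?m) \<partial>lborel) = I z"
          unfolding I_def using U1(3,4) by (intro nn_integral_cong) (use gF[OF inE] in \<open>simp add: indicator_def nm\<close>)
        moreover have "(\<integral>\<^sup>+s\<in>{0<..<e}. ennreal ((s * \<bar>H u (Ps (s, z))\<bar> - \<alpha> * F (Ps (s, z))) / s ^ Suc ?m) \<partial>lborel) = J z"
          unfolding J_def by (intro nn_integral_cong) (use gR[OF inE] in \<open>simp add: indicator_def nm\<close>)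
        ultimately show ?thesis using True by (simp add: \<beta>_def)
      qed simp
    qed
    let ?X = "\<integral>\<^sup>+q\<in>{\<sigma>..\<tau>} \<times> ball z0 r. gF q \<partial>lborel"
    have "ennreal \<beta> * ?X = (\<integral>\<^sup>+z. ennreal \<beta> * (I z * indicator (ball z0 r) z) \<partial>lborel)"
      unfolding fubI(1) by (rule nn_integral_cmult[symmetric]) (use fubI(2) in simp)
    also have "\<dots> \<le> (\<integral>\<^sup>+z\<in>ball z0 r. J z \<partial>lborel)" by (rule nn_integral_mono_AE[OF hardy])
    also have "\<dots> \<le> ennreal c1 * energy u" using E0R unfolding fubJ(1) .
    finally have X: "ennreal \<beta> * ?X \<le> ennreal c1 * energy u" .
    have "?X = ennreal (1 / \<beta>) * (ennreal \<beta> * ?X)"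
      using \<beta> by (simp add: mult.assoc[symmetric] ennreal_mult'[symmetric])
    also have "\<dots> \<le> ennreal (1 / \<beta>) * (ennreal c1 * energy u)" by (rule mult_left_mono[OF X]) simp
    also have "\<dots> = ennreal (c1 / \<beta>) * energy u"
      using \<beta> c1 by (simp add: mult.assoc[symmetric] ennreal_mult'[symmetric])
    finally have X1: "?X \<le> ennreal (c1 / \<beta>) * energy u" .
    have "(\<integral>\<^sup>+p\<in>U1. ennreal (F p) \<partial>dv) \<le> ennreal K2 * (\<integral>\<^sup>+q\<in>{\<sigma>..\<tau>} \<times> ball z0 r. ennreal (F (Ps q)) \<partial>lborel)"
      by (rule U1(6)) (use norm_sq_measurable[OF u] in \<open>simp add: F_def\<close>)
    also have "\<dots> \<le> ennreal K2 * (\<integral>\<^sup>+q. ennreal (e ^ ?n) * (gF q * indicator ({\<sigma>..\<tau>} \<times> ball z0 r) q) \<partial>lborel)"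
    proof (intro mult_left_mono nn_integral_mono)
      fix q
      show "ennreal (F (Ps q)) * indicator ({\<sigma>..\<tau>} \<times> ball z0 r) q \<le> ennreal (e ^ ?n) * (gF q * indicator ({\<sigma>..\<tau>} \<times> ball z0 r) q)"
      proof (cases "q \<in> {\<sigma>..\<tau>} \<times> ball z0 r")
        case True
        have qE: "q \<in> E0" by (rule subsetD[OF sub True])
        then have s: "0 < fst q" "fst q < e" by (auto simp: E0_def)
        have "F (Ps q) = fst q ^ ?n * (F (Ps q) / fst q ^ ?n)" using s by simp
        also have "\<dots> \<le> e ^ ?n * (F (Ps q) / fst q ^ ?n)"
          by (intro mult_right_mono power_mono divide_nonneg_nonneg F0) (use s in simp_all)
        finally have "ennreal (F (Ps q)) \<le> ennreal (e ^ ?n * (F (Ps q) / fst q ^ ?n))" by (rule ennreal_leI)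
        also have "\<dots> = ennreal (e ^ ?n) * gF q" unfolding gF[OF qE] by (rule ennreal_mult') (use e in simp)
        finally show ?thesis using True by simp
      qed simp
    qed simp
    also have "(\<integral>\<^sup>+q. ennreal (e ^ ?n) * (gF q * indicator ({\<sigma>..\<tau>} \<times> ball z0 r) q) \<partial>lborel) = ennreal (e ^ ?n) * ?X"
      by (rule nn_integral_cmult) (use gm(1) in \<open>intro borel_measurable_times_ennreal borel_measurable_indicator; simp add: borel_Times\<close>)
    also have "ennreal K2 * (ennreal (e ^ ?n) * ?X) \<le> ennreal K2 * (ennreal (e ^ ?n) * (ennreal (c1 / \<beta>) * energy u))"
      by (intro mult_left_mono X1) simp_all
    also have "\<dots> = ennreal (K2 * e ^ ?n * (c1 / \<beta>)) * energy u"
    proof -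
      have "ennreal (K2 * e ^ ?n * (c1 / \<beta>)) = ennreal K2 * ennreal (e ^ ?n) * ennreal (c1 / \<beta>)"
        using U1(5) e c1 \<beta> by (subst ennreal_mult, simp_all, subst ennreal_mult, simp_all)
      then show ?thesis by (simp only: mult.assoc)
    qed
    finally show ?thesis by (simp only: F_def)
  qed
  show thesis
  proof (rule that[OF _ U1(2)])
    have "0 \<le> K2 * e ^ ?n * (c1 / \<beta>)" using U1(5) e c1 \<beta> by simp
    then show "controlled U1" unfolding controlled_def using U1(1) bound by blast
  qed
qed

end

section \<open>The weighted Poincare inequality\<close>

text \<open>
  By compactness of the product with the unit sphere.
\<close>

lemma metric_lower_bound_compact:
  fixes M :: "'a::topological_space \<Rightarrow> real ^ 'l::finite ^ 'l"
  assumes K: "compact K" "K \<noteq> {}" and M: "continuous_on K M"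
    and pos: "\<And>p w. p \<in> K \<Longrightarrow> w \<noteq> 0 \<Longrightarrow> 0 < w \<bullet> (M p *v w)"
  obtains \<kappa> where "0 < \<kappa>" "\<And>p w. p \<in> K \<Longrightarrow> \<kappa> * (norm w)\<^sup>2 \<le> w \<bullet> (M p *v w)"
proof -
  let ?S = "K \<times> sphere (0 :: real ^ 'l) 1"
  let ?f = "\<lambda>a. snd a \<bullet> (M (fst a) *v snd a)"
  have Mc: "continuous_on ?S (\<lambda>a. M (fst a))" by (rule continuous_on_compose2[OF M]) (auto intro: continuous_intros)
  have fc: "continuous_on ?S ?f"
    unfolding inner_vec_def matrix_vector_mult_def
    by (simp, intro continuous_on_sum continuous_on_mult continuous_on_component Mc continuous_on_snd continuous_on_id)
  obtain i :: 'l where True by simp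
  have "axis i 1 \<in> sphere (0 :: real ^ 'l) 1" by (simp add: norm_axis_1)
  then have "?S \<noteq> {}" using K(2) by blast
  then have "\<exists>a\<in>?S. \<forall>b\<in>?S. ?f a \<le> ?f b"
    by (intro continuous_attains_inf fc compact_Times K(1) compact_sphere)
  then obtain a where a: "a \<in> ?S" "\<And>b. b \<in> ?S \<Longrightarrow> ?f a \<le> ?f b" by blast
  have a1: "fst a \<in> K" "norm (snd a) = 1" using a(1) by auto
  show thesis
  proof (rule that)
    show "0 < ?f a" by (rule pos) (use a1 in auto)
    fix p and w :: "real ^ 'l" assume p: "p \<in> K"
    show "?f a * (norm w)\<^sup>2 \<le> w \<bullet> (M p *v w)"
    proof (cases "w = 0")
      case False
      let ?w = "(1 / norm w) *\<^sub>R w"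
      have "(p, ?w) \<in> ?S" using p False by simp
      from a(2)[OF this] have "?f a \<le> ?w \<bullet> (M p *v ?w)" by simp
      also have "\<dots> = (w \<bullet> (M p *v w)) / (norm w)\<^sup>2"
        by (simp add: matrix_vector_mult_scaleR power2_eq_square)
      finally show ?thesis using False by (simp add: field_simps)
    qed simp
  qed
qed

text \<open>
  Unpacks the hypotheses into a half-tube: the gap in the limit superior yields \<open>\<theta>\<close> and \<open>e\<close>, and any
  point of the cross-section yields the ball.
\<close>

lemma (in end_setting) exists_controlled:
  assumes gap: "Limsup (end_filter dv W x) (\<lambda>p. ereal (end_symmetric_norm A T \<pi> ip \<Gamma> W x y p))
           < ereal ((real CARD('n) - 1) / 2)"
  shows "\<exists>U. controlled U \<and> U \<noteq> {}"
proof -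
  obtain \<theta> where th: "Limsup (end_filter dv W x) (\<lambda>p. ereal (end_symmetric_norm A T \<pi> ip \<Gamma> W x y p)) < ereal \<theta>"
    "ereal \<theta> < ereal ((real CARD('n) - 1) / 2)" using ereal_dense2[OF gap] by blast
  have "eventually (\<lambda>p. ereal (end_symmetric_norm A T \<pi> ip \<Gamma> W x y p) < ereal \<theta>) (end_filter dv W x)"
    by (rule Limsup_lessD[OF th(1)])
  then obtain Q R where Q: "eventually Q (ae_filter dv)" and R: "eventually R (inf (principal W) (filtercomap x (at_right 0)))"
    and QR: "\<And>p. Q p \<Longrightarrow> R p \<Longrightarrow> end_symmetric_norm A T \<pi> ip \<Gamma> W x y p < \<theta>"
    unfolding end_filter_def eventually_inf by auto
  obtain R1 R2 where R1: "\<And>p. p \<in> W \<Longrightarrow> R1 p" and R2: "eventually R2 (filtercomap x (at_right 0))"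
    and R12: "\<And>p. R1 p \<Longrightarrow> R2 p \<Longrightarrow> R p"
    using R unfolding eventually_inf eventually_principal by auto
  obtain Z where Z: "eventually Z (at_right (0::real))" "\<And>p. Z (x p) \<Longrightarrow> R2 p"
    using R2 unfolding eventually_filtercomap by blast
  obtain b where b: "0 < b" "\<And>s. 0 < s \<Longrightarrow> s < b \<Longrightarrow> Z s"
    using Z(1) unfolding eventually_at_right_field by blast
  define e where "e = min b x0"
  have e: "0 < e" "e \<le> x0" using b(1) x0_pos by (simp_all add: e_def)
  have small: "AE p in dv. p \<in> W \<and> x p < e \<longrightarrow> end_symmetric_norm A T \<pi> ip \<Gamma> W x y p \<le> \<theta>"
    using Q
  proof eventually_elim
    case (elim p)
    show ?case
    proof
      assume p: "p \<in> W \<and> x p < e"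
      then have "Z (x p)" using end_Psi(2)[of p] by (intro b(2)) (simp_all add: e_def)
      then have "R p" using p by (intro R12 R1 Z(2)) simp_all
      then show "end_symmetric_norm A T \<pi> ip \<Gamma> W x y p \<le> \<theta>" using QR[OF elim] by simp
    qed
  qed
  obtain k0 :: 'k where True by simp
  obtain d where d: "d \<in> AN" "k0 \<in> fst d" using N.charts_cover by blast
  have "\<exists>r>0. cball (snd d k0) r \<subseteq> snd d ` fst d" using N_chart_open[OF d(1)] d(2) open_contains_cball by blast
  then obtain r where r: "0 < r" "cball (snd d k0) r \<subseteq> snd d ` fst d" by blast
  let ?K = "cinv d ` cball (snd d k0) r"
  have K: "compact ?K" by (rule compact_continuous_image[OF continuous_on_subset[OF N.cinv_cont[OF d(1)] r(2)]]) simp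
  have Kd: "?K \<subseteq> fst d" using r(2) N.cinv_in[OF d(1)] by blast
  have hm: "riemannian_metric AN h" using hyp_end unfolding weakly_hyperboloidal_end_def by simp
  have hc: "continuous_on (fst d) (h d)" using hm d(1) unfolding riemannian_metric_def by blast
  have hp: "0 < w \<bullet> (h d p *v w)" if "p \<in> fst d" "w \<noteq> 0" for p w
    using hm d(1) that unfolding riemannian_metric_def by blast
  obtain \<kappa> where \<kappa>: "0 < \<kappa>" "\<And>p w. p \<in> ?K \<Longrightarrow> \<kappa> * (norm w)\<^sup>2 \<le> w \<bullet> (h d p *v w)"
  proof (rule metric_lower_bound_compact[OF K _ continuous_on_subset[OF hc Kd]])
    show "?K \<noteq> {}" using r(1) by simp
    show "0 < w \<bullet> (h d p *v w)" if "p \<in> ?K" "w \<noteq> 0" for p w by (rule hp) (use that Kd in blast)+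
  qed (rule that)
  obtain \<Lambda> where L: "0 < \<Lambda>" "\<forall>c\<in>A. \<forall>d\<in>AN. \<forall>p\<in>fst c \<inter> W \<inter> y -` fst d. \<forall>v.
        let w = cderiv c (\<lambda>p'. snd d (y p')) p v;
            Q = ((cderiv c x p v)\<^sup>2 + w \<bullet> (h d (y p) *v w)) / (x p)\<^sup>2
        in Q / \<Lambda> \<le> v \<bullet> (g c p *v v) \<and> v \<bullet> (g c p *v v) \<le> \<Lambda> * Q"
    using hyp_end unfolding weakly_hyperboloidal_end_def by (elim conjE exE) (rule that)
  have cmp: "((cderiv c x p v)\<^sup>2 + w \<bullet> (h d (y p) *v w)) / (x p)\<^sup>2 / \<Lambda> \<le> v \<bullet> (g c p *v v)"
    "v \<bullet> (g c p *v v) \<le> \<Lambda> * (((cderiv c x p v)\<^sup>2 + w \<bullet> (h d (y p) *v w)) / (x p)\<^sup>2)"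
    if "c \<in> A" "p \<in> fst c" "p \<in> W" "y p \<in> fst d" and w: "w = cderiv c (\<lambda>p. snd d (y p)) p v" for c p v w
  proof -
    have "p \<in> fst c \<inter> W \<inter> y -` fst d" using that by simp
    from L(2)[rule_format, OF that(1) d(1) this, of v]
    show "((cderiv c x p v)\<^sup>2 + w \<bullet> (h d (y p) *v w)) / (x p)\<^sup>2 / \<Lambda> \<le> v \<bullet> (g c p *v v)"
      "v \<bullet> (g c p *v v) \<le> \<Lambda> * (((cderiv c x p v)\<^sup>2 + w \<bullet> (h d (y p) *v w)) / (x p)\<^sup>2)"
      unfolding Let_def w by simp_all
  qed
  interpret end_chart A T \<pi> ip \<Gamma> g dv AN h W x0 x y d "snd d k0" r e \<Lambda> "min 1 \<kappa> / \<Lambda>" \<theta>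
  proof unfold_locales
    fix c p v assume c: "c \<in> A" "p \<in> fst c" "p \<in> W" "y p \<in> fst d"
    show "v \<bullet> (g c p *v v) \<le> \<Lambda> * (cderiv c x p v)\<^sup>2 / (x p)\<^sup>2" if w: "cderiv c (\<lambda>p. snd d (y p)) p v = 0"
      using cmp(2)[OF c w[symmetric]] by simp
    show "min 1 \<kappa> / \<Lambda> / (x p)\<^sup>2 * ((cderiv c x p v)\<^sup>2 + (norm (cderiv c (\<lambda>p. snd d (y p)) p v))\<^sup>2) \<le> v \<bullet> (g c p *v v)"
      if b: "snd d (y p) \<in> ball (snd d k0) r"
    proof -
      let ?w = "cderiv c (\<lambda>p. snd d (y p)) p v"
      have yK: "y p \<in> ?K" by (rule image_eqI[of _ _ "snd d (y p)"]) (use b c(4) d(1) in simp_all)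
      have "min 1 \<kappa> * ((cderiv c x p v)\<^sup>2 + (norm ?w)\<^sup>2) \<le> 1 * (cderiv c x p v)\<^sup>2 + \<kappa> * (norm ?w)\<^sup>2"
        unfolding distrib_left by (intro add_mono mult_right_mono) simp_all
      also have "\<dots> \<le> (cderiv c x p v)\<^sup>2 + ?w \<bullet> (h d (y p) *v ?w)" using \<kappa>(2)[OF yK] by simp
      finally have "min 1 \<kappa> * ((cderiv c x p v)\<^sup>2 + (norm ?w)\<^sup>2) / (x p)\<^sup>2 / \<Lambda>
          \<le> ((cderiv c x p v)\<^sup>2 + ?w \<bullet> (h d (y p) *v ?w)) / (x p)\<^sup>2 / \<Lambda>"
        using L(1) by (intro divide_right_mono) simp_all
      also have "\<dots> \<le> v \<bullet> (g c p *v v)" by (rule cmp(1)[OF c refl])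
      finally show ?thesis by (simp add: mult_ac)
    qed
  qed (use d r e L \<kappa> small th(2) in \<open>auto intro: subset_trans[OF ball_subset_cball]\<close>)
  show ?thesis by (rule end_controlled) blast
qed

theorem theorem9p10:
  fixes A :: "('m::{t2_space, second_countable_topology}, 'n::finite) chart set"
    and g :: "('m, 'n) chart \<Rightarrow> 'm \<Rightarrow> real ^ 'n ^ 'n"
    and dv :: "'m measure"
    and AN :: "('k::{t2_space, second_countable_topology}, 'l::finite) chart set"
    and h :: "('k, 'l) chart \<Rightarrow> 'k \<Rightarrow> real ^ 'l ^ 'l"
    and W :: "'m set" and x0 :: real and x :: "'m \<Rightarrow> real" and y :: "'m \<Rightarrow> 'k"
    and T :: "('m, 'e, 'r::finite) triv set" and \<pi> :: "'e \<Rightarrow> 'm"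
    and ip :: "'e \<Rightarrow> 'e \<Rightarrow> real"
    and \<Gamma> :: "('m, 'e, 'r) triv \<Rightarrow> ('m, 'n) chart \<Rightarrow> 'm \<Rightarrow> 'n \<Rightarrow> real ^ 'r ^ 'r"
  assumes "CARD('n) \<ge> 2" and "CARD('n) = CARD('l) + 1"
    and "smooth_manifold A" and "connected (UNIV :: 'm set)" and "compact (manifold_boundary A)"
    and "riemannian_metric A g" and "riemannian_volume A g dv"
    and "weakly_hyperboloidal_end A g AN h W x0 x y"
    and "vector_bundle A \<pi> T" and "bundle_inner_product A \<pi> T ip"
    and "connection A \<pi> T \<Gamma>" and "connection_Lp_loc (n_star CARD('n)) A T \<Gamma>"
    and "Limsup (end_filter dv W x) (\<lambda>p. ereal (end_symmetric_norm A T \<pi> ip \<Gamma> W x y p))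
           < ereal ((real CARD('n) - 1) / 2)"
  shows "\<exists>w :: 'm \<Rightarrow> real.
           w \<in> borel_measurable dv \<and>
           (\<forall>K. compact K \<longrightarrow> set_integrable dv K w) \<and>
           (\<forall>\<Omega>. compact (closure \<Omega>) \<longrightarrow> 0 < ess_inf_on dv \<Omega> w) \<and>
           (\<forall>u. C1_section_on A \<pi> T UNIV u \<and> compact (section_support ip u) \<longrightarrow>
              (\<integral>\<^sup>+p. ennreal (ip (u p) (u p) * w p) \<partial>dv)
                \<le> (\<integral>\<^sup>+p. ennreal (nabla_norm_sq A g T \<pi> ip \<Gamma> u p) \<partial>dv))"
proof -
  have AN: "smooth_manifold AN" using assms(8) unfolding weakly_hyperboloidal_end_def by simp
  interpret end_setting A T \<pi> ip \<Gamma> g dv AN h W x0 x y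
    by unfold_locales (fact assms AN)+
  have "\<exists>U. controlled U \<and> U \<noteq> {}" by (rule exists_controlled[OF assms(13)])
  then have all: "\<And>p. \<exists>U. controlled U \<and> p \<in> U"
    by (elim exE conjE) (rule controlled_everywhere[OF assms(4)])
  show ?thesis using weight_exists[OF all] unfolding admissible_def energy_def .
qed

end
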